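(* Let $m\in\mathbb{R}$ and let $V:\mathbb{R}^3\to\mathbb{R}$ be locally bounded (measurable) with $V(x)\to\infty$ as $|x|\to\infty$ and $\inf_{x\in\mathbb{R}^3}V(x)=0$. Let $a^*:=\|Q\|_2^2$, where $Q$ is a positive ground state of $\sqrt{-\Delta}\,u+u-(|x|^{-1}*u^2)u=0$ in $\mathbb{R}^3$, $u\in H^{1/2}(\mathbb{R}^3)$. For $a\ge 0$ let $$e(a):=\inf\{E_a(u): u\in\mathcal{H},\ \|u\|_2^2=1\},\qquad E_a(u)=\int_{\mathbb{R}^3}\big(u\sqrt{-\Delta+m^2}\,u+Vu^2\big)\,dx-\frac a2\int_{\mathbb{R}^3}(|x|^{-1}*u^2)u^2\,dx .$$ Then: (i) if $0\le a<a^*$, there exists at least one nonnegative minimizer $u_a$ for $e(a)$; (ii) if $a\ge a^*$, there is no minimizer for $e(a)$.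
   Context: All functions are real-valued; $\|\cdot\|_q$ is the $L^q(\mathbb{R}^3)$ norm. The operator $\sqrt{-\Delta+m^2}$ is defined by $\sqrt{-\Delta+m^2}\,u=\mathcal{F}^{-1}(\sqrt{|\xi|^2+m^2}\,\mathcal{F}u)$ with $\mathcal F$ the Fourier transform, and $\int u\sqrt{-\Delta+m^2}\,u\,dx$ is understood as the quadratic form $\int\sqrt{|\xi|^2+m^2}\,|\mathcal{F}u|^2\,d\xi$ ($\mathcal F$ normalized to be unitary on $L^2$), well defined for $u\in H^{1/2}(\mathbb{R}^3)$; similarly for $(-\Delta)^{s}$ with symbol $|\xi|^{2s}$. $\mathcal{H}:=\{u\in H^{1/2}(\mathbb{R}^3): \int_{\mathbb{R}^3}Vu^2\,dx<\infty\}$, with norm $\|u\|_{\mathcal{H}}=\big(\int_{\mathbb{R}^3}[|(-\Delta)^{1/4}u|^2+(1+V)u^2]\,dx\big)^{1/2}$. A minimizer for $e(a)$ is $u\in\mathcal{H}$ with $\|u\|_2^2=1$ and $E_a(u)=e(a)$ (in particular $e(a)>-\infty$). A ground state of $\sqrt{-\Delta}\,u+u-(|x|^{-1}*u^2)u=0$ is a nontrivial solution $u\in H^{1/2}(\mathbb{R}^3)$ minimizing the action $\frac12\int|(-\Delta)^{1/4}w|^2dx+\frac12\int w^2dx-\frac14\int(|x|^{-1}*w^2)w^2dx$ among all nontrivial solutions $w\in H^{1/2}(\mathbb{R}^3)$. It is known (and may be assumed) that a positive ground state $Q$, radially symmetric about the origin, exists; that every ground state $Q$ lies in $H^s(\mathbb{R}^3)$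 for all $s\ge\frac12$ and satisfies $Q(x)=O(|x|^{-4})$ as $|x|\to\infty$; and that $$\tfrac12\|Q\|_2^2=\inf_{0\not\equiv u\in H^{1/2}(\mathbb{R}^3)}\frac{\int|(-\Delta)^{1/4}u|^2dx\,\int u^2dx}{\int(|x|^{-1}*u^2)u^2dx},$$ so $a^*$ does not depend on the choice of $Q$. *)

theory Defs
  imports "HOL-Analysis.Analysis"
begin

text \<open>Elements of \<open>L\<^sup>2(\<real>\<^sup>3)\<close> are represented by Lebesgue measurable functions;
  everything below depends only on their almost-everywhere classes.\<close>

definition L2 :: "(real^3 \<Rightarrow> 'b::{real_normed_vector, second_countable_topology}) \<Rightarrow> bool"
  where "L2 f \<longleftrightarrow> f \<in> borel_measurable lebesgue \<and> integrable lebesgue (\<lambda>x. (norm (f x))\<^sup>2)"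

definition L2_norm_sq :: "(real^3 \<Rightarrow> real) \<Rightarrow> real"
  where "L2_norm_sq u = (\<integral>x. (u x)\<^sup>2 \<partial>lebesgue)"

definition fourier_integral :: "(real^3 \<Rightarrow> complex) \<Rightarrow> real^3 \<Rightarrow> complex"
  where "fourier_integral f \<xi> =
    (1 / (2 * pi) powr (3/2)) *\<^sub>R (\<integral>x. cis (- (x \<bullet> \<xi>)) * f x \<partial>lebesgue)"

text \<open>The unitary Fourier transform on \<open>L\<^sup>2\<close>: the \<open>L\<^sup>2\<close>-limit of the Fourier integrals of the
  truncations of \<open>f\<close> to balls. It exists by Plancherel's theorem and is unique up to null sets.\<close>

definition fourier :: "(real^3 \<Rightarrow> complex) \<Rightarrow> real^3 \<Rightarrow> complex"
  where "fourier f = (SOME g. L2 g \<and>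
    (\<lambda>n::nat. \<integral>\<^sup>+ \<xi>. ennreal ((cmod
        (fourier_integral (\<lambda>x. indicator (cball 0 (real n)) x *\<^sub>R f x) \<xi> - g \<xi>))\<^sup>2) \<partial>lebesgue)
      \<longlonglongrightarrow> 0)"

abbreviation fourier_real :: "(real^3 \<Rightarrow> real) \<Rightarrow> real^3 \<Rightarrow> complex"
  where "fourier_real u \<equiv> fourier (\<lambda>x. complex_of_real (u x))"

definition sobolev :: "real \<Rightarrow> (real^3 \<Rightarrow> real) set"
  where "sobolev s = {u. L2 u \<and>
    integrable lebesgue (\<lambda>\<xi>. (1 + (norm \<xi>)\<^sup>2) powr s * (cmod (fourier_real u \<xi>))\<^sup>2)}"

text \<open>The (bilinear) form of the Fourier multiplier with real symbol \<open>\<sigma>\<close>. The real part is taken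
  only to land in type \<^typ>\<open>real\<close>: for real-valued functions and an even symbol the integral
  is real.\<close>

definition multiplier_form ::
    "(real^3 \<Rightarrow> real) \<Rightarrow> (real^3 \<Rightarrow> real) \<Rightarrow> (real^3 \<Rightarrow> real) \<Rightarrow> real"
  where "multiplier_form \<sigma> u v =
    (\<integral>\<xi>. \<sigma> \<xi> * Re (fourier_real u \<xi> * cnj (fourier_real v \<xi>)) \<partial>lebesgue)"

definition multiplier_qform :: "(real^3 \<Rightarrow> real) \<Rightarrow> (real^3 \<Rightarrow> real) \<Rightarrow> real"
  where "multiplier_qform \<sigma> u = (\<integral>\<xi>. \<sigma> \<xi> * (cmod (fourier_real u \<xi>))\<^sup>2 \<partial>lebesgue)"

text \<open>The integral of \<open>|(-\<Delta>)\<^bsup>1/4\<^esup>u|\<^sup>2\<close>; the operator \<open>(-\<Delta>)\<^bsup>1/4\<^esup>\<close> has symbol \<open>|\<xi>|\<^bsup>1/2\<^esup>\<close>.\<close>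

definition kinetic :: "(real^3 \<Rightarrow> real) \<Rightarrow> real"
  where "kinetic u = multiplier_qform norm u"

definition coulomb_potential :: "(real^3 \<Rightarrow> real) \<Rightarrow> real^3 \<Rightarrow> real"
  where "coulomb_potential w x = (\<integral>y. w y / norm (x - y) \<partial>lebesgue)"

definition hartree :: "(real^3 \<Rightarrow> real) \<Rightarrow> real"
  where "hartree u = (\<integral>x. coulomb_potential (\<lambda>y. (u y)\<^sup>2) x * (u x)\<^sup>2 \<partial>lebesgue)"

text \<open>Solutions of \<open>\<surd>(-\<Delta>) u + u - (|x|\<^bsup>-1\<^esup> * u\<^sup>2) u = 0\<close> in \<open>H\<^bsup>1/2\<^esup>\<close> that do not vanish identically.
  For \<open>u \<in> H\<^bsup>1/2\<^esup>\<close> the left-hand side lies in the dual space of \<open>H\<^bsup>1/2\<^esup>\<close>, so the equation is tested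
  against all of \<open>H\<^bsup>1/2\<^esup>\<close>.\<close>

definition nontrivial_solution :: "(real^3 \<Rightarrow> real) \<Rightarrow> bool"
  where "nontrivial_solution u \<longleftrightarrow>
    u \<in> sobolev (1/2) \<and>
    \<not> (AE x in lebesgue. u x = 0) \<and>
    (\<forall>\<phi> \<in> sobolev (1/2).
       multiplier_form norm u \<phi> + (\<integral>x. u x * \<phi> x \<partial>lebesgue)
       - (\<integral>x. coulomb_potential (\<lambda>y. (u y)\<^sup>2) x * u x * \<phi> x \<partial>lebesgue) = 0)"

definition action :: "(real^3 \<Rightarrow> real) \<Rightarrow> real"
  where "action w = kinetic w / 2 + L2_norm_sq w / 2 - hartree w / 4"

definition ground_state :: "(real^3 \<Rightarrow> real) \<Rightarrow> bool"
  where "ground_state u \<longleftrightarrow>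
    nontrivial_solution u \<and> (\<forall>w. nontrivial_solution w \<longrightarrow> action u \<le> action w)"

text \<open>The space \<open>\<H>\<close>; it is only used for \<open>V \<ge> 0\<close>, where integrability of \<open>V u\<^sup>2\<close> means that its
  integral is finite.\<close>

definition energy_space :: "(real^3 \<Rightarrow> real) \<Rightarrow> (real^3 \<Rightarrow> real) set"
  where "energy_space V =
    {u \<in> sobolev (1/2). integrable lebesgue (\<lambda>x. V x * (u x)\<^sup>2)}"

definition energy ::
    "real \<Rightarrow> (real^3 \<Rightarrow> real) \<Rightarrow> real \<Rightarrow> (real^3 \<Rightarrow> real) \<Rightarrow> real"
  where "energy m V a u =
    multiplier_qform (\<lambda>\<xi>. sqrt ((norm \<xi>)\<^sup>2 + m\<^sup>2)) u
    + (\<integral>x. V x * (u x)\<^sup>2 \<partial>lebesgue) - a / 2 * hartree u"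

text \<open>The infimum is taken in \<^typ>\<open>ereal\<close> because it may be \<open>-\<infinity>\<close>.\<close>

definition ground_energy :: "real \<Rightarrow> (real^3 \<Rightarrow> real) \<Rightarrow> real \<Rightarrow> ereal"
  where "ground_energy m V a =
    (INF u \<in> {u \<in> energy_space V. L2_norm_sq u = 1}. ereal (energy m V a u))"

definition minimizer ::
    "real \<Rightarrow> (real^3 \<Rightarrow> real) \<Rightarrow> real \<Rightarrow> (real^3 \<Rightarrow> real) \<Rightarrow> bool"
  where "minimizer m V a u \<longleftrightarrow>
    u \<in> energy_space V \<and> L2_norm_sq u = 1 \<and> ereal (energy m V a u) = ground_energy m V a"

end

theory Submission
  imports Defs "HOL-Probability.Probability" "HOL-Complex_Analysis.Great_Picard" "HOL-Real_Asymp.Real_Asymp"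
begin

text \<open>The quadratic form of \<open>\<surd>(-\<Delta> + m\<^sup>2)\<close> is, by subordination, an average of heat forms. This yields the
  Gagliardo formula \<open>\<kappa> \<integral>\<integral>|u(x) - u(y)|\<^sup>2 / |x - y|\<^sup>4\<close> for the kinetic energy \<open>K(u)\<close>, lets \<open>u\<close> be replaced by \<open>|u|\<close>,
  and gives a local compactness theorem by averaging over small cells. With \<open>A = \<parallel>Q\<parallel>\<^sup>2\<close>, optimality of \<open>Q\<close> reads
  \<open>(A/2) D(u) \<le> K(u) N(u)\<close> with \<open>N(u) = \<parallel>u\<parallel>\<^sup>2\<close> and \<open>D\<close> the Hartree energy; below \<open>A\<close> the energy is therefore coercive and
  the direct method applies. Testing the equation with \<open>Q\<close> and its dilates gives \<open>K(Q) = N(Q) = A\<close> and \<open>D(Q) = 2 A\<close>.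
  Truncations of \<open>Q\<close> concentrating near a point where \<open>V\<close> is close to its essential infimum \<open>c\<close> show that the infimum
  is \<open>-\<infinity>\<close> above \<open>A\<close> and at most \<open>c\<close> at \<open>A\<close>. A minimizer at \<open>A\<close> would then be an optimizer of the Hartree
  inequality living on the bounded set where \<open>V = c\<close>; adding a small far copy of itself would contradict
  the inequality, since the form of \<open>\<surd>(-\<Delta>)\<close> is nonlocal.\<close>

section \<open>Gaussian integrals and the heat kernel\<close>

text \<open>The condition on \<open>inf V\<close> is pointwise while \<open>V\<close> is merely
  measurable, so \<open>V\<close> may be small only on a null set. Energies see the essential
  infimum \<open>c\<close>, possibly positive, and the critical energy is measured against
  \<open>c\<close>: trial functions push it down to \<open>c\<close>, the potential term keeps it at
  least \<open>c\<close>, so a critical minimizer has potential energy exactly \<open>c\<close> and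
  balanced kinetic and Hartree energies. The strict inequality between the symbols
  \<open>\<surd>(|\<xi>|\<^sup>2 + m\<^sup>2)\<close> and \<open>|\<xi>|\<close> would then exclude
  it for nonzero \<open>m\<close> but is lost at \<open>m = 0\<close>; bounded support treats every
  \<open>m\<close> alike. Of the virial relation a single inequality must be proved: the equation
  gives \<open>K + N = D\<close>, optimality gives \<open>D \<le> 2 K\<close>, hence
  \<open>N \<le> K\<close>. Dilates supply \<open>K \<le> N\<close>, and one-sided dilations suffice
  for that. Quadratic forms are integrals with values in \<open>[0, \<infinity>]\<close>, so
  exchanging integrals costs no integrability and finiteness is a result. The work is done on Borel
  functions, for which double integrals over the product measure make sense; Lebesgue measurable
  data are exchanged for Borel representatives at the end.\<close>

type_synonym R3 = "real^3"

lemma nn_integral_affine_R3: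
  fixes t :: R3
  assumes [measurable]: "f \<in> borel_measurable borel" and "c \<noteq> 0"
  shows "(\<integral>\<^sup>+x. f x \<partial>lborel) = ennreal (\<bar>c\<bar>^3) * (\<integral>\<^sup>+x. f (t + c *\<^sub>R x) \<partial>lborel)"
  by (subst lborel_affine[OF assms(2), of t])
     (simp add: nn_integral_density nn_integral_distr nn_integral_cmult ennreal_power)

lemma nn_integral_translate_R3:
  fixes t :: R3
  assumes [measurable]: "f \<in> borel_measurable borel"
  shows "(\<integral>\<^sup>+x. f (x + t) \<partial>lborel) = (\<integral>\<^sup>+x. f x \<partial>lborel)"
  using nn_integral_affine_R3[of f 1 t] by (simp add: add.commute)

lemma nn_integral_translate_diff_R3:
  fixes t :: R3
  assumes [measurable]: "f \<in> borel_measurable borel"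
  shows "(\<integral>\<^sup>+x. f (x - t) \<partial>lborel) = (\<integral>\<^sup>+x. f x \<partial>lborel)"
  using nn_integral_translate_R3[of f "-t"] by simp

lemma nn_integral_reflect_R3:
  fixes t :: R3
  assumes [measurable]: "f \<in> borel_measurable borel"
  shows "(\<integral>\<^sup>+x. f (t - x) \<partial>lborel) = (\<integral>\<^sup>+x. f x \<partial>lborel)"
  using nn_integral_affine_R3[of f "-1" t] by simp

lemma nn_integral_scale_R3:
  fixes f :: "R3 \<Rightarrow> ennreal"
  assumes [measurable]: "f \<in> borel_measurable borel" and "c > 0"
  shows "(\<integral>\<^sup>+x. f (c *\<^sub>R x) \<partial>lborel) = ennreal (1 / c^3) * (\<integral>\<^sup>+x. f x \<partial>lborel)"
proof -
  have "ennreal (1 / c^3) * (\<integral>\<^sup>+x. f x \<partial>lborel)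
      = ennreal (1 / c^3) * (ennreal (\<bar>c\<bar>^3) * (\<integral>\<^sup>+x. f (c *\<^sub>R x) \<partial>lborel))"
    using nn_integral_affine_R3[of f c 0] assms by simp
  also have "\<dots> = ennreal ((1 / c^3) * c^3) * (\<integral>\<^sup>+x. f (c *\<^sub>R x) \<partial>lborel)"
    using \<open>c > 0\<close> by (subst ennreal_mult) (auto simp: mult.assoc)
  finally show ?thesis using \<open>c > 0\<close> by simp
qed

text \<open>The characteristic function of the standard normal law is this Fourier integral up to
  scaling: stretching the variable by \<open>sqrt (2*t)\<close> turns its density into a multiple of
  \<open>exp (- t * x^2)\<close>.\<close>

lemma has_bochner_gauss_1d:
  fixes t z :: real
  assumes "t > 0"
  shows "has_bochner_integral lborel (\<lambda>x. complex_of_real (exp (- t * x^2)) * cis (- (z * x)))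
    (complex_of_real (sqrt (pi / t) * exp (- z\<^sup>2 / (4 * t))))"
proof -
  \<comment> \<open>Chosen so that \<open>u * (sqrt (2*t) * x) = - (z * x)\<close> after the
    substitution.\<close>
  define u where "u = - z / sqrt (2 * t)"
  have std: "integrable std_normal_distribution (\<lambda>x. iexp (u * x))"
    by (rule prob_space.integrable_iexp[OF prob_space_normal_density]) auto
  have "(LINT x|std_normal_distribution. iexp (u * x)) = complex_of_real (exp (- (u^2) / 2))"
    using fun_cong[OF char_std_normal_distribution, of u] by (simp add: char_def)
  then have "has_bochner_integral std_normal_distribution (\<lambda>x. iexp (u * x)) (exp (- (u^2) / 2))"
    using std by (simp add: has_bochner_integral_iff)
  then have "has_bochner_integral lborel (\<lambda>x. std_normal_density x *\<^sub>R iexp (u * x)) (exp (- (u^2) / 2))"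
    unfolding has_bochner_integral_iff
    by (subst (asm) integrable_density, simp, simp, simp add: normal_density_nonneg)
       (subst (asm) integral_density, auto simp: normal_density_nonneg)
  then have "has_bochner_integral lborel (\<lambda>x. std_normal_density (0 + sqrt (2*t) * x) *\<^sub>R iexp (u * (0 + sqrt (2*t) * x)))
     (complex_of_real (exp (- (u^2) / 2)) /\<^sub>R \<bar>sqrt (2*t)\<bar>)"
    using \<open>t > 0\<close> by (subst (asm) lborel_has_bochner_integral_real_affine_iff[of "sqrt (2*t)" _ _ 0]) (auto simp: scaleR_conv_of_real)
  then have "has_bochner_integral lborel (\<lambda>x. sqrt (2*pi) *\<^sub>R (std_normal_density (0 + sqrt (2*t) * x) *\<^sub>R iexp (u * (0 + sqrt (2*t) * x))))
     (sqrt (2*pi) *\<^sub>R (complex_of_real (exp (- (u^2) / 2)) /\<^sub>R \<bar>sqrt (2*t)\<bar>))"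
    by (intro has_bochner_integral_scaleR_right) auto
  moreover have "sqrt (2*pi) *\<^sub>R (std_normal_density (0 + sqrt (2*t) * x) *\<^sub>R iexp (u * (0 + sqrt (2*t) * x)))
     = complex_of_real (exp (- t * x^2)) * cis (- (z * x))" for x
    using \<open>t > 0\<close>
    by (simp add: std_normal_density_def u_def cis_conv_exp real_sqrt_mult power_mult_distrib scaleR_conv_of_real field_simps)
  moreover have "sqrt (2*pi) *\<^sub>R (complex_of_real (exp (- (u^2) / 2)) /\<^sub>R \<bar>sqrt (2*t)\<bar>)
     = complex_of_real (sqrt (pi / t) * exp (- z\<^sup>2 / (4 * t)))"
    using \<open>t > 0\<close>
    by (simp add: u_def scaleR_conv_of_real power_divide real_sqrt_mult real_sqrt_divide field_simps)
  ultimately show ?thesis by simp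
qed

text \<open>Lebesgue measure is the image of the product of one-dimensional Lebesgue measures
  indexed by \<open>Basis\<close>, so integrals of products of coordinate functions factor.\<close>

lemma has_bochner_lborel_prod:
  fixes f :: "'a::euclidean_space \<Rightarrow> real \<Rightarrow> complex"
  assumes "\<And>b. b \<in> Basis \<Longrightarrow> has_bochner_integral lborel (f b) (I b)"
  shows "has_bochner_integral lborel (\<lambda>x::'a. \<Prod>b\<in>Basis. f b (x \<bullet> b)) (\<Prod>b\<in>Basis. I b)"
proof -
  interpret product_sigma_finite "\<lambda>_. lborel :: real measure" by standard
  have int: "b \<in> Basis \<Longrightarrow> integrable lborel (f b)" for b
    using assms by (simp add: has_bochner_integral_iff)
  have [measurable]: "b \<in> Basis \<Longrightarrow> f b \<in> borel_measurable borel" for b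
    using int[of b] by (auto dest: borel_measurable_integrable)
  have ip: "integrable (\<Pi>\<^sub>M b\<in>Basis. lborel) (\<lambda>g. \<Prod>b\<in>Basis. f b (g b))"
    using int by (intro product_integrable_prod) auto
  have vp: "integral\<^sup>L (\<Pi>\<^sub>M b\<in>(Basis::'a set). lborel) (\<lambda>g. \<Prod>b\<in>Basis. f b (g b)) = (\<Prod>b\<in>Basis. I b)"
    using int assms by (subst product_integral_prod) (auto simp: has_bochner_integral_iff)
  have eq: "(\<Prod>b\<in>Basis. f b ((\<Sum>b\<in>Basis. g b *\<^sub>R b) \<bullet> b)) = (\<Prod>b\<in>(Basis::'a set). f b (g b))" for g
    by (intro prod.cong) (auto simp: inner_sum_left inner_Basis if_distrib sum.delta cong: if_cong)
  show ?thesis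
    unfolding has_bochner_integral_iff
    by (subst (1 2) lborel_eq, subst integrable_distr_eq)
       (auto simp: integral_distr eq ip vp)
qed

lemma gauss_prod: "(\<Prod>b\<in>(Basis::R3 set). exp (c * (x \<bullet> b)^2)) = exp (c * (norm x)^2)"
proof -
  have "(norm x)^2 = (\<Sum>b\<in>Basis. (x \<bullet> b)^2)"
    unfolding power2_norm_eq_inner by (subst euclidean_inner) (simp add: power2_eq_square)
  then show ?thesis by (simp add: exp_sum[symmetric] sum_distrib_left[symmetric])
qed

lemma has_bochner_gauss_R3:
  fixes z :: R3
  assumes "t > 0"
  shows "has_bochner_integral lborel (\<lambda>x::R3. complex_of_real (exp (- t * (norm x)^2)) * cis (- (z \<bullet> x)))
    (complex_of_real (sqrt (pi / t) ^ 3 * exp (- (norm z)\<^sup>2 / (4 * t))))"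
proof -
  have cis_prod: "(\<Prod>b\<in>Basis. cis (- ((z \<bullet> b) * (x \<bullet> b)))) = cis (- (z \<bullet> x))" for x :: R3
  proof -
    have "(\<Prod>b\<in>B. cis (g b)) = cis (\<Sum>b\<in>B. g b)" if "finite B" for B :: "R3 set" and g
      using that by induction (auto simp: cis_mult)
    then show ?thesis by (simp add: euclidean_inner[of z x] sum_negf)
  qed
  have "has_bochner_integral lborel
     (\<lambda>x::R3. \<Prod>b\<in>Basis. complex_of_real (exp (- t * (x \<bullet> b)^2)) * cis (- ((z \<bullet> b) * (x \<bullet> b))))
     (\<Prod>b\<in>(Basis::R3 set). complex_of_real (sqrt (pi / t) * exp (- (z \<bullet> b)\<^sup>2 / (4 * t))))"
    by (rule has_bochner_lborel_prod) (rule has_bochner_gauss_1d[OF assms])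
  moreover have "(\<Prod>b\<in>Basis. complex_of_real (exp (- t * (x \<bullet> b)^2)) * cis (- ((z \<bullet> b) * (x \<bullet> b))))
     = complex_of_real (exp (- t * (norm x)^2)) * cis (- (z \<bullet> x))" for x :: R3
    using gauss_prod[of "- t" x]
    by (simp add: prod.distrib cis_prod of_real_prod[symmetric] del: of_real_prod)
  moreover have "(\<Prod>b\<in>(Basis::R3 set). complex_of_real (sqrt (pi / t) * exp (- (z \<bullet> b)\<^sup>2 / (4 * t))))
     = complex_of_real (sqrt (pi / t) ^ 3 * exp (- (norm z)\<^sup>2 / (4 * t)))"
    using gauss_prod[of "- 1 / (4*t)" z]
    by (simp add: of_real_prod[symmetric] prod.distrib del: of_real_prod of_real_mult)
  ultimately show ?thesis by simp
qed

lemma nn_integral_gauss_R3: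
  assumes "t > 0"
  shows "(\<integral>\<^sup>+(x::R3). ennreal (exp (- t * (norm x)^2)) \<partial>lborel) = ennreal (sqrt (pi / t) ^ 3)"
proof -
  have "has_bochner_integral lborel (\<lambda>x::R3. complex_of_real (exp (- t * (norm x)^2))) (complex_of_real (sqrt (pi / t) ^ 3))"
    using has_bochner_gauss_R3[OF assms, of 0] by simp
  then have "has_bochner_integral lborel (\<lambda>x::R3. (exp (- t * (norm x)^2))) (sqrt (pi / t) ^ 3)"
    by (auto dest: has_bochner_integral_Re)
  then show ?thesis using assms
    by (subst nn_integral_eq_integral) (auto simp: has_bochner_integral_iff)
qed

text \<open>The kernel of \<open>exp (t \<Delta>)\<close>: convolution with it corresponds to the
  multiplier \<open>exp (-t |\<xi>|\<^sup>2)\<close>.\<close>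

definition heat :: "real \<Rightarrow> R3 \<Rightarrow> real"
  where "heat t z = exp (- (norm z)\<^sup>2 / (4 * t)) / sqrt (4 * pi * t) ^ 3"

lemma heat_measurable[measurable]: "heat t \<in> borel_measurable borel"
  unfolding heat_def by measurable

lemma heat_nonneg: "t > 0 \<Longrightarrow> heat t z \<ge> 0"
  unfolding heat_def by simp

lemma nn_integral_heat:
  assumes "t > 0" shows "(\<integral>\<^sup>+z. ennreal (heat t z) \<partial>lborel) = 1"
proof -
  have "(\<integral>\<^sup>+z. ennreal (heat t z) \<partial>lborel)
     = (\<integral>\<^sup>+z. ennreal (1 / sqrt (4 * pi * t) ^ 3) * ennreal (exp (- (1 / (4*t)) * (norm (z::R3))^2)) \<partial>lborel)"
    by (intro nn_integral_cong) (use assms in \<open>simp add: heat_def ennreal_mult[symmetric]\<close>)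
  also have "\<dots> = ennreal (1 / sqrt (4 * pi * t) ^ 3) * ennreal (sqrt (4 * pi * t) ^ 3)"
    using nn_integral_gauss_R3[of "1 / (4*t)"] assms by (subst nn_integral_cmult) (auto simp: mult_ac)
  also have "\<dots> = 1"
    using assms by (simp add: ennreal_mult[symmetric])
  finally show ?thesis .
qed

text \<open>Self-similarity of the heat kernel: with shifts measured in units of
  \<open>sqrt t\<close> the time disappears from the kernel, and \<open>(sqrt t)^3\<close> is the
  Jacobian.\<close>

lemma heat_scale:
  assumes "t > 0"
  shows "heat t (sqrt t *\<^sub>R w) * (sqrt t)^3 = heat 1 w"
  using assms by (simp add: heat_def power_mult_distrib real_sqrt_mult)

section \<open>Continuity of translations in mean\<close>

lemma ennreal_tendsto_0I:
  fixes f :: "'a \<Rightarrow> ennreal"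
  assumes "\<And>e::real. e > 0 \<Longrightarrow> \<forall>\<^sub>F n in F. f n \<le> ennreal e"
  shows "(f \<longlongrightarrow> 0) F"
proof (rule order_tendstoI)
  fix a :: ennreal assume "0 < a"
  obtain e where "e > 0" "ennreal e < a"
  proof (cases a)
    case (real r)
    then show ?thesis using \<open>0 < a\<close> by (intro that[of "r/2"]) (auto simp: ennreal_less_iff)
  next
    case top
    then show ?thesis by (intro that[of 1]) auto
  qed
  with assms[of e] show "\<forall>\<^sub>F x in F. f x < a"
    by (auto elim!: eventually_mono)
qed auto

lemma ennreal_tendsto_0_le:
  fixes f g :: "'a \<Rightarrow> ennreal"
  assumes "(g \<longlongrightarrow> 0) F" "\<And>n. f n \<le> g n"
  shows "(f \<longlongrightarrow> 0) F"
  by (rule tendsto_sandwich[OF _ _ tendsto_const assms(1)]) (use assms(2) in auto)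

lemma ennreal_tendsto_0D:
  fixes f :: "'a \<Rightarrow> ennreal"
  assumes "(f \<longlongrightarrow> 0) F" "e > 0"
  shows "\<forall>\<^sub>F n in F. f n < ennreal e"
  using order_tendstoD(2)[OF assms(1), of "ennreal e"] assms(2) by simp

lemma sq_add_le: "(norm (a + b))^2 \<le> 2 * (norm a)^2 + 2 * (norm (b::'b::real_normed_vector))^2"
proof -
  have "(norm (a + b))^2 \<le> (norm a + norm b)^2" by (intro power_mono norm_triangle_ineq) auto
  also have "\<dots> \<le> 2 * (norm a)^2 + 2 * (norm b)^2"
    using sum_squares_bound[of "norm a" "norm b"] by (simp add: power2_sum)
  finally show ?thesis .
qed

lemma sq_diff_le: "(norm (a - b))^2 \<le> 2 * (norm a)^2 + 2 * (norm (b::'b::real_normed_vector))^2"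
  using sq_add_le[of a "-b"] by simp

lemma sq_diff_le3: "(norm (a - c))^2 \<le> 2 * (norm (a - b))^2 + 2 * (norm (b - (c::'b::real_normed_vector)))^2"
  using sq_add_le[of "a - b" "b - c"] by simp

lemma nn_sq_diff_le3:
  fixes f g h :: "'a \<Rightarrow> 'b::{real_normed_vector, second_countable_topology}"
  assumes [measurable]: "f \<in> borel_measurable M" "g \<in> borel_measurable M" "h \<in> borel_measurable M"
  shows "(\<integral>\<^sup>+x. ennreal ((norm (f x - h x))^2) \<partial>M)
     \<le> 2 * (\<integral>\<^sup>+x. ennreal ((norm (f x - g x))^2) \<partial>M) + 2 * (\<integral>\<^sup>+x. ennreal ((norm (g x - h x))^2) \<partial>M)"
proof -
  have "(\<integral>\<^sup>+x. ennreal ((norm (f x - h x))^2) \<partial>M)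
    \<le> (\<integral>\<^sup>+x. 2 * ennreal ((norm (f x - g x))^2) + 2 * ennreal ((norm (g x - h x))^2) \<partial>M)"
  proof (intro nn_integral_mono)
    fix x
    have "ennreal ((norm (f x - h x))^2) \<le> ennreal (2 * (norm (f x - g x))^2 + 2 * (norm (g x - h x))^2)"
      by (intro ennreal_leI sq_diff_le3)
    also have "\<dots> = 2 * ennreal ((norm (f x - g x))^2) + 2 * ennreal ((norm (g x - h x))^2)"
      by (simp add: ennreal_plus ennreal_mult)
    finally show "ennreal ((norm (f x - h x))^2) \<le> \<dots>" .
  qed
  also have "\<dots> = 2 * (\<integral>\<^sup>+x. ennreal ((norm (f x - g x))^2) \<partial>M) + 2 * (\<integral>\<^sup>+x. ennreal ((norm (g x - h x))^2) \<partial>M)"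
    by (simp add: nn_integral_add nn_integral_cmult)
  finally show ?thesis .
qed

text \<open>A point of an open set stays in it under small shifts, so dominated convergence handles
  open sets; outer regularity passes to Borel sets of finite measure.\<close>

lemma translation_L1_indicator:
  fixes A :: "R3 set"
  assumes A[measurable]: "A \<in> sets borel" and fin: "emeasure lborel A < \<infinity>" and h: "h \<longlonglongrightarrow> (0::R3)"
  shows "(\<lambda>n::nat. \<integral>\<^sup>+x. ennreal \<bar>indicator A (x + h n) - indicator A x\<bar> \<partial>lborel) \<longlonglongrightarrow> 0"
proof -
  have op: "(\<lambda>n::nat. \<integral>\<^sup>+x. ennreal \<bar>indicator U (x + h n) - indicator U x\<bar> \<partial>lborel) \<longlonglongrightarrow> 0"
    if "open U" and finU: "emeasure lborel U < \<infinity>" for U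
  proof -
    have [measurable]: "U \<in> sets borel" using \<open>open U\<close> by auto
    let ?g = "\<lambda>n x. indicator U x * indicator (- U) (x + h n) :: ennreal"
    have lim: "(\<lambda>n. \<integral>\<^sup>+x. ?g n x \<partial>lborel) \<longlonglongrightarrow> (\<integral>\<^sup>+(x::R3). 0 \<partial>lborel)"
    proof (rule nn_integral_dominated_convergence[where w="indicator U"])
      show "(\<integral>\<^sup>+x. indicator U x \<partial>lborel) < \<infinity>" using finU by simp
      show "AE x in lborel. (\<lambda>n. ?g n x) \<longlonglongrightarrow> 0"
      proof (rule AE_I2)
        fix x :: R3
        show "(\<lambda>n. ?g n x) \<longlonglongrightarrow> 0"
        proof (cases "x \<in> U")
          case True
          have "(\<lambda>n. x + h n) \<longlonglongrightarrow> x + 0" by (intro tendsto_intros h)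
          then have "\<forall>\<^sub>F n in sequentially. x + h n \<in> U"
            using topological_tendstoD[OF _ \<open>open U\<close>] True by simp
          then have "\<forall>\<^sub>F n in sequentially. ?g n x = 0"
            by eventually_elim simp
          then show ?thesis by (rule tendsto_eventually)
        qed simp
      qed
    qed (auto split: split_indicator)
    \<comment> \<open>The two halves of the symmetric difference have equal measure because
      translation preserves measure; the half lying in \<open>U\<close> is the one dominated by
      \<open>indicator U\<close>.\<close>
    have eq: "(\<integral>\<^sup>+x. ennreal \<bar>indicator U (x + h n) - indicator U x\<bar> \<partial>lborel) = 2 * (\<integral>\<^sup>+x. ?g n x \<partial>lborel)" for n
    proof -
      let ?c = "\<integral>\<^sup>+x. indicator U x * indicator U (x + h n) \<partial>lborel"
      let ?b = "\<integral>\<^sup>+x. indicator (- U) x * indicator U (x + h n) \<partial>lborel"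
      have "(\<integral>\<^sup>+x. ?g n x \<partial>lborel) + ?c = (\<integral>\<^sup>+x. indicator U x \<partial>lborel)"
        by (subst nn_integral_add[symmetric], simp, simp, rule nn_integral_cong) (simp split: split_indicator)
      then have 1: "(\<integral>\<^sup>+x. ?g n x \<partial>lborel) + ?c = emeasure lborel U" by simp
      have 2: "?b + ?c = emeasure lborel U"
      proof -
        have "?b + ?c = (\<integral>\<^sup>+x. indicator U (x + h n) \<partial>lborel)"
          by (subst nn_integral_add[symmetric], simp, simp, rule nn_integral_cong) (simp split: split_indicator)
        then show ?thesis
          using nn_integral_translate_R3[of "indicator U :: R3 \<Rightarrow> ennreal" "h n"] by simp
      qed
      have "?c \<le> emeasure lborel U" unfolding 1[symmetric] by simp
      then have "?c < \<infinity>" using finU by (rule le_less_trans)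
      moreover have "?c + ?b = ?c + (\<integral>\<^sup>+x. ?g n x \<partial>lborel)"
        unfolding add.commute[of ?c] 1 2 ..
      ultimately have "?b = (\<integral>\<^sup>+x. ?g n x \<partial>lborel)"
        unfolding ennreal_add_left_cancel by (auto simp: less_top)
      moreover have "(\<integral>\<^sup>+x. ennreal \<bar>indicator U (x + h n) - indicator U x\<bar> \<partial>lborel) = (\<integral>\<^sup>+x. ?g n x \<partial>lborel) + ?b"
        by (subst nn_integral_add[symmetric], simp, simp, rule nn_integral_cong) (simp split: split_indicator)
      ultimately show ?thesis by (simp add: mult_2)
    qed
    show ?thesis unfolding eq using tendsto_mult_ennreal[OF tendsto_const[of 2] lim] by simp
  qed
  show ?thesis
  proof (rule ennreal_tendsto_0I)
    fix e :: real assume "e > 0"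
    then have e3: "e / 3 > 0" by simp
    obtain U where U: "open U" "A \<subseteq> U" "emeasure lborel (U - A) < ennreal (e / 3)"
      using outer_regular_lborel[OF A, of "e/3"] \<open>e > 0\<close> by auto
    have [measurable]: "U \<in> sets borel" using U by auto
    have "emeasure lborel U = emeasure lborel A + emeasure lborel (U - A)"
      using U by (subst plus_emeasure) (auto simp: Un_absorb1)
    also have "\<dots> < \<infinity>"
      using fin U(3) by (simp add: ennreal_add_less_top order.strict_trans[OF _ ennreal_less_top])
    finally have finU: "emeasure lborel U < \<infinity>" .
    show "\<forall>\<^sub>F n in sequentially. (\<integral>\<^sup>+x. ennreal \<bar>indicator A (x + h n) - indicator A x\<bar> \<partial>lborel) \<le> ennreal e"
      using ennreal_tendsto_0D[OF op[OF U(1) finU] e3]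
    proof eventually_elim
      case (elim n)
      have "(\<integral>\<^sup>+x. ennreal \<bar>indicator A (x + h n) - indicator A x\<bar> \<partial>lborel) \<le>
         (\<integral>\<^sup>+x. ennreal \<bar>indicator U (x + h n) - indicator U x\<bar> + (indicator (U - A) (x + h n) + indicator (U - A) x) \<partial>lborel)"
        using U(2) by (intro nn_integral_mono) (auto split: split_indicator)
      also have "\<dots> = (\<integral>\<^sup>+x. ennreal \<bar>indicator U (x + h n) - indicator U x\<bar> \<partial>lborel) + (emeasure lborel (U - A) + emeasure lborel (U - A))"
        using nn_integral_translate_R3[of "indicator (U - A) :: R3 \<Rightarrow> ennreal" "h n"]
        by (subst nn_integral_add, simp, simp, subst nn_integral_add) auto
      also have "\<dots> \<le> ennreal (e/3) + (ennreal (e/3) + ennreal (e/3))"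
        using elim U(3) \<open>e > 0\<close> by (intro add_mono) auto
      also have "\<dots> = ennreal e" using \<open>e > 0\<close> by (simp add: ennreal_plus[symmetric] del: ennreal_plus)
      finally show ?case .
    qed
  qed
qed

text \<open>Density of simple functions: translation acts isometrically on \<open>L\<^sup>1\<close>,
  so an approximation error \<open>e/3\<close> enters twice, once for the shifted and once for the
  unshifted function.\<close>

lemma translation_L1:
  fixes f :: "R3 \<Rightarrow> real"
  assumes "integrable lborel f" and h: "h \<longlonglongrightarrow> (0::R3)"
  shows "(\<lambda>n::nat. \<integral>\<^sup>+x. ennreal \<bar>f (x + h n) - f x\<bar> \<partial>lborel) \<longlonglongrightarrow> 0"
  using assms(1)
proof (induction rule: integrable_induct)
  case (base A c)
  have "(\<lambda>n::nat. ennreal \<bar>c\<bar> * (\<integral>\<^sup>+x. ennreal \<bar>indicator A (x + h n) - indicator A x\<bar> \<partial>lborel)) \<longlonglongrightarrow> ennreal \<bar>c\<bar> * 0"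
    using base by (intro tendsto_mult_ennreal tendsto_const translation_L1_indicator h) auto
  moreover have "ennreal \<bar>c\<bar> * (\<integral>\<^sup>+x. ennreal \<bar>indicator A (x + h n) - indicator A x\<bar> \<partial>lborel)
     = (\<integral>\<^sup>+x. ennreal \<bar>indicator A (x + h n) *\<^sub>R c - indicator A x *\<^sub>R c\<bar> \<partial>lborel)" for n
    using base by (subst nn_integral_cmult[symmetric])
      (auto intro!: nn_integral_cong simp: ennreal_mult[symmetric] abs_mult[symmetric] algebra_simps)
  ultimately show ?case by simp
next
  case (add f g)
  have [measurable]: "f \<in> borel_measurable borel" "g \<in> borel_measurable borel"
    using add by (auto dest: borel_measurable_integrable)
  have "(\<lambda>n. (\<integral>\<^sup>+x. ennreal \<bar>f (x + h n) - f x\<bar> \<partial>lborel) + (\<integral>\<^sup>+x. ennreal \<bar>g (x + h n) - g x\<bar> \<partial>lborel)) \<longlonglongrightarrow> 0 + 0"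
    by (intro tendsto_add add)
  then have "(\<lambda>n. (\<integral>\<^sup>+x. ennreal \<bar>f (x + h n) - f x\<bar> \<partial>lborel) + (\<integral>\<^sup>+x. ennreal \<bar>g (x + h n) - g x\<bar> \<partial>lborel)) \<longlonglongrightarrow> 0"
    by simp
  then show ?case
  proof (rule ennreal_tendsto_0_le)
    fix n
    show "(\<integral>\<^sup>+x. ennreal \<bar>f (x + h n) + g (x + h n) - (f x + g x)\<bar> \<partial>lborel)
      \<le> (\<integral>\<^sup>+x. ennreal \<bar>f (x + h n) - f x\<bar> \<partial>lborel) + (\<integral>\<^sup>+x. ennreal \<bar>g (x + h n) - g x\<bar> \<partial>lborel)"
      by (subst nn_integral_add[symmetric])
         (auto intro!: nn_integral_mono simp: ennreal_plus[symmetric] simp del: ennreal_plus)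
  qed
next
  case (lim f s)
  have [measurable]: "f \<in> borel_measurable borel" "s i \<in> borel_measurable borel" for i
    using lim(1,4) by (auto dest: borel_measurable_integrable)
  have conv: "(\<lambda>i. \<integral>\<^sup>+x. ennreal (norm (f x - s i x)) \<partial>lborel) \<longlonglongrightarrow> 0"
  proof -
    have "(\<lambda>i. \<integral>\<^sup>+x. ennreal (norm (f x - s i x)) \<partial>lborel) \<longlonglongrightarrow> (\<integral>\<^sup>+(x::R3). 0 \<partial>lborel)"
    proof (rule nn_integral_dominated_convergence[where w="\<lambda>x. 3 * ennreal (norm (f x))"])
      show "(\<integral>\<^sup>+x. 3 * ennreal (norm (f x)) \<partial>lborel) < \<infinity>"
        using lim(4) by (simp add: nn_integral_cmult integrable_iff_bounded ennreal_mult_less_top)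
      show "AE x in lborel. ennreal (norm (f x - s i x)) \<le> 3 * ennreal (norm (f x))" for i
      proof (rule AE_I2)
        fix x :: R3
        have "norm (f x - s i x) \<le> 3 * norm (f x)"
          using lim(3)[of x i] norm_triangle_ineq4[of "f x" "s i x"] by simp
        then show "ennreal (norm (f x - s i x)) \<le> 3 * ennreal (norm (f x))"
          by (metis ennreal_leI ennreal_mult' ennreal_numeral zero_le_numeral)
      qed
      show "AE x in lborel. (\<lambda>i. ennreal (norm (f x - s i x))) \<longlonglongrightarrow> 0"
      proof (rule AE_I2)
        fix x :: R3
        have "(\<lambda>i. ennreal (norm (f x - s i x))) \<longlonglongrightarrow> ennreal (norm (f x - f x))"
          using lim(2)[of x] by (intro tendsto_intros) auto
        then show "(\<lambda>i. ennreal (norm (f x - s i x))) \<longlonglongrightarrow> 0" by simp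
      qed
    qed auto
    then show ?thesis by simp
  qed
  show ?case
  proof (rule ennreal_tendsto_0I)
    fix e :: real assume "e > 0"
    then have e3: "e / 3 > 0" by simp
    obtain i where i: "(\<integral>\<^sup>+x. ennreal (norm (f x - s i x)) \<partial>lborel) < ennreal (e/3)"
      using ennreal_tendsto_0D[OF conv, of "e/3"] \<open>e > 0\<close> by (auto simp: eventually_sequentially)
    show "\<forall>\<^sub>F n in sequentially. (\<integral>\<^sup>+x. ennreal \<bar>f (x + h n) - f x\<bar> \<partial>lborel) \<le> ennreal e"
      using ennreal_tendsto_0D[OF lim(5)[of i] e3]
    proof eventually_elim
      case (elim n)
      have "(\<integral>\<^sup>+x. ennreal \<bar>f (x + h n) - f x\<bar> \<partial>lborel) \<le>
         (\<integral>\<^sup>+x. ennreal \<bar>s i (x + h n) - s i x\<bar> + (ennreal (norm (f (x + h n) - s i (x + h n))) + ennreal (norm (f x - s i x))) \<partial>lborel)"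
        by (intro nn_integral_mono) (auto simp: ennreal_plus[symmetric] simp del: ennreal_plus)
      also have "\<dots> = (\<integral>\<^sup>+x. ennreal \<bar>s i (x + h n) - s i x\<bar> \<partial>lborel) + ((\<integral>\<^sup>+x. ennreal (norm (f x - s i x)) \<partial>lborel) + (\<integral>\<^sup>+x. ennreal (norm (f x - s i x)) \<partial>lborel))"
        using nn_integral_translate_R3[of "\<lambda>x. ennreal (norm (f x - s i x))" "h n"]
        by (subst nn_integral_add, simp, simp, subst nn_integral_add) auto
      also have "\<dots> \<le> ennreal (e/3) + (ennreal (e/3) + ennreal (e/3))"
        using elim i \<open>e > 0\<close> by (intro add_mono) auto
      also have "\<dots> = ennreal e" using \<open>e > 0\<close> by (simp add: ennreal_plus[symmetric] del: ennreal_plus)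
      finally show ?case .
    qed
  qed
qed

text \<open>For nonnegative numbers \<open>(a - b)^2 \<le> |a^2 - b^2|\<close>, which reduces the
  claim to continuity in \<open>L\<^sup>1\<close> of the squares. Positive and negative parts are
  separated to have nonnegative numbers.\<close>

lemma translation_L2:
  fixes f :: "R3 \<Rightarrow> real"
  assumes [measurable]: "f \<in> borel_measurable borel" and int: "integrable lborel (\<lambda>x. (f x)^2)"
    and h: "h \<longlonglongrightarrow> (0::R3)"
  shows "(\<lambda>n::nat. \<integral>\<^sup>+x. ennreal ((f (x + h n) - f x)^2) \<partial>lborel) \<longlonglongrightarrow> 0"
proof -
  define p where "p x = max (f x) 0" for x
  define q where "q x = max (- f x) 0" for x
  have [measurable]: "p \<in> borel_measurable borel" "q \<in> borel_measurable borel"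
    unfolding p_def q_def by measurable
  have ip: "integrable lborel (\<lambda>x. (p x)^2)" "integrable lborel (\<lambda>x. (q x)^2)"
    by (rule Bochner_Integration.integrable_bound[OF int]; auto simp: p_def q_def max_def)+
  have key: "(a - b)^2 \<le> \<bar>a^2 - b\<^sup>2\<bar>" if "a \<ge> 0" "b \<ge> 0" for a b :: real
  proof -
    have "\<bar>a - b\<bar> * \<bar>a - b\<bar> \<le> \<bar>a - b\<bar> * (a + b)" using that by (intro mult_left_mono) auto
    also have "\<dots> = \<bar>(a - b) * (a + b)\<bar>" using that by (simp add: abs_mult)
    also have "(a - b) * (a + b) = a^2 - b\<^sup>2" by (simp add: algebra_simps power2_eq_square)
    finally show ?thesis by (simp add: power2_eq_square)
  qed
  have "(f (x + t) - f x)^2 \<le> 2 * \<bar>(p (x + t))^2 - (p x)\<^sup>2\<bar> + 2 * \<bar>(q (x + t))^2 - (q x)\<^sup>2\<bar>" for x t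
  proof -
    have "f (x + t) - f x = (p (x + t) - p x) - (q (x + t) - q x)" by (auto simp: p_def q_def max_def)
    then have "(f (x + t) - f x)^2 \<le> 2 * (p (x + t) - p x)^2 + 2 * (q (x + t) - q x)^2"
      using sq_diff_le[of "p (x + t) - p x" "q (x + t) - q x"] by simp
    also have "\<dots> \<le> 2 * \<bar>(p (x + t))^2 - (p x)\<^sup>2\<bar> + 2 * \<bar>(q (x + t))^2 - (q x)\<^sup>2\<bar>"
      by (intro add_mono mult_left_mono key) (auto simp: p_def q_def)
    finally show ?thesis .
  qed
  then have le: "(\<integral>\<^sup>+x. ennreal ((f (x + h n) - f x)^2) \<partial>lborel) \<le>
     2 * (\<integral>\<^sup>+x. ennreal \<bar>(p (x + h n))^2 - (p x)\<^sup>2\<bar> \<partial>lborel) + 2 * (\<integral>\<^sup>+x. ennreal \<bar>(q (x + h n))^2 - (q x)\<^sup>2\<bar> \<partial>lborel)" for n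
    by (subst (1 2) nn_integral_cmult[symmetric], simp, simp, subst nn_integral_add[symmetric])
       (auto intro!: nn_integral_mono simp: ennreal_mult[symmetric] ennreal_plus[symmetric] ennreal_numeral[symmetric] simp del: ennreal_plus ennreal_numeral)
  have "(\<lambda>n. 2 * (\<integral>\<^sup>+x. ennreal \<bar>(p (x + h n))^2 - (p x)\<^sup>2\<bar> \<partial>lborel) + 2 * (\<integral>\<^sup>+x. ennreal \<bar>(q (x + h n))^2 - (q x)\<^sup>2\<bar> \<partial>lborel)) \<longlonglongrightarrow> 2 * 0 + 2 * 0"
    by (intro tendsto_add tendsto_mult_ennreal tendsto_const translation_L1 ip h) auto
  then show ?thesis
    by (intro ennreal_tendsto_0_le[OF _ le]) simp
qed

section \<open>Completeness of \<open>L\<^sup>2\<close>\<close>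

lemma nn_fatou_AE:
  fixes u :: "nat \<Rightarrow> 'a \<Rightarrow> ennreal"
  assumes [measurable]: "\<And>n. u n \<in> borel_measurable M"
    and lim: "AE x in M. (\<lambda>n. u n x) \<longlonglongrightarrow> v x"
    and bd: "\<forall>\<^sub>F n in sequentially. (\<integral>\<^sup>+x. u n x \<partial>M) \<le> c"
  shows "(\<integral>\<^sup>+x. v x \<partial>M) \<le> c"
proof -
  have "(\<integral>\<^sup>+x. v x \<partial>M) = (\<integral>\<^sup>+x. liminf (\<lambda>n. u n x) \<partial>M)"
    by (rule nn_integral_cong_AE) (use lim in \<open>eventually_elim, simp add: lim_imp_Liminf\<close>)
  also have "\<dots> \<le> liminf (\<lambda>n. \<integral>\<^sup>+x. u n x \<partial>M)"
    by (rule nn_integral_liminf) simp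
  also have "\<dots> \<le> limsup (\<lambda>n. \<integral>\<^sup>+x. u n x \<partial>M)"
    by (rule Liminf_le_Limsup) simp
  also have "\<dots> \<le> c" by (rule Limsup_bounded[OF bd])
  finally show ?thesis .
qed

text \<open>A subsequence with squared gaps \<open>4^-k\<close> is summed against weights
  \<open>2^k\<close>; finiteness of the weighted sum almost everywhere makes the gaps decay
  geometrically pointwise. Fatou then lifts convergence to the whole sequence. The almost everywhere
  convergent subsequence is returned as well, for later uses of Fatou's lemma.\<close>

lemma riesz_fischer:
  fixes f :: "nat \<Rightarrow> 'a \<Rightarrow> 'b::{banach, second_countable_topology}"
  assumes meas[measurable]: "\<And>n. f n \<in> borel_measurable M"
    and cauchy: "\<And>e::real. e > 0 \<Longrightarrow> \<exists>N. \<forall>m\<ge>N. \<forall>n\<ge>N. (\<integral>\<^sup>+x. ennreal ((norm (f m x - f n x))^2) \<partial>M) \<le> ennreal e"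
  obtains g r where "g \<in> borel_measurable M" "strict_mono (r::nat\<Rightarrow>nat)"
    "AE x in M. (\<lambda>k. f (r k) x) \<longlonglongrightarrow> g x"
    "(\<lambda>n. \<integral>\<^sup>+x. ennreal ((norm (f n x - g x))^2) \<partial>M) \<longlonglongrightarrow> 0"
proof -
  have "\<exists>N. \<forall>m\<ge>N. \<forall>n\<ge>N. (\<integral>\<^sup>+x. ennreal ((norm (f m x - f n x))^2) \<partial>M) \<le> ennreal ((1/4)^k)" for k :: nat
    by (rule cauchy) simp
  then obtain N where N: "\<And>k m n. m \<ge> N k \<Longrightarrow> n \<ge> N k \<Longrightarrow> (\<integral>\<^sup>+x. ennreal ((norm (f m x - f n x))^2) \<partial>M) \<le> ennreal ((1/4)^k)"
    by metis
  define r where "r k = (\<Sum>i\<le>k. N i) + k" for k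
  have r: "strict_mono r" unfolding strict_mono_Suc_iff r_def by auto
  have rN: "N k \<le> r k" for k
    using member_le_sum[of k "{..k}" N] by (simp add: r_def)
  define d where "d k x = f (r (Suc k)) x - f (r k) x" for k x
  have [measurable]: "d k \<in> borel_measurable M" for k unfolding d_def by measurable
  have dk: "(\<integral>\<^sup>+x. ennreal ((norm (d k x))^2) \<partial>M) \<le> ennreal ((1/4)^k)" for k
    unfolding d_def using rN[of k] strict_monoD[OF r, of k "Suc k"] by (intro N) auto
  have "(\<integral>\<^sup>+x. (\<Sum>k. ennreal (2^k * (norm (d k x))^2)) \<partial>M) = (\<Sum>k. \<integral>\<^sup>+x. ennreal (2^k * (norm (d k x))^2) \<partial>M)"
    by (rule nn_integral_suminf) simp
  also have "\<dots> \<le> (\<Sum>k. ennreal ((1/2)^k))"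
  proof (intro suminf_le summableI)
    fix k :: nat
    have "(\<integral>\<^sup>+x. ennreal (2^k * (norm (d k x))^2) \<partial>M) = ennreal (2^k) * (\<integral>\<^sup>+x. ennreal ((norm (d k x))^2) \<partial>M)"
      by (subst nn_integral_cmult[symmetric]) (auto simp: ennreal_mult[symmetric])
    also have "\<dots> \<le> ennreal (2^k) * ennreal ((1/4)^k)" by (intro mult_left_mono dk) auto
    also have "\<dots> = ennreal ((1/2)^k)" by (simp add: ennreal_mult[symmetric] power_mult_distrib[symmetric])
    finally show "(\<integral>\<^sup>+x. ennreal (2^k * (norm (d k x))^2) \<partial>M) \<le> ennreal ((1/2)^k)" .
  qed
  also have "\<dots> < \<infinity>"
    by (subst suminf_ennreal2) (auto intro: summable_geometric)
  finally have fin: "(\<integral>\<^sup>+x. (\<Sum>k. ennreal (2^k * (norm (d k x))^2)) \<partial>M) < \<infinity>" .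
  have "AE x in M. (\<Sum>k. ennreal (2^k * (norm (d k x))^2)) \<noteq> \<infinity>"
    by (rule nn_integral_PInf_AE) (use fin in auto)
  then have conv: "AE x in M. convergent (\<lambda>k. f (r k) x)"
  proof eventually_elim
    case (elim x)
    have s: "summable (\<lambda>k. 2^k * (norm (d k x))^2)"
      by (rule summable_suminf_not_top) (use elim in auto)
    from summable_LIMSEQ_zero[OF s] have "Bseq (\<lambda>k. 2^k * (norm (d k x))^2)"
      by (intro convergent_imp_Bseq convergentI)
    then obtain C where C: "C > 0" "\<And>k. norm (2^k * (norm (d k x))^2) \<le> C" by (auto elim: BseqE)
    have bd: "norm (d k x) \<le> sqrt C * (1 / sqrt 2)^k" for k
    proof -
      have "(norm (d k x))^2 \<le> C / 2^k" using C(2)[of k] by (simp add: field_simps)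
      also have "\<dots> = (sqrt C * (1 / sqrt 2)^k)^2"
        using C(1) by (simp add: power_mult_distrib power_divide power2_eq_square[of "sqrt 2 ^ k"] flip: real_sqrt_power power_mult_distrib)
      finally show ?thesis by (rule power2_le_imp_le) (use C(1) in auto)
    qed
    have "summable (\<lambda>k. d k x)"
      by (rule summable_comparison_test'[where g="\<lambda>k. sqrt C * (1 / sqrt 2)^k" and N=0])
         (use bd in \<open>auto intro!: summable_mult summable_geometric\<close>)
    then have "convergent (\<lambda>n. \<Sum>k<n. d k x)" by (simp add: summable_iff_convergent)
    moreover have "(\<Sum>k<n. d k x) = f (r n) x - f (r 0) x" for n
      unfolding d_def by (rule sum_lessThan_telescope)
    ultimately have "convergent (\<lambda>n. (f (r n) x - f (r 0) x) + f (r 0) x)"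
      by (intro convergent_add convergent_const) simp
    then show ?case by simp
  qed
  define g where "g x = lim (\<lambda>k. f (r k) x)" for x
  have g[measurable]: "g \<in> borel_measurable M" unfolding g_def by (rule borel_measurable_lim_metric) simp
  have lim: "AE x in M. (\<lambda>k. f (r k) x) \<longlonglongrightarrow> g x"
    using conv by eventually_elim (simp add: g_def convergent_LIMSEQ_iff)
  have "(\<lambda>n. \<integral>\<^sup>+x. ennreal ((norm (f n x - g x))^2) \<partial>M) \<longlonglongrightarrow> 0"
  proof (rule ennreal_tendsto_0I)
    fix e :: real assume "e > 0"
    obtain N where N: "\<forall>m\<ge>N. \<forall>n\<ge>N. (\<integral>\<^sup>+x. ennreal ((norm (f m x - f n x))^2) \<partial>M) \<le> ennreal e"
      using cauchy[OF \<open>e > 0\<close>] by auto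
    show "\<forall>\<^sub>F n in sequentially. (\<integral>\<^sup>+x. ennreal ((norm (f n x - g x))^2) \<partial>M) \<le> ennreal e"
      using eventually_ge_at_top[of N]
    proof eventually_elim
      case (elim n)
      show ?case
      proof (rule nn_fatou_AE[where u="\<lambda>k x. ennreal ((norm (f n x - f (r k) x))^2)"])
        show "AE x in M. (\<lambda>k. ennreal ((norm (f n x - f (r k) x))^2)) \<longlonglongrightarrow> ennreal ((norm (f n x - g x))^2)"
          using lim by eventually_elim (auto intro!: tendsto_intros)
        show "\<forall>\<^sub>F k in sequentially. (\<integral>\<^sup>+x. ennreal ((norm (f n x - f (r k) x))^2) \<partial>M) \<le> ennreal e"
          using eventually_ge_at_top[of N]
          by eventually_elim (use N elim seq_suble[OF r] order_trans in blast)
      qed simp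
    qed
  qed
  with g r lim show thesis by (rule that)
qed

text \<open>A convergent sequence is Cauchy, so completeness yields an almost everywhere convergent
  subsequence, and its limit must agree with \<open>g\<close>.\<close>

lemma l2_AE_subseq:
  fixes f :: "nat \<Rightarrow> 'a \<Rightarrow> 'b::{banach, second_countable_topology}"
  assumes [measurable]: "\<And>n. f n \<in> borel_measurable M" "g \<in> borel_measurable M"
    and lim: "(\<lambda>n. \<integral>\<^sup>+x. ennreal ((norm (f n x - g x))^2) \<partial>M) \<longlonglongrightarrow> 0"
  obtains r where "strict_mono (r::nat\<Rightarrow>nat)" "AE x in M. (\<lambda>k. f (r k) x) \<longlonglongrightarrow> g x"
proof -
  have bound: "\<exists>N. \<forall>m\<ge>N. \<forall>n\<ge>N. (\<integral>\<^sup>+x. ennreal ((norm (f m x - f n x))^2) \<partial>M) \<le> ennreal e" if "e > 0" for e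
  proof -
    have "e / 4 > 0" using that by simp
    from ennreal_tendsto_0D[OF lim this] obtain N where
      N: "\<And>n. n \<ge> N \<Longrightarrow> (\<integral>\<^sup>+x. ennreal ((norm (f n x - g x))^2) \<partial>M) < ennreal (e/4)"
      by (auto simp: eventually_sequentially)
    show ?thesis
    proof (intro exI[of _ N] allI impI)
      fix m n assume mn: "N \<le> m" "N \<le> n"
      have "(\<integral>\<^sup>+x. ennreal ((norm (f m x - f n x))^2) \<partial>M)
        \<le> 2 * (\<integral>\<^sup>+x. ennreal ((norm (f m x - g x))^2) \<partial>M) + 2 * (\<integral>\<^sup>+x. ennreal ((norm (g x - f n x))^2) \<partial>M)"
        by (rule nn_sq_diff_le3) auto
      also have "\<dots> \<le> 2 * ennreal (e/4) + 2 * ennreal (e/4)"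
        using N[OF mn(1)] N[OF mn(2)] by (intro add_mono mult_left_mono) (auto simp: norm_minus_commute)
      also have "\<dots> = ennreal e"
        using that by (simp add: ennreal_numeral[symmetric] ennreal_mult[symmetric] ennreal_plus[symmetric] del: ennreal_plus ennreal_numeral)
      finally show "(\<integral>\<^sup>+x. ennreal ((norm (f m x - f n x))^2) \<partial>M) \<le> ennreal e" .
    qed
  qed
  obtain g' r where g': "g' \<in> borel_measurable M" and r: "strict_mono (r::nat\<Rightarrow>nat)"
    and ae: "AE x in M. (\<lambda>k. f (r k) x) \<longlonglongrightarrow> g' x"
    and lim': "(\<lambda>n. \<integral>\<^sup>+x. ennreal ((norm (f n x - g' x))^2) \<partial>M) \<longlonglongrightarrow> 0"
    using riesz_fischer[of f M, OF _ bound] by auto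
  note [measurable] = g'
  have "(\<integral>\<^sup>+x. ennreal ((norm (g x - g' x))^2) \<partial>M) \<le> 0"
  proof (rule LIMSEQ_le_const)
    show "(\<lambda>n. 2 * (\<integral>\<^sup>+x. ennreal ((norm (f n x - g x))^2) \<partial>M) + 2 * (\<integral>\<^sup>+x. ennreal ((norm (f n x - g' x))^2) \<partial>M)) \<longlonglongrightarrow> 0"
      using tendsto_add[OF tendsto_mult_ennreal[OF tendsto_const[of 2] lim] tendsto_mult_ennreal[OF tendsto_const[of 2] lim']]
      by simp
    show "\<exists>N. \<forall>n\<ge>N. (\<integral>\<^sup>+x. ennreal ((norm (g x - g' x))^2) \<partial>M)
        \<le> 2 * (\<integral>\<^sup>+x. ennreal ((norm (f n x - g x))^2) \<partial>M) + 2 * (\<integral>\<^sup>+x. ennreal ((norm (f n x - g' x))^2) \<partial>M)"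
      using nn_sq_diff_le3[of g M "f _" g'] by (auto simp: norm_minus_commute)
  qed
  then have "AE x in M. g x = g' x" by (simp add: nn_integral_0_iff_AE)
  with ae have "AE x in M. (\<lambda>k. f (r k) x) \<longlonglongrightarrow> g x" by eventually_elim simp
  with r show thesis by (rule that)
qed

lemma l2_unique:
  fixes g :: "'a \<Rightarrow> 'b::{banach, second_countable_topology}"
  assumes [measurable]: "\<And>n. f n \<in> borel_measurable M" "g \<in> borel_measurable M" "h \<in> borel_measurable M"
    and lim: "(\<lambda>n::nat. \<integral>\<^sup>+x. ennreal ((norm (f n x - g x))^2) \<partial>M) \<longlonglongrightarrow> 0"
    and lim': "(\<lambda>n. \<integral>\<^sup>+x. ennreal ((norm (f n x - h x))^2) \<partial>M) \<longlonglongrightarrow> 0"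
  shows "AE x in M. g x = h x"
proof -
  have "(\<integral>\<^sup>+x. ennreal ((norm (g x - h x))^2) \<partial>M) \<le> 0"
  proof (rule LIMSEQ_le_const)
    show "(\<lambda>n. 2 * (\<integral>\<^sup>+x. ennreal ((norm (f n x - g x))^2) \<partial>M) + 2 * (\<integral>\<^sup>+x. ennreal ((norm (f n x - h x))^2) \<partial>M)) \<longlonglongrightarrow> 0"
      using tendsto_add[OF tendsto_mult_ennreal[OF tendsto_const[of 2] lim] tendsto_mult_ennreal[OF tendsto_const[of 2] lim']]
      by simp
    show "\<exists>N. \<forall>n\<ge>N. (\<integral>\<^sup>+x. ennreal ((norm (g x - h x))^2) \<partial>M)
        \<le> 2 * (\<integral>\<^sup>+x. ennreal ((norm (f n x - g x))^2) \<partial>M) + 2 * (\<integral>\<^sup>+x. ennreal ((norm (f n x - h x))^2) \<partial>M)"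
      using nn_sq_diff_le3[of g M "f _" h] by (auto simp: norm_minus_commute)
  qed
  then show ?thesis by (simp add: nn_integral_0_iff_AE)
qed

text \<open>Young's inequality with a free parameter: the coefficient of \<open>|b|^2\<close> can be
  made small at the price of a large coefficient in front of the difference.\<close>

lemma abs_sq_diff_le:
  fixes a b :: "'b::real_normed_vector"
  assumes "d > 0"
  shows "\<bar>(norm a)^2 - (norm b)\<^sup>2\<bar> \<le> d * (norm b)^2 + (1 + 1/d) * (norm (a - b))^2"
proof -
  define p where "p = norm (a - b)"
  define q where "q = norm b"
  have 1: "\<bar>norm a - norm b\<bar> \<le> p" unfolding p_def by (rule norm_triangle_ineq3)
  have "\<bar>(norm a)^2 - (norm b)\<^sup>2\<bar> = \<bar>norm a - norm b\<bar> * (norm a + norm b)"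
  proof -
    have "(norm a)^2 - (norm b)\<^sup>2 = (norm a - norm b) * (norm a + norm b)"
      by (simp add: power2_eq_square algebra_simps)
    then show ?thesis by (simp add: abs_mult)
  qed
  also have "\<dots> \<le> p * (p + 2 * q)"
    using 1 by (intro mult_mono) (auto simp: p_def q_def)
  also have "\<dots> = p^2 + 2 * p * q" by (simp add: power2_eq_square algebra_simps)
  also have "2 * p * q \<le> d * q^2 + (1/d) * p^2"
  proof -
    have "0 \<le> (d * q - p)^2 / d" using assms by simp
    also have "\<dots> = d * q^2 + (1/d) * p^2 - 2 * p * q" using assms by (simp add: field_simps power2_eq_square)
    finally show ?thesis by simp
  qed
  finally show ?thesis unfolding p_def q_def by (simp add: algebra_simps)
qed

lemma l2_sq_L1:
  fixes g :: "'a \<Rightarrow> 'b::{banach, second_countable_topology}"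
  assumes [measurable]: "\<And>n. f n \<in> borel_measurable M" "g \<in> borel_measurable M"
    and fin: "(\<integral>\<^sup>+x. ennreal ((norm (g x))^2) \<partial>M) < \<infinity>"
    and lim: "(\<lambda>n::nat. \<integral>\<^sup>+x. ennreal ((norm (f n x - g x))^2) \<partial>M) \<longlonglongrightarrow> 0"
  shows "(\<lambda>n. \<integral>\<^sup>+x. ennreal \<bar>(norm (f n x))^2 - (norm (g x))\<^sup>2\<bar> \<partial>M) \<longlonglongrightarrow> 0"
proof (rule ennreal_tendsto_0I)
  fix e :: real assume "e > 0"
  obtain G where G: "(\<integral>\<^sup>+x. ennreal ((norm (g x))^2) \<partial>M) = ennreal G" "G \<ge> 0"
    using fin by (cases "\<integral>\<^sup>+x. ennreal ((norm (g x))^2) \<partial>M") auto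
  \<comment> \<open>The \<open>d\<close>-part takes half of the tolerance, against a fixed
    \<open>G\<close>; the large coefficient \<open>1 + 1/d\<close> is then beaten by the
    convergence. Adding 1 to \<open>G\<close> covers \<open>G = 0\<close>.\<close>
  define d where "d = e / (2 * (G + 1))"
  have d: "d > 0" "d * G \<le> e / 2" using \<open>e > 0\<close> G(2) by (auto simp: d_def field_simps)
  define e' where "e' = (e / 2) / (1 + 1/d)"
  have pos: "1 + 1/d > 0" using d(1) by (simp add: add_pos_pos)
  have e': "e' > 0" "(1 + 1/d) * e' = e/2" using \<open>e > 0\<close> pos unfolding e'_def by (simp, metis less_irrefl nonzero_eq_divide_eq mult.commute)
  show "\<forall>\<^sub>F n in sequentially. (\<integral>\<^sup>+x. ennreal \<bar>(norm (f n x))^2 - (norm (g x))\<^sup>2\<bar> \<partial>M) \<le> ennreal e"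
    using ennreal_tendsto_0D[OF lim e'(1)]
  proof eventually_elim
    case (elim n)
    have "(\<integral>\<^sup>+x. ennreal \<bar>(norm (f n x))^2 - (norm (g x))\<^sup>2\<bar> \<partial>M) \<le>
       (\<integral>\<^sup>+x. ennreal d * ennreal ((norm (g x))^2) + ennreal (1 + 1/d) * ennreal ((norm (f n x - g x))^2) \<partial>M)"
      using d pos abs_sq_diff_le[OF d(1)]
      by (intro nn_integral_mono) (auto simp: ennreal_mult[symmetric] ennreal_plus[symmetric] simp del: ennreal_plus)
    also have "\<dots> = ennreal d * ennreal G + ennreal (1 + 1/d) * (\<integral>\<^sup>+x. ennreal ((norm (f n x - g x))^2) \<partial>M)"
      by (simp add: nn_integral_add nn_integral_cmult G)
    also have "\<dots> \<le> ennreal (d * G) + ennreal (1 + 1/d) * ennreal e'"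
      using elim d G by (intro add_mono mult_left_mono) (auto simp: ennreal_mult)
    also have "\<dots> = ennreal (d * G + e / 2)"
      using e' pos d G \<open>e > 0\<close> by (simp add: ennreal_mult[symmetric] ennreal_plus[symmetric] del: ennreal_plus)
    also have "\<dots> \<le> ennreal e" using d by (intro ennreal_leI) simp
    finally show ?case .
  qed
qed

text \<open>Applied with weight 1 to masses and with weight \<open>exp (-t |\<xi>|\<^sup>2)\<close>
  to heat forms on the Fourier side.\<close>

lemma l2_weight_tendsto:
  fixes g :: "'a \<Rightarrow> 'b::{banach, second_countable_topology}"
  assumes [measurable]: "\<And>n. f n \<in> borel_measurable M" "g \<in> borel_measurable M" "w \<in> borel_measurable M"
    and int: "integrable M (\<lambda>x. (norm (g x))^2)" "\<And>n. integrable M (\<lambda>x. (norm (f n x))^2)"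
    and lim: "(\<lambda>n::nat. \<integral>\<^sup>+x. ennreal ((norm (f n x - g x))^2) \<partial>M) \<longlonglongrightarrow> 0"
    and w: "\<And>x. \<bar>w x\<bar> \<le> (1::real)"
  shows "(\<lambda>n. \<integral>x. w x * (norm (f n x))^2 \<partial>M) \<longlonglongrightarrow> (\<integral>x. w x * (norm (g x))^2 \<partial>M)"
proof (rule tendsto_L1_int)
  have wle: "\<bar>w x * y\<bar> \<le> \<bar>y\<bar>" for x y using mult_right_mono[OF w[of x], of "\<bar>y\<bar>"] by (simp add: abs_mult)
  show "integrable M (\<lambda>x. w x * (norm (f n x))^2)" for n
    by (rule Bochner_Integration.integrable_bound[OF int(2)[of n]]) (auto intro!: AE_I2 order_trans[OF wle])
  show "integrable M (\<lambda>x. w x * (norm (g x))^2)"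
    by (rule Bochner_Integration.integrable_bound[OF int(1)]) (auto intro!: AE_I2 order_trans[OF wle])
  have "(\<integral>\<^sup>+x. ennreal ((norm (g x))^2) \<partial>M) < \<infinity>" using int(1) by (simp add: integrable_iff_bounded)
  from l2_sq_L1[OF _ _ this lim]
  show "(\<lambda>n. \<integral>\<^sup>+x. ennreal (norm (w x * (norm (f n x))^2 - w x * (norm (g x))^2)) \<partial>M) \<longlonglongrightarrow> 0"
    by (rule ennreal_tendsto_0_le)
       (auto intro!: nn_integral_mono ennreal_leI simp: right_diff_distrib[symmetric] wle)
qed

section \<open>The Fourier transform and Plancherel's theorem\<close>

definition ft :: "(R3 \<Rightarrow> real) \<Rightarrow> R3 \<Rightarrow> complex"
  where "ft f \<xi> = fourier_integral (\<lambda>x. complex_of_real (f x)) \<xi>"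

lemma cis_measurable[measurable]: "cis \<in> borel_measurable borel"
  unfolding cis_conv_exp[abs_def] by measurable

lemma ft_lborel:
  assumes [measurable]: "f \<in> borel_measurable borel"
  shows "ft f \<xi> = (1 / (2 * pi) powr (3/2)) *\<^sub>R (\<integral>x. cis (- (x \<bullet> \<xi>)) * complex_of_real (f x) \<partial>lborel)"
  unfolding ft_def fourier_integral_def by (simp add: integral_completion)

lemma ft_measurable[measurable]:
  assumes [measurable]: "f \<in> borel_measurable borel"
  shows "ft f \<in> borel_measurable borel"
  unfolding ft_lborel[OF assms, abs_def] by measurable

lemma ft_diff:
  assumes "integrable lborel f" "integrable lborel g"
  shows "ft (\<lambda>x. f x - g x) \<xi> = ft f \<xi> - ft g \<xi>"
proof -
  have [measurable]: "f \<in> borel_measurable borel" "g \<in> borel_measurable borel"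
    using assms by (auto dest: borel_measurable_integrable)
  have "integrable lborel (\<lambda>x. cis (- (x \<bullet> \<xi>)) * complex_of_real (h x))" if h: "integrable lborel h" for h :: "R3 \<Rightarrow> real"
  proof (rule Bochner_Integration.integrable_bound[OF h])
    have [measurable]: "h \<in> borel_measurable borel" using h by (auto dest: borel_measurable_integrable)
    show "(\<lambda>x. cis (- (x \<bullet> \<xi>)) * complex_of_real (h x)) \<in> borel_measurable lborel" by measurable
  qed (auto simp: norm_mult)
  from Bochner_Integration.integral_diff[OF this[OF assms(1)] this[OF assms(2)]]
  show ?thesis
    by (simp add: ft_lborel right_diff_distrib scaleR_diff_right[symmetric])
qed

text \<open>Both sides equal a triple integral over \<open>x\<close>, \<open>y\<close>, \<open>\<xi>\<close>; the \<open>\<xi>\<close>-integral is a Gaussian.\<close>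

lemma ft_gauss:
  fixes f :: "R3 \<Rightarrow> real"
  assumes f: "integrable lborel f" and t: "t > 0"
  shows "(\<integral>\<xi>. exp (- t * (norm \<xi>)^2) * (cmod (ft f \<xi>))^2 \<partial>lborel)
       = (\<integral>p. heat t (fst p - snd p) * f (fst p) * f (snd p) \<partial>(lborel \<Otimes>\<^sub>M lborel))"
proof -
  have fm[measurable]: "f \<in> borel_measurable borel"
    using f by (auto dest: borel_measurable_integrable)
  let ?M2 = "lborel \<Otimes>\<^sub>M lborel :: (R3 \<times> R3) measure"
  interpret P: pair_sigma_finite ?M2 "lborel :: R3 measure"
    unfolding lborel_prod ..
  define c where "c = (1 / (2 * pi) powr (3/2))"
  let ?g = "\<lambda>\<xi> x. cis (- (x \<bullet> \<xi>)) * complex_of_real (f x)"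
  have ig: "integrable lborel (?g \<xi>)" for \<xi>
    by (rule Bochner_Integration.integrable_bound[OF f]) (auto simp: norm_mult)
  have prod_int: "integrable ?M2 (\<lambda>p. u (fst p) * v (snd p))"
    if uv: "integrable lborel u" "integrable lborel v" for u v :: "R3 \<Rightarrow> complex"
  proof -
    have [measurable]: "u \<in> borel_measurable borel" "v \<in> borel_measurable borel"
      using uv by (auto dest: borel_measurable_integrable)
    have "(\<integral>\<^sup>+p. ennreal (norm (u (fst p) * v (snd p))) \<partial>?M2)
       = (\<integral>\<^sup>+x. \<integral>\<^sup>+y. ennreal (norm (u x)) * ennreal (norm (v y)) \<partial>lborel \<partial>lborel)"
      by (subst lborel.nn_integral_fst[symmetric]) (auto simp: norm_mult ennreal_mult)
    also have "\<dots> = (\<integral>\<^sup>+x. ennreal (norm (u x)) \<partial>lborel) * (\<integral>\<^sup>+y. ennreal (norm (v y)) \<partial>lborel)"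
      by (simp add: nn_integral_cmult nn_integral_multc)
    also have "\<dots> < \<infinity>" using uv by (simp add: integrable_iff_bounded ennreal_mult_less_top)
    finally show ?thesis by (intro integrableI_bounded) auto
  qed
  have sq: "complex_of_real ((cmod (ft f \<xi>))^2)
      = complex_of_real (c^2) * (\<integral>p. cis (- ((fst p - snd p) \<bullet> \<xi>)) * complex_of_real (f (fst p) * f (snd p)) \<partial>?M2)" for \<xi>
  proof -
    have "complex_of_real ((cmod (ft f \<xi>))^2) = ft f \<xi> * cnj (ft f \<xi>)"
      by (rule complex_norm_square)
    also have "\<dots> = complex_of_real (c^2) * ((\<integral>x. ?g \<xi> x \<partial>lborel) * cnj (\<integral>x. ?g \<xi> x \<partial>lborel))"
      unfolding ft_lborel[OF fm] c_def[symmetric]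
      by (simp add: scaleR_conv_of_real power2_eq_square algebra_simps)
    also have "(\<integral>x. ?g \<xi> x \<partial>lborel) * cnj (\<integral>x. ?g \<xi> x \<partial>lborel)
       = (\<integral>x. (\<integral>y. ?g \<xi> x * cnj (?g \<xi> y) \<partial>lborel) \<partial>lborel)"
      by (simp only: integral_mult_right_zero integral_mult_left_zero Bochner_Integration.integral_cnj)
    also have "\<dots> = (\<integral>p. ?g \<xi> (fst p) * cnj (?g \<xi> (snd p)) \<partial>?M2)"
      by (rule lborel_pair.integral_fst'[OF prod_int[OF ig[of \<xi>] integrable_cnj[OF ig[of \<xi>]]], simplified fst_conv snd_conv])
    also have "\<dots> = (\<integral>p. cis (- ((fst p - snd p) \<bullet> \<xi>)) * complex_of_real (f (fst p) * f (snd p)) \<partial>?M2)"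
    proof (intro Bochner_Integration.integral_cong refl)
      fix p :: "R3 \<times> R3"
      have "cis (- (fst p \<bullet> \<xi>)) * cnj (cis (- (snd p \<bullet> \<xi>))) = cis (- ((fst p - snd p) \<bullet> \<xi>))"
        by (simp add: cis_cnj cis_mult inner_diff_left)
      from this[symmetric] show "?g \<xi> (fst p) * cnj (?g \<xi> (snd p)) = cis (- ((fst p - snd p) \<bullet> \<xi>)) * complex_of_real (f (fst p) * f (snd p))"
        by (simp add: mult_ac)
    qed
    finally show ?thesis .
  qed
  let ?h = "\<lambda>p \<xi>. complex_of_real (exp (- t * (norm \<xi>)^2)) * (cis (- ((fst p - snd p) \<bullet> \<xi>)) * complex_of_real (f (fst p) * f (snd p)))"
  have trip: "integrable (?M2 \<Otimes>\<^sub>M lborel) (\<lambda>(p, \<xi>). ?h p \<xi>)"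
  proof -
    have "integrable lborel (\<lambda>x. complex_of_real (f x))" using f by simp
    from prod_int[OF this this] have i2: "(\<integral>\<^sup>+p. ennreal (norm (f (fst p) * f (snd p))) \<partial>?M2) < \<infinity>"
      by (simp add: integrable_iff_bounded norm_mult abs_mult)
    have "(\<integral>\<^sup>+q. ennreal (norm (case q of (p, \<xi>) \<Rightarrow> ?h p \<xi>)) \<partial>(?M2 \<Otimes>\<^sub>M lborel))
       = (\<integral>\<^sup>+p. \<integral>\<^sup>+\<xi>. ennreal (norm (f (fst p) * f (snd p))) * ennreal (exp (- t * (norm (\<xi>::R3))^2)) \<partial>lborel \<partial>?M2)"
      by (subst lborel.nn_integral_fst[symmetric]) (auto simp: norm_mult abs_mult ennreal_mult[symmetric] mult_ac)
    also have "\<dots> = (\<integral>\<^sup>+p. ennreal (norm (f (fst p) * f (snd p))) \<partial>?M2) * ennreal (sqrt (pi / t) ^ 3)"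
      using nn_integral_gauss_R3[OF t] by (simp add: nn_integral_cmult nn_integral_multc)
    also have "\<dots> < \<infinity>" using i2 by (simp add: ennreal_mult_less_top)
    finally show ?thesis by (intro integrableI_bounded) auto
  qed
  have inner: "(\<integral>\<xi>. ?h p \<xi> \<partial>lborel) = complex_of_real (sqrt (pi / t) ^ 3 * exp (- (norm (fst p - snd p))\<^sup>2 / (4 * t)) * (f (fst p) * f (snd p)))" for p
  proof -
    have "has_bochner_integral lborel (\<lambda>\<xi>. complex_of_real (exp (- t * (norm \<xi>)^2)) * cis (- ((fst p - snd p) \<bullet> \<xi>)) * complex_of_real (f (fst p) * f (snd p)))
      (complex_of_real (sqrt (pi / t) ^ 3 * exp (- (norm (fst p - snd p))\<^sup>2 / (4 * t))) * complex_of_real (f (fst p) * f (snd p)))"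
      by (intro has_bochner_integral_mult_left has_bochner_gauss_R3[OF t])
    then show ?thesis by (simp add: has_bochner_integral_iff mult.assoc)
  qed
  have "complex_of_real (\<integral>\<xi>. exp (- t * (norm \<xi>)^2) * (cmod (ft f \<xi>))^2 \<partial>lborel)
     = (\<integral>\<xi>. complex_of_real (c^2) * (\<integral>p. ?h p \<xi> \<partial>?M2) \<partial>lborel)"
  proof (subst integral_complex_of_real[symmetric], intro Bochner_Integration.integral_cong refl)
    fix \<xi> :: R3
    have "(\<integral>p. ?h p \<xi> \<partial>?M2) = complex_of_real (exp (- t * (norm \<xi>)^2)) *
        (\<integral>p. cis (- ((fst p - snd p) \<bullet> \<xi>)) * complex_of_real (f (fst p) * f (snd p)) \<partial>?M2)"
      by (rule integral_mult_right_zero)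
    then show "complex_of_real (exp (- t * (norm \<xi>)^2) * (cmod (ft f \<xi>))^2) = complex_of_real (c^2) * (\<integral>p. ?h p \<xi> \<partial>?M2)"
      unfolding of_real_mult sq by (simp only: mult_ac)
  qed
  also have "\<dots> = complex_of_real (c^2) * (\<integral>\<xi>. (\<integral>p. ?h p \<xi> \<partial>?M2) \<partial>lborel)" by simp
  also have "(\<integral>\<xi>. (\<integral>p. ?h p \<xi> \<partial>?M2) \<partial>lborel) = (\<integral>p. (\<integral>\<xi>. ?h p \<xi> \<partial>lborel) \<partial>?M2)"
    by (rule P.Fubini_integral[OF trip])
  also have "complex_of_real (c^2) * \<dots> = (\<integral>p. complex_of_real (heat t (fst p - snd p) * f (fst p) * f (snd p)) \<partial>?M2)"
  proof -
    \<comment> \<open>The factor \<open>(2\<pi>)^-3\<close> from the two Fourier normalizations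
      times \<open>(\<pi>/t)^(3/2)\<close> from the Gaussian integral is the heat kernel
      normalization \<open>(4\<pi>t)^(-3/2)\<close>.\<close>
    have cc: "c^2 * sqrt (pi / t) ^ 3 = 1 / sqrt (4 * pi * t) ^ 3"
    proof -
      have "c^2 = 1 / (2 * pi)^3"
        by (simp add: c_def power_divide powr_power)
      moreover have "sqrt (4 * pi * t) ^ 3 * sqrt (pi / t) ^ 3 = (2 * pi) ^ 3"
      proof -
        have "sqrt (4 * pi * t) * sqrt (pi / t) = 2 * pi"
          using t by (simp add: real_sqrt_mult[symmetric] field_simps) (simp add: real_sqrt_mult)
        then show ?thesis by (simp flip: power_mult_distrib)
      qed
      moreover have "sqrt (4 * pi * t) ^ 3 \<noteq> 0" using t by simp
      ultimately show ?thesis by (simp add: field_simps)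
    qed
    have cp: "complex_of_real (c^2) * complex_of_real (sqrt (pi / t) ^ 3 * e * q) = complex_of_real (e / sqrt (4 * pi * t) ^ 3 * q)" for e q
    proof -
      have "c^2 * (sqrt (pi / t) ^ 3 * e * q) = (c^2 * sqrt (pi / t) ^ 3) * (e * q)" by (simp only: mult_ac)
      also have "\<dots> = e / sqrt (4 * pi * t) ^ 3 * q" unfolding cc by simp
      finally show ?thesis by (simp only: of_real_mult[symmetric])
    qed
    show ?thesis
      unfolding inner integral_mult_right_zero[symmetric] cp by (simp only: heat_def mult.assoc)
  qed
  also have "\<dots> = complex_of_real (\<integral>p. heat t (fst p - snd p) * f (fst p) * f (snd p) \<partial>?M2)"
    by (rule integral_complex_of_real)
  finally show ?thesis by (simp only: of_real_eq_iff)
qed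

section \<open>Heat forms of square-integrable functions\<close>

abbreviation lborel2 :: "(R3 \<times> R3) measure"
  where "lborel2 \<equiv> lborel \<Otimes>\<^sub>M lborel"

text \<open>Borel rather than Lebesgue measurability, so that \<open>u (fst p)\<close> and
  \<open>u (snd p)\<close> are measurable for the product \<open>lborel2\<close>.\<close>

definition square_integrable :: "(R3 \<Rightarrow> real) \<Rightarrow> bool"
  where "square_integrable u \<longleftrightarrow> u \<in> borel_measurable borel \<and> integrable lborel (\<lambda>x. (u x)^2)"

definition mass :: "(R3 \<Rightarrow> real) \<Rightarrow> real"
  where "mass u = (\<integral>x. (u x)^2 \<partial>lborel)"

text \<open>For square-integrable \<open>u\<close>, twice the quadratic form of
  \<open>1 - exp (t \<Delta>)\<close>, written through squared differences to exhibit its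
  sign.\<close>

definition heat_jump :: "real \<Rightarrow> (R3 \<Rightarrow> real) \<Rightarrow> ennreal"
  where "heat_jump t u = (\<integral>\<^sup>+p. ennreal (heat t (fst p - snd p) * (u (fst p) - u (snd p))^2) \<partial>lborel2)"

lemma square_integrableD:
  assumes "square_integrable u"
  shows "u \<in> borel_measurable borel" "integrable lborel (\<lambda>x. (u x)^2)"
  using assms by (auto simp: square_integrable_def)

lemma mass_nonneg: "mass u \<ge> 0"
  unfolding mass_def by simp

lemma nn_mass: "square_integrable u \<Longrightarrow> (\<integral>\<^sup>+x. ennreal ((u x)^2) \<partial>lborel) = ennreal (mass u)"
  unfolding mass_def by (subst nn_integral_eq_integral) (auto simp: square_integrable_def)

lemma square_integrable_iff_nn:
  "u \<in> borel_measurable borel \<Longrightarrow> square_integrable u \<longleftrightarrow> (\<integral>\<^sup>+x. ennreal ((u x)^2) \<partial>lborel) < \<infinity>"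
  by (simp add: square_integrable_def integrable_iff_bounded)

lemma square_integrable_bound:
  assumes "square_integrable v" and [measurable]: "u \<in> borel_measurable borel" and "\<And>x. \<bar>u x\<bar> \<le> \<bar>v x\<bar>"
  shows "square_integrable u"
  unfolding square_integrable_def
  using assms by (auto intro!: Bochner_Integration.integrable_bound[OF square_integrableD(2)[OF assms(1)]] simp: abs_le_square_iff)

lemma square_integrable_cmult:
  assumes "square_integrable u" shows "square_integrable (\<lambda>x. c * u x)"
  using assms by (auto simp: square_integrable_def power_mult_distrib)

lemma square_integrable_add:
  assumes "square_integrable u" "square_integrable v"
  shows "square_integrable (\<lambda>x. u x + v x)"
proof -
  note [measurable] = square_integrableD(1)[OF assms(1)] square_integrableD(1)[OF assms(2)]
  have "integrable lborel (\<lambda>x. 2 * (u x)^2 + 2 * (v x)^2)"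
    using assms by (auto simp: square_integrable_def)
  then have "integrable lborel (\<lambda>x. (u x + v x)^2)"
  proof (rule Bochner_Integration.integrable_bound)
    show "AE x in lborel. norm ((u x + v x)^2) \<le> norm (2 * (u x)^2 + 2 * (v x)^2)"
      by (rule AE_I2) (use sq_add_le[of "u _" "v _"] in simp)
  qed simp
  then show ?thesis by (auto simp: square_integrable_def)
qed

lemma square_integrable_diff:
  assumes "square_integrable u" "square_integrable v"
  shows "square_integrable (\<lambda>x. u x - v x)"
  using square_integrable_add[OF assms(1) square_integrable_cmult[OF assms(2), of "-1"]] by simp

lemma nn_heat_fst:
  assumes "t > 0" and [measurable]: "h \<in> borel_measurable borel"
  shows "(\<integral>\<^sup>+p. ennreal (heat t (fst p - snd p)) * h (fst p) \<partial>lborel2) = (\<integral>\<^sup>+x. h x \<partial>lborel)"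
proof -
  have "(\<integral>\<^sup>+p. ennreal (heat t (fst p - snd p)) * h (fst p) \<partial>lborel2)
     = (\<integral>\<^sup>+x. \<integral>\<^sup>+y. ennreal (heat t (x - y)) * h x \<partial>lborel \<partial>lborel)"
    by (subst lborel.nn_integral_fst[symmetric]) auto
  also have "\<dots> = (\<integral>\<^sup>+x. h x \<partial>lborel)"
    using nn_integral_reflect_R3[of "\<lambda>z. ennreal (heat t z)"]
    by (simp add: nn_integral_multc nn_integral_heat[OF assms(1)])
  finally show ?thesis .
qed

lemma nn_heat_snd:
  assumes "t > 0" and [measurable]: "h \<in> borel_measurable borel"
  shows "(\<integral>\<^sup>+p. ennreal (heat t (fst p - snd p)) * h (snd p) \<partial>lborel2) = (\<integral>\<^sup>+x. h x \<partial>lborel)"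
proof -
  have "(\<integral>\<^sup>+p. ennreal (heat t (fst p - snd p)) * h (snd p) \<partial>lborel2)
     = (\<integral>\<^sup>+y. \<integral>\<^sup>+x. ennreal (heat t (x - y)) * h y \<partial>lborel \<partial>lborel)"
    by (subst lborel_pair.nn_integral_snd[symmetric]) auto
  also have "\<dots> = (\<integral>\<^sup>+x. h x \<partial>lborel)"
    using nn_integral_translate_diff_R3[of "\<lambda>z. ennreal (heat t z)"]
    by (simp add: nn_integral_multc nn_integral_heat[OF assms(1)])
  finally show ?thesis .
qed

lemma heat_sq_integrable:
  assumes u: "square_integrable u" and t: "t > 0"
  shows "has_bochner_integral lborel2 (\<lambda>p. heat t (fst p - snd p) * (u (fst p))^2) (mass u)"
    and "has_bochner_integral lborel2 (\<lambda>p. heat t (fst p - snd p) * (u (snd p))^2) (mass u)"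
proof -
  note [measurable] = square_integrableD(1)[OF u]
  show "has_bochner_integral lborel2 (\<lambda>p. heat t (fst p - snd p) * (u (fst p))^2) (mass u)"
    using nn_heat_fst[OF t, of "\<lambda>x. ennreal ((u x)^2)"] nn_mass[OF u] heat_nonneg[OF t] mass_nonneg[of u]
    by (intro has_bochner_integral_nn_integral) (auto simp: ennreal_mult[symmetric])
  show "has_bochner_integral lborel2 (\<lambda>p. heat t (fst p - snd p) * (u (snd p))^2) (mass u)"
    using nn_heat_snd[OF t, of "\<lambda>x. ennreal ((u x)^2)"] nn_mass[OF u] heat_nonneg[OF t] mass_nonneg[of u]
    by (intro has_bochner_integral_nn_integral) (auto simp: ennreal_mult[symmetric])
qed

lemma heat_form_integrable:
  assumes u: "square_integrable u" and t: "t > 0"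
  shows "integrable lborel2 (\<lambda>p. heat t (fst p - snd p) * u (fst p) * u (snd p))"
proof -
  note [measurable] = square_integrableD(1)[OF u]
  have "integrable lborel2 (\<lambda>p. heat t (fst p - snd p) * (u (fst p))^2 + heat t (fst p - snd p) * (u (snd p))^2)"
    using heat_sq_integrable[OF u t] by (auto simp: has_bochner_integral_iff)
  then show ?thesis
  proof (rule Bochner_Integration.integrable_bound)
    show "AE p in lborel2. norm (heat t (fst p - snd p) * u (fst p) * u (snd p))
      \<le> norm (heat t (fst p - snd p) * (u (fst p))^2 + heat t (fst p - snd p) * (u (snd p))^2)"
    proof (rule AE_I2)
      fix p :: "R3 \<times> R3"
      have "0 \<le> (\<bar>u (fst p)\<bar> - \<bar>u (snd p)\<bar>)^2 + (u (fst p))^2 + (u (snd p))^2" by simp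
      then have "\<bar>u (fst p)\<bar> * \<bar>u (snd p)\<bar> \<le> (u (fst p))^2 + (u (snd p))^2"
        by (simp add: power2_diff)
      from mult_left_mono[OF this heat_nonneg[OF t]]
      show "norm (heat t (fst p - snd p) * u (fst p) * u (snd p))
      \<le> norm (heat t (fst p - snd p) * (u (fst p))^2 + heat t (fst p - snd p) * (u (snd p))^2)"
        using heat_nonneg[OF t] by (simp add: abs_mult distrib_left mult.assoc)
    qed
  qed simp
qed

text \<open>Expanding the square leaves two copies of the mass, because the heat kernel has integral
  1 in either variable.\<close>

lemma heat_jump_eq:
  assumes u: "square_integrable u" and t: "t > 0"
  shows "heat_jump t u = ennreal (2 * mass u - 2 * (\<integral>p. heat t (fst p - snd p) * u (fst p) * u (snd p) \<partial>lborel2))"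
proof -
  note [measurable] = square_integrableD(1)[OF u]
  have hb: "has_bochner_integral lborel2
     (\<lambda>p. heat t (fst p - snd p) * (u (fst p))^2 + heat t (fst p - snd p) * (u (snd p))^2
          - 2 * (heat t (fst p - snd p) * u (fst p) * u (snd p)))
     (mass u + mass u - 2 * (\<integral>p. heat t (fst p - snd p) * u (fst p) * u (snd p) \<partial>lborel2))"
    using heat_form_integrable[OF u t]
    by (intro has_bochner_integral_diff has_bochner_integral_add heat_sq_integrable[OF u t] has_bochner_integral_mult_right)
       (auto simp: has_bochner_integral_iff)
  have eq: "heat t (fst p - snd p) * (u (fst p))^2 + heat t (fst p - snd p) * (u (snd p))^2
          - 2 * (heat t (fst p - snd p) * u (fst p) * u (snd p)) = heat t (fst p - snd p) * (u (fst p) - u (snd p))^2" for p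
    by (simp add: power2_diff algebra_simps)
  have "heat_jump t u = ennreal (\<integral>p. heat t (fst p - snd p) * (u (fst p) - u (snd p))^2 \<partial>lborel2)"
    unfolding heat_jump_def
    using hb[unfolded eq] heat_nonneg[OF t] by (intro nn_integral_eq_integral) (auto simp: has_bochner_integral_iff)
  also have "(\<integral>p. heat t (fst p - snd p) * (u (fst p) - u (snd p))^2 \<partial>lborel2)
     = 2 * mass u - 2 * (\<integral>p. heat t (fst p - snd p) * u (fst p) * u (snd p) \<partial>lborel2)"
    using hb[unfolded eq] by (simp add: has_bochner_integral_iff)
  finally show ?thesis .
qed

text \<open>The average of the \<open>L\<^sup>2\<close> modulus of continuity over a Gaussian shift
  of size \<open>sqrt t\<close>; by self-similarity the kernel stays at time 1 and \<open>t\<close>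
  enters through the shift alone.\<close>

lemma heat_jump_shift:
  assumes [measurable]: "u \<in> borel_measurable borel" and t: "t > 0"
  shows "heat_jump t u = (\<integral>\<^sup>+w. ennreal (heat 1 w) * (\<integral>\<^sup>+x. ennreal ((u (x + sqrt t *\<^sub>R w) - u x)^2) \<partial>lborel) \<partial>lborel)"
proof -
  define \<omega> where "\<omega> z = (\<integral>\<^sup>+x. ennreal ((u (x + z) - u x)^2) \<partial>lborel)" for z
  have [measurable]: "\<omega> \<in> borel_measurable borel" unfolding \<omega>_def by measurable
  have "heat_jump t u = (\<integral>\<^sup>+y. \<integral>\<^sup>+x. ennreal (heat t (x - y) * (u x - u y)^2) \<partial>lborel \<partial>lborel)"
    unfolding heat_jump_def by (subst lborel_pair.nn_integral_snd[symmetric]) auto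
  also have "\<dots> = (\<integral>\<^sup>+y. \<integral>\<^sup>+z. ennreal (heat t z * (u (y + z) - u y)^2) \<partial>lborel \<partial>lborel)"
  proof (rule nn_integral_cong)
    fix y :: R3
    show "(\<integral>\<^sup>+x. ennreal (heat t (x - y) * (u x - u y)^2) \<partial>lborel) = (\<integral>\<^sup>+z. ennreal (heat t z * (u (y + z) - u y)^2) \<partial>lborel)"
      using nn_integral_translate_diff_R3[of "\<lambda>z. ennreal (heat t z * (u (y + z) - u y)^2)" y] by simp
  qed
  also have "\<dots> = (\<integral>\<^sup>+z. \<integral>\<^sup>+y. ennreal (heat t z * (u (y + z) - u y)^2) \<partial>lborel \<partial>lborel)"
    by (rule lborel_pair.Fubini') measurable
  also have "\<dots> = (\<integral>\<^sup>+z. ennreal (heat t z) * \<omega> z \<partial>lborel)"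
    unfolding \<omega>_def using heat_nonneg[OF t]
    by (intro nn_integral_cong) (simp add: nn_integral_cmult[symmetric] ennreal_mult)
  also have "\<dots> = ennreal (\<bar>sqrt t\<bar>^3) * (\<integral>\<^sup>+w. ennreal (heat t (sqrt t *\<^sub>R w)) * \<omega> (sqrt t *\<^sub>R w) \<partial>lborel)"
    using nn_integral_affine_R3[of "\<lambda>z. ennreal (heat t z) * \<omega> z" "sqrt t" 0] t by simp
  also have "\<dots> = (\<integral>\<^sup>+w. ennreal (heat 1 w) * \<omega> (sqrt t *\<^sub>R w) \<partial>lborel)"
    using t heat_nonneg[OF t] by (subst nn_integral_cmult[symmetric])
       (auto simp flip: heat_scale[OF t] simp: ennreal_mult mult_ac intro!: nn_integral_cong)
  finally show ?thesis unfolding \<omega>_def .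
qed

text \<open>Pointwise in the shift direction \<open>w\<close> this is continuity of translations;
  \<open>4 * mass u\<close> times the kernel at time 1 dominates.\<close>

lemma heat_jump_tendsto_0:
  assumes u: "square_integrable u" and t: "\<And>n. t n > 0" "t \<longlonglongrightarrow> 0"
  shows "(\<lambda>n::nat. heat_jump (t n) u) \<longlonglongrightarrow> 0"
proof -
  note um[measurable] = square_integrableD(1)[OF u]
  have "(\<lambda>n. \<integral>\<^sup>+w. ennreal (heat 1 w) * (\<integral>\<^sup>+x. ennreal ((u (x + sqrt (t n) *\<^sub>R w) - u x)^2) \<partial>lborel) \<partial>lborel)
     \<longlonglongrightarrow> (\<integral>\<^sup>+(w::R3). 0 \<partial>lborel)"
  proof (rule nn_integral_dominated_convergence[where w="\<lambda>w. ennreal (4 * mass u) * ennreal (heat 1 w)"])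
    show "(\<integral>\<^sup>+w. ennreal (4 * mass u) * ennreal (heat 1 w) \<partial>lborel) < \<infinity>"
      by (simp add: nn_integral_cmult nn_integral_heat ennreal_mult_less_top)
    show "AE w in lborel. ennreal (heat 1 w) * (\<integral>\<^sup>+x. ennreal ((u (x + sqrt (t n) *\<^sub>R w) - u x)^2) \<partial>lborel)
       \<le> ennreal (4 * mass u) * ennreal (heat 1 w)" for n
    proof (rule AE_I2)
      fix w :: R3
      have "(\<integral>\<^sup>+x. ennreal ((norm (u (x + sqrt (t n) *\<^sub>R w) - u x))^2) \<partial>lborel)
        \<le> 2 * (\<integral>\<^sup>+x. ennreal ((norm (u (x + sqrt (t n) *\<^sub>R w) - 0))^2) \<partial>lborel) + 2 * (\<integral>\<^sup>+x. ennreal ((norm (0 - u x))^2) \<partial>lborel)"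
        by (rule nn_sq_diff_le3) auto
      also have "\<dots> = ennreal (4 * mass u)"
        using nn_integral_translate_R3[of "\<lambda>x. ennreal ((u x)^2)" "sqrt (t n) *\<^sub>R w"] nn_mass[OF u] mass_nonneg[of u]
        by (simp add: ennreal_mult[symmetric] ennreal_plus[symmetric] ennreal_numeral[symmetric] del: ennreal_plus ennreal_numeral)
      finally show "ennreal (heat 1 w) * (\<integral>\<^sup>+x. ennreal ((u (x + sqrt (t n) *\<^sub>R w) - u x)^2) \<partial>lborel)
        \<le> ennreal (4 * mass u) * ennreal (heat 1 w)"
        by (simp add: mult.commute mult_left_mono)
    qed
    show "AE w in lborel. (\<lambda>n. ennreal (heat 1 w) * (\<integral>\<^sup>+x. ennreal ((u (x + sqrt (t n) *\<^sub>R w) - u x)^2) \<partial>lborel)) \<longlonglongrightarrow> 0"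
    proof (rule AE_I2)
      fix w :: R3
      have "(\<lambda>n. sqrt (t n) *\<^sub>R w) \<longlonglongrightarrow> sqrt 0 *\<^sub>R w" by (intro tendsto_intros t)
      then have "(\<lambda>n. \<integral>\<^sup>+x. ennreal ((u (x + sqrt (t n) *\<^sub>R w) - u x)^2) \<partial>lborel) \<longlonglongrightarrow> 0"
        by (intro translation_L2 um square_integrableD(2)[OF u]) simp
      from tendsto_mult_ennreal[OF tendsto_const[of "ennreal (heat 1 w)"] this]
      show "(\<lambda>n. ennreal (heat 1 w) * (\<integral>\<^sup>+x. ennreal ((u (x + sqrt (t n) *\<^sub>R w) - u x)^2) \<partial>lborel)) \<longlonglongrightarrow> 0"
        by simp
    qed
  qed auto
  then show ?thesis using t(1) by (simp add: heat_jump_shift[OF um])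
qed

text \<open>The damping \<open>exp (-t |\<xi>|\<^sup>2)\<close> is inserted and \<open>t\<close>
  tends to 0: on the Fourier side by monotone convergence, on the space side because the heat form
  differs from the mass by half of \<open>heat_jump\<close>, which vanishes in the limit.\<close>

lemma ft_isometry:
  assumes f: "integrable lborel f" and u: "square_integrable f"
  shows "(\<integral>\<^sup>+\<xi>. ennreal ((cmod (ft f \<xi>))^2) \<partial>lborel) = ennreal (mass f)"
proof -
  note fm[measurable] = square_integrableD(1)[OF u]
  define B where "B t = (\<integral>p. heat t (fst p - snd p) * f (fst p) * f (snd p) \<partial>lborel2)" for t
  define C where "C = (1 / (2 * pi) powr (3/2)) * (\<integral>x. \<bar>f x\<bar> \<partial>lborel)"
  have bd: "cmod (ft f \<xi>) \<le> C" for \<xi>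
  proof -
    have "cmod (\<integral>x. cis (- (x \<bullet> \<xi>)) * complex_of_real (f x) \<partial>lborel) \<le> (\<integral>x. norm (cis (- (x \<bullet> \<xi>)) * complex_of_real (f x)) \<partial>lborel)"
      by (rule integral_norm_bound)
    then show ?thesis unfolding ft_lborel[OF fm] C_def
      by (simp add: norm_mult divide_right_mono)
  qed
  have Beq: "(\<integral>\<^sup>+\<xi>. ennreal (exp (- t * (norm \<xi>)^2) * (cmod (ft f \<xi>))^2) \<partial>lborel) = ennreal (B t)" if t: "t > 0" for t
  proof -
    have "integrable lborel (\<lambda>\<xi>::R3. C^2 * exp (- t * (norm \<xi>)^2))"
      using nn_integral_gauss_R3[OF t] by (intro integrable_mult_right integrableI_nonneg) auto
    then have "integrable lborel (\<lambda>\<xi>. exp (- t * (norm \<xi>)^2) * (cmod (ft f \<xi>))^2)"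
      by (rule Bochner_Integration.integrable_bound) (use bd in \<open>auto intro!: AE_I2 mult_mono power_mono simp: mult.commute\<close>)
    then show ?thesis unfolding B_def ft_gauss[OF f t, symmetric]
      by (rule nn_integral_eq_integral) auto
  qed
  define t where "t n = 1 / real (Suc n)" for n
  have t: "t n > 0" "t \<longlonglongrightarrow> 0" for n
    unfolding t_def using LIMSEQ_inverse_real_of_nat by (auto simp: inverse_eq_divide)
  have 1: "(\<lambda>n. ennreal (B (t n))) \<longlonglongrightarrow> ennreal (mass f)"
  proof -
    have j: "heat_jump (t n) f = ennreal (2 * mass f - 2 * B (t n))" for n
      unfolding B_def by (rule heat_jump_eq[OF u t(1)])
    have nonneg: "B (t n) \<le> mass f" "B (t n) \<ge> 0" for n
    proof -
      show "B (t n) \<ge> 0"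
        unfolding B_def ft_gauss[OF f t(1), symmetric] by (intro integral_nonneg_AE) simp
      have "0 \<le> (\<integral>p. heat (t n) (fst p - snd p) * (f (fst p) - f (snd p))^2 \<partial>lborel2)"
        using heat_nonneg[OF t(1)] by (intro integral_nonneg_AE) simp
      also have "\<dots> = mass f + mass f - 2 * B (t n)"
      proof -
        have hb: "has_bochner_integral lborel2
         (\<lambda>p. heat (t n) (fst p - snd p) * (f (fst p))^2 + heat (t n) (fst p - snd p) * (f (snd p))^2
          - 2 * (heat (t n) (fst p - snd p) * f (fst p) * f (snd p)))
         (mass f + mass f - 2 * B (t n))"
          unfolding B_def using heat_form_integrable[OF u t(1)]
          by (intro has_bochner_integral_diff has_bochner_integral_add heat_sq_integrable[OF u t(1)] has_bochner_integral_mult_right)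
            (auto simp: has_bochner_integral_iff)
        then show ?thesis
          by (simp add: has_bochner_integral_iff power2_diff algebra_simps)
      qed
      finally show "B (t n) \<le> mass f" by simp
    qed
    have "(\<lambda>n. 2 * mass f - 2 * B (t n)) \<longlonglongrightarrow> 0"
      using heat_jump_tendsto_0[OF u t] nonneg unfolding j by (simp add: tendsto_ennreal_iff flip: ennreal_0)
    then have "(\<lambda>n. mass f - (2 * mass f - 2 * B (t n)) / 2) \<longlonglongrightarrow> mass f - 0 / 2"
      by (intro tendsto_intros) auto
    then show ?thesis by (simp add: diff_divide_distrib tendsto_ennrealI)
  qed
  have 2: "(\<lambda>n. ennreal (B (t n))) \<longlonglongrightarrow> (\<integral>\<^sup>+\<xi>. ennreal ((cmod (ft f \<xi>))^2) \<partial>lborel)"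
  proof -
    let ?u = "\<lambda>n \<xi>. ennreal (exp (- t n * (norm \<xi>)^2) * (cmod (ft f \<xi>))^2)"
    have "(\<lambda>n. \<integral>\<^sup>+\<xi>. ?u n \<xi> \<partial>lborel) \<longlonglongrightarrow> (\<integral>\<^sup>+\<xi>. ennreal ((cmod (ft f \<xi>))^2) \<partial>lborel)"
    proof (rule nn_integral_LIMSEQ)
      show "incseq ?u"
        by (auto simp: incseq_def le_fun_def t_def intro!: ennreal_leI mult_right_mono divide_left_mono)
      show "(\<lambda>n. ?u n \<xi>) \<longlonglongrightarrow> ennreal ((cmod (ft f \<xi>))^2)" for \<xi>
      proof -
        have "(\<lambda>n. ?u n \<xi>) \<longlonglongrightarrow> ennreal (exp (- 0 * (norm \<xi>)^2) * (cmod (ft f \<xi>))^2)"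
          by (intro tendsto_intros t)
        then show ?thesis by simp
      qed
    qed auto
    then show ?thesis unfolding Beq[OF t(1)] .
  qed
  show ?thesis using LIMSEQ_unique[OF 2 1] .
qed

section \<open>The transform on L^2 as a limit over truncations\<close>

definition trunc :: "nat \<Rightarrow> (R3 \<Rightarrow> real) \<Rightarrow> R3 \<Rightarrow> real"
  where "trunc n u x = indicator (cball 0 (real n)) x * u x"

lemma trunc_measurable[measurable]:
  assumes [measurable]: "u \<in> borel_measurable borel"
  shows "trunc n u \<in> borel_measurable borel"
  unfolding trunc_def[abs_def] by (intro borel_measurable_times borel_measurable_indicator) auto

lemma abs_trunc_le: "\<bar>trunc n u x\<bar> \<le> \<bar>u x\<bar>"
  by (simp add: trunc_def split: split_indicator)

lemma trunc_square_integrable: "square_integrable u \<Longrightarrow> square_integrable (trunc n u)"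
  by (rule square_integrable_bound[of u]) (auto simp: square_integrable_def abs_trunc_le)

lemma trunc_eventually: "\<forall>\<^sub>F n in sequentially. trunc n u x = u x"
proof -
  obtain N where "norm x \<le> real N" using real_arch_simple by blast
  then show ?thesis
    by (intro eventually_sequentiallyI[of N]) (auto simp: trunc_def split: split_indicator)
qed

lemma trunc_integrable:
  assumes "square_integrable u" shows "integrable lborel (trunc n u)"
proof -
  note [measurable] = square_integrableD(1)[OF assms]
  have "integrable lborel (\<lambda>x::R3. indicator (cball 0 (real n)) x + (u x)^2)"
    using emeasure_lborel_cball_finite[of "0::R3" "real n"] square_integrableD(2)[OF assms]
    by (intro Bochner_Integration.integrable_add) auto
  then show ?thesis
  proof (rule Bochner_Integration.integrable_bound)
    have "\<bar>y\<bar> \<le> 1 + y^2" for y :: real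
      using sum_squares_bound[of "\<bar>y\<bar>" 1] by (simp add: power2_eq_square)
    then show "AE x in lborel. norm (trunc n u x) \<le> norm (indicator (cball 0 (real n)) x + (u x)^2)"
      by (auto intro!: AE_I2 simp: trunc_def split: split_indicator)
  qed simp
qed

lemma trunc_tendsto:
  assumes u: "square_integrable u"
  shows "(\<lambda>n. \<integral>\<^sup>+x. ennreal ((norm (trunc n u x - u x))^2) \<partial>lborel) \<longlonglongrightarrow> 0"
proof -
  note [measurable] = square_integrableD(1)[OF u]
  have "(\<lambda>n. \<integral>\<^sup>+x. ennreal ((norm (trunc n u x - u x))^2) \<partial>lborel) \<longlonglongrightarrow> (\<integral>\<^sup>+(x::R3). 0 \<partial>lborel)"
  proof (rule nn_integral_dominated_convergence[where w="\<lambda>x. ennreal ((u x)^2)"])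
    show "(\<integral>\<^sup>+x. ennreal ((u x)^2) \<partial>lborel) < \<infinity>" by (simp add: nn_mass[OF u])
    show "AE x in lborel. ennreal ((norm (trunc n u x - u x))^2) \<le> ennreal ((u x)^2)" for n
      by (intro AE_I2) (simp add: trunc_def split: split_indicator)
    show "AE x in lborel. (\<lambda>n. ennreal ((norm (trunc n u x - u x))^2)) \<longlonglongrightarrow> 0"
    proof (rule AE_I2)
      fix x :: R3
      have "\<forall>\<^sub>F n in sequentially. ennreal ((norm (trunc n u x - u x))^2) = 0"
        using trunc_eventually[of u x] by eventually_elim simp
      then show "(\<lambda>n. ennreal ((norm (trunc n u x - u x))^2)) \<longlonglongrightarrow> 0" by (rule tendsto_eventually)
    qed
  qed auto
  then show ?thesis by simp
qed

lemma nn_ft_diff: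
  assumes "integrable lborel f" "integrable lborel g" "square_integrable f" "square_integrable g"
  shows "(\<integral>\<^sup>+\<xi>. ennreal ((norm (ft f \<xi> - ft g \<xi>))^2) \<partial>lborel) = (\<integral>\<^sup>+x. ennreal ((norm (f x - g x))^2) \<partial>lborel)"
  using ft_isometry[of "\<lambda>x. f x - g x"] square_integrable_diff[OF assms(3,4)] assms(1,2) nn_mass[of "\<lambda>x. f x - g x"]
  by (simp add: ft_diff)

lemma ft_trunc_cauchy:
  assumes u: "square_integrable u" and "e > 0"
  shows "\<exists>N. \<forall>m\<ge>N. \<forall>n\<ge>N. (\<integral>\<^sup>+\<xi>. ennreal ((norm (ft (trunc m u) \<xi> - ft (trunc n u) \<xi>))^2) \<partial>lborel) \<le> ennreal e"
proof -
  note [measurable] = square_integrableD(1)[OF u]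
  have "e / 4 > 0" using \<open>e > 0\<close> by simp
  from ennreal_tendsto_0D[OF trunc_tendsto[OF u] this] obtain N where
    N: "\<And>n. n \<ge> N \<Longrightarrow> (\<integral>\<^sup>+x. ennreal ((norm (trunc n u x - u x))^2) \<partial>lborel) < ennreal (e/4)"
    by (auto simp: eventually_sequentially)
  show ?thesis
  proof (intro exI[of _ N] allI impI)
    fix m n assume mn: "N \<le> m" "N \<le> n"
    have "(\<integral>\<^sup>+\<xi>. ennreal ((norm (ft (trunc m u) \<xi> - ft (trunc n u) \<xi>))^2) \<partial>lborel)
       = (\<integral>\<^sup>+x. ennreal ((norm (trunc m u x - trunc n u x))^2) \<partial>lborel)"
      by (intro nn_ft_diff trunc_integrable trunc_square_integrable u)
    also have "\<dots> \<le> 2 * (\<integral>\<^sup>+x. ennreal ((norm (trunc m u x - u x))^2) \<partial>lborel) + 2 * (\<integral>\<^sup>+x. ennreal ((norm (u x - trunc n u x))^2) \<partial>lborel)"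
      by (rule nn_sq_diff_le3) auto
    also have "\<dots> \<le> 2 * ennreal (e/4) + 2 * ennreal (e/4)"
      using N[OF mn(1)] N[OF mn(2)] by (intro add_mono mult_left_mono) (auto simp: abs_minus_commute)
    also have "\<dots> = ennreal e"
      using \<open>e > 0\<close> by (simp add: ennreal_numeral[symmetric] ennreal_mult[symmetric] ennreal_plus[symmetric] del: ennreal_plus ennreal_numeral)
    finally show "(\<integral>\<^sup>+\<xi>. ennreal ((norm (ft (trunc m u) \<xi> - ft (trunc n u) \<xi>))^2) \<partial>lborel) \<le> ennreal e" .
  qed
qed

lemma nn_sq_tendsto:
  fixes g :: "'a \<Rightarrow> 'b::{banach, second_countable_topology}"
  assumes [measurable]: "\<And>n. f n \<in> borel_measurable M" "g \<in> borel_measurable M"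
    and c: "(\<lambda>n::nat. \<integral>\<^sup>+x. ennreal ((norm (f n x))^2) \<partial>M) \<longlonglongrightarrow> ennreal c"
    and fin: "\<And>n. (\<integral>\<^sup>+x. ennreal ((norm (f n x))^2) \<partial>M) < \<infinity>"
    and lim: "(\<lambda>n::nat. \<integral>\<^sup>+x. ennreal ((norm (f n x - g x))^2) \<partial>M) \<longlonglongrightarrow> 0"
  shows "(\<integral>\<^sup>+x. ennreal ((norm (g x))^2) \<partial>M) = ennreal c"
proof -
  have g_fin: "(\<integral>\<^sup>+x. ennreal ((norm (g x))^2) \<partial>M) < \<infinity>"
  proof -
    obtain n where n: "(\<integral>\<^sup>+x. ennreal ((norm (f n x - g x))^2) \<partial>M) < ennreal 1"
      using ennreal_tendsto_0D[OF lim, of 1] by (auto simp: eventually_sequentially)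
    have "(\<integral>\<^sup>+x. ennreal ((norm (g x - 0))^2) \<partial>M) \<le> 2 * (\<integral>\<^sup>+x. ennreal ((norm (g x - f n x))^2) \<partial>M) + 2 * (\<integral>\<^sup>+x. ennreal ((norm (f n x - 0))^2) \<partial>M)"
      by (rule nn_sq_diff_le3) auto
    also have "\<dots> < \<infinity>"
      using n fin[of n] by (auto simp: norm_minus_commute ennreal_mult_less_top ennreal_add_less_top intro: less_trans)
    finally show ?thesis by simp
  qed
  have i: "integrable M (\<lambda>x. (norm (g x))^2)" "integrable M (\<lambda>x. (norm (f n x))^2)" for n
    using g_fin fin[of n] by (auto simp: integrable_iff_bounded)
  have "(\<lambda>n. \<integral>x. 1 * (norm (f n x))^2 \<partial>M) \<longlonglongrightarrow> (\<integral>x. 1 * (norm (g x))^2 \<partial>M)"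
    by (rule l2_weight_tendsto[OF _ _ _ i lim]) auto
  then have "(\<lambda>n. ennreal (\<integral>x. (norm (f n x))^2 \<partial>M)) \<longlonglongrightarrow> ennreal (\<integral>x. (norm (g x))^2 \<partial>M)"
    by (intro tendsto_ennrealI) simp
  then have "(\<lambda>n. \<integral>\<^sup>+x. ennreal ((norm (f n x))^2) \<partial>M) \<longlonglongrightarrow> (\<integral>\<^sup>+x. ennreal ((norm (g x))^2) \<partial>M)"
    using i by (simp add: nn_integral_eq_integral)
  from LIMSEQ_unique[OF this c] show ?thesis .
qed

lemma mass_trunc_tendsto:
  assumes u: "square_integrable u"
  shows "(\<lambda>n. mass (trunc n u)) \<longlonglongrightarrow> mass u"
proof -
  note [measurable] = square_integrableD(1)[OF u]
  have "(\<lambda>n. \<integral>x. 1 * (norm (trunc n u x))^2 \<partial>lborel) \<longlonglongrightarrow> (\<integral>x. 1 * (norm (u x))^2 \<partial>lborel)"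
    by (rule l2_weight_tendsto[OF _ _ _ _ _ trunc_tendsto[OF u]])
       (use square_integrableD(2)[OF u] square_integrableD(2)[OF trunc_square_integrable[OF u]] in auto)
  then show ?thesis by (simp add: mass_def)
qed

text \<open>The isometry makes the transforms of truncations Cauchy, so the choice in
  \<open>fourier\<close> is made from a nonempty set; uniqueness of \<open>L\<^sup>2\<close> limits
  then identifies the chosen function with a Borel one almost everywhere.\<close>

lemma fourier_exists:
  assumes u: "square_integrable u"
  shows "\<exists>g. g \<in> borel_measurable borel \<and> (AE \<xi> in lborel. fourier_real u \<xi> = g \<xi>)
     \<and> (\<lambda>n. \<integral>\<^sup>+\<xi>. ennreal ((norm (ft (trunc n u) \<xi> - g \<xi>))^2) \<partial>lborel) \<longlonglongrightarrow> 0"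
proof -
  note um[measurable] = square_integrableD(1)[OF u]
  obtain g where g[measurable]: "g \<in> borel_measurable borel"
    and lim: "(\<lambda>n. \<integral>\<^sup>+\<xi>. ennreal ((norm (ft (trunc n u) \<xi> - g \<xi>))^2) \<partial>lborel) \<longlonglongrightarrow> 0"
    using riesz_fischer[of "\<lambda>n. ft (trunc n u)" lborel, OF _ ft_trunc_cauchy[OF u]] by auto
  have mf: "(\<integral>\<^sup>+\<xi>. ennreal ((norm (ft (trunc n u) \<xi>))^2) \<partial>lborel) = ennreal (mass (trunc n u))" for n
    by (rule ft_isometry[OF trunc_integrable[OF u] trunc_square_integrable[OF u]])
  have gm: "(\<integral>\<^sup>+\<xi>. ennreal ((norm (g \<xi>))^2) \<partial>lborel) = ennreal (mass u)"
    by (rule nn_sq_tendsto[OF _ _ _ _ lim]) (auto simp: mf intro!: tendsto_ennrealI mass_trunc_tendsto u)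
  have eq: "fourier_integral (\<lambda>x. indicator (cball 0 (real n)) x *\<^sub>R complex_of_real (u x)) = ft (trunc n u)" for n
    unfolding ft_def[abs_def] trunc_def by (simp add: scaleR_conv_of_real)
  define P where "P g \<longleftrightarrow> L2 g \<and>
    (\<lambda>n::nat. \<integral>\<^sup>+ \<xi>. ennreal ((cmod
        (fourier_integral (\<lambda>x. indicator (cball 0 (real n)) x *\<^sub>R complex_of_real (u x)) \<xi> - g \<xi>))^2) \<partial>lebesgue)
      \<longlonglongrightarrow> 0" for g
  have "L2 g"
    unfolding L2_def using gm
    by (auto intro: measurable_completion simp: integrable_iff_bounded nn_integral_completion)
  then have "P g" unfolding P_def eq using lim by (simp add: nn_integral_completion)
  then have P: "P (fourier_real u)"
    unfolding fourier_def P_def by (rule someI[where P="P", unfolded P_def])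
  have "AE \<xi> in lebesgue. fourier_real u \<xi> = g \<xi>"
  proof (rule l2_unique)
    show "ft (trunc n u) \<in> borel_measurable lebesgue" "g \<in> borel_measurable lebesgue" for n
      by (auto intro: measurable_completion)
    show "fourier_real u \<in> borel_measurable lebesgue" using P by (simp add: P_def L2_def)
    show "(\<lambda>n. \<integral>\<^sup>+\<xi>. ennreal ((norm (ft (trunc n u) \<xi> - fourier_real u \<xi>))^2) \<partial>lebesgue) \<longlonglongrightarrow> 0"
      using P unfolding P_def eq by blast
    show "(\<lambda>n. \<integral>\<^sup>+\<xi>. ennreal ((norm (ft (trunc n u) \<xi> - g \<xi>))^2) \<partial>lebesgue) \<longlonglongrightarrow> 0"
      using lim by (simp add: nn_integral_completion)
  qed
  with g lim show ?thesis unfolding AE_completion_iff by blast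
qed

text \<open>A Borel representative of the Fourier transform: the choice made in \<open>fourier\<close> is only Lebesgue measurable.\<close>

definition fhat :: "(R3 \<Rightarrow> real) \<Rightarrow> R3 \<Rightarrow> complex"
  where "fhat u = (SOME g. g \<in> borel_measurable borel \<and> (AE \<xi> in lborel. fourier_real u \<xi> = g \<xi>)
     \<and> (\<lambda>n. \<integral>\<^sup>+\<xi>. ennreal ((norm (ft (trunc n u) \<xi> - g \<xi>))^2) \<partial>lborel) \<longlonglongrightarrow> 0)"

lemma
  assumes u: "square_integrable u"
  shows fhat_measurable: "fhat u \<in> borel_measurable borel"
    and fourier_eq_fhat: "AE \<xi> in lborel. fourier_real u \<xi> = fhat u \<xi>"
    and ft_trunc_tendsto: "(\<lambda>n. \<integral>\<^sup>+\<xi>. ennreal ((norm (ft (trunc n u) \<xi> - fhat u \<xi>))^2) \<partial>lborel) \<longlonglongrightarrow> 0"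
  using someI_ex[OF fourier_exists[OF u]] unfolding fhat_def by auto

lemma nn_fhat:
  assumes u: "square_integrable u"
  shows "(\<integral>\<^sup>+\<xi>. ennreal ((cmod (fhat u \<xi>))^2) \<partial>lborel) = ennreal (mass u)"
proof -
  note [measurable] = square_integrableD(1)[OF u] fhat_measurable[OF u]
  have mf: "(\<integral>\<^sup>+\<xi>. ennreal ((norm (ft (trunc n u) \<xi>))^2) \<partial>lborel) = ennreal (mass (trunc n u))" for n
    by (rule ft_isometry[OF trunc_integrable[OF u] trunc_square_integrable[OF u]])
  show ?thesis
    by (rule nn_sq_tendsto[OF _ _ _ _ ft_trunc_tendsto[OF u]]) (auto simp: mf intro!: tendsto_ennrealI mass_trunc_tendsto u)
qed

lemma fhat_sq_integrable:
  assumes u: "square_integrable u"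
  shows "integrable lborel (\<lambda>\<xi>. (cmod (fhat u \<xi>))^2)"
  using fhat_measurable[OF u] nn_fhat[OF u] by (auto simp: integrable_iff_bounded)

text \<open>Since the transform is a choice, linearity is obtained almost everywhere: both sides are
  \<open>L\<^sup>2\<close> limits of the same integral transforms.\<close>

lemma fhat_diff:
  assumes u: "square_integrable u" and v: "square_integrable v"
  shows "AE \<xi> in lborel. fhat (\<lambda>x. u x - v x) \<xi> = fhat u \<xi> - fhat v \<xi>"
proof (rule l2_unique)
  note uv = square_integrable_diff[OF u v]
  note [measurable] = fhat_measurable[OF u] fhat_measurable[OF v] fhat_measurable[OF uv]
    square_integrableD(1)[OF u] square_integrableD(1)[OF v]
  show "ft (trunc n (\<lambda>x. u x - v x)) \<in> borel_measurable lborel" "fhat (\<lambda>x. u x - v x) \<in> borel_measurable lborel"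
    "(\<lambda>\<xi>. fhat u \<xi> - fhat v \<xi>) \<in> borel_measurable lborel" for n by auto
  show "(\<lambda>n. \<integral>\<^sup>+\<xi>. ennreal ((norm (ft (trunc n (\<lambda>x. u x - v x)) \<xi> - fhat (\<lambda>x. u x - v x) \<xi>))^2) \<partial>lborel) \<longlonglongrightarrow> 0"
    by (rule ft_trunc_tendsto[OF uv])
  have eq: "ft (trunc n (\<lambda>x. u x - v x)) \<xi> = ft (trunc n u) \<xi> - ft (trunc n v) \<xi>" for n \<xi>
  proof -
    have "trunc n (\<lambda>x. u x - v x) = (\<lambda>x. trunc n u x - trunc n v x)"
      by (simp add: trunc_def fun_eq_iff right_diff_distrib)
    then show ?thesis by (simp add: ft_diff trunc_integrable u v)
  qed
  have lim: "(\<lambda>n. 2 * (\<integral>\<^sup>+\<xi>. ennreal ((norm (ft (trunc n u) \<xi> - fhat u \<xi>))^2) \<partial>lborel)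
      + 2 * (\<integral>\<^sup>+\<xi>. ennreal ((norm (ft (trunc n v) \<xi> - fhat v \<xi>))^2) \<partial>lborel)) \<longlonglongrightarrow> 0"
    using tendsto_add[OF tendsto_mult_ennreal[OF tendsto_const[of 2] ft_trunc_tendsto[OF u]] tendsto_mult_ennreal[OF tendsto_const[of 2] ft_trunc_tendsto[OF v]]]
    by simp
  show "(\<lambda>n. \<integral>\<^sup>+\<xi>. ennreal ((norm (ft (trunc n (\<lambda>x. u x - v x)) \<xi> - (fhat u \<xi> - fhat v \<xi>)))^2) \<partial>lborel) \<longlonglongrightarrow> 0"
  proof (rule ennreal_tendsto_0_le[OF lim])
    fix n
    show "(\<integral>\<^sup>+\<xi>. ennreal ((norm (ft (trunc n (\<lambda>x. u x - v x)) \<xi> - (fhat u \<xi> - fhat v \<xi>)))^2) \<partial>lborel)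
      \<le> 2 * (\<integral>\<^sup>+\<xi>. ennreal ((norm (ft (trunc n u) \<xi> - fhat u \<xi>))^2) \<partial>lborel)
      + 2 * (\<integral>\<^sup>+\<xi>. ennreal ((norm (ft (trunc n v) \<xi> - fhat v \<xi>))^2) \<partial>lborel)"
      using nn_sq_diff_le3[of "\<lambda>\<xi>. ft (trunc n u) \<xi> - fhat u \<xi>" lborel "\<lambda>_. 0" "\<lambda>\<xi>. ft (trunc n v) \<xi> - fhat v \<xi>"]
      by (simp add: eq algebra_simps norm_minus_commute[of "fhat v _"])
  qed
qed

text \<open>The way back to the explicit integral, by which the transform of a dilate is computed
  later.\<close>

lemma fhat_eq_ft:
  assumes i: "integrable lborel u" and u: "square_integrable u"
  shows "AE \<xi> in lborel. fhat u \<xi> = ft u \<xi>"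
proof (rule l2_unique[OF _ _ _ ft_trunc_tendsto[OF u]])
  note [measurable] = fhat_measurable[OF u] square_integrableD(1)[OF u]
  show "ft (trunc n u) \<in> borel_measurable lborel" "fhat u \<in> borel_measurable lborel" "ft u \<in> borel_measurable lborel" for n
    by auto
  show "(\<lambda>n. \<integral>\<^sup>+\<xi>. ennreal ((norm (ft (trunc n u) \<xi> - ft u \<xi>))^2) \<partial>lborel) \<longlonglongrightarrow> 0"
    using trunc_tendsto[OF u] by (simp add: nn_ft_diff[OF trunc_integrable[OF u] i trunc_square_integrable[OF u] u])
qed

text \<open>The identity for truncations passes to the limit on both sides: in frequency as an
  integral with bounded weight, in space with the untruncated integrand as dominating
  function.\<close>

lemma fhat_heat_integral:
  assumes u: "square_integrable u" and t: "t > 0"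
  shows "(\<integral>\<xi>. exp (- t * (norm \<xi>)^2) * (cmod (fhat u \<xi>))^2 \<partial>lborel)
     = (\<integral>p. heat t (fst p - snd p) * u (fst p) * u (snd p) \<partial>lborel2)"
proof (rule LIMSEQ_unique)
  note [measurable] = fhat_measurable[OF u] square_integrableD(1)[OF u]
  show "(\<lambda>n. \<integral>\<xi>. exp (- t * (norm \<xi>)^2) * (cmod (ft (trunc n u) \<xi>))^2 \<partial>lborel)
     \<longlonglongrightarrow> (\<integral>\<xi>. exp (- t * (norm \<xi>)^2) * (cmod (fhat u \<xi>))^2 \<partial>lborel)"
  proof (rule l2_weight_tendsto[OF _ _ _ fhat_sq_integrable[OF u] _ ft_trunc_tendsto[OF u]])
    show "integrable lborel (\<lambda>\<xi>. (cmod (ft (trunc n u) \<xi>))^2)" for n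
      using ft_isometry[OF trunc_integrable[OF u] trunc_square_integrable[OF u], of n] by (simp add: integrable_iff_bounded)
  qed (use t in auto)
  have "(\<lambda>n. \<integral>p. heat t (fst p - snd p) * trunc n u (fst p) * trunc n u (snd p) \<partial>lborel2)
     \<longlonglongrightarrow> (\<integral>p. heat t (fst p - snd p) * u (fst p) * u (snd p) \<partial>lborel2)"
  proof (rule integral_dominated_convergence[where w="\<lambda>p. \<bar>heat t (fst p - snd p) * u (fst p) * u (snd p)\<bar>"])
    show "integrable lborel2 (\<lambda>p. \<bar>heat t (fst p - snd p) * u (fst p) * u (snd p)\<bar>)"
      using heat_form_integrable[OF u t] by simp
    show "AE p in lborel2. (\<lambda>n. heat t (fst p - snd p) * trunc n u (fst p) * trunc n u (snd p)) \<longlonglongrightarrow> heat t (fst p - snd p) * u (fst p) * u (snd p)"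
    proof (rule AE_I2)
      fix p :: "R3 \<times> R3"
      show "(\<lambda>n. heat t (fst p - snd p) * trunc n u (fst p) * trunc n u (snd p)) \<longlonglongrightarrow> heat t (fst p - snd p) * u (fst p) * u (snd p)"
        by (intro tendsto_intros tendsto_eventually trunc_eventually)
    qed
    show "AE p in lborel2. norm (heat t (fst p - snd p) * trunc n u (fst p) * trunc n u (snd p)) \<le> \<bar>heat t (fst p - snd p) * u (fst p) * u (snd p)\<bar>" for n
      by (intro AE_I2) (auto simp: abs_mult abs_trunc_le intro!: mult_mono)
  qed auto
  then show "(\<lambda>n. \<integral>\<xi>. exp (- t * (norm \<xi>)^2) * (cmod (ft (trunc n u) \<xi>))^2 \<partial>lborel)
     \<longlonglongrightarrow> (\<integral>p. heat t (fst p - snd p) * u (fst p) * u (snd p) \<partial>lborel2)"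
    by (simp only: ft_gauss[OF trunc_integrable[OF u] t])
qed

text \<open>Both sides are the quadratic form of \<open>1 - exp (t \<Delta>)\<close>; the factor 1/2
  undoes the doubling in \<open>heat_jump\<close>.\<close>

lemma fhat_heat_jump:
  assumes u: "square_integrable u" and t: "t > 0"
  shows "(\<integral>\<^sup>+\<xi>. ennreal ((1 - exp (- t * (norm \<xi>)^2)) * (cmod (fhat u \<xi>))^2) \<partial>lborel) = ennreal (1/2) * heat_jump t u"
proof -
  note [measurable] = fhat_measurable[OF u] square_integrableD(1)[OF u]
  have i: "integrable lborel (\<lambda>\<xi>. exp (- t * (norm \<xi>)^2) * (cmod (fhat u \<xi>))^2)"
    by (rule Bochner_Integration.integrable_bound[OF fhat_sq_integrable[OF u]])
       (use t in \<open>auto intro!: AE_I2 mult_left_le_one_le\<close>)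
  have m: "(\<integral>\<xi>. (cmod (fhat u \<xi>))^2 \<partial>lborel) = mass u"
    using nn_fhat[OF u] nn_integral_eq_integral[OF fhat_sq_integrable[OF u]] mass_nonneg[of u] by simp
  have "(\<integral>\<^sup>+\<xi>. ennreal ((1 - exp (- t * (norm \<xi>)^2)) * (cmod (fhat u \<xi>))^2) \<partial>lborel)
     = (\<integral>\<^sup>+\<xi>. ennreal ((cmod (fhat u \<xi>))^2 - exp (- t * (norm \<xi>)^2) * (cmod (fhat u \<xi>))^2) \<partial>lborel)"
    by (simp add: algebra_simps)
  also have "\<dots> = ennreal (mass u - (\<integral>p. heat t (fst p - snd p) * u (fst p) * u (snd p) \<partial>lborel2))"
    using i fhat_sq_integrable[OF u] t m
    by (subst nn_integral_eq_integral) (auto simp: fhat_heat_integral[OF u t, simplified] intro!: AE_I2 mult_left_le_one_le)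
  also have "\<dots> = ennreal (1/2) * heat_jump t u"
    unfolding heat_jump_eq[OF u t]
    by (subst ennreal_mult'[symmetric]) (auto simp: diff_divide_distrib)
  finally show ?thesis .
qed

section \<open>Subordination formulas\<close>

lemma heat_measurable'[measurable]:
  assumes [measurable]: "f \<in> borel_measurable M" "g \<in> borel_measurable M"
  shows "(\<lambda>x. heat (f x) (g x)) \<in> borel_measurable M"
  unfolding heat_def by measurable

lemma nn_integral_powr_Ioc:
  assumes "a > -1"
  shows "(\<integral>\<^sup>+x. ennreal (x powr a) * indicator {0<..1} x \<partial>lborel) = ennreal (1 / (a + 1))"
proof -
  have "(\<integral>\<^sup>+x. ennreal (x powr a) * indicator {0<..1} x \<partial>lborel) = (\<integral>\<^sup>+x. ennreal (indicator {0..1} x * x powr a) \<partial>lborel)"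
    by (intro nn_integral_cong) (auto split: split_indicator)
  also have "\<dots> = ennreal (1 powr (a+1) / (a+1))"
    by (rule nn_integral_has_integral_lebesgue) (use has_integral_powr_from_0[OF assms, of 1] in auto)
  finally show ?thesis by simp
qed

lemma nn_integral_powr_Ici:
  assumes "a < -1"
  shows "(\<integral>\<^sup>+x. ennreal (x powr a) * indicator {1..} x \<partial>lborel) = ennreal (1 / (- a - 1))"
proof -
  have "(\<integral>\<^sup>+x. ennreal (x powr a) * indicator {1..} x \<partial>lborel) = (\<integral>\<^sup>+x. ennreal (indicator {1..} x * x powr a) \<partial>lborel)"
    by (intro nn_integral_cong) (auto split: split_indicator)
  also have "\<dots> = ennreal (- (1 powr (a+1)) / (a+1))"
    by (rule nn_integral_has_integral_lebesgue) (use has_integral_powr_to_inf[of a 1] assms in auto)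
  also have "- (1 powr (a+1)) / (a+1) = 1 / (- a - 1)" using assms by (simp add: field_simps)
  finally show ?thesis .
qed

text \<open>The powers \<open>-1/2\<close> and \<open>-3/2\<close> lie on the integrable sides of
  \<open>-1\<close> at the two ends; the three representation formulas below all fit this
  pattern.\<close>

lemma nn_integral_Ioi_finite:
  fixes f :: "real \<Rightarrow> real"
  assumes [measurable]: "f \<in> borel_measurable borel"
    and 0: "\<And>t. 0 < t \<Longrightarrow> t \<le> 1 \<Longrightarrow> f t \<le> C * t powr (- 1 / 2)"
    and 1: "\<And>t. 1 \<le> t \<Longrightarrow> f t \<le> C * t powr (- 3 / 2)" and C: "C \<ge> 0"
  shows "(\<integral>\<^sup>+t. ennreal (f t) * indicator {0<..} t \<partial>lborel) < \<infinity>"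
proof -
  have "(\<integral>\<^sup>+t. ennreal (f t) * indicator {0<..} t \<partial>lborel)
    \<le> (\<integral>\<^sup>+t. ennreal C * (ennreal (t powr (- 1 / 2)) * indicator {0<..1} t) + ennreal C * (ennreal (t powr (- 3 / 2)) * indicator {1..} t) \<partial>lborel)"
    using 0 1 C
    by (intro nn_integral_mono) (auto split: split_indicator simp: ennreal_mult[symmetric] ennreal_plus[symmetric] simp del: ennreal_plus intro!: ennreal_leI add_increasing2)
  also have "\<dots> = ennreal C * ennreal (1 / (- 1 / 2 + 1)) + ennreal C * ennreal (1 / (- (- 3 / 2) - 1))"
    by (subst nn_integral_add, simp, simp, (subst nn_integral_cmult, simp)+, subst nn_integral_powr_Ioc, simp,
        subst nn_integral_powr_Ici, simp, rule refl)
  also have "\<dots> < \<infinity>" by (simp add: ennreal_mult_less_top)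
  finally show ?thesis .
qed

lemma nn_integral_Ioi_scale:
  assumes [measurable]: "f \<in> borel_measurable borel" and c: "c > (0::real)"
  shows "(\<integral>\<^sup>+t. f t * indicator {0<..} t \<partial>lborel) = ennreal c * (\<integral>\<^sup>+t. f (c * t) * indicator {0<..} t \<partial>lborel)"
proof -
  have ind: "indicator {0<..} (c * t) = (indicator {0<..} t :: ennreal)" for t
    using c by (auto simp: zero_less_mult_iff split: split_indicator)
  have "(\<integral>\<^sup>+t. f t * indicator {0<..} t \<partial>lborel) = ennreal \<bar>c\<bar> * (\<integral>\<^sup>+t. f (0 + c * t) * indicator {0<..} (0 + c * t) \<partial>lborel)"
    by (rule nn_integral_real_affine) (use c in auto)
  then show ?thesis using c by (simp add: ind)
qed

text \<open>Serves to make the constants of the representation formulas strictly positive, so that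
  they can be divided out.\<close>

lemma nn_integral_Ioi_pos:
  fixes f :: "real \<Rightarrow> real"
  assumes [measurable]: "f \<in> borel_measurable borel" and pos: "\<And>t. t > 0 \<Longrightarrow> f t > 0"
  shows "(\<integral>\<^sup>+t. ennreal (f t) * indicator {0<..} t \<partial>lborel) \<noteq> 0"
proof
  assume "(\<integral>\<^sup>+t. ennreal (f t) * indicator {0<..} t \<partial>lborel) = 0"
  then have "AE t in lborel. ennreal (f t) * indicator {0<..} t = 0"
    by (subst (asm) nn_integral_0_iff_AE) auto
  then have "AE t in lborel. t \<notin> {0<..<1::real}"
  proof eventually_elim
    case (elim t)
    show ?case
    proof
      assume t: "t \<in> {0<..<1}"
      then have "f t > 0" using pos by auto
      with elim t show False by (simp add: ennreal_eq_0_iff)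
    qed
  qed
  then have "{0<..<1::real} \<in> null_sets lborel"
    by (subst AE_iff_null_sets) auto
  then have "emeasure lborel {0<..<1::real} = 0" by (rule null_setsD1)
  then show False by simp
qed

lemma ennreal_pos_finite_obtain:
  fixes x :: ennreal
  assumes "x \<noteq> 0" "x < \<infinity>"
  obtains c where "c > 0" "x = ennreal c"
  using assms by (cases x) auto

lemma powr_mult_neg: "c > 0 \<Longrightarrow> t > 0 \<Longrightarrow> (c * t) powr a = c powr a * t powr (a::real)"
  by (simp add: powr_mult)

text \<open>Homogeneity: substituting \<open>t / s\<close> for \<open>t\<close> pulls out
  \<open>sqrt s\<close>, and what remains is a constant, finite at 0 because
  \<open>1 - exp (- t) \<le> t\<close>.\<close>

lemma sqrt_representation:
  obtains c where "c > 0"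
    "\<And>s. s \<ge> 0 \<Longrightarrow> (\<integral>\<^sup>+t. ennreal ((1 - exp (- t * s)) * t powr (- 3 / 2)) * indicator {0<..} t \<partial>lborel) = ennreal (c * sqrt s)"
proof -
  define I where "I = (\<integral>\<^sup>+t. ennreal ((1 - exp (- t)) * t powr (- 3 / 2)) * indicator {0<..} t \<partial>lborel)"
  have "I < \<infinity>" unfolding I_def
  proof (rule nn_integral_Ioi_finite[where C=1])
    fix t :: real assume t: "0 < t" "t \<le> 1"
    have "1 - exp (- t) \<le> t" using exp_ge_add_one_self[of "-t"] by simp
    then have "(1 - exp (- t)) * t powr (- 3 / 2) \<le> t powr 1 * t powr (- 3 / 2)"
      using t by (intro mult_right_mono) auto
    also have "\<dots> = t powr (- 1 / 2)" unfolding powr_add[symmetric] by simp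
    finally show "(1 - exp (- t)) * t powr (- 3 / 2) \<le> 1 * t powr (- 1 / 2)" by simp
  qed (auto intro!: mult_left_le_one_le)
  moreover have "I \<noteq> 0" unfolding I_def by (rule nn_integral_Ioi_pos) auto
  ultimately obtain c where c: "c > 0" "I = ennreal c" using ennreal_pos_finite_obtain by metis
  have "(\<integral>\<^sup>+t. ennreal ((1 - exp (- t * s)) * t powr (- 3 / 2)) * indicator {0<..} t \<partial>lborel) = ennreal (c * sqrt s)"
    if s: "s \<ge> 0" for s
  proof (cases "s = 0")
    case False
    then have s: "s > 0" using s by simp
    have "(\<integral>\<^sup>+t. ennreal ((1 - exp (- t * s)) * t powr (- 3 / 2)) * indicator {0<..} t \<partial>lborel)
      = ennreal (1/s) * (\<integral>\<^sup>+t. ennreal ((1 - exp (- (1/s * t) * s)) * (1/s * t) powr (- 3 / 2)) * indicator {0<..} t \<partial>lborel)"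
      by (rule nn_integral_Ioi_scale) (use s in auto)
    also have "(\<integral>\<^sup>+t. ennreal ((1 - exp (- (1/s * t) * s)) * (1/s * t) powr (- 3 / 2)) * indicator {0<..} t \<partial>lborel)
      = (\<integral>\<^sup>+t. ennreal (s powr (3/2)) * (ennreal ((1 - exp (- t)) * t powr (- 3 / 2)) * indicator {0<..} t) \<partial>lborel)"
    proof (rule nn_integral_cong)
      fix t :: real
      have "(1/s * t) powr (- 3 / 2) = s powr (3/2) * t powr (- 3 / 2)" if "t > 0"
        using s that powr_mult_neg[of "1/s" t "- 3 / 2"] by (simp add: powr_divide powr_minus_divide)
      then show "ennreal ((1 - exp (- (1/s * t) * s)) * (1/s * t) powr (- 3 / 2)) * indicator {0<..} t
         = ennreal (s powr (3/2)) * (ennreal ((1 - exp (- t)) * t powr (- 3 / 2)) * indicator {0<..} t)"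
        using s by (auto split: split_indicator simp: ennreal_mult[symmetric] mult_ac)
    qed
    also have "ennreal (1/s) * \<dots> = ennreal (1/s) * (ennreal (s powr (3/2)) * ennreal c)"
      by (subst nn_integral_cmult, simp, simp only: I_def[symmetric] c)
    also have "\<dots> = ennreal (c * (s powr (3/2) / s))"
      using s c by (simp add: ennreal_mult[symmetric] mult_ac)
    also have "s powr (3/2) / s = sqrt s"
      using s powr_diff[of s "3/2" 1] by (simp add: powr_half_sqrt)
    finally show ?thesis .
  qed simp
  with c(1) show thesis by (rule that)
qed

text \<open>The heat kernel is homogeneous when \<open>z\<close> scales by \<open>r\<close> and
  \<open>t\<close> by \<open>r^2\<close>: \<open>dt\<close>, the power \<open>t powr (-3/2)\<close>
  and the kernel contribute the degrees 2, -3 and -3, in total -4.\<close>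

lemma inverse_fourth_power_representation:
  obtains c where "c > 0"
    "\<And>z. z \<noteq> 0 \<Longrightarrow> (\<integral>\<^sup>+t. ennreal (heat t z * t powr (- 3 / 2)) * indicator {0<..} t \<partial>lborel) = ennreal (c / norm z ^ 4)"
proof -
  define h where "h t = exp (- 1 / (4 * t)) / sqrt (4 * pi * t) ^ 3" for t :: real
  have [measurable]: "h \<in> borel_measurable borel" unfolding h_def by measurable
  define I where "I = (\<integral>\<^sup>+t. ennreal (h t * t powr (- 3 / 2)) * indicator {0<..} t \<partial>lborel)"
  have sq: "sqrt (4 * pi * t) ^ 3 = (4 * pi) powr (3/2) * t powr (3/2)" if "t > 0" for t
  proof -
    have "sqrt (4 * pi * t) ^ 3 = ((4 * pi * t) powr (1/2)) powr 3"
      using that by (simp add: powr_half_sqrt powr_numeral)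
    also have "\<dots> = (4 * pi * t) powr (3/2)" by (simp add: powr_powr)
    also have "\<dots> = (4 * pi) powr (3/2) * t powr (3/2)" using that by (intro powr_mult_neg) auto
    finally show ?thesis .
  qed
  have pi1: "(4 * pi) powr (3/2) \<ge> 1"
    using pi_gt3 by (intro ge_one_powr_ge_zero) auto
  have hb: "h t * t powr (- 3 / 2) \<le> exp (- 1 / (4 * t)) * t powr (- 3)" if "t > 0" for t
  proof -
    have "h t * t powr (- 3 / 2) = exp (- 1 / (4 * t)) * (t powr (-3/2) * t powr (- 3 / 2)) / (4 * pi) powr (3/2)"
      unfolding h_def sq[OF that] using that by (simp add: powr_minus field_simps)
    also have "t powr (-3/2) * t powr (- 3 / 2) = t powr (-3)" unfolding powr_add[symmetric] by simp
    also have "exp (- 1 / (4 * t)) * t powr (-3) / (4 * pi) powr (3/2) \<le> exp (- 1 / (4 * t)) * t powr (-3) / 1"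
      using pi1 by (intro divide_left_mono) auto
    finally show ?thesis by simp
  qed
  have "I < \<infinity>" unfolding I_def
  proof (rule nn_integral_Ioi_finite[where C=384])
    fix t :: real assume t: "0 < t" "t \<le> 1"
    \<comment> \<open>The cubic term of the exponential series at \<open>1/(4*t)\<close>;
      \<open>384 = 3! * 4^3\<close>, and \<open>t^3\<close> cancels the singularity
      \<open>t powr (-3)\<close>.\<close>
    have "(1/(4*t))^3 / fact 3 \<le> exp (1/(4*t))"
      using sum_le_suminf[OF summable_exp_generic[of "1/(4*t)"], of "{3}"] t
      by (simp add: exp_def scaleR_conv_of_real field_simps)
    then have "exp (- 1 / (4 * t)) \<le> 384 * t^3"
      using t by (simp add: exp_minus field_simps power_divide fact_numeral)
    then have "exp (- 1 / (4 * t)) * t powr (-3) \<le> 384 * t^3 * t powr (-3)"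
      by (intro mult_right_mono) auto
    also have "\<dots> = 384" using t by (simp add: powr_minus powr_numeral)
    also have "\<dots> \<le> 384 * t powr (- 1 / 2)"
      using t powr_mono2'[of "-1/2" t 1] by simp
    finally show "h t * t powr (- 3 / 2) \<le> 384 * t powr (- 1 / 2)" using hb[of t] t by simp
  next
    fix t :: real assume t: "1 \<le> t"
    have "exp (- 1 / (4 * t)) * t powr (- 3) \<le> 1 * t powr (- 3 / 2)"
      using t by (intro mult_mono powr_mono) auto
    also have "\<dots> \<le> 384 * t powr (- 3 / 2)" by (intro mult_right_mono) auto
    finally have "exp (- 1 / (4 * t)) * t powr (- 3) \<le> 384 * t powr (- 3 / 2)" .
    moreover have "t > 0" using t by simp
    ultimately show "h t * t powr (- 3 / 2) \<le> 384 * t powr (- 3 / 2)" using hb order_trans by blast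
  qed auto
  moreover have "I \<noteq> 0" unfolding I_def by (rule nn_integral_Ioi_pos) (auto simp: h_def)
  ultimately obtain c where c: "c > 0" "I = ennreal c" using ennreal_pos_finite_obtain by metis
  have "(\<integral>\<^sup>+t. ennreal (heat t z * t powr (- 3 / 2)) * indicator {0<..} t \<partial>lborel) = ennreal (c / norm z ^ 4)"
    if z: "z \<noteq> 0" for z
  proof -
    define r where "r = norm z"
    have r: "r > 0" using z by (simp add: r_def)
    have "(\<integral>\<^sup>+t. ennreal (heat t z * t powr (- 3 / 2)) * indicator {0<..} t \<partial>lborel)
      = ennreal (r^2) * (\<integral>\<^sup>+t. ennreal (heat (r^2 * t) z * (r^2 * t) powr (- 3 / 2)) * indicator {0<..} t \<partial>lborel)"
      by (rule nn_integral_Ioi_scale) (use r in auto)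
    also have "(\<integral>\<^sup>+t. ennreal (heat (r^2 * t) z * (r^2 * t) powr (- 3 / 2)) * indicator {0<..} t \<partial>lborel)
      = (\<integral>\<^sup>+t. ennreal (1 / r^6) * (ennreal (h t * t powr (- 3 / 2)) * indicator {0<..} t) \<partial>lborel)"
    proof (rule nn_integral_cong)
      fix t :: real
      have "heat (r^2 * t) z * (r^2 * t) powr (- 3 / 2) = (1 / r^6) * (h t * t powr (- 3 / 2))" if t: "t > 0"
      proof -
        have 1: "(r^2 * t) powr (- 3 / 2) = t powr (- 3 / 2) / r^3"
        proof -
          have "(r^2) powr (- 3 / 2) = (r powr 2) powr (- 3 / 2)" using r by (simp add: powr_numeral)
          also have "\<dots> = r powr (- 3)" by (simp only: powr_powr) simp
          also have "\<dots> = 1 / r^3" using r by (simp add: powr_minus_divide powr_numeral)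
          finally show ?thesis using r t by (simp add: powr_mult_neg)
        qed
        have 2: "sqrt (4 * pi * (r^2 * t)) ^ 3 = r^3 * sqrt (4 * pi * t) ^ 3"
          using r by (simp add: real_sqrt_mult power_mult_distrib)
        show ?thesis unfolding heat_def r_def[symmetric] 1 2 h_def using r t
          by (simp add: field_simps eval_nat_numeral)
      qed
      then show "ennreal (heat (r^2 * t) z * (r^2 * t) powr (- 3 / 2)) * indicator {0<..} t
        = ennreal (1 / r^6) * (ennreal (h t * t powr (- 3 / 2)) * indicator {0<..} t)"
        using r by (auto split: split_indicator simp: ennreal_mult[symmetric] h_def)
    qed
    also have "ennreal (r^2) * \<dots> = ennreal (r^2) * (ennreal (1 / r^6) * ennreal c)"
      by (subst nn_integral_cmult, simp, simp only: I_def[symmetric] c)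
    also have "\<dots> = ennreal (r^2 * (1 / r^6 * c))"
      using r c by (simp add: ennreal_mult[symmetric])
    also have "r^2 * (1 / r^6 * c) = c / r^4" using r by (simp add: field_simps eval_nat_numeral)
    finally show ?thesis by (simp add: r_def)
  qed
  with c(1) show thesis by (rule that)
qed

text \<open>A Gamma integral, by homogeneity. The exponent carries \<open>r^2 / 2\<close> because
  two Gaussians centred at \<open>x\<close> and \<open>y\<close>, multiplied and integrated over
  their common variable, leave \<open>exp (- s |x - y|^2 / 2)\<close>.\<close>

lemma inverse_representation:
  obtains c where "c > 0"
    "\<And>r. r > 0 \<Longrightarrow> (\<integral>\<^sup>+s. ennreal (s powr (- 1 / 2) * exp (- s * r^2 / 2)) * indicator {0<..} s \<partial>lborel) = ennreal (c / r)"
proof -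
  define I where "I = (\<integral>\<^sup>+s. ennreal (s powr (- 1 / 2) * exp (- s / 2)) * indicator {0<..} s \<partial>lborel)"
  have "I < \<infinity>" unfolding I_def
  proof (rule nn_integral_Ioi_finite[where C=2])
    fix t :: real assume t: "1 \<le> t"
    have "t \<le> 2 * exp (t/2)" using exp_ge_add_one_self[of "t/2"] by linarith
    then have "exp (- t / 2) \<le> 2 * t powr (-1)" using t by (simp add: exp_minus field_simps powr_minus)
    then have "t powr (- 1 / 2) * exp (- t / 2) \<le> t powr (- 1 / 2) * (2 * t powr (-1))"
      by (intro mult_left_mono) auto
    also have "\<dots> = 2 * t powr (- 3 / 2)"
      using powr_add[of t "-1/2" "-1"] by simp
    finally show "t powr (- 1 / 2) * exp (- t / 2) \<le> 2 * t powr (- 3 / 2)" .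
  next
    fix t :: real assume t: "0 < t" "t \<le> 1"
    have "t powr (- 1 / 2) * exp (- t / 2) \<le> t powr (- 1 / 2) * 2"
      using t by (intro mult_left_mono) (auto intro: order_trans[of _ 1])
    then show "t powr (- 1 / 2) * exp (- t / 2) \<le> 2 * t powr (- 1 / 2)" by simp
  qed auto
  moreover have "I \<noteq> 0" unfolding I_def by (rule nn_integral_Ioi_pos) auto
  ultimately obtain c where c: "c > 0" "I = ennreal c" using ennreal_pos_finite_obtain by metis
  have "(\<integral>\<^sup>+s. ennreal (s powr (- 1 / 2) * exp (- s * r^2 / 2)) * indicator {0<..} s \<partial>lborel) = ennreal (c / r)"
    if r: "r > 0" for r
  proof -
    have "(\<integral>\<^sup>+s. ennreal (s powr (- 1 / 2) * exp (- s * r^2 / 2)) * indicator {0<..} s \<partial>lborel)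
      = ennreal (1/r^2) * (\<integral>\<^sup>+s. ennreal ((1/r^2 * s) powr (- 1 / 2) * exp (- (1/r^2 * s) * r^2 / 2)) * indicator {0<..} s \<partial>lborel)"
      by (rule nn_integral_Ioi_scale) (use r in auto)
    also have "(\<integral>\<^sup>+s. ennreal ((1/r^2 * s) powr (- 1 / 2) * exp (- (1/r^2 * s) * r^2 / 2)) * indicator {0<..} s \<partial>lborel)
      = (\<integral>\<^sup>+s. ennreal r * (ennreal (s powr (- 1 / 2) * exp (- s / 2)) * indicator {0<..} s) \<partial>lborel)"
    proof (rule nn_integral_cong)
      fix s :: real
      have "(1/r^2 * s) powr (- 1 / 2) = r * s powr (- 1 / 2)" if "s > 0"
      proof -
        have "(1/r^2) powr (- 1 / 2) = (r powr (-2)) powr (-1/2)" using r by (simp add: powr_minus_divide powr_numeral)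
        also have "\<dots> = r" using r by (simp only: powr_powr) simp
        finally show ?thesis using powr_mult_neg[of "1/r^2" s "-1/2"] r that by simp
      qed
      then show "ennreal ((1/r^2 * s) powr (- 1 / 2) * exp (- (1/r^2 * s) * r^2 / 2)) * indicator {0<..} s
        = ennreal r * (ennreal (s powr (- 1 / 2) * exp (- s / 2)) * indicator {0<..} s)"
        using r by (auto split: split_indicator simp: ennreal_mult[symmetric] mult_ac)
    qed
    also have "ennreal (1/r^2) * \<dots> = ennreal (1/r^2) * (ennreal r * ennreal c)"
      by (subst nn_integral_cmult, simp, simp only: I_def[symmetric] c)
    also have "\<dots> = ennreal (1/r^2 * (r * c))"
      using r c by (simp add: ennreal_mult[symmetric])
    also have "1/r^2 * (r * c) = c / r" using r by (simp add: field_simps power2_eq_square)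
    finally show ?thesis .
  qed
  with c(1) show thesis by (rule that)
qed

section \<open>Relativistic forms and the Gagliardo seminorm\<close>

text \<open>The square of the Gagliardo seminorm of order 1/2: the exponent is the dimension 3 plus
  twice the order. Division by zero makes the integrand 0 on the diagonal, a null set.\<close>

definition seminorm :: "(R3 \<Rightarrow> real) \<Rightarrow> ennreal"
  where "seminorm u = (\<integral>\<^sup>+p. ennreal ((u (fst p) - u (snd p))^2 / norm (fst p - snd p) ^ 4) \<partial>lborel2)"

definition symbol_form :: "real \<Rightarrow> (R3 \<Rightarrow> real) \<Rightarrow> ennreal"
  where "symbol_form m u = (\<integral>\<^sup>+\<xi>. ennreal (sqrt ((norm \<xi>)^2 + m^2) * (cmod (fhat u \<xi>))^2) \<partial>lborel)"

text \<open>Subordination: \<open>c \<surd>s = \<integral>(1 - exp (-ts)) t\<^bsup>-3/2\<^esup> dt\<close> with \<open>s = |\<xi>|\<^sup>2 + m\<^sup>2\<close> turns the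
  multiplier into an average of heat semigroups, which have positive kernels.\<close>

lemma symbol_form_representation:
  obtains c where "c > 0"
    "\<And>m u. square_integrable u \<Longrightarrow> ennreal c * symbol_form m u =
      (\<integral>\<^sup>+t. (ennreal ((1 - exp (- t * m^2)) * t powr (- 3 / 2)) * ennreal (mass u)
         + ennreal (exp (- t * m^2) * t powr (- 3 / 2)) * (ennreal (1/2) * heat_jump t u)) * indicator {0<..} t \<partial>lborel)"
proof -
  obtain c where c: "c > 0"
    "\<And>s. s \<ge> 0 \<Longrightarrow> (\<integral>\<^sup>+t. ennreal ((1 - exp (- t * s)) * t powr (- 3 / 2)) * indicator {0<..} t \<partial>lborel) = ennreal (c * sqrt s)"
    by (rule sqrt_representation) blast
  have "ennreal c * symbol_form m u =
      (\<integral>\<^sup>+t. (ennreal ((1 - exp (- t * m^2)) * t powr (- 3 / 2)) * ennreal (mass u)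
         + ennreal (exp (- t * m^2) * t powr (- 3 / 2)) * (ennreal (1/2) * heat_jump t u)) * indicator {0<..} t \<partial>lborel)"
    if u: "square_integrable u" for m u
  proof -
    note [measurable] = square_integrableD(1)[OF u] fhat_measurable[OF u]
    let ?s = "\<lambda>\<xi>::R3. (norm \<xi>)^2 + m^2"
    have "ennreal c * symbol_form m u = (\<integral>\<^sup>+\<xi>. ennreal (c * sqrt (?s \<xi>)) * ennreal ((cmod (fhat u \<xi>))^2) \<partial>lborel)"
      unfolding symbol_form_def using c(1)
      by (subst nn_integral_cmult[symmetric]) (auto simp: ennreal_mult[symmetric] mult.assoc)
    also have "\<dots> = (\<integral>\<^sup>+\<xi>. (\<integral>\<^sup>+t. ennreal ((1 - exp (- t * ?s \<xi>)) * t powr (- 3 / 2)) * indicator {0<..} t * ennreal ((cmod (fhat u \<xi>))^2) \<partial>lborel) \<partial>lborel)"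
      by (subst nn_integral_multc, simp, subst c(2)) auto
    also have "\<dots> = (\<integral>\<^sup>+t. (\<integral>\<^sup>+\<xi>. ennreal ((1 - exp (- t * ?s \<xi>)) * t powr (- 3 / 2)) * indicator {0<..} t * ennreal ((cmod (fhat u \<xi>))^2) \<partial>lborel) \<partial>lborel)"
      by (rule lborel_pair.Fubini') measurable
    also have "\<dots> = (\<integral>\<^sup>+t. (ennreal ((1 - exp (- t * m^2)) * t powr (- 3 / 2)) * ennreal (mass u)
         + ennreal (exp (- t * m^2) * t powr (- 3 / 2)) * (ennreal (1/2) * heat_jump t u)) * indicator {0<..} t \<partial>lborel)"
    proof (rule nn_integral_cong)
      fix t :: real
      show "(\<integral>\<^sup>+\<xi>. ennreal ((1 - exp (- t * ?s \<xi>)) * t powr (- 3 / 2)) * indicator {0<..} t * ennreal ((cmod (fhat u \<xi>))^2) \<partial>lborel)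
        = (ennreal ((1 - exp (- t * m^2)) * t powr (- 3 / 2)) * ennreal (mass u)
         + ennreal (exp (- t * m^2) * t powr (- 3 / 2)) * (ennreal (1/2) * heat_jump t u)) * indicator {0<..} t"
      proof (cases "t > 0")
        case True
        \<comment> \<open>With \<open>a = |\<xi>|\<^sup>2\<close> and \<open>b = m\<^sup>2\<close>,
          \<open>1 - exp (-t(a + b)) = (1 - exp (-t b)) + exp (-t b) (1 - exp (-t a))\<close>. Both
          summands are nonnegative; the first integrates to a mass, the second to a heat
          form.\<close>
        have pw: "ennreal ((1 - exp (- t * ?s \<xi>)) * t powr (- 3 / 2)) * indicator {0<..} t * ennreal ((cmod (fhat u \<xi>))^2)
          = ennreal ((1 - exp (- t * m^2)) * t powr (- 3 / 2)) * ennreal ((cmod (fhat u \<xi>))^2)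
           + ennreal (exp (- t * m^2) * t powr (- 3 / 2)) * ennreal ((1 - exp (- t * (norm \<xi>)^2)) * (cmod (fhat u \<xi>))^2)" for \<xi>
        proof -
          have e: "exp (- t * ?s \<xi>) = exp (- t * m^2) * exp (- t * (norm \<xi>)^2)"
            by (simp add: exp_add[symmetric] algebra_simps)
          have 1: "exp (- t * m^2) \<le> 1" "exp (- t * (norm \<xi>)^2) \<le> 1" using True by auto
          then have 2: "exp (- t * m^2) * exp (- t * (norm \<xi>)^2) \<le> 1" by (intro mult_le_one) auto
          have "ennreal ((1 - exp (- t * m^2)) * t powr (- 3 / 2)) * ennreal ((cmod (fhat u \<xi>))^2)
           + ennreal (exp (- t * m^2) * t powr (- 3 / 2)) * ennreal ((1 - exp (- t * (norm \<xi>)^2)) * (cmod (fhat u \<xi>))^2)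
           = ennreal ((1 - exp (- t * m^2)) * t powr (- 3 / 2) * (cmod (fhat u \<xi>))^2 + exp (- t * m^2) * t powr (- 3 / 2) * ((1 - exp (- t * (norm \<xi>)^2)) * (cmod (fhat u \<xi>))^2))"
            using 1 by (subst ennreal_plus) (auto simp: ennreal_mult)
          also have "(1 - exp (- t * m^2)) * t powr (- 3 / 2) * (cmod (fhat u \<xi>))^2 + exp (- t * m^2) * t powr (- 3 / 2) * ((1 - exp (- t * (norm \<xi>)^2)) * (cmod (fhat u \<xi>))^2)
            = (1 - exp (- t * ?s \<xi>)) * t powr (- 3 / 2) * (cmod (fhat u \<xi>))^2"
            unfolding e by (simp add: algebra_simps)
          also have "ennreal \<dots> = ennreal ((1 - exp (- t * ?s \<xi>)) * t powr (- 3 / 2)) * ennreal ((cmod (fhat u \<xi>))^2)"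
            by (rule ennreal_mult'') simp
          finally show ?thesis using True by simp
        qed
        have "(\<integral>\<^sup>+\<xi>. ennreal ((1 - exp (- t * ?s \<xi>)) * t powr (- 3 / 2)) * indicator {0<..} t * ennreal ((cmod (fhat u \<xi>))^2) \<partial>lborel)
          = ennreal ((1 - exp (- t * m^2)) * t powr (- 3 / 2)) * (\<integral>\<^sup>+\<xi>. ennreal ((cmod (fhat u \<xi>))^2) \<partial>lborel)
           + ennreal (exp (- t * m^2) * t powr (- 3 / 2)) * (\<integral>\<^sup>+\<xi>. ennreal ((1 - exp (- t * (norm \<xi>)^2)) * (cmod (fhat u \<xi>))^2) \<partial>lborel)"
          unfolding pw by (subst nn_integral_add, simp, simp, subst nn_integral_cmult, simp, subst nn_integral_cmult, simp, rule refl)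
        then show ?thesis
          using True by (simp only: nn_fhat[OF u] fhat_heat_jump[OF u True]) simp
      qed simp
    qed
    finally show ?thesis .
  qed
  with c(1) show thesis by (rule that)
qed

text \<open>Each heat form decreases since \<open>||a| - |b|| \<le> |a - b|\<close> and the kernel
  is positive, while the mass term is unchanged. This is what makes a nonnegative minimizer
  available, for every \<open>m\<close>.\<close>

lemma symbol_form_abs_le:
  assumes u: "square_integrable u"
  shows "symbol_form m (\<lambda>x. \<bar>u x\<bar>) \<le> symbol_form m u"
proof -
  note [measurable] = square_integrableD(1)[OF u]
  have au: "square_integrable (\<lambda>x. \<bar>u x\<bar>)"
    by (rule square_integrable_bound[OF u]) auto
  have m: "mass (\<lambda>x. \<bar>u x\<bar>) = mass u" by (simp add: mass_def)
  have j: "heat_jump t (\<lambda>x. \<bar>u x\<bar>) \<le> heat_jump t u" if "t > 0" for t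
    unfolding heat_jump_def
  proof (intro nn_integral_mono ennreal_leI mult_left_mono)
    fix p :: "R3 \<times> R3"
    show "(\<bar>u (fst p)\<bar> - \<bar>u (snd p)\<bar>)^2 \<le> (u (fst p) - u (snd p))^2"
      using abs_triangle_ineq3[of "u (fst p)" "u (snd p)"] by (simp add: abs_le_square_iff[symmetric])
  qed (use that heat_nonneg in auto)
  obtain c where c: "c > 0"
    "\<And>m u. square_integrable u \<Longrightarrow> ennreal c * symbol_form m u =
      (\<integral>\<^sup>+t. (ennreal ((1 - exp (- t * m^2)) * t powr (- 3 / 2)) * ennreal (mass u)
         + ennreal (exp (- t * m^2) * t powr (- 3 / 2)) * (ennreal (1/2) * heat_jump t u)) * indicator {0<..} t \<partial>lborel)"
    by (rule symbol_form_representation) blast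
  have "ennreal c * symbol_form m (\<lambda>x. \<bar>u x\<bar>) \<le> ennreal c * symbol_form m u"
    unfolding c(2)[OF au] c(2)[OF u] m
    by (intro nn_integral_mono) (auto split: split_indicator intro!: add_mono mult_left_mono j)
  then show ?thesis using c(1) by (subst (asm) ennreal_mult_le_mult_iff) auto
qed

text \<open>For \<open>m = 0\<close> the mass term drops out; integrating the heat kernels over
  \<open>t\<close> first gives a multiple of \<open>1 / |x - y|^4\<close>. The 2 in
  \<open>d / (2 * c)\<close> comes from the doubling in \<open>heat_jump\<close>.\<close>

lemma gagliardo:
  obtains \<kappa> where "\<kappa> > 0" "\<And>u. square_integrable u \<Longrightarrow> symbol_form 0 u = ennreal \<kappa> * seminorm u"
proof -
  obtain c where c: "c > 0"
    "\<And>m u. square_integrable u \<Longrightarrow> ennreal c * symbol_form m u =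
      (\<integral>\<^sup>+t. (ennreal ((1 - exp (- t * m^2)) * t powr (- 3 / 2)) * ennreal (mass u)
         + ennreal (exp (- t * m^2) * t powr (- 3 / 2)) * (ennreal (1/2) * heat_jump t u)) * indicator {0<..} t \<partial>lborel)"
    by (rule symbol_form_representation) blast
  obtain d where d: "d > 0"
    "\<And>z. z \<noteq> 0 \<Longrightarrow> (\<integral>\<^sup>+t. ennreal (heat t z * t powr (- 3 / 2)) * indicator {0<..} t \<partial>lborel) = ennreal (d / norm z ^ 4)"
    by (rule inverse_fourth_power_representation) blast
  interpret PP: pair_sigma_finite "lborel :: real measure" lborel2
    unfolding lborel_prod ..
  have "symbol_form 0 u = ennreal (d / (2 * c)) * seminorm u" if u: "square_integrable u" for u
  proof -
    note [measurable] = square_integrableD(1)[OF u]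
    have "ennreal c * symbol_form 0 u = (\<integral>\<^sup>+t. ennreal (1/2) * (\<integral>\<^sup>+p. ennreal (heat t (fst p - snd p) * (u (fst p) - u (snd p))^2) * ennreal (t powr (- 3 / 2)) * indicator {0<..} t \<partial>lborel2) \<partial>lborel)"
      unfolding c(2)[OF u]
    proof (rule nn_integral_cong)
      fix t :: real
      have "(\<integral>\<^sup>+p. ennreal (heat t (fst p - snd p) * (u (fst p) - u (snd p))^2) * ennreal (t powr (- 3 / 2)) * indicator {0<..} t \<partial>lborel2)
        = heat_jump t u * (ennreal (t powr (- 3 / 2)) * indicator {0<..} t)"
        unfolding heat_jump_def mult.assoc by (rule nn_integral_multc) measurable
      then show "(ennreal ((1 - exp (- t * 0^2)) * t powr (- 3 / 2)) * ennreal (mass u)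
         + ennreal (exp (- t * 0^2) * t powr (- 3 / 2)) * (ennreal (1/2) * heat_jump t u)) * indicator {0<..} t
         = ennreal (1/2) * (\<integral>\<^sup>+p. ennreal (heat t (fst p - snd p) * (u (fst p) - u (snd p))^2) * ennreal (t powr (- 3 / 2)) * indicator {0<..} t \<partial>lborel2)"
        by (simp add: mult_ac)
    qed
    also have "\<dots> = ennreal (1/2) * (\<integral>\<^sup>+t. (\<integral>\<^sup>+p. ennreal (heat t (fst p - snd p) * (u (fst p) - u (snd p))^2) * ennreal (t powr (- 3 / 2)) * indicator {0<..} t \<partial>lborel2) \<partial>lborel)"
      by (rule nn_integral_cmult) measurable
    also have "(\<integral>\<^sup>+t. (\<integral>\<^sup>+p. ennreal (heat t (fst p - snd p) * (u (fst p) - u (snd p))^2) * ennreal (t powr (- 3 / 2)) * indicator {0<..} t \<partial>lborel2) \<partial>lborel)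
      = (\<integral>\<^sup>+p. (\<integral>\<^sup>+t. ennreal (heat t (fst p - snd p) * (u (fst p) - u (snd p))^2) * ennreal (t powr (- 3 / 2)) * indicator {0<..} t \<partial>lborel) \<partial>lborel2)"
      by (rule PP.Fubini'[symmetric]) measurable
    also have "\<dots> = (\<integral>\<^sup>+p. ennreal d * ennreal ((u (fst p) - u (snd p))^2 / norm (fst p - snd p) ^ 4) \<partial>lborel2)"
    proof (rule nn_integral_cong)
      fix p :: "R3 \<times> R3"
      show "(\<integral>\<^sup>+t. ennreal (heat t (fst p - snd p) * (u (fst p) - u (snd p))^2) * ennreal (t powr (- 3 / 2)) * indicator {0<..} t \<partial>lborel)
        = ennreal d * ennreal ((u (fst p) - u (snd p))^2 / norm (fst p - snd p) ^ 4)"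
      proof (cases "fst p = snd p")
        case False
        have "(\<integral>\<^sup>+t. ennreal (heat t (fst p - snd p) * (u (fst p) - u (snd p))^2) * ennreal (t powr (- 3 / 2)) * indicator {0<..} t \<partial>lborel)
          = (\<integral>\<^sup>+t. ennreal (heat t (fst p - snd p) * t powr (- 3 / 2)) * indicator {0<..} t * ennreal ((u (fst p) - u (snd p))^2) \<partial>lborel)"
          by (intro nn_integral_cong) (auto split: split_indicator simp: ennreal_mult[symmetric] heat_nonneg mult_ac)
        also have "\<dots> = ennreal (d / norm (fst p - snd p) ^ 4) * ennreal ((u (fst p) - u (snd p))^2)"
          using False by (subst nn_integral_multc, simp, subst d(2)) auto
        also have "\<dots> = ennreal d * ennreal ((u (fst p) - u (snd p))^2 / norm (fst p - snd p) ^ 4)"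
          using d(1) by (simp add: ennreal_mult[symmetric])
        finally show ?thesis .
      qed simp
    qed
    also have "\<dots> = ennreal d * seminorm u" unfolding seminorm_def by (rule nn_integral_cmult) measurable
    finally have eq: "ennreal c * symbol_form 0 u = ennreal (1/2) * (ennreal d * seminorm u)" .
    have "symbol_form 0 u = ennreal (1/c) * (ennreal c * symbol_form 0 u)"
      using c(1) by (simp add: mult.assoc[symmetric] ennreal_mult[symmetric])
    also have "\<dots> = ennreal (1/c * (1/2 * d)) * seminorm u"
    proof -
      have "ennreal (1/c * (1/2 * d)) = ennreal (1/c) * (ennreal (1/2) * ennreal d)"
        using c(1) d(1) ennreal_mult[of "1/c" "1/2 * d"] ennreal_mult[of "1/2" d] by (simp only:) simp
      then show ?thesis unfolding eq by (simp only: mult.assoc)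
    qed
    also have "1/c * (1/2 * d) = d / (2 * c)" by simp
    finally show ?thesis .
  qed
  moreover have "d / (2 * c) > 0" using c(1) d(1) by simp
  ultimately show thesis using that by blast
qed

section \<open>Coulomb energy and its positive definiteness\<close>

definition coulomb :: "(R3 \<Rightarrow> real) \<Rightarrow> (R3 \<Rightarrow> real) \<Rightarrow> ennreal"
  where "coulomb f g = (\<integral>\<^sup>+p. ennreal (f (fst p) * g (snd p) / norm (fst p - snd p)) \<partial>lborel2)"

text \<open>The Gaussian representation of \<open>1 / |x - y|\<close> is valid for distinct points,
  whereas division by zero gives 0 on the diagonal; so the diagonal has to be discarded.\<close>

lemma AE_offdiagonal: "AE p in lborel2. fst p \<noteq> snd p"
proof -
  have "AE x in lborel. AE y in lborel. x \<noteq> (y::R3)"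
  proof (rule AE_I2)
    fix x :: R3
    show "AE y in lborel. x \<noteq> y" using AE_lborel_singleton[of x] by eventually_elim auto
  qed
  moreover have "{p \<in> space lborel2. fst p \<noteq> snd p} \<in> sets lborel2"
  proof -
    have "{p::R3 \<times> R3. fst p \<noteq> snd p} \<in> sets borel"
      by (intro borel_open open_Collect_neq continuous_intros)
    then show ?thesis by (simp add: space_pair_measure flip: borel_prod)
  qed
  ultimately show ?thesis
    using lborel_pair.AE_pair_measure[where P="\<lambda>p. fst p \<noteq> snd (p::R3 \<times> R3)"] by simp
qed

lemma ennreal_AMGM:
  fixes A B :: ennreal
  assumes "l > 0"
  shows "2 * (A * B) \<le> ennreal l * (A * A) + ennreal (1/l) * (B * B)"
proof (cases A)
  case (real a)
  show ?thesis
  proof (cases B)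
    case (real b)
    have "0 \<le> (l * a - b)^2 / l" using assms by simp
    also have "\<dots> = l * (a * a) + 1/l * (b * b) - 2 * (a * b)" using assms by (simp add: field_simps power2_eq_square)
    finally have "2 * (a * b) \<le> l * (a * a) + 1/l * (b * b)" by simp
    then show ?thesis using \<open>A = ennreal a\<close> \<open>0 \<le> a\<close> real assms
      by (simp add: ennreal_mult[symmetric] ennreal_plus[symmetric] ennreal_numeral[symmetric] ennreal_leI del: ennreal_plus ennreal_numeral)
  qed (use assms in \<open>auto simp: ennreal_mult_top ennreal_top_mult\<close>)
qed (use assms in \<open>auto simp: ennreal_mult_top ennreal_top_mult\<close>)

text \<open>Positive definiteness of the Coulomb kernel: \<open>1/|x-y|\<close> is a positive superposition of the
  products \<open>exp (-s|x-z|\<^sup>2) exp (-s|y-z|\<^sup>2)\<close> over \<open>s\<close> and \<open>z\<close>.\<close>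

lemma coulomb_AMGM:
  assumes [measurable]: "f \<in> borel_measurable borel" "g \<in> borel_measurable borel"
    and f: "\<And>x. f x \<ge> 0" and g: "\<And>x. g x \<ge> 0" and l: "l > 0"
  shows "2 * coulomb f g \<le> ennreal l * coulomb f f + ennreal (1/l) * coulomb g g"
proof -
  obtain c where c: "c > 0"
    "\<And>r. r > 0 \<Longrightarrow> (\<integral>\<^sup>+s. ennreal (s powr (- 1 / 2) * exp (- s * r^2 / 2)) * indicator {0<..} s \<partial>lborel) = ennreal (c / r)"
    by (rule inverse_representation) blast
  define d where "d = c * (sqrt (pi / 2))^3"
  have d: "d > 0" using c by (simp add: d_def)
  define k where "k s z x = ennreal (exp (- s * (norm (x - z))^2))" for s :: real and z x :: R3
  have [measurable]: "(\<lambda>q. k (s q) (z q) (x q)) \<in> borel_measurable M"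
    if [measurable]: "s \<in> borel_measurable M" "z \<in> borel_measurable M" "x \<in> borel_measurable M" for s z x and M :: "'z measure"
    unfolding k_def by measurable
  let ?q = "lborel \<Otimes>\<^sub>M lborel :: (real \<times> R3) measure"
  interpret PQ: pair_sigma_finite lborel2 ?q
    unfolding lborel_prod ..
  \<comment> \<open>Integrating out \<open>z\<close> costs \<open>s powr (-3/2)\<close>; the weight
    \<open>s\<close> leaves the power \<open>-1/2\<close> required by the representation of
    \<open>1 / r\<close>.\<close>
  define W where "W q = ennreal (fst q) * indicator {0<..} (fst q)" for q :: "real \<times> R3"
  have [measurable]: "W \<in> borel_measurable ?q" unfolding W_def by measurable
  have kern: "(\<integral>\<^sup>+q. W q * (k (fst q) (snd q) x * k (fst q) (snd q) y) \<partial>?q) = ennreal (d / norm (x - y))" if "x \<noteq> y" for x y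
  proof -
    have "(\<integral>\<^sup>+q. W q * (k (fst q) (snd q) x * k (fst q) (snd q) y) \<partial>?q)
      = (\<integral>\<^sup>+s. \<integral>\<^sup>+z. ennreal s * indicator {0<..} s * (k s z x * k s z y) \<partial>lborel \<partial>lborel)"
      by (subst lborel.nn_integral_fst[symmetric]) (auto simp: W_def)
    also have "\<dots> = (\<integral>\<^sup>+s. ennreal (sqrt (pi / 2) ^ 3) * (ennreal (s powr (- 1 / 2) * exp (- s * (norm (x - y))^2 / 2)) * indicator {0<..} s) \<partial>lborel)"
    proof (rule nn_integral_cong)
      fix s :: real
      show "(\<integral>\<^sup>+z. ennreal s * indicator {0<..} s * (k s z x * k s z y) \<partial>lborel)
         = ennreal (sqrt (pi / 2) ^ 3) * (ennreal (s powr (- 1 / 2) * exp (- s * (norm (x - y))^2 / 2)) * indicator {0<..} s)"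
      proof (cases "s > 0")
        case True
        \<comment> \<open>The midpoint: completing the square around it decouples \<open>z\<close>
          from \<open>x - y\<close>.\<close>
        define v where "v = (1/2) *\<^sub>R (x + y)"
        have id: "(norm (x - z))^2 + (norm (y - z))^2 = 2 * (norm (z - v))^2 + (norm (x - y))^2 / 2" for z
          unfolding v_def power2_norm_eq_inner by (simp add: inner_simps inner_commute field_simps)
        have "(\<integral>\<^sup>+z. ennreal s * indicator {0<..} s * (k s z x * k s z y) \<partial>lborel)
          = (\<integral>\<^sup>+z. ennreal (s * exp (- s * (norm (x - y))^2 / 2)) * ennreal (exp (- (2 * s) * (norm (z - v))^2)) \<partial>lborel)"
        proof (rule nn_integral_cong)
          fix z
          have "exp (- s * (norm (x - z))^2) * exp (- s * (norm (y - z))^2) = exp (- s * ((norm (x - z))^2 + (norm (y - z))^2))"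
            by (simp add: exp_add[symmetric] algebra_simps)
          also have "\<dots> = exp (- s * (norm (x - y))^2 / 2) * exp (- (2 * s) * (norm (z - v))^2)"
            unfolding id by (simp add: exp_add[symmetric] algebra_simps)
          finally show "ennreal s * indicator {0<..} s * (k s z x * k s z y)
             = ennreal (s * exp (- s * (norm (x - y))^2 / 2)) * ennreal (exp (- (2 * s) * (norm (z - v))^2))"
            using True by (simp add: k_def ennreal_mult[symmetric])
        qed
        also have "\<dots> = ennreal (s * exp (- s * (norm (x - y))^2 / 2)) * ennreal (sqrt (pi / (2 * s)) ^ 3)"
          using nn_integral_gauss_R3[of "2 * s"] nn_integral_translate_diff_R3[of "\<lambda>z. ennreal (exp (- (2 * s) * (norm z)^2))" v] True
          by (subst nn_integral_cmult) auto
        also have "\<dots> = ennreal (sqrt (pi / 2) ^ 3 * (s * (1 / sqrt s ^ 3) * exp (- s * (norm (x - y))^2 / 2)))"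
          using True by (simp add: ennreal_mult[symmetric] real_sqrt_divide real_sqrt_mult power_divide power_mult_distrib field_simps)
        also have "s * (1 / sqrt s ^ 3) = s powr (- 1 / 2)"
        proof -
          have "sqrt s ^ 3 = s * sqrt s" using True by (simp add: eval_nat_numeral)
          then show ?thesis using True by (simp add: powr_minus powr_half_sqrt field_simps)
        qed
        finally show ?thesis using True by (simp add: ennreal_mult)
      qed simp
    qed
    also have "\<dots> = ennreal (sqrt (pi / 2) ^ 3) * ennreal (c / norm (x - y))"
      using that by (subst nn_integral_cmult, simp, subst c(2)) auto
    also have "\<dots> = ennreal (d / norm (x - y))"
      using c(1) by (simp add: d_def ennreal_mult[symmetric] mult.commute)
    finally show ?thesis .
  qed
  \<comment> \<open>The smearing of \<open>h\<close> at scale \<open>s\<close> around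
    \<open>z\<close>. The Coulomb energy becomes a weighted inner product of such smearings, to
    which the scalar inequality applies pointwise.\<close>
  define F where "F h q = (\<integral>\<^sup>+x. k (fst q) (snd q) x * ennreal (h x) \<partial>lborel)" for h and q :: "real \<times> R3"
  have Fm[measurable]: "F h \<in> borel_measurable ?q" if [measurable]: "h \<in> borel_measurable borel" for h
    unfolding F_def by measurable
  have rep: "ennreal d * coulomb f g = (\<integral>\<^sup>+q. W q * (F f q * F g q) \<partial>?q)"
    if [measurable]: "f \<in> borel_measurable borel" "g \<in> borel_measurable borel"
      and f: "\<And>x. f x \<ge> 0" and g: "\<And>x. g x \<ge> 0" for f g
  proof -
    have "ennreal d * coulomb f g = (\<integral>\<^sup>+p. ennreal d * ennreal (f (fst p) * g (snd p) / norm (fst p - snd p)) \<partial>lborel2)"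
      unfolding coulomb_def by (rule nn_integral_cmult[symmetric]) measurable
    also have "\<dots> = (\<integral>\<^sup>+p. (\<integral>\<^sup>+q. W q * (k (fst q) (snd q) (fst p) * k (fst q) (snd q) (snd p)) * (ennreal (f (fst p)) * ennreal (g (snd p))) \<partial>?q) \<partial>lborel2)"
    proof (rule nn_integral_cong_AE)
      show "AE p in lborel2. ennreal d * ennreal (f (fst p) * g (snd p) / norm (fst p - snd p)) =
        (\<integral>\<^sup>+q. W q * (k (fst q) (snd q) (fst p) * k (fst q) (snd q) (snd p)) * (ennreal (f (fst p)) * ennreal (g (snd p))) \<partial>?q)"
        using AE_offdiagonal
      proof eventually_elim
        case (elim p)
        have "(\<integral>\<^sup>+q. W q * (k (fst q) (snd q) (fst p) * k (fst q) (snd q) (snd p)) * (ennreal (f (fst p)) * ennreal (g (snd p))) \<partial>?q)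
          = ennreal (d / norm (fst p - snd p)) * (ennreal (f (fst p)) * ennreal (g (snd p)))"
          by (subst nn_integral_multc, simp, subst kern[OF elim]) (rule refl)
        then show ?case using d f g by (simp add: ennreal_mult[symmetric])
      qed
    qed
    also have "\<dots> = (\<integral>\<^sup>+q. (\<integral>\<^sup>+p. W q * (k (fst q) (snd q) (fst p) * k (fst q) (snd q) (snd p)) * (ennreal (f (fst p)) * ennreal (g (snd p))) \<partial>lborel2) \<partial>?q)"
      by (rule PQ.Fubini'[symmetric]) measurable
    also have "\<dots> = (\<integral>\<^sup>+q. W q * (F f q * F g q) \<partial>?q)"
    proof (rule nn_integral_cong)
      fix q :: "real \<times> R3"
      have "(\<integral>\<^sup>+p. W q * (k (fst q) (snd q) (fst p) * k (fst q) (snd q) (snd p)) * (ennreal (f (fst p)) * ennreal (g (snd p))) \<partial>lborel2)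
        = (\<integral>\<^sup>+x. \<integral>\<^sup>+y. W q * (k (fst q) (snd q) x * ennreal (f x)) * (k (fst q) (snd q) y * ennreal (g y)) \<partial>lborel \<partial>lborel)"
        by (subst lborel.nn_integral_fst[symmetric]) (auto simp: mult_ac)
      also have "\<dots> = W q * (F f q * F g q)"
      proof -
        have "(\<integral>\<^sup>+y. W q * (k (fst q) (snd q) x * ennreal (f x)) * (k (fst q) (snd q) y * ennreal (g y)) \<partial>lborel)
          = W q * F g q * (k (fst q) (snd q) x * ennreal (f x))" for x
          unfolding F_def by (subst nn_integral_cmult, simp, simp only: mult_ac)
        then show ?thesis
          by (simp only:) (subst nn_integral_cmult, simp, simp only: F_def mult_ac)
      qed
      finally show "(\<integral>\<^sup>+p. W q * (k (fst q) (snd q) (fst p) * k (fst q) (snd q) (snd p)) * (ennreal (f (fst p)) * ennreal (g (snd p))) \<partial>lborel2) = W q * (F f q * F g q)" .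
    qed
    finally show ?thesis .
  qed
  have "ennreal d * (2 * coulomb f g) = (\<integral>\<^sup>+q. W q * (2 * (F f q * F g q)) \<partial>?q)"
    using rep[OF assms(1,2) f g] by (subst mult.left_commute, simp only:, subst nn_integral_cmult[symmetric]) (auto simp: mult_ac)
  also have "\<dots> \<le> (\<integral>\<^sup>+q. W q * (ennreal l * (F f q * F f q) + ennreal (1/l) * (F g q * F g q)) \<partial>?q)"
    by (intro nn_integral_mono mult_left_mono ennreal_AMGM l) auto
  also have "\<dots> = (\<integral>\<^sup>+q. ennreal l * (W q * (F f q * F f q)) + ennreal (1/l) * (W q * (F g q * F g q)) \<partial>?q)"
    by (intro nn_integral_cong) (simp add: distrib_left mult_ac)
  also have "\<dots> = ennreal l * (ennreal d * coulomb f f) + ennreal (1/l) * (ennreal d * coulomb g g)"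
    unfolding rep[OF assms(1,1) f f] rep[OF assms(2,2) g g]
    by (simp add: nn_integral_add nn_integral_cmult)
  also have "\<dots> = ennreal d * (ennreal l * coulomb f f + ennreal (1/l) * coulomb g g)"
    by (simp add: distrib_left mult_ac)
  finally show ?thesis using d by (subst (asm) ennreal_mult_le_mult_iff) auto
qed

section \<open>Sobolev spaces, Hartree energy and scaling\<close>

lemma borel_imp_lebesgue: "f \<in> borel_measurable borel \<Longrightarrow> f \<in> borel_measurable (lebesgue :: 'a::euclidean_space measure)"
  by (rule measurable_completion) simp

text \<open>Equality everywhere, in spite of the hypothesis: the truncated Fourier integrals
  coincide, hence so does the predicate from which \<open>fourier\<close> chooses.\<close>

lemma fourier_real_cong:
  assumes [measurable]: "u \<in> borel_measurable lebesgue" "v \<in> borel_measurable lebesgue"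
    and ae: "AE x in lebesgue. u x = v x"
  shows "fourier_real u = fourier_real v"
proof -
  have "fourier_integral (\<lambda>x. indicator (cball 0 (real n)) x *\<^sub>R complex_of_real (u x)) \<xi>
     = fourier_integral (\<lambda>x. indicator (cball 0 (real n)) x *\<^sub>R complex_of_real (v x)) \<xi>" for n \<xi>
  proof -
    have [measurable]: "(\<lambda>x::R3. cis (- (x \<bullet> \<xi>))) \<in> borel_measurable lebesgue"
      by (rule borel_imp_lebesgue) measurable
    have [measurable]: "(indicator (cball 0 (real n)) :: R3 \<Rightarrow> real) \<in> borel_measurable lebesgue"
      by (rule borel_imp_lebesgue, rule borel_measurable_indicator) simp
    show ?thesis unfolding fourier_integral_def
      by (intro arg_cong2[where f=scaleR] refl integral_cong_AE) (use ae in auto)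
  qed
  then show ?thesis unfolding fourier_def by simp
qed

lemma coulomb_potential_cong:
  assumes [measurable]: "u \<in> borel_measurable lebesgue" "v \<in> borel_measurable lebesgue"
    and ae: "AE x in lebesgue. u x = v x"
  shows "coulomb_potential (\<lambda>y. (u y)^2) = coulomb_potential (\<lambda>y. (v y)^2)"
proof
  fix x :: R3
  have [measurable]: "(\<lambda>y::R3. norm (x - y)) \<in> borel_measurable lebesgue"
    by (rule borel_imp_lebesgue) measurable
  show "coulomb_potential (\<lambda>y. (u y)^2) x = coulomb_potential (\<lambda>y. (v y)^2) x"
    unfolding coulomb_potential_def by (intro integral_cong_AE) (use ae in auto)
qed

lemma borel_representative:
  assumes "u \<in> borel_measurable lebesgue"
  obtains v :: "R3 \<Rightarrow> real" where "v \<in> borel_measurable borel" "AE x in lebesgue. u x = v x"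
  using completion_ex_borel_measurable_real[OF assms] by (auto simp: AE_completion_iff)

lemma lebesgue_integral_borel:
  fixes f :: "'a::euclidean_space \<Rightarrow> 'b::{banach, second_countable_topology}"
  assumes "f \<in> borel_measurable borel"
  shows "(\<integral>x. f x \<partial>lebesgue) = (\<integral>x. f x \<partial>lborel)"
  using assms by (simp add: integral_completion)

lemma L2_norm_sq_mass: "square_integrable u \<Longrightarrow> L2_norm_sq u = mass u"
  unfolding L2_norm_sq_def mass_def by (subst lebesgue_integral_borel) (auto simp: square_integrable_def)

lemma L2_iff_square_integrable:
  assumes "u \<in> borel_measurable borel"
  shows "L2 u \<longleftrightarrow> square_integrable u"
  using assms unfolding L2_def square_integrable_def by (simp add: integrable_completion borel_imp_lebesgue)

lemma multiplier_fhat: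
  assumes u: "square_integrable u" and [measurable]: "\<sigma> \<in> borel_measurable borel"
  shows "(\<integral>\<^sup>+\<xi>. ennreal (\<sigma> \<xi> * (cmod (fourier_real u \<xi>))^2) \<partial>lebesgue) = (\<integral>\<^sup>+\<xi>. ennreal (\<sigma> \<xi> * (cmod (fhat u \<xi>))^2) \<partial>lborel)"
    and "fourier_real u \<in> borel_measurable lebesgue"
proof -
  show "(\<integral>\<^sup>+\<xi>. ennreal (\<sigma> \<xi> * (cmod (fourier_real u \<xi>))^2) \<partial>lebesgue) = (\<integral>\<^sup>+\<xi>. ennreal (\<sigma> \<xi> * (cmod (fhat u \<xi>))^2) \<partial>lborel)"
    unfolding nn_integral_completion
    by (rule nn_integral_cong_AE) (use fourier_eq_fhat[OF u] in \<open>eventually_elim, simp\<close>)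
  have "AE \<xi> in lebesgue. fhat u \<xi> = fourier_real u \<xi>"
    using fourier_eq_fhat[OF u] by (simp add: AE_completion_iff eq_commute)
  then show "fourier_real u \<in> borel_measurable lebesgue"
    using borel_measurable_AE[OF borel_imp_lebesgue[OF fhat_measurable[OF u]]] by blast
qed

lemma multiplier_qform_eq:
  assumes u: "square_integrable u" and [measurable]: "\<sigma> \<in> borel_measurable borel" and pos: "\<And>\<xi>. \<sigma> \<xi> \<ge> 0"
  shows "multiplier_qform \<sigma> u = enn2real (\<integral>\<^sup>+\<xi>. ennreal (\<sigma> \<xi> * (cmod (fhat u \<xi>))^2) \<partial>lborel)"
proof -
  have [measurable]: "\<sigma> \<in> borel_measurable lebesgue" by (rule borel_imp_lebesgue) measurable
  note [measurable] = multiplier_fhat(2)[OF u assms(2)]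
  have "multiplier_qform \<sigma> u = enn2real (\<integral>\<^sup>+\<xi>. ennreal (\<sigma> \<xi> * (cmod (fourier_real u \<xi>))^2) \<partial>lebesgue)"
    unfolding multiplier_qform_def using pos by (intro integral_eq_nn_integral) auto
  then show ?thesis using multiplier_fhat(1)[OF u assms(2)] by simp
qed

lemma relativistic_form_eq: "square_integrable u \<Longrightarrow> multiplier_qform (\<lambda>\<xi>. sqrt ((norm \<xi>)^2 + m^2)) u = enn2real (symbol_form m u)"
  unfolding symbol_form_def by (subst multiplier_qform_eq) auto

lemma kinetic_eq: "square_integrable u \<Longrightarrow> kinetic u = enn2real (symbol_form 0 u)"
  unfolding kinetic_def using relativistic_form_eq[of u 0] by simp

lemma sobolev_iff_nn:
  assumes u: "square_integrable u"
  shows "u \<in> sobolev s \<longleftrightarrow> (\<integral>\<^sup>+\<xi>. ennreal ((1 + (norm \<xi>)^2) powr s * (cmod (fhat u \<xi>))^2) \<partial>lborel) < \<infinity>"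
proof -
  have [measurable]: "(\<lambda>\<xi>::R3. (1 + (norm \<xi>)^2) powr s) \<in> borel_measurable lebesgue"
    by (rule borel_imp_lebesgue) measurable
  have m: "(\<lambda>\<xi>::R3. (1 + (norm \<xi>)^2) powr s) \<in> borel_measurable borel" by measurable
  note [measurable] = multiplier_fhat(2)[OF u m]
  have "L2 u" using u L2_iff_square_integrable square_integrable_def by blast
  then have "u \<in> sobolev s \<longleftrightarrow> integrable lebesgue (\<lambda>\<xi>. (1 + (norm \<xi>)^2) powr s * (cmod (fourier_real u \<xi>))^2)"
    by (simp add: sobolev_def)
  also have "\<dots> \<longleftrightarrow> (\<integral>\<^sup>+\<xi>. ennreal ((1 + (norm \<xi>)^2) powr s * (cmod (fourier_real u \<xi>))^2) \<partial>lebesgue) < \<infinity>"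
    by (simp add: integrable_iff_bounded abs_mult)
  finally show ?thesis using multiplier_fhat(1)[OF u m] by simp
qed

lemma symbol_form_le:
  assumes u: "square_integrable u"
  shows "symbol_form m u \<le> symbol_form 0 u + ennreal (\<bar>m\<bar> * mass u)"
proof -
  note [measurable] = fhat_measurable[OF u]
  have "symbol_form m u \<le> (\<integral>\<^sup>+\<xi>. ennreal (norm \<xi> * (cmod (fhat u \<xi>))^2) + ennreal \<bar>m\<bar> * ennreal ((cmod (fhat u \<xi>))^2) \<partial>lborel)"
    unfolding symbol_form_def
  proof (rule nn_integral_mono)
    fix \<xi> :: R3
    have "sqrt ((norm \<xi>)^2 + m^2) \<le> norm \<xi> + \<bar>m\<bar>"
      using sqrt_sum_squares_le_sum_abs[of "norm \<xi>" m] by simp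
    then have "sqrt ((norm \<xi>)^2 + m^2) * (cmod (fhat u \<xi>))^2 \<le> (norm \<xi> + \<bar>m\<bar>) * (cmod (fhat u \<xi>))^2"
      by (rule mult_right_mono) simp
    then show "ennreal (sqrt ((norm \<xi>)^2 + m^2) * (cmod (fhat u \<xi>))^2) \<le> ennreal (norm \<xi> * (cmod (fhat u \<xi>))^2) + ennreal \<bar>m\<bar> * ennreal ((cmod (fhat u \<xi>))^2)"
      by (simp add: ennreal_mult[symmetric] ennreal_plus[symmetric] distrib_right del: ennreal_plus)
  qed
  also have "\<dots> = symbol_form 0 u + ennreal \<bar>m\<bar> * ennreal (mass u)"
    unfolding symbol_form_def by (subst nn_integral_add) (auto simp: nn_integral_cmult nn_fhat[OF u])
  finally show ?thesis using mass_nonneg[of u] by (simp add: ennreal_mult)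
qed

lemma symbol_form_ge: "symbol_form 0 u \<le> symbol_form m u"
  unfolding symbol_form_def by (intro nn_integral_mono ennreal_leI mult_right_mono) auto

text \<open>The weight \<open>(1 + |\<xi>|\<^sup>2)^(1/2)\<close> is the symbol for
  \<open>m = 1\<close>, which lies between the symbol for \<open>m = 0\<close> and that symbol plus
  1.\<close>

lemma sobolev_half_iff:
  assumes u: "square_integrable u"
  shows "u \<in> sobolev (1/2) \<longleftrightarrow> symbol_form 0 u < \<infinity>"
proof -
  have eq: "(\<integral>\<^sup>+\<xi>. ennreal ((1 + (norm \<xi>)^2) powr (1/2) * (cmod (fhat u \<xi>))^2) \<partial>lborel) = symbol_form 1 u"
    unfolding symbol_form_def by (intro nn_integral_cong) (simp add: powr_half_sqrt add.commute)
  show ?thesis unfolding sobolev_iff_nn[OF u] eq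
    using symbol_form_le[OF u, of 1] symbol_form_ge[of u 1]
    by (auto simp: less_top[symmetric] ennreal_add_eq_top top_unique)
qed

text \<open>In three dimensions \<open>1/r^2\<close> is integrable at 0 and \<open>1/r^4\<close> at
  infinity. The function majorizes the Coulomb singularity near 0 and the tail \<open>r^-4\<close>,
  and it is the profile of the localization error of cutoffs.\<close>

definition radial_weight :: "real \<Rightarrow> real"
  where "radial_weight r = (if r \<le> 1 then 1 / r^2 else 1 / r^4)"

lemma radial_weight_measurable[measurable]: "radial_weight \<in> borel_measurable borel"
  unfolding radial_weight_def by measurable

lemma radial_weight_nonneg: "radial_weight r \<ge> 0"
  unfolding radial_weight_def by auto

lemma radial_weight_antimono: "0 < r \<Longrightarrow> r \<le> s \<Longrightarrow> radial_weight s \<le> radial_weight r"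
proof -
  assume r: "0 < r" "r \<le> s"
  show ?thesis
  proof (cases "s \<le> 1 \<or> r > 1")
    case True
    then show ?thesis using r by (auto simp: radial_weight_def intro!: divide_left_mono power_mono)
  next
    case False
    then have a: "1 / s^4 \<le> 1" and b: "1 \<le> 1 / r^2" using r
      by (auto simp: divide_simps power_le_one)
    have "1 / s^4 \<le> 1 / r^2" by (rule order_trans[OF a b])
    then show ?thesis using False unfolding radial_weight_def by simp
  qed
qed

lemma radial_weight_double: "0 < r \<Longrightarrow> radial_weight r \<le> 16 * radial_weight (2 * r)"
proof -
  assume r: "0 < r"
  consider "2 * r \<le> 1" | "2 * r > 1" "r \<le> 1" | "r > 1" by linarith
  then show ?thesis
  proof cases
    case 2
    then have "r^4 \<le> r^2" using r by (intro power_decreasing) auto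
    then show ?thesis using 2 r by (simp add: radial_weight_def divide_simps power_mult_distrib)
  qed (use r in \<open>auto simp: radial_weight_def field_simps power_mult_distrib\<close>)
qed

text \<open>Layer cake: \<open>\<phi>(|z|)\<close> is bounded by a multiple of the integral of \<open>\<phi>(s)/s\<close> over \<open>[|z|, 2|z|]\<close>.\<close>

lemma nn_integral_radial_weight: "(\<integral>\<^sup>+(z::R3). ennreal (radial_weight (norm z)) \<partial>lborel) < \<infinity>"
proof -
  let ?I = "\<lambda>(z::R3) s. indicator {norm z..2 * norm z} s :: ennreal"
  \<comment> \<open>Here 16 is the doubling constant of the weight, and a further 2 arises since the
    integral over \<open>[r, 2r]\<close> is at least
    \<open>radial_weight (2 * r) / 2\<close>.\<close>
  have pt: "ennreal (radial_weight (norm z)) \<le> 32 * (\<integral>\<^sup>+s. ennreal (radial_weight s / s) * indicator {0<..} s * ?I z s \<partial>lborel)"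
    if z: "z \<noteq> 0" for z :: R3
  proof -
    define r where "r = norm z"
    have r: "r > 0" using z by (simp add: r_def)
    have "ennreal (radial_weight (2 * r) / (2 * r)) * ennreal r = (\<integral>\<^sup>+s. ennreal (radial_weight (2 * r) / (2 * r)) * ?I z s \<partial>lborel)"
      using r by (subst nn_integral_cmult) (auto simp: r_def[symmetric])
    also have "\<dots> \<le> (\<integral>\<^sup>+s. ennreal (radial_weight s / s) * indicator {0<..} s * ?I z s \<partial>lborel)"
    proof (rule nn_integral_mono)
      fix s
      have "radial_weight (2 * r) / (2 * r) \<le> radial_weight s / s" if "r \<le> s" "s \<le> 2 * r"
        using that r radial_weight_antimono[of s "2 * r"] radial_weight_nonneg by (intro frac_le) auto
      then show "ennreal (radial_weight (2 * r) / (2 * r)) * ?I z s \<le> ennreal (radial_weight s / s) * indicator {0<..} s * ?I z s"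
        using r by (auto simp: r_def[symmetric] split: split_indicator intro!: ennreal_leI)
    qed
    finally have "ennreal (radial_weight (2 * r) / 2) \<le> (\<integral>\<^sup>+s. ennreal (radial_weight s / s) * indicator {0<..} s * ?I z s \<partial>lborel)"
      using r radial_weight_nonneg[of "2*r"] by (simp add: ennreal_mult[symmetric])
    then have "32 * ennreal (radial_weight (2 * r) / 2) \<le> 32 * (\<integral>\<^sup>+s. ennreal (radial_weight s / s) * indicator {0<..} s * ?I z s \<partial>lborel)"
      by (intro mult_left_mono) auto
    moreover have "ennreal (radial_weight r) \<le> 32 * ennreal (radial_weight (2 * r) / 2)"
    proof -
      have "ennreal (radial_weight r) \<le> ennreal (32 * (radial_weight (2 * r) / 2))"
        using radial_weight_double[OF r] by (intro ennreal_leI) simp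
      moreover have "ennreal (32 * y) = 32 * ennreal y" if "y \<ge> 0" for y
        using that by (simp add: ennreal_mult)
      ultimately show ?thesis using radial_weight_nonneg[of "2*r"] by (metis divide_nonneg_nonneg zero_le_numeral)
    qed
    ultimately show ?thesis unfolding r_def by (rule order_trans[rotated])
  qed
  have "(\<integral>\<^sup>+(z::R3). ennreal (radial_weight (norm z)) \<partial>lborel)
     \<le> (\<integral>\<^sup>+z. 32 * (\<integral>\<^sup>+s. ennreal (radial_weight s / s) * indicator {0<..} s * ?I z s \<partial>lborel) \<partial>lborel)"
    by (rule nn_integral_mono_AE, rule eventually_mono[OF AE_lborel_singleton[of "0::R3"]]) (rule pt)
  also have "\<dots> = 32 * (\<integral>\<^sup>+z. (\<integral>\<^sup>+s. ennreal (radial_weight s / s) * indicator {0<..} s * ?I z s \<partial>lborel) \<partial>lborel)"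
    unfolding indicator_def of_bool_def atLeastAtMost_iff greaterThan_iff by (rule nn_integral_cmult) measurable
  also have "(\<integral>\<^sup>+z. (\<integral>\<^sup>+s. ennreal (radial_weight s / s) * indicator {0<..} s * ?I z s \<partial>lborel) \<partial>lborel)
      = (\<integral>\<^sup>+s. (\<integral>\<^sup>+z. ennreal (radial_weight s / s) * indicator {0<..} s * ?I z s \<partial>lborel) \<partial>lborel)"
    unfolding indicator_def of_bool_def atLeastAtMost_iff greaterThan_iff by (rule lborel_pair.Fubini') measurable
  \<comment> \<open>For fixed \<open>s\<close> the relevant \<open>z\<close> lie in a ball of radius
    \<open>s\<close>, of volume proportional to \<open>s^3\<close>; what is left is
    \<open>radial_weight s * s^2\<close>, that is 1 up to \<open>s = 1\<close> and
    \<open>s^-2\<close> beyond.\<close>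
  also have "\<dots> \<le> (\<integral>\<^sup>+s. ennreal (unit_ball_vol 3) * (ennreal (s powr 0) * indicator {0<..1} s + ennreal (s powr (-2)) * indicator {1..} s) \<partial>lborel)"
  proof (rule nn_integral_mono)
    fix s :: real
    show "(\<integral>\<^sup>+z. ennreal (radial_weight s / s) * indicator {0<..} s * ?I z s \<partial>lborel)
      \<le> ennreal (unit_ball_vol 3) * (ennreal (s powr 0) * indicator {0<..1} s + ennreal (s powr (-2)) * indicator {1..} s)"
    proof (cases "s > 0")
      case True
      have "(\<integral>\<^sup>+z. ennreal (radial_weight s / s) * indicator {0<..} s * ?I z s \<partial>lborel)
        \<le> (\<integral>\<^sup>+(z::R3). ennreal (radial_weight s / s) * indicator (cball 0 s) z \<partial>lborel)"
        using True by (intro nn_integral_mono) (auto split: split_indicator)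
      also have "\<dots> = ennreal (radial_weight s / s) * ennreal (unit_ball_vol 3 * s ^ 3)"
        using True emeasure_cball[of s "0::R3"] by (subst nn_integral_cmult_indicator) auto
      also have "\<dots> = ennreal (unit_ball_vol 3) * ennreal (radial_weight s * s^2)"
        using True radial_weight_nonneg[of s] unit_ball_vol_nonneg[of 3]
        by (simp add: ennreal_mult[symmetric] eval_nat_numeral mult_ac)
      also have "ennreal (radial_weight s * s^2) \<le> ennreal (s powr 0) * indicator {0<..1} s + ennreal (s powr (-2)) * indicator {1..} s"
        using True by (auto simp: radial_weight_def powr_minus_divide powr_numeral split: split_indicator simp: field_simps eval_nat_numeral)
      finally show ?thesis by (simp add: mult_left_mono)
    qed simp
  qed
  also have "\<dots> = ennreal (unit_ball_vol 3) * (ennreal (1 / (0 + 1)) + ennreal (1 / (- (-2) - 1)))"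
    by (subst nn_integral_cmult, simp, subst nn_integral_add, simp, simp, subst nn_integral_powr_Ioc, simp, subst nn_integral_powr_Ici, simp, rule refl)
  also have "32 * \<dots> < \<infinity>" by (simp add: ennreal_mult_less_top)
  finally show ?thesis by (simp add: mult_left_mono)
qed

section \<open>The space H^(1/2) and the Hartree energy\<close>

definition half_sobolev :: "(R3 \<Rightarrow> real) \<Rightarrow> bool"
  where "half_sobolev u \<longleftrightarrow> square_integrable u \<and> seminorm u < \<infinity>"

text \<open>A fixed choice of the Gagliardo constant, so that the kinetic energies of different
  functions are compared with the same factor.\<close>

definition kappa :: real
  where "kappa = (SOME \<kappa>. \<kappa> > 0 \<and> (\<forall>u. square_integrable u \<longrightarrow> symbol_form 0 u = ennreal \<kappa> * seminorm u))"

lemma kappa_pos: "kappa > 0"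
  and symbol_form_seminorm: "square_integrable u \<Longrightarrow> symbol_form 0 u = ennreal kappa * seminorm u"
proof -
  have "\<exists>\<kappa>. \<kappa> > 0 \<and> (\<forall>u. square_integrable u \<longrightarrow> symbol_form 0 u = ennreal \<kappa> * seminorm u)"
    by (rule gagliardo) blast
  from someI_ex[OF this] show "kappa > 0" "square_integrable u \<Longrightarrow> symbol_form 0 u = ennreal kappa * seminorm u"
    unfolding kappa_def by auto
qed

lemma half_sobolevD: "half_sobolev u \<Longrightarrow> square_integrable u" "half_sobolev u \<Longrightarrow> seminorm u < \<infinity>"
  by (auto simp: half_sobolev_def)

lemma half_sobolev_iff_sobolev: "square_integrable u \<Longrightarrow> u \<in> sobolev (1/2) \<longleftrightarrow> half_sobolev u"
  using kappa_pos by (auto simp: half_sobolev_def sobolev_half_iff symbol_form_seminorm ennreal_mult_less_top ennreal_eq_0_iff)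

lemma kinetic_seminorm: "square_integrable u \<Longrightarrow> kinetic u = kappa * enn2real (seminorm u)"
  using kappa_pos by (simp add: kinetic_eq symbol_form_seminorm enn2real_mult)

lemma kinetic_nonneg: "square_integrable u \<Longrightarrow> kinetic u \<ge> 0"
  by (simp add: kinetic_eq)

lemma ennreal_kinetic: "half_sobolev u \<Longrightarrow> ennreal (kinetic u) = symbol_form 0 u"
  using kappa_pos
  by (subst kinetic_eq) (auto simp: half_sobolev_def symbol_form_seminorm ennreal_mult_less_top)

abbreviation hart :: "(R3 \<Rightarrow> real) \<Rightarrow> ennreal"
  where "hart u \<equiv> coulomb (\<lambda>x. (u x)^2) (\<lambda>x. (u x)^2)"

lemma coulomb_iterated:
  assumes [measurable]: "f \<in> borel_measurable borel" "g \<in> borel_measurable borel"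
    and "\<And>x. f x \<ge> 0" "\<And>x. g x \<ge> 0"
  shows "coulomb f g = (\<integral>\<^sup>+x. ennreal (f x) * (\<integral>\<^sup>+y. ennreal (g y / norm (x - y)) \<partial>lborel) \<partial>lborel)"
proof -
  have "coulomb f g = (\<integral>\<^sup>+x. (\<integral>\<^sup>+y. ennreal (f x) * ennreal (g y / norm (x - y)) \<partial>lborel) \<partial>lborel)"
    unfolding coulomb_def using assms(3,4)
    by (subst lborel.nn_integral_fst[symmetric]) (auto simp: ennreal_mult[symmetric])
  then show ?thesis by (simp add: nn_integral_cmult)
qed

lemma coulomb_sym:
  assumes [measurable]: "f \<in> borel_measurable borel" "g \<in> borel_measurable borel"
  shows "coulomb f g = coulomb g f"
proof -
  have "coulomb f g = (\<integral>\<^sup>+x. (\<integral>\<^sup>+y. ennreal (f x * g y / norm (x - y)) \<partial>lborel) \<partial>lborel)"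
    unfolding coulomb_def by (subst lborel.nn_integral_fst[symmetric]) auto
  moreover have "coulomb g f = (\<integral>\<^sup>+y. (\<integral>\<^sup>+x. ennreal (g x * f y / norm (x - y)) \<partial>lborel) \<partial>lborel)"
    unfolding coulomb_def by (subst lborel_pair.nn_integral_snd[symmetric]) auto
  ultimately show ?thesis by (simp add: mult.commute norm_minus_commute)
qed

text \<open>Both bounds come from the integral of \<open>radial_weight\<close>; the first is uniform
  in the centre \<open>y\<close> by translation. The constant is enlarged by 1 to be
  positive.\<close>

lemma inverse_norm_local:
  obtains C where "C > 0" "\<And>y::R3. (\<integral>\<^sup>+x. ennreal (indicator (cball y 1) x / norm (x - y)) \<partial>lborel) \<le> ennreal C"
    "(\<integral>\<^sup>+(x::R3). ennreal (indicator {x. norm x \<ge> 1} x / norm x ^ 4) \<partial>lborel) \<le> ennreal C"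
proof -
  obtain C where C: "(\<integral>\<^sup>+(z::R3). ennreal (radial_weight (norm z)) \<partial>lborel) = ennreal C" "C \<ge> 0"
    using nn_integral_radial_weight by (cases "\<integral>\<^sup>+(z::R3). ennreal (radial_weight (norm z)) \<partial>lborel") auto
  have 1: "(\<integral>\<^sup>+x. ennreal (indicator (cball y 1) x / norm (x - y)) \<partial>lborel) \<le> ennreal (C + 1)" for y :: R3
  proof -
    have "(\<integral>\<^sup>+x. ennreal (indicator (cball y 1) x / norm (x - y)) \<partial>lborel) \<le> (\<integral>\<^sup>+x. ennreal (radial_weight (norm (x - y))) \<partial>lborel)"
    proof (intro nn_integral_mono ennreal_leI)
      fix x :: R3
      have "1 / r \<le> radial_weight r" if "r \<le> 1" "r \<ge> 0" for r
      proof (cases "r = 0")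
        case False
        then have "r^2 \<le> r" using that by (simp add: power2_eq_square mult_left_le_one_le)
        then show ?thesis using that False by (simp add: radial_weight_def divide_left_mono)
      qed (simp add: radial_weight_def)
      then show "indicator (cball y 1) x / norm (x - y) \<le> radial_weight (norm (x - y))"
        using radial_weight_nonneg by (auto simp: dist_norm norm_minus_commute split: split_indicator)
    qed
    also have "\<dots> = ennreal C" using C nn_integral_translate_diff_R3[of "\<lambda>x. ennreal (radial_weight (norm x))" y] by simp
    also have "\<dots> \<le> ennreal (C + 1)" by (intro ennreal_leI) simp
    finally show ?thesis .
  qed
  have "(\<integral>\<^sup>+(x::R3). ennreal (indicator {x. norm x \<ge> 1} x / norm x ^ 4) \<partial>lborel) \<le> (\<integral>\<^sup>+(z::R3). ennreal (radial_weight (norm z)) \<partial>lborel)"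
    by (intro nn_integral_mono ennreal_leI) (auto simp: radial_weight_def split: split_indicator)
  also have "\<dots> \<le> ennreal (C + 1)" unfolding C by (intro ennreal_leI) simp
  finally have 2: "(\<integral>\<^sup>+(x::R3). ennreal (indicator {x. norm x \<ge> 1} x / norm x ^ 4) \<partial>lborel) \<le> ennreal (C + 1)" .
  show thesis by (rule that[OF _ 1 2]) (use C(2) in simp)
qed

text \<open>The kernel splits into a uniformly integrable singularity and a part bounded by 1, so
  the potential has a finite integral over every ball. Finiteness matters because the Bochner
  integral in \<open>coulomb_potential\<close> is 0 by default where it diverges.\<close>

lemma coulomb_potential_AE_finite:
  fixes g :: "R3 \<Rightarrow> real"
  assumes [measurable]: "g \<in> borel_measurable borel" and g: "\<And>x. g x \<ge> 0" and fin: "(\<integral>\<^sup>+x. ennreal (g x) \<partial>lborel) < \<infinity>"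
  shows "AE x in lborel. (\<integral>\<^sup>+y. ennreal (g y / norm (x - y)) \<partial>lborel) < \<infinity>"
proof -
  let ?W = "\<lambda>x. \<integral>\<^sup>+y. ennreal (g y / norm (x - y)) \<partial>lborel"
  obtain C where C: "C > 0" "\<And>y::R3. (\<integral>\<^sup>+x. ennreal (indicator (cball y 1) x / norm (x - y)) \<partial>lborel) \<le> ennreal C"
    by (rule inverse_norm_local) blast
  have "AE x in lborel. norm x \<le> real n \<longrightarrow> ?W x < \<infinity>" for n :: nat
  proof -
    let ?B = "cball (0::R3) (real n)"
    define chi :: "R3 \<Rightarrow> ennreal" where "chi = indicator ?B"
    have [measurable]: "chi \<in> borel_measurable borel" unfolding chi_def by (rule borel_measurable_indicator) simp
    have inner: "(\<integral>\<^sup>+x. chi x * ennreal (1 / norm (x - y)) \<partial>lborel) \<le> ennreal C + emeasure lborel ?B" for y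
    proof -
      have [measurable]: "(\<lambda>x. indicator (cball y 1) x :: real) \<in> borel_measurable borel" by (rule borel_measurable_indicator) simp
      have "(\<integral>\<^sup>+x. chi x * ennreal (1 / norm (x - y)) \<partial>lborel) \<le> (\<integral>\<^sup>+x. ennreal (indicator (cball y 1) x / norm (x - y)) + chi x \<partial>lborel)"
      proof (rule nn_integral_mono)
        fix x :: R3
        have "1 / norm (x - y) \<le> 1" if "x \<notin> cball y 1"
        proof -
          have "norm (x - y) > 1" using that by (simp add: dist_norm norm_minus_commute not_le)
          then show ?thesis by (simp add: divide_le_eq)
        qed
        then show "chi x * ennreal (1 / norm (x - y)) \<le> ennreal (indicator (cball y 1) x / norm (x - y)) + chi x"
          by (cases "x \<in> cball y 1") (auto split: split_indicator simp: ennreal_le_1 chi_def)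
      qed
      also have "\<dots> = (\<integral>\<^sup>+x. ennreal (indicator (cball y 1) x / norm (x - y)) \<partial>lborel) + (\<integral>\<^sup>+x. chi x \<partial>lborel)"
        by (rule nn_integral_add) auto
      also have "\<dots> \<le> ennreal C + emeasure lborel ?B" using C(2)[of y] by (intro add_mono) (auto simp: chi_def)
      finally show ?thesis .
    qed
    have "(\<integral>\<^sup>+x. chi x * ?W x \<partial>lborel) = (\<integral>\<^sup>+x. (\<integral>\<^sup>+y. chi x * ennreal (g y / norm (x - y)) \<partial>lborel) \<partial>lborel)"
      by (intro nn_integral_cong nn_integral_cmult[symmetric]) measurable
    also have "\<dots> = (\<integral>\<^sup>+y. (\<integral>\<^sup>+x. chi x * ennreal (g y / norm (x - y)) \<partial>lborel) \<partial>lborel)"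
      by (intro lborel_pair.Fubini') measurable
    also have "\<dots> = (\<integral>\<^sup>+y. ennreal (g y) * (\<integral>\<^sup>+x. chi x * ennreal (1 / norm (x - y)) \<partial>lborel) \<partial>lborel)"
    proof (rule nn_integral_cong)
      fix y :: R3
      show "(\<integral>\<^sup>+x. chi x * ennreal (g y / norm (x - y)) \<partial>lborel) = ennreal (g y) * (\<integral>\<^sup>+x. chi x * ennreal (1 / norm (x - y)) \<partial>lborel)"
        using g[of y] by (subst nn_integral_cmult[symmetric]) (auto simp: ennreal_mult[symmetric] mult_ac intro!: nn_integral_cong)
    qed
    also have "\<dots> \<le> (\<integral>\<^sup>+y. ennreal (g y) * (ennreal C + emeasure lborel ?B) \<partial>lborel)"
      by (intro nn_integral_mono mult_left_mono inner) auto
    also have "\<dots> < \<infinity>" using fin emeasure_lborel_cball_finite[of "0::R3" "real n"]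
      by (subst nn_integral_multc) (auto simp: ennreal_mult_less_top ennreal_add_less_top)
    finally have "AE x in lborel. chi x * ?W x \<noteq> \<infinity>"
      by (intro nn_integral_PInf_AE) auto
    then show ?thesis by eventually_elim (auto simp: less_top[symmetric] chi_def split: split_indicator_asm)
  qed
  then have "AE x in lborel. \<forall>n::nat. norm x \<le> real n \<longrightarrow> ?W x < \<infinity>" by (subst AE_all_countable) auto
  then show ?thesis by eventually_elim (meson real_arch_simple)
qed

lemma coulomb_potential_borel:
  assumes [measurable]: "u \<in> borel_measurable borel"
  shows "coulomb_potential (\<lambda>y. (u y)^2) x = enn2real (\<integral>\<^sup>+y. ennreal ((u y)^2 / norm (x - y)) \<partial>lborel)"
  unfolding coulomb_potential_def
  by (subst lebesgue_integral_borel, simp, rule integral_eq_nn_integral) auto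

text \<open>Almost everywhere finiteness lets the Bochner potential be replaced by the nonnegative
  integral, after which the iterated integral is the double integral.\<close>

lemma nn_coulomb_potential:
  assumes u: "square_integrable u" and v: "v \<in> borel_measurable borel"
  shows "(\<integral>\<^sup>+x. ennreal (coulomb_potential (\<lambda>y. (u y)^2) x * (v x)^2) \<partial>lborel) = coulomb (\<lambda>x. (u x)^2) (\<lambda>x. (v x)^2)"
proof -
  note [measurable] = square_integrableD(1)[OF u] v
  have "AE x in lborel. (\<integral>\<^sup>+y. ennreal ((u y)^2 / norm (x - y)) \<partial>lborel) < \<infinity>"
    by (rule coulomb_potential_AE_finite) (auto simp: nn_mass[OF u])
  then have "(\<integral>\<^sup>+x. ennreal (coulomb_potential (\<lambda>y. (u y)^2) x * (v x)^2) \<partial>lborel)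
    = (\<integral>\<^sup>+x. ennreal ((v x)^2) * (\<integral>\<^sup>+y. ennreal ((u y)^2 / norm (x - y)) \<partial>lborel) \<partial>lborel)"
    by (intro nn_integral_cong_AE, eventually_elim)
       (auto simp: coulomb_potential_borel[OF square_integrableD(1)[OF u]] ennreal_mult mult.commute)
  also have "\<dots> = coulomb (\<lambda>x. (v x)^2) (\<lambda>x. (u x)^2)" by (rule coulomb_iterated[symmetric]) auto
  finally show ?thesis using coulomb_sym[of "\<lambda>x. (v x)^2" "\<lambda>x. (u x)^2"] by simp
qed

lemma coulomb_potential_measurable[measurable]:
  assumes [measurable]: "u \<in> borel_measurable borel"
  shows "coulomb_potential (\<lambda>y. (u y)^2) \<in> borel_measurable borel"
  unfolding coulomb_potential_borel[OF assms, abs_def] by measurable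

lemma coulomb_potential_nonneg: "coulomb_potential (\<lambda>y. (u y)^2) x \<ge> 0"
  unfolding coulomb_potential_def by (intro integral_nonneg_AE) simp

lemma hartree_eq:
  assumes u: "square_integrable u"
  shows "hartree u = enn2real (hart u)"
proof -
  note [measurable] = square_integrableD(1)[OF u]
  have "hartree u = (\<integral>x. coulomb_potential (\<lambda>y. (u y)^2) x * (u x)^2 \<partial>lborel)"
    unfolding hartree_def by (rule lebesgue_integral_borel) measurable
  also have "\<dots> = enn2real (\<integral>\<^sup>+x. ennreal (coulomb_potential (\<lambda>y. (u y)^2) x * (u x)^2) \<partial>lborel)"
    by (intro integral_eq_nn_integral) (auto simp: coulomb_potential_nonneg)
  finally show ?thesis using nn_coulomb_potential[OF u, of u] by simp
qed

lemma nn_affine_R3: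
  fixes x0 :: R3
  assumes [measurable]: "f \<in> borel_measurable borel" and l: "l > 0"
  shows "(\<integral>\<^sup>+x. f (l *\<^sub>R (x - x0)) \<partial>lborel) = ennreal (1 / l^3) * (\<integral>\<^sup>+x. f x \<partial>lborel)"
proof -
  have "(\<integral>\<^sup>+x. f (l *\<^sub>R (x - x0)) \<partial>lborel) = (\<integral>\<^sup>+x. f (l *\<^sub>R x) \<partial>lborel)"
    by (rule nn_integral_translate_diff_R3) measurable
  then show ?thesis using nn_integral_scale_R3[OF assms] by simp
qed

lemma nn_affine_pair:
  fixes x0 :: R3
  assumes [measurable]: "f \<in> borel_measurable lborel2" and l: "l > 0"
  shows "(\<integral>\<^sup>+p. f (l *\<^sub>R (fst p - x0), l *\<^sub>R (snd p - x0)) \<partial>lborel2) = ennreal (1 / l^6) * (\<integral>\<^sup>+p. f p \<partial>lborel2)"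
proof -
  have [measurable]: "(\<lambda>x. f (a, x)) \<in> borel_measurable borel" "(\<lambda>x. f (x, b)) \<in> borel_measurable borel" for a b
    using assms(1) by auto
  have "(\<integral>\<^sup>+p. f (l *\<^sub>R (fst p - x0), l *\<^sub>R (snd p - x0)) \<partial>lborel2)
     = (\<integral>\<^sup>+x. \<integral>\<^sup>+y. f (l *\<^sub>R (x - x0), l *\<^sub>R (y - x0)) \<partial>lborel \<partial>lborel)"
    by (subst lborel.nn_integral_fst[symmetric]) auto
  also have "\<dots> = (\<integral>\<^sup>+x. ennreal (1 / l^3) * (\<integral>\<^sup>+y. f (l *\<^sub>R (x - x0), y) \<partial>lborel) \<partial>lborel)"
    using l by (intro nn_integral_cong nn_affine_R3) auto
  also have "\<dots> = ennreal (1 / l^3) * (\<integral>\<^sup>+x. (\<integral>\<^sup>+y. f (l *\<^sub>R (x - x0), y) \<partial>lborel) \<partial>lborel)"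
    by (rule nn_integral_cmult) measurable
  also have "(\<integral>\<^sup>+x. (\<integral>\<^sup>+y. f (l *\<^sub>R (x - x0), y) \<partial>lborel) \<partial>lborel) = ennreal (1 / l^3) * (\<integral>\<^sup>+x. (\<integral>\<^sup>+y. f (x, y) \<partial>lborel) \<partial>lborel)"
    using l by (intro nn_affine_R3[where f="\<lambda>x. \<integral>\<^sup>+y. f (x, y) \<partial>lborel"]) auto
  also have "(\<integral>\<^sup>+x. (\<integral>\<^sup>+y. f (x, y) \<partial>lborel) \<partial>lborel) = (\<integral>\<^sup>+p. f p \<partial>lborel2)"
    by (rule lborel.nn_integral_fst) measurable
  also have "ennreal (1 / l^3) * (ennreal (1 / l^3) * (\<integral>\<^sup>+p. f p \<partial>lborel2)) = ennreal (1 / l^6) * (\<integral>\<^sup>+p. f p \<partial>lborel2)"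
    using l by (simp add: mult.assoc[symmetric] ennreal_mult[symmetric] flip: power_add)
  finally show ?thesis .
qed

text \<open>Mass, kinetic and Hartree energy acquire the factors \<open>c^2/l^3\<close>,
  \<open>c^2/l^2\<close> and \<open>c^4/l^5\<close>. The product of the first two is the third, so
  the Hartree inequality is scale invariant and concentration leaves its quotient unchanged.
  Dilates, translates and the concentrating trial functions are all of this form.\<close>

definition rescale :: "real \<Rightarrow> real \<Rightarrow> R3 \<Rightarrow> (R3 \<Rightarrow> real) \<Rightarrow> R3 \<Rightarrow> real"
  where "rescale c l x0 u x = c * u (l *\<^sub>R (x - x0))"

lemma rescale_measurable[measurable]:
  assumes [measurable]: "u \<in> borel_measurable borel"
  shows "rescale c l x0 u \<in> borel_measurable borel"
  unfolding rescale_def[abs_def] by measurable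

lemma nn_rescale:
  assumes [measurable]: "u \<in> borel_measurable borel" and l: "l > 0"
  shows "(\<integral>\<^sup>+x. ennreal ((rescale c l x0 u x)^2) \<partial>lborel) = ennreal (c^2 / l^3) * (\<integral>\<^sup>+x. ennreal ((u x)^2) \<partial>lborel)"
proof -
  have "(\<integral>\<^sup>+x. ennreal ((rescale c l x0 u x)^2) \<partial>lborel) = ennreal (1 / l^3) * (\<integral>\<^sup>+x. ennreal (c^2 * (u x)^2) \<partial>lborel)"
    using nn_affine_R3[of "\<lambda>x. ennreal (c^2 * (u x)^2)" l x0] l by (simp add: rescale_def power_mult_distrib)
  also have "(\<integral>\<^sup>+x. ennreal (c^2 * (u x)^2) \<partial>lborel) = ennreal (c^2) * (\<integral>\<^sup>+x. ennreal ((u x)^2) \<partial>lborel)"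
    by (subst nn_integral_cmult[symmetric]) (auto simp: ennreal_mult)
  also have "ennreal (1 / l^3) * (ennreal (c^2) * (\<integral>\<^sup>+x. ennreal ((u x)^2) \<partial>lborel)) = ennreal (c^2 / l^3) * (\<integral>\<^sup>+x. ennreal ((u x)^2) \<partial>lborel)"
    using l by (simp add: mult.assoc[symmetric] ennreal_mult[symmetric])
  finally show ?thesis .
qed

lemma square_integrable_rescale:
  assumes u: "square_integrable u" and l: "l > 0"
  shows "square_integrable (rescale c l x0 u)"
  using square_integrableD(1)[OF u] nn_rescale[OF square_integrableD(1)[OF u] l, of c x0]
  by (subst square_integrable_iff_nn) (auto simp: nn_mass[OF u] ennreal_mult_less_top)

lemma mass_rescale:
  assumes u: "square_integrable u" and l: "l > 0"
  shows "mass (rescale c l x0 u) = c^2 / l^3 * mass u"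
proof -
  have "ennreal (mass (rescale c l x0 u)) = ennreal (c^2 / l^3 * mass u)"
    using nn_rescale[OF square_integrableD(1)[OF u] l, of c x0] nn_mass[OF u] nn_mass[OF square_integrable_rescale[OF u l, of c x0]] l mass_nonneg[of u]
    by (simp add: ennreal_mult[symmetric])
  then show ?thesis using mass_nonneg l by simp
qed

lemma seminorm_rescale:
  assumes [measurable]: "u \<in> borel_measurable borel" and l: "l > 0"
  shows "seminorm (rescale c l x0 u) = ennreal (c^2 / l^2) * seminorm u"
proof -
  let ?f = "\<lambda>p. ennreal ((u (fst p) - u (snd p))^2 / norm (fst p - snd p) ^ 4)"
  have "seminorm (rescale c l x0 u) = (\<integral>\<^sup>+p. ennreal (c^2 * l^4) * ?f (l *\<^sub>R (fst p - x0), l *\<^sub>R (snd p - x0)) \<partial>lborel2)"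
    unfolding seminorm_def
  proof (intro nn_integral_cong)
    fix p :: "R3 \<times> R3"
    have n: "norm (l *\<^sub>R (fst p - x0) - l *\<^sub>R (snd p - x0)) = l * norm (fst p - snd p)"
      using l by (simp add: scaleR_diff_right[symmetric])
    have "(rescale c l x0 u (fst p) - rescale c l x0 u (snd p))^2 = c^2 * (u (l *\<^sub>R (fst p - x0)) - u (l *\<^sub>R (snd p - x0)))^2"
      by (simp add: rescale_def power_mult_distrib flip: right_diff_distrib)
    then show "ennreal ((rescale c l x0 u (fst p) - rescale c l x0 u (snd p))^2 / norm (fst p - snd p) ^ 4)
      = ennreal (c^2 * l^4) * ?f (l *\<^sub>R (fst p - x0), l *\<^sub>R (snd p - x0))"
      using l by (simp add: n power_mult_distrib ennreal_mult[symmetric])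
  qed
  also have "\<dots> = ennreal (c^2 * l^4) * (\<integral>\<^sup>+p. ?f (l *\<^sub>R (fst p - x0), l *\<^sub>R (snd p - x0)) \<partial>lborel2)"
    by (rule nn_integral_cmult) simp
  also have "(\<integral>\<^sup>+p. ?f (l *\<^sub>R (fst p - x0), l *\<^sub>R (snd p - x0)) \<partial>lborel2) = ennreal (1 / l^6) * seminorm u"
    unfolding seminorm_def by (rule nn_affine_pair) (use l in auto)
  also have "ennreal (c^2 * l^4) * (ennreal (1 / l^6) * seminorm u) = ennreal (c^2 / l^2) * seminorm u"
    using l by (simp add: mult.assoc[symmetric] ennreal_mult[symmetric] eval_nat_numeral)
  finally show ?thesis .
qed

lemma hart_rescale:
  assumes [measurable]: "u \<in> borel_measurable borel" and l: "l > 0"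
  shows "hart (rescale c l x0 u) = ennreal (c^4 / l^5) * hart u"
proof -
  let ?f = "\<lambda>p. ennreal ((u (fst p))^2 * (u (snd p))^2 / norm (fst p - snd p))"
  have "hart (rescale c l x0 u) = (\<integral>\<^sup>+p. ennreal (c^4 * l) * ?f (l *\<^sub>R (fst p - x0), l *\<^sub>R (snd p - x0)) \<partial>lborel2)"
    unfolding coulomb_def
  proof (intro nn_integral_cong)
    fix p :: "R3 \<times> R3"
    have n: "norm (l *\<^sub>R (fst p - x0) - l *\<^sub>R (snd p - x0)) = l * norm (fst p - snd p)"
      using l by (simp add: scaleR_diff_right[symmetric])
    show "ennreal ((rescale c l x0 u (fst p))^2 * (rescale c l x0 u (snd p))^2 / norm (fst p - snd p))
      = ennreal (c^4 * l) * ?f (l *\<^sub>R (fst p - x0), l *\<^sub>R (snd p - x0))"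
      using l by (simp add: n rescale_def power_mult_distrib ennreal_mult[symmetric] mult_ac flip: power_add)
  qed
  also have "\<dots> = ennreal (c^4 * l) * (\<integral>\<^sup>+p. ?f (l *\<^sub>R (fst p - x0), l *\<^sub>R (snd p - x0)) \<partial>lborel2)"
    by (rule nn_integral_cmult) simp
  also have "(\<integral>\<^sup>+p. ?f (l *\<^sub>R (fst p - x0), l *\<^sub>R (snd p - x0)) \<partial>lborel2) = ennreal (1 / l^6) * hart u"
    unfolding coulomb_def by (rule nn_affine_pair) (use l in auto)
  also have "ennreal (c^4 * l) * (ennreal (1 / l^6) * hart u) = ennreal (c^4 / l^5) * hart u"
  proof -
    have "c^4 * l * (1 / l^6) = c^4 / l^5" using l by (simp add: eval_nat_numeral)
    moreover have "ennreal (c^4 * l) * ennreal (1 / l^6) = ennreal (c^4 * l * (1 / l^6))"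
      by (rule ennreal_mult[symmetric]) (use l in auto)
    ultimately show ?thesis by (simp only: mult.assoc[symmetric])
  qed
  finally show ?thesis .
qed

lemma half_sobolev_rescale: "half_sobolev u \<Longrightarrow> l > 0 \<Longrightarrow> half_sobolev (rescale c l x0 u)"
  using square_integrable_rescale[of u l c x0] seminorm_rescale[OF square_integrableD(1), of u l c x0]
  by (auto simp: half_sobolev_def ennreal_mult_less_top)

lemma kinetic_rescale:
  assumes u: "half_sobolev u" and l: "l > 0"
  shows "kinetic (rescale c l x0 u) = c^2 / l^2 * kinetic u"
  using square_integrable_rescale[OF half_sobolevD(1)[OF u] l, of c x0] l
    seminorm_rescale[OF square_integrableD(1)[OF half_sobolevD(1)[OF u]] l, of c x0]
  by (simp add: kinetic_seminorm half_sobolevD(1)[OF u] enn2real_mult)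

section \<open>Local compactness\<close>

lemma ennreal_two_mult: "0 \<le> a \<Longrightarrow> ennreal (2 * a) = 2 * ennreal a"
  by (simp add: ennreal_mult)

lemma seminorm_diff_le:
  assumes [measurable]: "u \<in> borel_measurable borel" "v \<in> borel_measurable borel"
  shows "seminorm (\<lambda>x. u x - v x) \<le> 2 * seminorm u + 2 * seminorm v"
proof -
  have "seminorm (\<lambda>x. u x - v x) \<le> (\<integral>\<^sup>+p. 2 * ennreal ((u (fst p) - u (snd p))^2 / norm (fst p - snd p) ^ 4)
      + 2 * ennreal ((v (fst p) - v (snd p))^2 / norm (fst p - snd p) ^ 4) \<partial>lborel2)"
    unfolding seminorm_def
  proof (rule nn_integral_mono)
    fix p :: "R3 \<times> R3"
    let ?a = "u (fst p) - u (snd p)" and ?b = "v (fst p) - v (snd p)" and ?n = "norm (fst p - snd p) ^ 4"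
    have "(u (fst p) - v (fst p) - (u (snd p) - v (snd p)))^2 \<le> 2 * ?a^2 + 2 * ?b^2"
      using sq_diff_le[of ?a ?b] by (simp add: algebra_simps)
    then have "(u (fst p) - v (fst p) - (u (snd p) - v (snd p)))^2 / ?n \<le> (2 * ?a^2 + 2 * ?b^2) / ?n"
      by (rule divide_right_mono) simp
    also have "\<dots> = 2 * (?a^2 / ?n) + 2 * (?b^2 / ?n)" by (simp add: add_divide_distrib)
    finally have "ennreal ((u (fst p) - v (fst p) - (u (snd p) - v (snd p)))^2 / ?n) \<le> ennreal (2 * (?a^2 / ?n) + 2 * (?b^2 / ?n))"
      by (rule ennreal_leI)
    also have "\<dots> = 2 * ennreal (?a^2 / ?n) + 2 * ennreal (?b^2 / ?n)"
      by (subst ennreal_plus, simp, simp, subst ennreal_two_mult, simp, subst ennreal_two_mult, simp, rule refl)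
    finally show "ennreal ((u (fst p) - v (fst p) - (u (snd p) - v (snd p)))^2 / ?n) \<le> \<dots>" .
  qed
  also have "\<dots> = 2 * seminorm u + 2 * seminorm v"
    unfolding seminorm_def by (simp add: nn_integral_add nn_integral_cmult)
  finally show ?thesis .
qed

lemma half_sobolev_diff: "half_sobolev u \<Longrightarrow> half_sobolev v \<Longrightarrow> half_sobolev (\<lambda>x. u x - v x)"
  unfolding half_sobolev_def
  using seminorm_diff_le[OF square_integrableD(1) square_integrableD(1), of u v]
  by (auto simp: square_integrable_diff ennreal_mult_less_top ennreal_add_less_top intro: le_less_trans)

text \<open>For \<open>h > 0\<close>, the index of the half-open cube of side \<open>h\<close>
  containing \<open>x\<close>; the cubes of one mesh partition space.\<close>

definition cell :: "real \<Rightarrow> R3 \<Rightarrow> int \<times> int \<times> int"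
  where "cell h x = (\<lfloor>x $ 1 / h\<rfloor>, \<lfloor>x $ 2 / h\<rfloor>, \<lfloor>x $ 3 / h\<rfloor>)"

definition in_cell :: "real \<Rightarrow> int \<times> int \<times> int \<Rightarrow> R3 \<Rightarrow> real"
  where "in_cell h k x = (if cell h x = k then 1 else 0)"

lemma in_cell_measurable[measurable]: "in_cell h k \<in> borel_measurable borel"
  unfolding in_cell_def cell_def by (cases k) (simp, measurable)

lemma cell_bounds:
  assumes "h > 0" "cell h x = (k1, k2, k3)"
  shows "real_of_int k1 * h \<le> x $ 1" "x $ 1 < real_of_int k1 * h + h"
    "real_of_int k2 * h \<le> x $ 2" "x $ 2 < real_of_int k2 * h + h"
    "real_of_int k3 * h \<le> x $ 3" "x $ 3 < real_of_int k3 * h + h"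
proof -
  have *: "real_of_int \<lfloor>y / h\<rfloor> * h \<le> y \<and> y < real_of_int \<lfloor>y / h\<rfloor> * h + h" for y
  proof -
    have "real_of_int \<lfloor>y / h\<rfloor> \<le> y / h" "y / h < real_of_int \<lfloor>y / h\<rfloor> + 1" by linarith+
    then show ?thesis
      unfolding pos_le_divide_eq[OF assms(1)] pos_divide_less_eq[OF assms(1)] by (simp add: distrib_right)
  qed
  show "real_of_int k1 * h \<le> x $ 1" "x $ 1 < real_of_int k1 * h + h"
    "real_of_int k2 * h \<le> x $ 2" "x $ 2 < real_of_int k2 * h + h"
    "real_of_int k3 * h \<le> x $ 3" "x $ 3 < real_of_int k3 * h + h"
    using assms(2) * by (auto simp: cell_def)
qed

lemma cell_diam:
  assumes h: "h > 0" and "cell h x = cell h y"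
  shows "norm (x - y) \<le> 3 * h"
proof -
  obtain k1 k2 k3 where k: "cell h x = (k1, k2, k3)" by (cases "cell h x")
  note bx = cell_bounds[OF h k] and by' = cell_bounds[OF h k[unfolded assms(2)]]
  have "norm (x - y) \<le> (\<Sum>i\<in>UNIV. \<bar>(x - y) $ i\<bar>)" by (rule norm_le_l1_cart)
  also have "\<dots> \<le> 3 * h" using bx by' unfolding sum_3 by simp
  finally show ?thesis .
qed

lemma prod_cart_box: "(\<Prod>b\<in>Basis. ((\<chi> i. c) :: R3) \<bullet> b) = c ^ 3"
proof -
  have "((\<chi> i. c) :: R3) \<bullet> b = c" if b: "b \<in> Basis" for b
    using b by (auto simp: Basis_vec_def inner_axis)
  then show ?thesis by simp
qed

text \<open>The cube is half-open, hence squeezed between an open and a closed box of the same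
  volume.\<close>

lemma nn_in_cell:
  assumes h: "h > 0"
  shows "(\<integral>\<^sup>+x. ennreal (in_cell h k x) \<partial>lborel) = ennreal (h^3)"
proof (rule antisym)
  obtain k1 k2 k3 where k: "k = (k1, k2, k3)" by (cases k)
  define l :: R3 where "l = vector [real_of_int k1 * h, real_of_int k2 * h, real_of_int k3 * h]"
  define d :: R3 where "d = (\<chi> i. h)"
  have d: "\<And>b. b \<in> Basis \<Longrightarrow> l \<bullet> b \<le> (l + d) \<bullet> b" "(\<Prod>b\<in>Basis. (l + d - l) \<bullet> b) = h^3"
    using prod_cart_box[of h] h by (auto simp: d_def inner_add_left Basis_vec_def inner_axis)
  have sub: "in_cell h k x \<le> indicator (cbox l (l + d)) x" for x
    using cell_bounds[OF h, of x k1 k2 k3]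
    by (auto simp: in_cell_def k mem_box_cart forall_3 l_def d_def split: split_indicator)
  have sup: "indicator (box l (l + d)) x \<le> in_cell h k x" for x
  proof (cases "x \<in> box l (l + d)")
    case True
    have *: "\<lfloor>y / h\<rfloor> = j" if "real_of_int j * h < y" "y < real_of_int j * h + h" for y j
      using that h by (intro floor_unique) (auto simp: field_simps)
    have "cell h x = k" using True
      by (auto simp: cell_def k mem_box_cart forall_3 l_def d_def intro!: *)
    then show ?thesis by (simp add: in_cell_def)
  qed (simp add: in_cell_def)
  have "(\<integral>\<^sup>+x. ennreal (in_cell h k x) \<partial>lborel) \<le> (\<integral>\<^sup>+x. indicator (cbox l (l + d)) x \<partial>lborel)"
    using sub by (intro nn_integral_mono) (auto simp: ennreal_indicator[symmetric] intro!: ennreal_leI)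
  also have "\<dots> = ennreal (h^3)" using d by simp
  finally show "(\<integral>\<^sup>+x. ennreal (in_cell h k x) \<partial>lborel) \<le> ennreal (h^3)" .
  have "ennreal (h^3) = (\<integral>\<^sup>+x. indicator (box l (l + d)) x \<partial>lborel)" using d by (simp add: emeasure_lborel_box)
  also have "\<dots> \<le> (\<integral>\<^sup>+x. ennreal (in_cell h k x) \<partial>lborel)"
    using sup by (intro nn_integral_mono) (auto simp: ennreal_indicator[symmetric] intro!: ennreal_leI)
  finally show "ennreal (h^3) \<le> (\<integral>\<^sup>+x. ennreal (in_cell h k x) \<partial>lborel)" .
qed

lemma has_bochner_product:
  fixes a b :: "R3 \<Rightarrow> real"
  assumes a: "integrable lborel a" and b: "integrable lborel b"
  shows "has_bochner_integral lborel2 (\<lambda>p. a (fst p) * b (snd p)) ((\<integral>x. a x \<partial>lborel) * (\<integral>x. b x \<partial>lborel))"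
proof -
  have [measurable]: "a \<in> borel_measurable borel" "b \<in> borel_measurable borel"
    using a b by (auto dest: borel_measurable_integrable)
  have "(\<integral>\<^sup>+p. ennreal (norm (a (fst p) * b (snd p))) \<partial>lborel2)
     = (\<integral>\<^sup>+x. \<integral>\<^sup>+y. ennreal (norm (a x)) * ennreal (norm (b y)) \<partial>lborel \<partial>lborel)"
    by (subst lborel.nn_integral_fst[symmetric]) (auto simp: abs_mult ennreal_mult)
  also have "\<dots> = (\<integral>\<^sup>+x. ennreal (norm (a x)) \<partial>lborel) * (\<integral>\<^sup>+y. ennreal (norm (b y)) \<partial>lborel)"
    by (simp add: nn_integral_cmult nn_integral_multc)
  also have "\<dots> < \<infinity>" using a b by (simp add: integrable_iff_bounded ennreal_mult_less_top)
  finally have i: "integrable lborel2 (\<lambda>p. a (fst p) * b (snd p))" by (intro integrableI_bounded) auto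
  have "(\<integral>p. a (fst p) * b (snd p) \<partial>lborel2) = (\<integral>x. (\<integral>y. a x * b y \<partial>lborel) \<partial>lborel)"
    by (rule lborel_pair.integral_fst'[OF i, simplified fst_conv snd_conv, symmetric])
  also have "\<dots> = (\<integral>x. a x \<partial>lborel) * (\<integral>x. b x \<partial>lborel)" by simp
  finally show ?thesis using i by (simp add: has_bochner_integral_iff)
qed

lemma in_cell_integrable:
  assumes h: "h > 0" and w: "square_integrable w"
  shows "integrable lborel (in_cell h k)" "(\<integral>x. in_cell h k x \<partial>lborel) = h^3"
    "integrable lborel (\<lambda>x. in_cell h k x * w x)" "integrable lborel (\<lambda>x. in_cell h k x * (w x)^2)"
proof -
  note [measurable] = square_integrableD(1)[OF w]
  have hb: "has_bochner_integral lborel (in_cell h k) (h^3)"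
    using nn_in_cell[OF h, of k] h by (intro has_bochner_integral_nn_integral) (auto simp: in_cell_def)
  then show 1: "integrable lborel (in_cell h k)" "(\<integral>x. in_cell h k x \<partial>lborel) = h^3"
    by (auto simp: has_bochner_integral_iff)
  show 2: "integrable lborel (\<lambda>x. in_cell h k x * (w x)^2)"
    by (rule Bochner_Integration.integrable_bound[OF square_integrableD(2)[OF w]], measurable) (simp add: in_cell_def)
  have "\<bar>y\<bar> \<le> 1 + y^2" for y :: real
    using sum_squares_bound[of "\<bar>y\<bar>" 1] by (simp add: power2_eq_square)
  then show "integrable lborel (\<lambda>x. in_cell h k x * w x)"
    by (intro Bochner_Integration.integrable_bound[OF Bochner_Integration.integrable_add[OF 1(1) 2]], measurable) (auto simp: in_cell_def)
qed

text \<open>The double integral of \<open>(w x - w y)^2\<close> over a cube is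
  \<open>2 (h^3 A - B^2)\<close>, with \<open>A\<close> the mass and \<open>B\<close> the integral
  of \<open>w\<close> on the cube. Points of a cube are at distance at most \<open>3 h\<close>, so
  the factor \<open>81 h^4 / |x - y|^4 \<ge> 1\<close> can be inserted.\<close>

lemma cell_poincare:
  assumes h: "h > 0" and w: "square_integrable w"
  shows "ennreal (h^3) * (\<integral>\<^sup>+x. ennreal (in_cell h k x * (w x)^2) \<partial>lborel)
    \<le> ennreal ((\<integral>x. in_cell h k x * w x \<partial>lborel)^2)
      + ennreal (81 * h^4 / 2) * (\<integral>\<^sup>+p. ennreal (in_cell h k (fst p) * in_cell h k (snd p) * ((w (fst p) - w (snd p))^2 / norm (fst p - snd p) ^ 4)) \<partial>lborel2)"
proof -
  note [measurable] = square_integrableD(1)[OF w]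
  note ic = in_cell_integrable[OF h w, of k]
  let ?f = "in_cell h k"
  let ?A = "\<integral>x. ?f x * (w x)^2 \<partial>lborel" and ?B = "\<integral>x. ?f x * w x \<partial>lborel"
  have eq: "(?f (fst p) * (w (fst p))^2) * ?f (snd p) + ?f (fst p) * (?f (snd p) * (w (snd p))^2)
      - 2 * ((?f (fst p) * w (fst p)) * (?f (snd p) * w (snd p))) = ?f (fst p) * ?f (snd p) * (w (fst p) - w (snd p))^2" for p
    by (simp add: power2_diff algebra_simps)
  have "has_bochner_integral lborel2 (\<lambda>p. (?f (fst p) * (w (fst p))^2) * ?f (snd p) + ?f (fst p) * (?f (snd p) * (w (snd p))^2)
      - 2 * ((?f (fst p) * w (fst p)) * (?f (snd p) * w (snd p)))) (?A * h^3 + h^3 * ?A - 2 * (?B * ?B))"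
    using has_bochner_product[OF ic(4) ic(1)] has_bochner_product[OF ic(1) ic(4)] has_bochner_product[OF ic(3) ic(3)]
    unfolding ic(2)
    by (intro has_bochner_integral_diff has_bochner_integral_add has_bochner_integral_mult_right)
  then have hb: "has_bochner_integral lborel2 (\<lambda>p. ?f (fst p) * ?f (snd p) * (w (fst p) - w (snd p))^2) (2 * (h^3 * ?A - ?B^2))"
    unfolding eq by (simp add: power2_eq_square algebra_simps)
  have nn: "?f (fst p) * ?f (snd p) * (w (fst p) - w (snd p))^2 \<ge> 0" for p by (simp add: in_cell_def)
  have J: "(\<integral>\<^sup>+p. ennreal (?f (fst p) * ?f (snd p) * (w (fst p) - w (snd p))^2) \<partial>lborel2) = ennreal (2 * (h^3 * ?A - ?B^2))"
    using hb nn by (subst nn_integral_eq_integral) (auto simp: has_bochner_integral_iff)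
  have J0: "2 * (h^3 * ?A - ?B^2) \<ge> 0"
  proof -
    have "0 \<le> (\<integral>p. ?f (fst p) * ?f (snd p) * (w (fst p) - w (snd p))^2 \<partial>lborel2)"
      by (intro integral_nonneg_AE AE_I2 nn)
    then show ?thesis using hb by (simp add: has_bochner_integral_iff)
  qed
  have A: "(\<integral>\<^sup>+x. ennreal (?f x * (w x)^2) \<partial>lborel) = ennreal ?A" "?A \<ge> 0"
    using ic(4) by (auto intro!: nn_integral_eq_integral integral_nonneg_AE simp: in_cell_def)
  have "ennreal (2 * (h^3 * ?A - ?B^2)) \<le> (\<integral>\<^sup>+p. ennreal (81 * h^4) * ennreal (?f (fst p) * ?f (snd p) * ((w (fst p) - w (snd p))^2 / norm (fst p - snd p) ^ 4)) \<partial>lborel2)"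
    unfolding J[symmetric]
  proof (rule nn_integral_mono)
    fix p :: "R3 \<times> R3"
    show "ennreal (?f (fst p) * ?f (snd p) * (w (fst p) - w (snd p))^2)
      \<le> ennreal (81 * h^4) * ennreal (?f (fst p) * ?f (snd p) * ((w (fst p) - w (snd p))^2 / norm (fst p - snd p) ^ 4))"
    proof (cases "cell h (fst p) = k \<and> cell h (snd p) = k \<and> fst p \<noteq> snd p")
      case True
      then have "norm (fst p - snd p) ^ 4 \<le> (3 * h) ^ 4" using cell_diam[OF h, of "fst p" "snd p"] by (intro power_mono) auto
      then have "norm (fst p - snd p) ^ 4 \<le> 81 * h^4" by (simp add: power_mult_distrib)
      moreover have "norm (fst p - snd p) ^ 4 > 0" using True by simp
      ultimately have "1 \<le> 81 * h^4 / norm (fst p - snd p) ^ 4" by simp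
      from mult_left_mono[OF this, of "(w (fst p) - w (snd p))^2"]
      have "(w (fst p) - w (snd p))^2 \<le> 81 * h^4 * ((w (fst p) - w (snd p))^2 / norm (fst p - snd p) ^ 4)" by (simp add: mult_ac)
      then show ?thesis using True h by (simp add: in_cell_def ennreal_mult[symmetric] ennreal_leI)
    next
      case False
      then have "?f (fst p) * ?f (snd p) * (w (fst p) - w (snd p))^2 = 0" by (auto simp: in_cell_def)
      then show ?thesis by (simp only: ennreal_0 zero_le)
    qed
  qed
  also have "\<dots> = ennreal (81 * h^4) * (\<integral>\<^sup>+p. ennreal (?f (fst p) * ?f (snd p) * ((w (fst p) - w (snd p))^2 / norm (fst p - snd p) ^ 4)) \<partial>lborel2)"
    (is "_ = _ * ?S") by (rule nn_integral_cmult) measurable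
  finally have le: "ennreal (2 * (h^3 * ?A - ?B^2)) \<le> ennreal (81 * h^4) * ?S" .
  have "ennreal (h^3 * ?A - ?B^2) = ennreal (1/2) * ennreal (2 * (h^3 * ?A - ?B^2))"
    by (subst ennreal_mult[symmetric]) (use J0 in auto)
  also have "\<dots> \<le> ennreal (1/2) * (ennreal (81 * h^4) * ?S)" by (intro mult_left_mono le) simp
  also have "\<dots> = ennreal (81 * h^4 / 2) * ?S"
  proof -
    have "ennreal (1/2) * ennreal (81 * h^4) = ennreal (81 * h^4 / 2)"
      by (subst ennreal_mult[symmetric]) auto
    then show ?thesis by (simp only: mult.assoc[symmetric])
  qed
  finally have le2: "ennreal (h^3 * ?A - ?B^2) \<le> ennreal (81 * h^4 / 2) * ?S" .
  have "ennreal (h^3) * ennreal ?A = ennreal (?B^2 + (h^3 * ?A - ?B^2))"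
    using A(2) h by (simp add: ennreal_mult)
  also have "\<dots> = ennreal (?B^2) + ennreal (h^3 * ?A - ?B^2)" using J0 by (intro ennreal_plus) auto
  also have "\<dots> \<le> ennreal (?B^2) + ennreal (81 * h^4 / 2) * ?S" by (intro add_left_mono le2)
  finally show ?thesis unfolding A(1) .
qed

text \<open>Distinct cubes are disjoint, so the double integrals over the single cubes add up to at
  most the whole seminorm, whatever the number of cubes.\<close>

lemma cells_poincare:
  assumes h: "h > 0" and w: "square_integrable w" and K: "finite K" and R: "\<And>x. norm x \<le> R \<Longrightarrow> cell h x \<in> K"
  shows "ennreal (h^3) * (\<integral>\<^sup>+x. ennreal (indicator {x. norm x \<le> R} x * (w x)^2) \<partial>lborel)
    \<le> ennreal (\<Sum>k\<in>K. (\<integral>x. in_cell h k x * w x \<partial>lborel)^2) + ennreal (81 * h^4 / 2) * seminorm w"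
proof -
  note [measurable] = square_integrableD(1)[OF w]
  have sum_le: "(\<Sum>k\<in>K. in_cell h k x * in_cell h k y) \<le> 1" for x y
  proof -
    have "(\<Sum>k\<in>K. in_cell h k x * in_cell h k y) = (\<Sum>k\<in>K \<inter> {cell h x}. in_cell h k x * in_cell h k y)"
      by (intro sum.mono_neutral_right K) (auto simp: in_cell_def)
    also have "\<dots> \<le> 1" by (cases "cell h x \<in> K") (auto simp: in_cell_def)
    finally show ?thesis .
  qed
  let ?s = "\<lambda>p. (w (fst p) - w (snd p))^2 / norm (fst p - snd p) ^ 4"
  have "ennreal (h^3) * (\<integral>\<^sup>+x. ennreal (indicator {x. norm x \<le> R} x * (w x)^2) \<partial>lborel)
    \<le> ennreal (h^3) * (\<integral>\<^sup>+x. (\<Sum>k\<in>K. ennreal (in_cell h k x * (w x)^2)) \<partial>lborel)"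
  proof (intro mult_left_mono nn_integral_mono)
    fix x :: R3
    have "indicator {x. norm x \<le> R} x * (w x)^2 \<le> (\<Sum>k\<in>K. in_cell h k x * (w x)^2)"
    proof (cases "norm x \<le> R")
      case True
      have "in_cell h (cell h x) x * (w x)^2 \<le> (\<Sum>k\<in>K. in_cell h k x * (w x)^2)"
        by (rule member_le_sum[of "cell h x"]) (use R[OF True] K in \<open>auto simp: in_cell_def\<close>)
      then show ?thesis using True by (simp add: in_cell_def)
    qed (auto intro!: sum_nonneg simp: in_cell_def)
    then show "ennreal (indicator {x. norm x \<le> R} x * (w x)^2) \<le> (\<Sum>k\<in>K. ennreal (in_cell h k x * (w x)^2))"
      by (subst sum_ennreal) (auto simp: in_cell_def intro!: ennreal_leI)
  qed simp
  also have "\<dots> = (\<Sum>k\<in>K. ennreal (h^3) * (\<integral>\<^sup>+x. ennreal (in_cell h k x * (w x)^2) \<partial>lborel))"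
    by (simp add: nn_integral_sum sum_distrib_left)
  also have "\<dots> \<le> (\<Sum>k\<in>K. ennreal ((\<integral>x. in_cell h k x * w x \<partial>lborel)^2)
      + ennreal (81 * h^4 / 2) * (\<integral>\<^sup>+p. ennreal (in_cell h k (fst p) * in_cell h k (snd p) * ?s p) \<partial>lborel2))"
    by (intro sum_mono cell_poincare h w)
  also have "\<dots> = (\<Sum>k\<in>K. ennreal ((\<integral>x. in_cell h k x * w x \<partial>lborel)^2))
      + ennreal (81 * h^4 / 2) * (\<integral>\<^sup>+p. (\<Sum>k\<in>K. ennreal (in_cell h k (fst p) * in_cell h k (snd p) * ?s p)) \<partial>lborel2)"
    by (simp add: sum.distrib sum_distrib_left nn_integral_sum)
  also have "\<dots> \<le> ennreal (\<Sum>k\<in>K. (\<integral>x. in_cell h k x * w x \<partial>lborel)^2) + ennreal (81 * h^4 / 2) * seminorm w"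
  proof (intro add_mono mult_left_mono)
    show "(\<Sum>k\<in>K. ennreal ((\<integral>x. in_cell h k x * w x \<partial>lborel)^2)) \<le> ennreal (\<Sum>k\<in>K. (\<integral>x. in_cell h k x * w x \<partial>lborel)^2)"
      by (subst sum_ennreal) auto
    show "(\<integral>\<^sup>+p. (\<Sum>k\<in>K. ennreal (in_cell h k (fst p) * in_cell h k (snd p) * ?s p)) \<partial>lborel2) \<le> seminorm w"
      unfolding seminorm_def
    proof (rule nn_integral_mono)
      fix p :: "R3 \<times> R3"
      have "(\<Sum>k\<in>K. in_cell h k (fst p) * in_cell h k (snd p) * ?s p) = (\<Sum>k\<in>K. in_cell h k (fst p) * in_cell h k (snd p)) * ?s p"
        by (rule sum_distrib_right[symmetric])
      also have "\<dots> \<le> 1 * ?s p" by (intro mult_right_mono sum_le) simp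
      finally have "(\<Sum>k\<in>K. in_cell h k (fst p) * in_cell h k (snd p) * ?s p) \<le> ?s p" by simp
      then show "(\<Sum>k\<in>K. ennreal (in_cell h k (fst p) * in_cell h k (snd p) * ?s p)) \<le> ennreal (?s p)"
        by (subst sum_ennreal) (auto simp: in_cell_def intro!: ennreal_leI)
    qed
  qed auto
  finally show ?thesis .
qed

lemma finite_cells:
  assumes h: "h > 0"
  obtains K where "finite K" "\<And>x. norm x \<le> R \<Longrightarrow> cell h x \<in> K"
proof
  let ?I = "{\<lfloor>- \<bar>R\<bar> / h\<rfloor>..\<lfloor>\<bar>R\<bar> / h\<rfloor>}"
  show "finite (?I \<times> ?I \<times> ?I)" by simp
  fix x :: R3 assume x: "norm x \<le> R"
  have "- \<bar>R\<bar> / h \<le> x $ i / h \<and> x $ i / h \<le> \<bar>R\<bar> / h" for i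
  proof -
    have "\<bar>x $ i\<bar> \<le> \<bar>R\<bar>" using component_le_norm_cart[of x i] x by linarith
    then have "- \<bar>R\<bar> \<le> x $ i" "x $ i \<le> \<bar>R\<bar>" by linarith+
    then show ?thesis using divide_right_mono[of "- \<bar>R\<bar>" "x $ i" h] divide_right_mono[of "x $ i" "\<bar>R\<bar>" h] h by simp
  qed
  then show "cell h x \<in> ?I \<times> ?I \<times> ?I" unfolding cell_def by (auto intro!: floor_mono)
qed

lemma l2_limit_square_integrable:
  fixes v :: "R3 \<Rightarrow> real"
  assumes u: "\<And>n. square_integrable (u n)" and v[measurable]: "v \<in> borel_measurable borel"
    and lim: "(\<lambda>n::nat. \<integral>\<^sup>+x. ennreal ((norm (u n x - v x))^2) \<partial>lborel) \<longlonglongrightarrow> 0"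
  shows "square_integrable v" "(\<lambda>n. mass (u n)) \<longlonglongrightarrow> mass v"
proof -
  note [measurable] = square_integrableD(1)[OF u]
  obtain n where n: "(\<integral>\<^sup>+x. ennreal ((norm (u n x - v x))^2) \<partial>lborel) < ennreal 1"
    using ennreal_tendsto_0D[OF lim, of 1] by (auto simp: eventually_sequentially)
  have "(\<integral>\<^sup>+x. ennreal ((norm (v x - 0))^2) \<partial>lborel) \<le> 2 * (\<integral>\<^sup>+x. ennreal ((norm (v x - u n x))^2) \<partial>lborel) + 2 * (\<integral>\<^sup>+x. ennreal ((norm (u n x - 0))^2) \<partial>lborel)"
    by (rule nn_sq_diff_le3) auto
  also have "\<dots> < \<infinity>"
    using n nn_mass[OF u, of n] by (auto simp: abs_minus_commute ennreal_mult_less_top ennreal_add_less_top intro: less_trans)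
  finally show sv: "square_integrable v" by (subst square_integrable_iff_nn) auto
  have "(\<lambda>n. \<integral>x. 1 * (norm (u n x))^2 \<partial>lborel) \<longlonglongrightarrow> (\<integral>x. 1 * (norm (v x))^2 \<partial>lborel)"
    by (rule l2_weight_tendsto[OF _ _ _ _ _ lim]) (use square_integrableD(2)[OF u] square_integrableD(2)[OF sv] in auto)
  then show "(\<lambda>n. mass (u n)) \<longlonglongrightarrow> mass v" by (simp add: mass_def)
qed

text \<open>Cube averages decide convergence: they form countably many bounded sequences, hence
  converge along one subsequence, and the Poincare estimate bounds the rest by the mesh size.
  Tightness removes the restriction to a bounded region, so the convergence is global.\<close>

lemma rellich:
  fixes u :: "nat \<Rightarrow> R3 \<Rightarrow> real"
  assumes u: "\<And>n. square_integrable (u n)" and mass: "\<And>n. mass (u n) \<le> C"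
    and sem: "\<And>n. seminorm (u n) \<le> ennreal C"
    and tight: "\<And>e. e > 0 \<Longrightarrow> \<exists>R. \<forall>n. (\<integral>\<^sup>+x. ennreal (indicator {x. norm x > R} x * (u n x)^2) \<partial>lborel) \<le> ennreal e"
  obtains r v where "strict_mono (r::nat\<Rightarrow>nat)" "square_integrable v" "AE x in lborel. (\<lambda>n. u (r n) x) \<longlonglongrightarrow> v x"
    "(\<lambda>n. \<integral>\<^sup>+x. ennreal ((norm (u (r n) x - v x))^2) \<partial>lborel) \<longlonglongrightarrow> 0"
proof -
  note [measurable] = square_integrableD(1)[OF u]
  have C: "C \<ge> 0" using mass[of 0] mass_nonneg[of "u 0"] by linarith
  define h where "h j = 1 / real (Suc j)" for j
  have h: "h j > 0" "h j \<le> 1" for j by (auto simp: h_def)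
  \<comment> \<open>Indexed by mesh number and cube at once, a countable set, so that one diagonal
    subsequence serves all meshes.\<close>
  define a where "a n q = (\<integral>x. in_cell (h (fst q)) (snd q) x * u n x \<partial>lborel)" for n and q :: "nat \<times> (int \<times> int \<times> int)"
  have abd: "norm (a n q) \<le> 1 + C" for n q
  proof -
    note ic = in_cell_integrable[OF h(1) u, of "fst q" "snd q"]
    have "norm (a n q) \<le> (\<integral>x. norm (in_cell (h (fst q)) (snd q) x * u n x) \<partial>lborel)"
      unfolding a_def by (rule integral_norm_bound)
    also have "\<dots> \<le> (\<integral>x. in_cell (h (fst q)) (snd q) x + (u n x)^2 \<partial>lborel)"
    proof (rule integral_mono)
      have "\<bar>y\<bar> \<le> 1 + y^2" for y :: real
        using sum_squares_bound[of "\<bar>y\<bar>" 1] by (simp add: power2_eq_square)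
      then show "norm (in_cell (h (fst q)) (snd q) x * u n x) \<le> in_cell (h (fst q)) (snd q) x + (u n x)^2" for x
        by (simp add: in_cell_def)
    qed (use ic square_integrableD(2)[OF u] in auto)
    also have "\<dots> = h (fst q) ^ 3 + mass (u n)"
      using ic square_integrableD(2)[OF u] by (simp add: mass_def)
    also have "\<dots> \<le> 1 + C" using h[of "fst q"] mass[of n] by (intro add_mono power_le_one) auto
    finally show ?thesis .
  qed
  obtain k where k: "strict_mono (k::nat\<Rightarrow>nat)" "\<And>q. q \<in> UNIV \<Longrightarrow> \<exists>l. (\<lambda>n. a (k n) q) \<longlonglongrightarrow> l"
    by (rule function_convergent_subsequence[of UNIV a "1 + C"]) (use abd in auto)
  then have "\<forall>q. \<exists>l. (\<lambda>n. a (k n) q) \<longlonglongrightarrow> l" by simp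
  from choice[OF this] obtain l where "\<forall>q. (\<lambda>n. a (k n) q) \<longlonglongrightarrow> l q" ..
  then have l: "(\<lambda>n. a (k n) q) \<longlonglongrightarrow> l q" for q by (rule spec)
  have cauchy: "\<exists>N. \<forall>m\<ge>N. \<forall>n\<ge>N. (\<integral>\<^sup>+x. ennreal ((norm (u (k m) x - u (k n) x))^2) \<partial>lborel) \<le> ennreal e"
    if e: "e > 0" for e
  proof -
    obtain R where R: "\<And>n. (\<integral>\<^sup>+x. ennreal (indicator {x. norm x > R} x * (u n x)^2) \<partial>lborel) \<le> ennreal (e/16)"
      using tight[of "e/16"] e by auto
    \<comment> \<open>Here \<open>162 = 81 / 2 * 4\<close>, where \<open>4 C\<close> bounds the
      seminorm of a difference; \<open>648 = 4 * 162\<close> leaves a mesh error of at most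
      \<open>e/4\<close>.\<close>
    obtain j where j: "648 * C / e < real j" using reals_Archimedean2 by blast
    define H where "H = h j"
    have H: "H > 0" using h by (simp add: H_def)
    have jH: "162 * C * H \<le> e/4"
    proof -
      have "648 * C / e \<le> real (Suc j)" using j by simp
      then have "648 * C \<le> e * real (Suc j)" using e by (simp add: field_simps)
      then show ?thesis by (simp add: H_def h_def field_simps)
    qed
    obtain K where K: "finite K" "\<And>x. norm x \<le> R \<Longrightarrow> cell H x \<in> K" using finite_cells[OF H] by blast
    have "(\<lambda>n. \<Sum>q\<in>K. (a (k n) (j, q) - l (j, q))^2) \<longlonglongrightarrow> (\<Sum>q\<in>K. (l (j, q) - l (j, q))^2)"
      by (intro tendsto_intros l)
    then have "\<forall>\<^sub>F n in sequentially. (\<Sum>q\<in>K. (a (k n) (j, q) - l (j, q))^2) < H^3 * e / 16"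
      by (rule order_tendstoD) (use H e in simp)
    then obtain N where N: "\<And>n. n \<ge> N \<Longrightarrow> (\<Sum>q\<in>K. (a (k n) (j, q) - l (j, q))^2) < H^3 * e / 16"
      by (auto simp: eventually_sequentially)
    show ?thesis
    proof (intro exI[of _ N] allI impI)
      fix m n assume mn: "N \<le> m" "N \<le> n"
      let ?w = "\<lambda>x. u (k m) x - u (k n) x"
      have w: "square_integrable ?w" by (intro square_integrable_diff u)
      have sw: "seminorm ?w \<le> ennreal (4 * C)"
      proof -
        have "seminorm ?w \<le> 2 * seminorm (u (k m)) + 2 * seminorm (u (k n))" by (rule seminorm_diff_le) auto
        also have "\<dots> \<le> 2 * ennreal C + 2 * ennreal C" by (intro add_mono mult_left_mono sem) auto
        also have "\<dots> = ennreal (4 * C)" using C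
          by (simp add: ennreal_two_mult[symmetric] ennreal_plus[symmetric] del: ennreal_plus)
        finally show ?thesis .
      qed
      have ain: "(\<integral>x. in_cell H q x * ?w x \<partial>lborel) = a (k m) (j, q) - a (k n) (j, q)" for q
        using in_cell_integrable(3)[OF h(1) u, of j q] by (simp add: a_def H_def right_diff_distrib)
      have "(\<Sum>q\<in>K. (a (k m) (j, q) - a (k n) (j, q))^2) \<le> (\<Sum>q\<in>K. 2 * (a (k m) (j, q) - l (j, q))^2 + 2 * (a (k n) (j, q) - l (j, q))^2)"
      proof (rule sum_mono)
        fix q
        show "(a (k m) (j, q) - a (k n) (j, q))^2 \<le> 2 * (a (k m) (j, q) - l (j, q))^2 + 2 * (a (k n) (j, q) - l (j, q))^2"
          using sq_diff_le[of "a (k m) (j, q) - l (j, q)" "a (k n) (j, q) - l (j, q)"] by simp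
      qed
      also have "\<dots> \<le> H^3 * e / 4"
        using N[OF mn(1)] N[OF mn(2)] by (simp add: sum.distrib sum_distrib_left[symmetric])
      finally have S: "(\<Sum>q\<in>K. (a (k m) (j, q) - a (k n) (j, q))^2) \<le> H^3 * e / 4" .
      have "ennreal (H^3) * (\<integral>\<^sup>+x. ennreal (indicator {x. norm x \<le> R} x * (?w x)^2) \<partial>lborel)
        \<le> ennreal (\<Sum>q\<in>K. (a (k m) (j, q) - a (k n) (j, q))^2) + ennreal (81 * H^4 / 2) * seminorm ?w"
        using cells_poincare[OF H w K] unfolding ain .
      also have "\<dots> \<le> ennreal (H^3 * e / 4) + ennreal (81 * H^4 / 2) * ennreal (4 * C)"
        by (intro add_mono mult_left_mono ennreal_leI S sw) auto
      also have "\<dots> = ennreal (H^3 * (e / 4 + 162 * C * H))"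
        using H C e by (simp add: ennreal_mult[symmetric] ennreal_plus[symmetric] algebra_simps eval_nat_numeral del: ennreal_plus)
      also have "\<dots> \<le> ennreal (H^3 * (e / 2))"
        using jH H by (intro ennreal_leI mult_left_mono) auto
      also have "\<dots> = ennreal (H^3) * ennreal (e / 2)" using H e by (intro ennreal_mult) auto
      finally have inner: "(\<integral>\<^sup>+x. ennreal (indicator {x. norm x \<le> R} x * (?w x)^2) \<partial>lborel) \<le> ennreal (e / 2)"
        using H by (subst (asm) ennreal_mult_le_mult_iff) auto
      have "(\<integral>\<^sup>+x. ennreal (indicator {x. norm x > R} x * (?w x)^2) \<partial>lborel)
         \<le> (\<integral>\<^sup>+x. 2 * ennreal (indicator {x. norm x > R} x * (u (k m) x)^2) + 2 * ennreal (indicator {x. norm x > R} x * (u (k n) x)^2) \<partial>lborel)"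
      proof (rule nn_integral_mono)
        fix x :: R3
        show "ennreal (indicator {x. norm x > R} x * (?w x)^2) \<le> 2 * ennreal (indicator {x. norm x > R} x * (u (k m) x)^2) + 2 * ennreal (indicator {x. norm x > R} x * (u (k n) x)^2)"
          using sq_diff_le[of "u (k m) x" "u (k n) x"]
          by (cases "norm x > R") (simp_all add: ennreal_two_mult[symmetric] ennreal_plus[symmetric] ennreal_leI del: ennreal_plus)
      qed
      also have "\<dots> = 2 * (\<integral>\<^sup>+x. ennreal (indicator {x. norm x > R} x * (u (k m) x)^2) \<partial>lborel) + 2 * (\<integral>\<^sup>+x. ennreal (indicator {x. norm x > R} x * (u (k n) x)^2) \<partial>lborel)"
        by (simp add: nn_integral_add nn_integral_cmult)
      also have "\<dots> \<le> 2 * ennreal (e/16) + 2 * ennreal (e/16)" by (intro add_mono mult_left_mono R) auto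
      also have "\<dots> = ennreal (e/4)" using e by (simp add: ennreal_two_mult[symmetric] ennreal_plus[symmetric] del: ennreal_plus)
      finally have outer: "(\<integral>\<^sup>+x. ennreal (indicator {x. norm x > R} x * (?w x)^2) \<partial>lborel) \<le> ennreal (e/4)" .
      have "(\<integral>\<^sup>+x. ennreal ((norm (?w x))^2) \<partial>lborel)
        = (\<integral>\<^sup>+x. ennreal (indicator {x. norm x \<le> R} x * (?w x)^2) + ennreal (indicator {x. norm x > R} x * (?w x)^2) \<partial>lborel)"
        by (intro nn_integral_cong) (auto split: split_indicator)
      also have "\<dots> = (\<integral>\<^sup>+x. ennreal (indicator {x. norm x \<le> R} x * (?w x)^2) \<partial>lborel) + (\<integral>\<^sup>+x. ennreal (indicator {x. norm x > R} x * (?w x)^2) \<partial>lborel)"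
        by (rule nn_integral_add) measurable
      also have "\<dots> \<le> ennreal (e/2) + ennreal (e/4)" by (intro add_mono inner outer)
      also have "\<dots> \<le> ennreal e" using e by (simp add: ennreal_plus[symmetric] ennreal_leI del: ennreal_plus)
      finally show "(\<integral>\<^sup>+x. ennreal ((norm (u (k m) x - u (k n) x))^2) \<partial>lborel) \<le> ennreal e" .
    qed
  qed
  obtain v r where v: "v \<in> borel_measurable lborel" and r: "strict_mono (r::nat\<Rightarrow>nat)"
    and ae: "AE x in lborel. (\<lambda>i. u (k (r i)) x) \<longlonglongrightarrow> v x"
    and lim: "(\<lambda>n. \<integral>\<^sup>+x. ennreal ((norm (u (k n) x - v x))^2) \<partial>lborel) \<longlonglongrightarrow> 0"
    by (rule riesz_fischer[of "\<lambda>n. u (k n)" lborel, OF _ cauchy]) auto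
  have lim': "(\<lambda>n. \<integral>\<^sup>+x. ennreal ((norm (u (k (r n)) x - v x))^2) \<partial>lborel) \<longlonglongrightarrow> 0"
    using LIMSEQ_subseq_LIMSEQ[OF lim r] by (simp add: comp_def)
  show thesis
  proof (rule that[of "k \<circ> r" v])
    show "strict_mono (k \<circ> r)" using k(1) r by (rule strict_mono_o)
    show "square_integrable v" by (rule l2_limit_square_integrable(1)[OF _ _ lim]) (use u v in auto)
  qed (use ae lim' in auto)
qed

section \<open>Limits of the energies\<close>

text \<open>By Plancherel the transforms converge in \<open>L\<^sup>2\<close> too, hence almost
  everywhere along a subsequence, and Fatou applies to the weighted squares.\<close>

lemma symbol_form_lsc:
  assumes u: "\<And>n. square_integrable (u n)" and v: "square_integrable v"
    and lim: "(\<lambda>n::nat. \<integral>\<^sup>+x. ennreal ((norm (u n x - v x))^2) \<partial>lborel) \<longlonglongrightarrow> 0"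
    and bd: "\<forall>\<^sub>F n in sequentially. symbol_form m (u n) \<le> c"
  shows "symbol_form m v \<le> c"
proof -
  note [measurable] = fhat_measurable[OF u] fhat_measurable[OF v]
  have "(\<integral>\<^sup>+\<xi>. ennreal ((norm (fhat (u n) \<xi> - fhat v \<xi>))^2) \<partial>lborel) = (\<integral>\<^sup>+x. ennreal ((norm (u n x - v x))^2) \<partial>lborel)" for n
  proof -
    have "(\<integral>\<^sup>+\<xi>. ennreal ((norm (fhat (u n) \<xi> - fhat v \<xi>))^2) \<partial>lborel) = (\<integral>\<^sup>+\<xi>. ennreal ((norm (fhat (\<lambda>x. u n x - v x) \<xi>))^2) \<partial>lborel)"
      by (rule nn_integral_cong_AE) (use fhat_diff[OF u v, of n] in \<open>eventually_elim, simp\<close>)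
    then show ?thesis
      using nn_fhat[OF square_integrable_diff[OF u v], of n] nn_mass[OF square_integrable_diff[OF u v], of n] by simp
  qed
  then have "(\<lambda>n. \<integral>\<^sup>+\<xi>. ennreal ((norm (fhat (u n) \<xi> - fhat v \<xi>))^2) \<partial>lborel) \<longlonglongrightarrow> 0" using lim by simp
  then obtain r where r: "strict_mono (r::nat\<Rightarrow>nat)" "AE \<xi> in lborel. (\<lambda>n. fhat (u (r n)) \<xi>) \<longlonglongrightarrow> fhat v \<xi>"
    by (rule l2_AE_subseq[rotated 2]) auto
  show ?thesis unfolding symbol_form_def
  proof (rule nn_fatou_AE[where u="\<lambda>n \<xi>. ennreal (sqrt ((norm \<xi>)^2 + m^2) * (cmod (fhat (u (r n)) \<xi>))^2)"])
    show "AE \<xi> in lborel. (\<lambda>n. ennreal (sqrt ((norm \<xi>)^2 + m^2) * (cmod (fhat (u (r n)) \<xi>))^2)) \<longlonglongrightarrow> ennreal (sqrt ((norm \<xi>)^2 + m^2) * (cmod (fhat v \<xi>))^2)"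
      using r(2) by eventually_elim (intro tendsto_intros)
    show "\<forall>\<^sub>F n in sequentially. (\<integral>\<^sup>+\<xi>. ennreal (sqrt ((norm \<xi>)^2 + m^2) * (cmod (fhat (u (r n)) \<xi>))^2) \<partial>lborel) \<le> c"
      using eventually_subseq[OF r(1) bd] by (simp add: symbol_form_def)
  qed simp
qed

text \<open>Pointwise \<open>u^2 \<le> (1 + l) v^2 + (1 + 1/l) (u - v)^2\<close>, and the mixed
  Coulomb terms are absorbed by positive definiteness. Sending the difference to 0 first and
  \<open>l\<close> to 0 afterwards gives upper semicontinuity of the Hartree energy.\<close>

lemma hart_perturb:
  assumes [measurable]: "u \<in> borel_measurable borel" "v \<in> borel_measurable borel" and l: "l > 0"
  shows "hart u \<le> ennreal ((1 + l)^3) * hart v + ennreal ((1 + 1/l)^3) * hart (\<lambda>x. u x - v x)"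
proof -
  define a where "a = 1 + l"
  define b where "b = 1 + 1/l"
  have ab: "a > 0" "b > 0" using l by (auto simp: a_def b_def add_pos_pos)
  let ?r = "\<lambda>x. u x - v x"
  have pt: "(u x)^2 \<le> a * (v x)^2 + b * (?r x)^2" for x
    using abs_sq_diff_le[OF l, of "u x" "v x"] by (simp add: a_def b_def algebra_simps)
  let ?k = "\<lambda>p. norm (fst p - snd p)"
  let ?V = "\<lambda>x. (v x)^2" and ?R = "\<lambda>x. (?r x)^2"
  have "hart u \<le> (\<integral>\<^sup>+p. (ennreal (a * a) * ennreal (?V (fst p) * ?V (snd p) / ?k p) + ennreal (a * b) * ennreal (?V (fst p) * ?R (snd p) / ?k p))
     + (ennreal (a * b) * ennreal (?R (fst p) * ?V (snd p) / ?k p) + ennreal (b * b) * ennreal (?R (fst p) * ?R (snd p) / ?k p)) \<partial>lborel2)"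
    unfolding coulomb_def
  proof (rule nn_integral_mono)
    fix p :: "R3 \<times> R3"
    have "(u (fst p))^2 * (u (snd p))^2 \<le> (a * ?V (fst p) + b * ?R (fst p)) * (a * ?V (snd p) + b * ?R (snd p))"
      using ab by (intro mult_mono pt) auto
    then have "(u (fst p))^2 * (u (snd p))^2 / ?k p \<le> (a * ?V (fst p) + b * ?R (fst p)) * (a * ?V (snd p) + b * ?R (snd p)) / ?k p"
      by (rule divide_right_mono) simp
    also have "\<dots> = (a * a * (?V (fst p) * ?V (snd p) / ?k p) + a * b * (?V (fst p) * ?R (snd p) / ?k p))
       + (a * b * (?R (fst p) * ?V (snd p) / ?k p) + b * b * (?R (fst p) * ?R (snd p) / ?k p))"
      by (simp add: add_divide_distrib[symmetric] algebra_simps)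
    finally have "ennreal ((u (fst p))^2 * (u (snd p))^2 / ?k p) \<le> ennreal \<dots>" by (rule ennreal_leI)
    also have "\<dots> = (ennreal (a * a) * ennreal (?V (fst p) * ?V (snd p) / ?k p) + ennreal (a * b) * ennreal (?V (fst p) * ?R (snd p) / ?k p))
     + (ennreal (a * b) * ennreal (?R (fst p) * ?V (snd p) / ?k p) + ennreal (b * b) * ennreal (?R (fst p) * ?R (snd p) / ?k p))"
    proof -
      have split: "ennreal ((c1 * x1 + c2 * x2) + (c3 * x3 + c4 * x4)) = (ennreal c1 * ennreal x1 + ennreal c2 * ennreal x2) + (ennreal c3 * ennreal x3 + ennreal c4 * ennreal x4)"
        if "c1 \<ge> 0" "c2 \<ge> 0" "c3 \<ge> 0" "c4 \<ge> 0" "x1 \<ge> 0" "x2 \<ge> 0" "x3 \<ge> 0" "x4 \<ge> 0" for c1 c2 c3 c4 x1 x2 x3 x4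
        using that by (simp add: ennreal_mult)
      show ?thesis by (rule split) (use ab in auto)
    qed
    finally show "ennreal ((u (fst p))^2 * (u (snd p))^2 / ?k p) \<le> \<dots>" .
  qed
  also have "\<dots> = (ennreal (a * a) * hart v + ennreal (a * b) * coulomb ?V ?R) + (ennreal (a * b) * coulomb ?R ?V + ennreal (b * b) * hart ?r)"
    unfolding coulomb_def by (simp add: nn_integral_add nn_integral_cmult)
  also have "coulomb ?R ?V = coulomb ?V ?R" by (rule coulomb_sym) auto
  also have "(ennreal (a * a) * hart v + ennreal (a * b) * coulomb ?V ?R) + (ennreal (a * b) * coulomb ?V ?R + ennreal (b * b) * hart ?r)
     = (ennreal (a * a) * hart v + ennreal (b * b) * hart ?r) + ennreal (a * b) * (2 * coulomb ?V ?R)"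
    by (simp add: mult_2 distrib_left add_ac)
  \<comment> \<open>The parameter \<open>l * a / b\<close> makes the two new coefficients exactly
    \<open>l * a^2\<close> and \<open>b^2 / l\<close>, so that both totals become cubes.\<close>
  also have "\<dots> \<le> (ennreal (a * a) * hart v + ennreal (b * b) * hart ?r) + ennreal (a * b) * (ennreal (l * a / b) * hart v + ennreal (1 / (l * a / b)) * hart ?r)"
    using l ab by (intro add_left_mono mult_left_mono coulomb_AMGM) auto
  also have "\<dots> = (ennreal (a * a) * hart v + ennreal (b * b) * hart ?r) + (ennreal (l * (a * a)) * hart v + ennreal (b * b / l) * hart ?r)"
  proof -
    have 1: "ennreal (a * b) * ennreal (l * a / b) = ennreal (l * (a * a))"
      using l ab by (subst ennreal_mult[symmetric]) auto
    have 2: "ennreal (a * b) * ennreal (1 / (l * a / b)) = ennreal (b * b / l)"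
      using l ab by (subst ennreal_mult[symmetric]) auto
    show ?thesis by (simp only: distrib_left mult.assoc[symmetric] 1 2)
  qed
  also have "\<dots> = ennreal (a * a + l * (a * a)) * hart v + ennreal (b * b + b * b / l) * hart ?r"
    using l ab by (simp add: distrib_right add_ac)
  also have "a * a + l * (a * a) = (1 + l)^3" by (simp add: a_def eval_nat_numeral algebra_simps)
  also have "b * b + b * b / l = b * b * (1 + 1/l)" by (simp add: distrib_left)
  also have "\<dots> = (1 + 1/l)^3" by (simp add: b_def power3_eq_cube)
  finally show ?thesis .
qed

text \<open>Finiteness is stated separately because \<open>enn2real\<close> sends infinity to 0,
  where the inequality would carry no information.\<close>

definition hartree_bound :: "real \<Rightarrow> bool"
  where "hartree_bound A \<longleftrightarrow> A > 0 \<and> (\<forall>u. half_sobolev u \<longrightarrow> hart u < \<infinity> \<and> A / 2 * enn2real (hart u) \<le> kinetic u * mass u)"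

section \<open>Existence of minimizers below the threshold\<close>

lemma hartree_boundD:
  assumes "hartree_bound A"
  shows "A > 0" "half_sobolev u \<Longrightarrow> hart u < \<infinity>" "half_sobolev u \<Longrightarrow> A / 2 * enn2real (hart u) \<le> kinetic u * mass u"
  using assms by (auto simp: hartree_bound_def)

lemma symbol_form_finite: "half_sobolev u \<Longrightarrow> symbol_form m u < \<infinity>"
  using symbol_form_le[of u m] symbol_form_seminorm[of u]
  by (auto simp: half_sobolev_def ennreal_mult_less_top ennreal_add_less_top intro: le_less_trans)

lemma kinetic_le_symbol_form:
  assumes "half_sobolev u" shows "kinetic u \<le> enn2real (symbol_form m u)"
  unfolding kinetic_eq[OF half_sobolevD(1)[OF assms]]
  using symbol_form_finite[OF assms, of m] symbol_form_ge[of u m] by (intro enn2real_mono) auto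

lemma half_sobolev_abs: "half_sobolev u \<Longrightarrow> half_sobolev (\<lambda>x. \<bar>u x\<bar>)"
proof -
  assume u: "half_sobolev u"
  note [measurable] = square_integrableD(1)[OF half_sobolevD(1)[OF u]]
  have a: "square_integrable (\<lambda>x. \<bar>u x\<bar>)"
    by (rule square_integrable_bound[OF half_sobolevD(1)[OF u]]) auto
  have "symbol_form 0 (\<lambda>x. \<bar>u x\<bar>) < \<infinity>"
    using symbol_form_abs_le[OF half_sobolevD(1)[OF u], of 0] symbol_form_finite[OF u, of 0] by (rule le_less_trans)
  then show ?thesis using a kappa_pos
    by (auto simp: half_sobolev_def symbol_form_seminorm ennreal_mult_less_top ennreal_eq_0_iff)
qed

definition potential_form :: "(R3 \<Rightarrow> real) \<Rightarrow> (R3 \<Rightarrow> real) \<Rightarrow> ennreal"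
  where "potential_form V u = (\<integral>\<^sup>+x. ennreal (V x * (u x)^2) \<partial>lborel)"

text \<open>Growth and local boundedness are required almost everywhere, as they have to survive the
  passage to a Borel representative.\<close>

definition trapping :: "(R3 \<Rightarrow> real) \<Rightarrow> bool"
  where "trapping V \<longleftrightarrow> V \<in> borel_measurable borel \<and> (\<forall>x. V x \<ge> 0)
    \<and> (\<forall>M. \<exists>R. AE x in lborel. norm x \<ge> R \<longrightarrow> V x \<ge> M)
    \<and> (\<forall>R. \<exists>M. AE x in lborel. norm x \<le> R \<longrightarrow> V x \<le> M)"

definition admissible :: "(R3 \<Rightarrow> real) \<Rightarrow> (R3 \<Rightarrow> real) \<Rightarrow> bool"
  where "admissible V u \<longleftrightarrow> half_sobolev u \<and> potential_form V u < \<infinity> \<and> mass u = 1"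

definition total_energy :: "real \<Rightarrow> (R3 \<Rightarrow> real) \<Rightarrow> real \<Rightarrow> (R3 \<Rightarrow> real) \<Rightarrow> real"
  where "total_energy m V a u = enn2real (symbol_form m u) + enn2real (potential_form V u) - a / 2 * enn2real (hart u)"

text \<open>The mass \<open>m\<close> can only raise the form, and the Hartree inequality bounds the
  attraction by the fraction \<open>a / A\<close> of the kinetic energy. At \<open>a = A\<close> the
  potential term alone survives, which is the case used at the threshold.\<close>

lemma total_energy_lower:
  assumes A: "hartree_bound A" and a: "0 \<le> a" "a \<le> A" and u: "admissible V u"
  shows "(1 - a / A) * kinetic u + enn2real (potential_form V u) \<le> total_energy m V a u"
proof -
  have h: "half_sobolev u" "mass u = 1" using u by (auto simp: admissible_def)
  have "a / 2 * enn2real (hart u) = a / A * (A / 2 * enn2real (hart u))" using hartree_boundD(1)[OF A] by simp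
  also have "\<dots> \<le> a / A * (kinetic u * mass u)"
    using hartree_boundD(1,3)[OF A] h(1) a by (intro mult_left_mono) auto
  finally have "a / 2 * enn2real (hart u) \<le> a / A * kinetic u" by (simp only: h(2) mult_1_right)
  moreover have "(1 - a / A) * kinetic u = kinetic u - a / A * kinetic u" by (simp add: left_diff_distrib)
  ultimately show ?thesis
    using kinetic_le_symbol_form[OF h(1), of m] unfolding total_energy_def by linarith
qed

lemma admissible_abs:
  assumes "admissible V u"
  shows "admissible V (\<lambda>x. \<bar>u x\<bar>)" "total_energy m V a (\<lambda>x. \<bar>u x\<bar>) \<le> total_energy m V a u"
proof -
  have h: "half_sobolev u" using assms by (simp add: admissible_def)
  show "admissible V (\<lambda>x. \<bar>u x\<bar>)"
    using assms half_sobolev_abs[OF h] by (simp add: admissible_def potential_form_def mass_def)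
  have "enn2real (symbol_form m (\<lambda>x. \<bar>u x\<bar>)) \<le> enn2real (symbol_form m u)"
    using symbol_form_abs_le[OF half_sobolevD(1)[OF h], of m] symbol_form_finite[OF h, of m] by (intro enn2real_mono) auto
  then show "total_energy m V a (\<lambda>x. \<bar>u x\<bar>) \<le> total_energy m V a u"
    by (simp add: total_energy_def potential_form_def)
qed

text \<open>Chebyshev's inequality: outside the ball the potential is at least
  \<open>M\<close>.\<close>

lemma tail_le_potential:
  assumes V: "V \<in> borel_measurable borel" "\<And>x. V x \<ge> 0" and R: "AE x in lborel. norm x \<ge> R \<longrightarrow> V x \<ge> M" and M: "M > 0"
    and u[measurable]: "u \<in> borel_measurable borel"
  shows "(\<integral>\<^sup>+x. ennreal (indicator {x. norm x > R} x * (u x)^2) \<partial>lborel) \<le> ennreal (1/M) * potential_form V u"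
proof -
  note [measurable] = V(1)
  have "(\<integral>\<^sup>+x. ennreal (indicator {x. norm x > R} x * (u x)^2) \<partial>lborel) \<le> (\<integral>\<^sup>+x. ennreal (1/M) * ennreal (V x * (u x)^2) \<partial>lborel)"
  proof (rule nn_integral_mono_AE)
    show "AE x in lborel. ennreal (indicator {x. norm x > R} x * (u x)^2) \<le> ennreal (1/M) * ennreal (V x * (u x)^2)"
      using R
    proof eventually_elim
      case (elim x)
      have "indicator {x. norm x > R} x * (u x)^2 \<le> 1/M * (V x * (u x)^2)"
      proof (cases "norm x > R")
        case True
        then have "M * (u x)^2 \<le> V x * (u x)^2" using elim by (intro mult_right_mono) auto
        then show ?thesis using True M by (simp add: field_simps)
      qed (use V(2)[of x] M in auto)
      then show ?case using V(2)[of x] M by (subst ennreal_mult[symmetric]) (auto intro!: ennreal_leI)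
    qed
  qed
  then show ?thesis unfolding potential_form_def by (subst nn_integral_cmult[symmetric]) auto
qed

lemma bounded_pair_subseq:
  fixes T P :: "nat \<Rightarrow> real"
  assumes "\<And>n. \<bar>T n\<bar> \<le> B" "\<And>n. \<bar>P n\<bar> \<le> B"
  obtains k t p where "strict_mono (k::nat\<Rightarrow>nat)" "(\<lambda>n. T (k n)) \<longlonglongrightarrow> t" "(\<lambda>n. P (k n)) \<longlonglongrightarrow> p"
proof -
  obtain k where k: "strict_mono (k::nat\<Rightarrow>nat)" "\<And>i. i \<in> (UNIV::bool set) \<Longrightarrow> \<exists>l. (\<lambda>n. if i then T (k n) else P (k n)) \<longlonglongrightarrow> l"
    by (rule function_convergent_subsequence[of "UNIV::bool set" "\<lambda>n i. if i then T n else P n" B]) (use assms in auto)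
  from k(2)[of True] k(2)[of False] k(1) show thesis using that by auto
qed

text \<open>Coercivity bounds the kinetic energy and the potential forces tightness, so a minimizing
  sequence converges in \<open>L\<^sup>2\<close> along a subsequence. The attraction passes to the
  limit through the Hartree inequality for the differences: their kinetic energies are bounded and
  their masses vanish. Finally the limit is replaced by its absolute value.\<close>

lemma exists_minimizer:
  assumes A: "hartree_bound A" and a: "0 \<le> a" "a < A" and V: "trapping V" and ne: "admissible V w0"
  shows "\<exists>v. admissible V v \<and> (\<forall>w. admissible V w \<longrightarrow> total_energy m V a v \<le> total_energy m V a w) \<and> (\<forall>x. 0 \<le> v x)"
proof -
  have Vm[measurable]: "V \<in> borel_measurable borel" and V0: "\<And>x. V x \<ge> 0"
    and Vinf: "\<And>M. \<exists>R. AE x in lborel. norm x \<ge> R \<longrightarrow> V x \<ge> M"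
    using V by (auto simp: trapping_def)
  let ?E = "total_energy m V a"
  have A0: "A > 0" by (rule hartree_boundD(1)[OF A])
  \<comment> \<open>The fraction of kinetic energy left over by the attraction; it is positive
    because \<open>a < A\<close>.\<close>
  define q where "q = 1 - a / A"
  have q: "q > 0" using a A0 by (simp add: q_def)
  have low: "q * kinetic u + enn2real (potential_form V u) \<le> ?E u" if "admissible V u" for u
    unfolding q_def using total_energy_lower[OF A a(1) _ that] a by simp
  have kin0: "kinetic u \<ge> 0" if "admissible V u" for u
    using that kinetic_nonneg by (simp add: admissible_def half_sobolev_def)
  have E0: "0 \<le> ?E u" if "admissible V u" for u
  proof -
    have "0 \<le> q * kinetic u" using kin0[OF that] q by simp
    then show ?thesis using low[OF that] enn2real_nonneg[of "potential_form V u"] by linarith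
  qed
  define S where "S = ?E ` {u. admissible V u}"
  define e0 where "e0 = Inf S"
  have bdd: "bdd_below S" unfolding S_def using E0 by (intro bdd_belowI[of _ 0]) auto
  have e0_le: "e0 \<le> ?E u" if "admissible V u" for u
    unfolding e0_def by (rule cInf_lower[OF _ bdd]) (use that in \<open>auto simp: S_def\<close>)
  have "\<exists>u. admissible V u \<and> ?E u < e0 + 1 / real (Suc n)" for n
  proof -
    have "\<exists>s\<in>S. s < e0 + 1 / real (Suc n)"
      unfolding e0_def by (rule cInf_lessD) (use ne in \<open>auto simp: S_def\<close>)
    then show ?thesis by (auto simp: S_def)
  qed
  then obtain u where u: "\<And>n. admissible V (u n)" and uE: "\<And>n. ?E (u n) < e0 + 1 / real (Suc n)" by metis
  have us: "half_sobolev (u n)" "square_integrable (u n)" "mass (u n) = 1" for n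
    using u by (auto simp: admissible_def half_sobolev_def)
  note [measurable] = square_integrableD(1)[OF us(2)]
  define B where "B = e0 + 1"
  have uB: "?E (u n) \<le> B" for n
  proof -
    have "1 / real (Suc n) \<le> 1" by simp
    then show ?thesis using uE[of n] unfolding B_def by linarith
  qed
  have B0: "B \<ge> 0" using E0[OF u] uB by (meson order_trans)
  have P: "enn2real (potential_form V (u n)) \<le> B" for n
  proof -
    have "0 \<le> q * kinetic (u n)" using kin0[OF u, of n] q by simp
    then show ?thesis using low[OF u, of n] uB[of n] by linarith
  qed
  have K: "kinetic (u n) \<le> B / q" for n
  proof -
    have "q * kinetic (u n) \<le> B" using low[OF u, of n] uB[of n] enn2real_nonneg[of "potential_form V (u n)"] by linarith
    then show ?thesis using q by (simp add: field_simps)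
  qed
  have Pe: "potential_form V (u n) \<le> ennreal B" for n
  proof -
    have "potential_form V (u n) = ennreal (enn2real (potential_form V (u n)))"
      using u[of n] by (simp add: admissible_def)
    also have "\<dots> \<le> ennreal B" by (intro ennreal_leI P)
    finally show ?thesis .
  qed
  define D where "D n = enn2real (hart (u n))" for n
  have D: "A / 2 * D n \<le> kinetic (u n)" for n
    using hartree_boundD(3)[OF A us(1), of n] us(3) by (simp add: D_def)
  have Tb: "enn2real (symbol_form m (u n)) \<le> B + a / A * (B / q)" for n
  proof -
    have "a / 2 * D n = a / A * (A / 2 * D n)" using A0 by simp
    also have "\<dots> \<le> a / A * (B / q)" using order_trans[OF D K, of n] a A0 by (intro mult_left_mono) auto
    finally show ?thesis using uB[of n] enn2real_nonneg[of "potential_form V (u n)"]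
      unfolding total_energy_def D_def[symmetric] by linarith
  qed
  \<comment> \<open>One constant has to bound masses and seminorms; the masses equal 1.\<close>
  define C where "C = max 1 (B / q / kappa)"
  have sem: "seminorm (u n) \<le> ennreal C" for n
  proof -
    have "seminorm (u n) = ennreal (enn2real (seminorm (u n)))" using us(1)[of n] by (simp add: half_sobolev_def)
    also have "ennreal (enn2real (seminorm (u n))) = ennreal (kinetic (u n) / kappa)"
      using kappa_pos by (simp add: kinetic_seminorm us)
    also have "\<dots> \<le> ennreal C"
    proof (rule ennreal_leI)
      have "kinetic (u n) / kappa \<le> B / q / kappa" using K[of n] kappa_pos by (intro divide_right_mono) auto
      also have "\<dots> \<le> C" unfolding C_def by (rule max.cobounded2)
      finally show "kinetic (u n) / kappa \<le> C" .
    qed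
    finally show ?thesis .
  qed
  have tight: "\<exists>R. \<forall>n. (\<integral>\<^sup>+x. ennreal (indicator {x. norm x > R} x * (u n x)^2) \<partial>lborel) \<le> ennreal e" if e: "e > 0" for e
  proof -
    \<comment> \<open>The summand 1 keeps \<open>M\<close> positive when
      \<open>B = 0\<close>.\<close>
    define M where "M = (B + 1) / e"
    have M: "M > 0" "1 / M * B \<le> e" using e B0 by (auto simp: M_def field_simps)
    obtain R where R: "AE x in lborel. norm x \<ge> R \<longrightarrow> V x \<ge> M" using Vinf by blast
    show ?thesis
    proof (intro exI[of _ R] allI)
      fix n
      have "(\<integral>\<^sup>+x. ennreal (indicator {x. norm x > R} x * (u n x)^2) \<partial>lborel) \<le> ennreal (1/M) * potential_form V (u n)"
        by (rule tail_le_potential[OF Vm V0 R M(1)]) simp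
      also have "\<dots> \<le> ennreal (1/M) * ennreal B" by (intro mult_left_mono Pe) simp
      also have "\<dots> = ennreal (1/M * B)" using M B0 by (intro ennreal_mult[symmetric]) auto
      also have "\<dots> \<le> ennreal e" by (intro ennreal_leI M)
      finally show "(\<integral>\<^sup>+x. ennreal (indicator {x. norm x > R} x * (u n x)^2) \<partial>lborel) \<le> ennreal e" .
    qed
  qed
  obtain r v where r: "strict_mono (r::nat\<Rightarrow>nat)" and v: "square_integrable v"
    and ae: "AE x in lborel. (\<lambda>n. u (r n) x) \<longlonglongrightarrow> v x"
    and lim: "(\<lambda>n. \<integral>\<^sup>+x. ennreal ((norm (u (r n) x - v x))^2) \<partial>lborel) \<longlonglongrightarrow> 0"
    by (rule rellich[OF us(2) _ sem tight]) (auto simp: us C_def)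
  note [measurable] = square_integrableD(1)[OF v]
  define T where "T n = enn2real (symbol_form m (u (r n)))" for n
  define Q where "Q n = enn2real (potential_form V (u (r n)))" for n
  have aAq: "a / A * (B / q) \<ge> 0" using a A0 B0 q by simp
  have TB: "\<bar>T n\<bar> \<le> B + a / A * (B / q)" for n
    unfolding T_def using Tb[of "r n"] enn2real_nonneg[of "symbol_form m (u (r n))"] by linarith
  have QB: "\<bar>Q n\<bar> \<le> B + a / A * (B / q)" for n
    unfolding Q_def using P[of "r n"] aAq enn2real_nonneg[of "potential_form V (u (r n))"] by linarith
  \<comment> \<open>Kinetic and potential part are lower semicontinuous separately, so each gets a
    limit of its own before being compared with its value at \<open>v\<close>.\<close>
  obtain k t p where k: "strict_mono (k::nat\<Rightarrow>nat)" and t: "(\<lambda>n. T (k n)) \<longlonglongrightarrow> t" and p: "(\<lambda>n. Q (k n)) \<longlonglongrightarrow> p"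
    by (rule bounded_pair_subseq[OF TB QB])
  define w where "w n = u (r (k n))" for n
  have ws: "half_sobolev (w n)" "square_integrable (w n)" "mass (w n) = 1" "admissible V (w n)" for n
    using us u by (auto simp: w_def)
  note [measurable] = square_integrableD(1)[OF ws(2)]
  have wlim: "(\<lambda>n. \<integral>\<^sup>+x. ennreal ((norm (w n x - v x))^2) \<partial>lborel) \<longlonglongrightarrow> 0"
    using LIMSEQ_subseq_LIMSEQ[OF lim k] by (simp add: comp_def w_def)
  have wae: "AE x in lborel. (\<lambda>n. w n x) \<longlonglongrightarrow> v x"
    using ae
  proof eventually_elim
    case (elim x)
    show ?case using LIMSEQ_subseq_LIMSEQ[OF elim k] by (simp add: comp_def w_def)
  qed
  have wE: "?E (w n) < e0 + 1 / real (Suc n)" for n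
  proof -
    have "n \<le> r (k n)" using seq_suble[OF r, of "k n"] seq_suble[OF k, of n] by linarith
    then have "1 / real (Suc (r (k n))) \<le> 1 / real (Suc n)" by (intro divide_left_mono) auto
    then show ?thesis using uE[of "r (k n)"] unfolding w_def by linarith
  qed
  have massv: "mass v = 1"
    using l2_limit_square_integrable(2)[OF ws(2) _ wlim] by (simp add: ws(3) LIMSEQ_const_iff)
  have t0: "t \<ge> 0" by (rule LIMSEQ_le_const[OF t]) (auto simp: T_def)
  have p0: "p \<ge> 0" by (rule LIMSEQ_le_const[OF p]) (auto simp: Q_def)
  have Tv: "symbol_form m v \<le> ennreal t"
  proof (rule ennreal_le_epsilon)
    fix e :: real assume e: "0 < e"
    have ev: "\<forall>\<^sub>F n in sequentially. T (k n) < t + e" by (rule order_tendstoD(2)[OF t]) (use e in simp)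
    have "symbol_form m v \<le> ennreal (t + e)"
    proof (rule symbol_form_lsc[OF ws(2) v wlim])
      show "\<forall>\<^sub>F n in sequentially. symbol_form m (w n) \<le> ennreal (t + e)"
        using ev
      proof eventually_elim
        case (elim n)
        have "symbol_form m (w n) = ennreal (T (k n))"
          using symbol_form_finite[OF ws(1), of m n] by (simp add: T_def w_def)
        then show ?case using elim by (simp add: ennreal_leI)
      qed
    qed
    then show "symbol_form m v \<le> ennreal t + ennreal e" using t0 e by simp
  qed
  have Pv: "potential_form V v \<le> ennreal p"
  proof (rule ennreal_le_epsilon)
    fix e :: real assume e: "0 < e"
    have ev: "\<forall>\<^sub>F n in sequentially. Q (k n) < p + e" by (rule order_tendstoD(2)[OF p]) (use e in simp)
    have "potential_form V v \<le> ennreal (p + e)" unfolding potential_form_def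
    proof (rule nn_fatou_AE[where u="\<lambda>n x. ennreal (V x * (w n x)^2)"])
      show "AE x in lborel. (\<lambda>n. ennreal (V x * (w n x)^2)) \<longlonglongrightarrow> ennreal (V x * (v x)^2)"
        using wae by eventually_elim (intro tendsto_intros)
      show "\<forall>\<^sub>F n in sequentially. (\<integral>\<^sup>+x. ennreal (V x * (w n x)^2) \<partial>lborel) \<le> ennreal (p + e)"
        using ev
      proof eventually_elim
        case (elim n)
        have "potential_form V (w n) = ennreal (Q (k n))"
          using ws(4)[of n] by (simp add: Q_def w_def admissible_def)
        then show ?case using elim by (simp add: ennreal_leI potential_form_def)
      qed
    qed simp
    then show "potential_form V v \<le> ennreal p + ennreal e" using p0 e by simp
  qed
  have hv: "half_sobolev v"
  proof -
    have "symbol_form 0 v < \<infinity>"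
      by (rule le_less_trans[OF order_trans[OF symbol_form_ge Tv]]) simp
    then show ?thesis using v kappa_pos
      by (auto simp: half_sobolev_def symbol_form_seminorm ennreal_mult_less_top ennreal_eq_0_iff)
  qed
  have av: "admissible V v"
    using hv Pv massv by (auto simp: admissible_def intro: le_less_trans)
  define d where "d n = (\<lambda>x. w n x - v x)" for n
  have hd: "half_sobolev (d n)" for n unfolding d_def by (rule half_sobolev_diff[OF ws(1) hv])
  define G where "G = kappa * (2 * C + 2 * enn2real (seminorm v))"
  have kd: "kinetic (d n) \<le> G" for n
  proof -
    have "seminorm (d n) \<le> 2 * seminorm (w n) + 2 * seminorm v" unfolding d_def by (rule seminorm_diff_le) auto
    also have "\<dots> \<le> 2 * ennreal C + 2 * ennreal (enn2real (seminorm v))"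
      using sem hv by (intro add_mono mult_left_mono) (auto simp: w_def half_sobolev_def)
    also have "\<dots> = ennreal (2 * C + 2 * enn2real (seminorm v))"
      using C_def by (simp add: ennreal_two_mult[symmetric] ennreal_plus[symmetric] del: ennreal_plus)
    finally have "enn2real (seminorm (d n)) \<le> 2 * C + 2 * enn2real (seminorm v)"
      by (intro enn2real_leI) (auto simp: C_def)
    then show ?thesis using kappa_pos by (simp add: G_def kinetic_seminorm[OF half_sobolevD(1)[OF hd]])
  qed
  have md: "(\<lambda>n. mass (d n)) \<longlonglongrightarrow> 0"
  proof -
    have "(\<lambda>n. ennreal (mass (d n))) \<longlonglongrightarrow> ennreal 0"
      using wlim nn_mass[OF half_sobolevD(1)[OF hd]] by (simp add: d_def)
    then show ?thesis by (subst (asm) tendsto_ennreal_iff) (auto simp: mass_nonneg)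
  qed
  have Dd: "(\<lambda>n. enn2real (hart (d n))) \<longlonglongrightarrow> 0"
  proof (rule tendsto_sandwich[OF _ _ tendsto_const])
    show "(\<lambda>n. 2 / A * (G * mass (d n))) \<longlonglongrightarrow> 0"
      using tendsto_mult[OF tendsto_const[of "2/A"] tendsto_mult[OF tendsto_const[of G] md]] by simp
    show "\<forall>\<^sub>F n in sequentially. enn2real (hart (d n)) \<le> 2 / A * (G * mass (d n))"
    proof (intro always_eventually allI)
      fix n
      have "A / 2 * enn2real (hart (d n)) \<le> G * mass (d n)"
        using hartree_boundD(3)[OF A hd, of n] mult_right_mono[OF kd mass_nonneg, of n "d n"] by linarith
      then show "enn2real (hart (d n)) \<le> 2 / A * (G * mass (d n))" using A0 by (simp add: field_simps)
    qed
  qed auto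
  define Dv where "Dv = enn2real (hart v)"
  \<comment> \<open>The index \<open>n\<close> tends to infinity with \<open>l\<close> fixed, which
    kills the term with the large factor \<open>(1 + 1/l)^3\<close>; \<open>l\<close> goes to 0
    afterwards.\<close>
  have step: "t + p \<le> e0 + a / 2 * ((1 + l)^3 * Dv)" if l: "l > 0" for l
  proof (rule LIMSEQ_le[OF tendsto_add[OF t p]])
    have "(\<lambda>n. e0 + 1 / real (Suc n) + a / 2 * ((1 + l)^3 * Dv + (1 + 1/l)^3 * enn2real (hart (d n))))
       \<longlonglongrightarrow> e0 + 0 + a / 2 * ((1 + l)^3 * Dv + (1 + 1/l)^3 * 0)"
      by (intro tendsto_intros Dd LIMSEQ_Suc[OF lim_1_over_n])
    then show "(\<lambda>n. e0 + 1 / real (Suc n) + a / 2 * ((1 + l)^3 * Dv + (1 + 1/l)^3 * enn2real (hart (d n)))) \<longlonglongrightarrow> e0 + a / 2 * ((1 + l)^3 * Dv)"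
      by simp
    show "\<exists>N. \<forall>n\<ge>N. T (k n) + Q (k n) \<le> e0 + 1 / real (Suc n) + a / 2 * ((1 + l)^3 * Dv + (1 + 1/l)^3 * enn2real (hart (d n)))"
    proof (intro exI[of _ 0] allI impI)
      fix n
      have "hart (w n) \<le> ennreal ((1 + l)^3) * hart v + ennreal ((1 + 1/l)^3) * hart (d n)"
        unfolding d_def by (rule hart_perturb) (use l in auto)
      also have "\<dots> = ennreal ((1 + l)^3) * ennreal Dv + ennreal ((1 + 1/l)^3) * ennreal (enn2real (hart (d n)))"
        using hartree_boundD(2)[OF A hv] hartree_boundD(2)[OF A hd, of n] by (simp add: Dv_def)
      also have "\<dots> = ennreal ((1 + l)^3 * Dv + (1 + 1/l)^3 * enn2real (hart (d n)))"
        using l by (simp add: ennreal_mult Dv_def)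
      finally have "enn2real (hart (w n)) \<le> (1 + l)^3 * Dv + (1 + 1/l)^3 * enn2real (hart (d n))"
        using l by (intro enn2real_leI) (auto simp: Dv_def)
      then have "a / 2 * enn2real (hart (w n)) \<le> a / 2 * ((1 + l)^3 * Dv + (1 + 1/l)^3 * enn2real (hart (d n)))"
        using a by (intro mult_left_mono) auto
      moreover have "T (k n) + Q (k n) = ?E (w n) + a / 2 * enn2real (hart (w n))"
        by (simp add: T_def Q_def w_def total_energy_def)
      ultimately show "T (k n) + Q (k n) \<le> e0 + 1 / real (Suc n) + a / 2 * ((1 + l)^3 * Dv + (1 + 1/l)^3 * enn2real (hart (d n)))"
        using wE[of n] by linarith
    qed
  qed
  have fin: "t + p \<le> e0 + a / 2 * Dv"
  proof (rule LIMSEQ_le_const)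
    have "(\<lambda>n. e0 + a / 2 * ((1 + 1 / real (Suc n))^3 * Dv)) \<longlonglongrightarrow> e0 + a / 2 * ((1 + 0)^3 * Dv)"
      by (intro tendsto_intros LIMSEQ_Suc[OF lim_1_over_n])
    then show "(\<lambda>n. e0 + a / 2 * ((1 + 1 / real (Suc n))^3 * Dv)) \<longlonglongrightarrow> e0 + a / 2 * Dv" by simp
    show "\<exists>N. \<forall>n\<ge>N. t + p \<le> e0 + a / 2 * ((1 + 1 / real (Suc n))^3 * Dv)"
      by (intro exI[of _ 0] allI impI step) simp
  qed
  have "enn2real (symbol_form m v) \<le> t" "enn2real (potential_form V v) \<le> p"
    using Tv Pv t0 p0 by (auto intro!: enn2real_leI)
  then have "?E v \<le> e0" using fin by (simp add: total_energy_def Dv_def)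
  then have "?E (\<lambda>x. \<bar>v x\<bar>) \<le> e0" using admissible_abs(2)[OF av, of m a] by linarith
  then show ?thesis
    using admissible_abs(1)[OF av] e0_le by (intro exI[of _ "\<lambda>x. \<bar>v x\<bar>"]) force
qed

section \<open>The virial inequality\<close>

lemma integrable_norm_fhat:
  assumes u: "half_sobolev u"
  shows "integrable lborel (\<lambda>\<xi>. norm \<xi> * (cmod (fhat u \<xi>))^2)" "(\<integral>\<xi>. norm \<xi> * (cmod (fhat u \<xi>))^2 \<partial>lborel) = kinetic u"
proof -
  note [measurable] = fhat_measurable[OF half_sobolevD(1)[OF u]]
  have s: "(\<integral>\<^sup>+\<xi>. ennreal (norm \<xi> * (cmod (fhat u \<xi>))^2) \<partial>lborel) = symbol_form 0 u"
    unfolding symbol_form_def by simp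
  show "integrable lborel (\<lambda>\<xi>. norm \<xi> * (cmod (fhat u \<xi>))^2)"
    using symbol_form_finite[OF u, of 0] s by (intro integrableI_nonneg) auto
  have "(\<integral>\<xi>. norm \<xi> * (cmod (fhat u \<xi>))^2 \<partial>lborel) = enn2real (symbol_form 0 u)"
    unfolding s[symmetric] by (intro integral_eq_nn_integral) auto
  then show "(\<integral>\<xi>. norm \<xi> * (cmod (fhat u \<xi>))^2 \<partial>lborel) = kinetic u"
    by (simp add: kinetic_eq[OF half_sobolevD(1)[OF u]])
qed

section \<open>Polarization of the weak equation\<close>

text \<open>Polarized through the difference rather than the sum, since the difference of
  \<open>Q\<close> and its dilate is the small quantity later.\<close>

lemma multiplier_form_polarization:
  assumes u: "half_sobolev u" and v: "half_sobolev v"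
  shows "multiplier_form norm u v = (kinetic u + kinetic v - kinetic (\<lambda>x. u x - v x)) / 2"
proof -
  note su = half_sobolevD(1)[OF u] and sv = half_sobolevD(1)[OF v]
  have uv: "half_sobolev (\<lambda>x. u x - v x)" by (rule half_sobolev_diff[OF u v])
  note suv = half_sobolevD(1)[OF uv]
  note [measurable] = fhat_measurable[OF su] fhat_measurable[OF sv] fhat_measurable[OF suv]
  have pol: "Re (a * cnj b) = ((cmod a)^2 + (cmod b)^2 - (cmod (a - b))\<^sup>2) / 2" for a b
    unfolding cmod_power2 by (simp add: power2_eq_square algebra_simps)
  have ae: "AE \<xi> in lborel. norm \<xi> * Re (fourier_real u \<xi> * cnj (fourier_real v \<xi>))
     = (norm \<xi> * (cmod (fhat u \<xi>))^2 + norm \<xi> * (cmod (fhat v \<xi>))^2 - norm \<xi> * (cmod (fhat (\<lambda>x. u x - v x) \<xi>))^2) / 2"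
    using fourier_eq_fhat[OF su] fourier_eq_fhat[OF sv] fhat_diff[OF su sv]
    by eventually_elim (simp only: pol, simp add: right_diff_distrib distrib_left)
  have rm: "(\<lambda>\<xi>. (norm \<xi> * (cmod (fhat u \<xi>))^2 + norm \<xi> * (cmod (fhat v \<xi>))^2 - norm \<xi> * (cmod (fhat (\<lambda>x. u x - v x) \<xi>))^2) / 2) \<in> borel_measurable lebesgue"
    by (rule borel_imp_lebesgue) measurable
  have "multiplier_form norm u v = (\<integral>\<xi>. (norm \<xi> * (cmod (fhat u \<xi>))^2 + norm \<xi> * (cmod (fhat v \<xi>))^2 - norm \<xi> * (cmod (fhat (\<lambda>x. u x - v x) \<xi>))^2) / 2 \<partial>lebesgue)"
    unfolding multiplier_form_def
  proof (rule integral_cong_AE)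
    show "(\<lambda>\<xi>. norm \<xi> * Re (fourier_real u \<xi> * cnj (fourier_real v \<xi>))) \<in> borel_measurable lebesgue"
      by (rule borel_measurable_AE[OF rm]) (use ae in \<open>simp add: AE_completion_iff eq_commute\<close>)
  qed (use ae rm in \<open>simp_all add: AE_completion_iff\<close>)
  also have "\<dots> = (\<integral>\<xi>. (norm \<xi> * (cmod (fhat u \<xi>))^2 + norm \<xi> * (cmod (fhat v \<xi>))^2 - norm \<xi> * (cmod (fhat (\<lambda>x. u x - v x) \<xi>))^2) / 2 \<partial>lborel)"
    by (rule lebesgue_integral_borel) measurable
  also have "\<dots> = (kinetic u + kinetic v - kinetic (\<lambda>x. u x - v x)) / 2"
    using integrable_norm_fhat[OF u] integrable_norm_fhat[OF v] integrable_norm_fhat[OF uv] by simp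
  finally show ?thesis .
qed

lemma product_polarization: "a * b = (a^2 + b^2 - (a - b)\<^sup>2) / (2::real)"
  by (simp add: power2_eq_square algebra_simps)

lemma integral_product_polarization:
  assumes u: "square_integrable u" and v: "square_integrable v"
  shows "(\<integral>x. u x * v x \<partial>lebesgue) = (mass u + mass v - mass (\<lambda>x. u x - v x)) / 2"
proof -
  note [measurable] = square_integrableD(1)[OF u] square_integrableD(1)[OF v]
  have "(\<integral>x. u x * v x \<partial>lebesgue) = (\<integral>x. u x * v x \<partial>lborel)" by (rule lebesgue_integral_borel) measurable
  also have "\<dots> = (\<integral>x. ((u x)^2 + (v x)^2 - (u x - v x)\<^sup>2) / 2 \<partial>lborel)" by (simp add: product_polarization)
  also have "\<dots> = (mass u + mass v - mass (\<lambda>x. u x - v x)) / 2"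
    using square_integrableD(2)[OF u] square_integrableD(2)[OF v] square_integrableD(2)[OF square_integrable_diff[OF u v]]
    by (simp add: mass_def)
  finally show ?thesis .
qed

lemma coulomb_finite:
  assumes A: "hartree_bound A" and u: "half_sobolev u" and v: "half_sobolev v"
  shows "coulomb (\<lambda>x. (u x)^2) (\<lambda>x. (v x)^2) < \<infinity>"
    and "2 * enn2real (coulomb (\<lambda>x. (u x)^2) (\<lambda>x. (v x)^2)) \<le> enn2real (hart u) + enn2real (hart v)"
proof -
  note [measurable] = square_integrableD(1)[OF half_sobolevD(1)[OF u]] square_integrableD(1)[OF half_sobolevD(1)[OF v]]
  have le: "2 * coulomb (\<lambda>x. (u x)^2) (\<lambda>x. (v x)^2) \<le> hart u + hart v"
    using coulomb_AMGM[of "\<lambda>x. (u x)^2" "\<lambda>x. (v x)^2" 1] by simp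
  have fin: "hart u + hart v < \<infinity>" using hartree_boundD(2)[OF A u] hartree_boundD(2)[OF A v] by (simp add: ennreal_add_less_top)
  have "coulomb (\<lambda>x. (u x)^2) (\<lambda>x. (v x)^2) \<le> 2 * coulomb (\<lambda>x. (u x)^2) (\<lambda>x. (v x)^2)"
    by (simp add: mult_2)
  then show "coulomb (\<lambda>x. (u x)^2) (\<lambda>x. (v x)^2) < \<infinity>" using le fin by (meson le_less_trans)
  have "enn2real (2 * coulomb (\<lambda>x. (u x)^2) (\<lambda>x. (v x)^2)) \<le> enn2real (hart u + hart v)"
    using fin by (intro enn2real_mono[OF le]) auto
  also have "\<dots> = enn2real (hart u) + enn2real (hart v)"
    using hartree_boundD(2)[OF A u] hartree_boundD(2)[OF A v] by (intro enn2real_plus) auto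
  finally show "2 * enn2real (coulomb (\<lambda>x. (u x)^2) (\<lambda>x. (v x)^2)) \<le> enn2real (hart u) + enn2real (hart v)"
    by (simp add: enn2real_mult)
qed

text \<open>With \<open>w\<close> frozen its Coulomb potential is a nonnegative weight, so the
  bilinear term polarizes like an integral of products; the Hartree inequality makes all three terms
  finite.\<close>

lemma potential_polarization:
  assumes A: "hartree_bound A" and u: "half_sobolev u" and v: "half_sobolev v" and w: "half_sobolev w"
  shows "(\<integral>x. coulomb_potential (\<lambda>y. (w y)^2) x * u x * v x \<partial>lebesgue)
    = (enn2real (coulomb (\<lambda>x. (w x)^2) (\<lambda>x. (u x)^2)) + enn2real (coulomb (\<lambda>x. (w x)^2) (\<lambda>x. (v x)^2))
        - enn2real (coulomb (\<lambda>x. (w x)^2) (\<lambda>x. (u x - v x)^2))) / 2"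
proof -
  let ?W = "coulomb_potential (\<lambda>y. (w y)^2)"
  note sw = half_sobolevD(1)[OF w]
  note [measurable] = square_integrableD(1)[OF half_sobolevD(1)[OF u]] square_integrableD(1)[OF half_sobolevD(1)[OF v]] square_integrableD(1)[OF sw]
  have X: "has_bochner_integral lborel (\<lambda>x. ?W x * (g x)^2) (enn2real (coulomb (\<lambda>x. (w x)^2) (\<lambda>x. (g x)^2)))"
    if g: "half_sobolev g" for g
  proof -
    note [measurable] = square_integrableD(1)[OF half_sobolevD(1)[OF g]]
    have "(\<integral>\<^sup>+x. ennreal (?W x * (g x)^2) \<partial>lborel) = ennreal (enn2real (coulomb (\<lambda>x. (w x)^2) (\<lambda>x. (g x)^2)))"
      using nn_coulomb_potential[OF sw, of g] coulomb_finite(1)[OF A w g] by simp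
    then show ?thesis by (intro has_bochner_integral_nn_integral) (auto simp: coulomb_potential_nonneg)
  qed
  have "(\<integral>x. ?W x * u x * v x \<partial>lebesgue) = (\<integral>x. ?W x * u x * v x \<partial>lborel)" by (rule lebesgue_integral_borel) measurable
  also have "\<dots> = (\<integral>x. (?W x * (u x)^2 + ?W x * (v x)^2 - ?W x * (u x - v x)^2) / 2 \<partial>lborel)"
    by (simp add: power2_eq_square algebra_simps)
  also have "\<dots> = (enn2real (coulomb (\<lambda>x. (w x)^2) (\<lambda>x. (u x)^2)) + enn2real (coulomb (\<lambda>x. (w x)^2) (\<lambda>x. (v x)^2))
        - enn2real (coulomb (\<lambda>x. (w x)^2) (\<lambda>x. (u x - v x)^2))) / 2"
    using X[OF u] X[OF v] X[OF half_sobolev_diff[OF u v]] by (simp add: has_bochner_integral_iff)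
  finally show ?thesis .
qed

text \<open>After polarization the mixed Coulomb energy is at most the mean of the two Hartree
  energies, by positive definiteness, and the Coulomb term of the remainder has a favourable sign.
  Hence kinetic energy and mass are all that has to be estimated of the remainder
  \<open>Q - \<phi>\<close>.\<close>

lemma weak_equation_identity:
  assumes A: "hartree_bound A" and Q: "half_sobolev Q" and \<phi>: "half_sobolev \<phi>"
    and eq: "multiplier_form norm Q \<phi> + (\<integral>x. Q x * \<phi> x \<partial>lebesgue) - (\<integral>x. coulomb_potential (\<lambda>y. (Q y)^2) x * Q x * \<phi> x \<partial>lebesgue) = 0"
  shows "kinetic Q + kinetic \<phi> + mass Q + mass \<phi> - (enn2real (hart Q) + enn2real (hart \<phi>)) / 2 - enn2real (hart Q)
     \<le> kinetic (\<lambda>x. Q x - \<phi> x) + mass (\<lambda>x. Q x - \<phi> x)"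
proof -
  have alg: "k + k1 + n + n1 - (d + d1) / 2 - d \<le> kr + nr"
    if "(k + k1 - kr) / 2 + (n + n1 - nr) / 2 - (d + x - xr) / 2 = 0" "2 * x \<le> d + d1" "0 \<le> xr"
    for k k1 kr n n1 nr d d1 x xr :: real
    using that by (simp add: field_simps)
  show ?thesis
    by (rule alg[OF _ coulomb_finite(2)[OF A Q \<phi>] enn2real_nonneg[of "coulomb (\<lambda>x. (Q x)^2) (\<lambda>x. (Q x - \<phi> x)^2)"]])
       (use eq in \<open>simp only: multiplier_form_polarization[OF Q \<phi>]
          integral_product_polarization[OF half_sobolevD(1)[OF Q] half_sobolevD(1)[OF \<phi>]]
          potential_polarization[OF A Q \<phi> Q]\<close>)
qed

lemma ennreal_mult_le_cancel: "c > 0 \<Longrightarrow> ennreal c * a \<le> ennreal c * b \<Longrightarrow> a \<le> b"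
  by (subst (asm) ennreal_mult_le_mult_iff) auto

section \<open>Estimates for the difference between a function and its dilate\<close>

text \<open>On pairs at distance at most \<open>2 h\<close> the heat kernel at time
  \<open>h^2\<close> is at least a constant times \<open>h^-3\<close>, so the integral is controlled
  by \<open>h^3\<close> times \<open>heat_jump (h^2) u\<close>; and
  \<open>1 - exp (-y) \<le> y\<close> bounds the latter by \<open>2 h^2 S\<close>.\<close>

lemma nn_close_pairs:
  assumes u: "square_integrable u" and h: "h > 0"
    and S: "(\<integral>\<^sup>+\<xi>. ennreal ((norm \<xi>)^2 * (cmod (fhat u \<xi>))^2) \<partial>lborel) \<le> ennreal S" "S \<ge> 0"
  shows "(\<integral>\<^sup>+p. ennreal (indicator {p. norm (fst p - snd p) \<le> 2 * h} p * (u (fst p) - u (snd p))^2) \<partial>lborel2)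
     \<le> ennreal (2 * exp 1 * sqrt (4 * pi) ^ 3 * S * h^5)"
proof -
  note [measurable] = square_integrableD(1)[OF u] fhat_measurable[OF u]
  \<comment> \<open>The factor \<open>exp 1\<close> is the loss of the Gaussian at distance
    \<open>2 h\<close>, the cube of the root its normalization.\<close>
  define c where "c = exp 1 * sqrt (4 * pi) ^ 3"
  have c: "c > 0" by (simp add: c_def)
  have h2: "h^2 > 0" using h by simp
  have "heat_jump (h^2) u \<le> ennreal (2 * h^2 * S)"
  proof -
    have "ennreal (1/2) * heat_jump (h^2) u \<le> (\<integral>\<^sup>+\<xi>. ennreal (h^2) * ennreal ((norm \<xi>)^2 * (cmod (fhat u \<xi>))^2) \<partial>lborel)"
      unfolding fhat_heat_jump[OF u h2, symmetric]
    proof (rule nn_integral_mono)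
      fix \<xi> :: R3
      have "1 - exp (- h\<^sup>2 * (norm \<xi>)^2) \<le> h^2 * (norm \<xi>)^2"
        using exp_ge_add_one_self[of "- h\<^sup>2 * (norm \<xi>)^2"] by simp
      from mult_right_mono[OF this, of "(cmod (fhat u \<xi>))^2"]
      show "ennreal ((1 - exp (- h\<^sup>2 * (norm \<xi>)^2)) * (cmod (fhat u \<xi>))^2) \<le> ennreal (h^2) * ennreal ((norm \<xi>)^2 * (cmod (fhat u \<xi>))^2)"
        by (subst ennreal_mult[symmetric]) (auto intro!: ennreal_leI simp: mult.assoc)
    qed
    also have "\<dots> \<le> ennreal (h^2) * ennreal S" using S(1) by (subst nn_integral_cmult) (auto intro: mult_left_mono)
    also have "\<dots> = ennreal (h^2 * S)" using S(2) by (intro ennreal_mult[symmetric]) auto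
    finally have "2 * (ennreal (1/2) * heat_jump (h^2) u) \<le> 2 * ennreal (h^2 * S)" by (intro mult_left_mono) auto
    moreover have "2 * (ennreal (1/2) * heat_jump (h^2) u) = heat_jump (h^2) u"
      using ennreal_two_mult[of "1/2"] by (simp only: mult.assoc[symmetric]) simp
    moreover have "2 * ennreal (h^2 * S) = ennreal (2 * h^2 * S)"
      using ennreal_two_mult[of "h^2 * S"] S(2) by (simp add: mult.assoc)
    ultimately show ?thesis by simp
  qed
  note hj = this
  have "(\<integral>\<^sup>+p. ennreal (indicator {p. norm (fst p - snd p) \<le> 2 * h} p * (u (fst p) - u (snd p))^2) \<partial>lborel2)
    \<le> (\<integral>\<^sup>+p. ennreal (c * h^3) * ennreal (heat (h^2) (fst p - snd p) * (u (fst p) - u (snd p))^2) \<partial>lborel2)"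
  proof (rule nn_integral_mono)
    fix p :: "R3 \<times> R3"
    have "indicator {p. norm (fst p - snd p) \<le> 2 * h} p \<le> c * h^3 * heat (h^2) (fst p - snd p)"
    proof (cases "norm (fst p - snd p) \<le> 2 * h")
      case True
      then have "(norm (fst p - snd p))^2 \<le> (2 * h)^2" by (intro power_mono) auto
      then have "(norm (fst p - snd p))^2 / (4 * h^2) \<le> 1" using h by (simp add: power_mult_distrib)
      then have e: "exp 1 * exp (- (norm (fst p - snd p))\<^sup>2 / (4 * h^2)) \<ge> 1" by (simp add: exp_add[symmetric])
      have "sqrt (4 * pi * h^2) ^ 3 = sqrt (4 * pi) ^ 3 * h^3" using h by (simp add: real_sqrt_mult power_mult_distrib)
      then have "c * h^3 * heat (h^2) (fst p - snd p) = exp 1 * exp (- (norm (fst p - snd p))\<^sup>2 / (4 * h^2))"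
        using h by (simp add: c_def heat_def)
      then show ?thesis using e True by simp
    qed (use c h h2 heat_nonneg in auto)
    from mult_right_mono[OF this, of "(u (fst p) - u (snd p))^2"]
    show "ennreal (indicator {p. norm (fst p - snd p) \<le> 2 * h} p * (u (fst p) - u (snd p))^2)
      \<le> ennreal (c * h^3) * ennreal (heat (h^2) (fst p - snd p) * (u (fst p) - u (snd p))^2)"
      using c h heat_nonneg[OF h2] by (subst ennreal_mult[symmetric]) (auto intro!: ennreal_leI simp: mult.assoc)
  qed
  also have "\<dots> = ennreal (c * h^3) * heat_jump (h^2) u" unfolding heat_jump_def by (rule nn_integral_cmult) measurable
  also have "\<dots> \<le> ennreal (c * h^3) * ennreal (2 * h^2 * S)" by (intro mult_left_mono hj) simp
  also have "\<dots> = ennreal (2 * exp 1 * sqrt (4 * pi) ^ 3 * S * h^5)"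
    using c h S(2) by (subst ennreal_mult[symmetric]) (auto simp: c_def eval_nat_numeral mult_ac)
  finally show ?thesis .
qed

text \<open>The points \<open>x\<close> and \<open>\<lambda>x\<close> are compared through an average over the points \<open>y\<close> of a small ball around \<open>x\<close>.\<close>

lemma dilation_difference_inner:
  assumes u: "square_integrable u" and \<rho>: "\<rho> > 0" and R: "R > 0"
    and S: "(\<integral>\<^sup>+\<xi>. ennreal ((norm \<xi>)^2 * (cmod (fhat u \<xi>))^2) \<partial>lborel) \<le> ennreal S" "S \<ge> 0"
  shows "(\<integral>\<^sup>+x. ennreal (indicator {x. norm x \<le> R} x * (u ((1 + \<rho>) *\<^sub>R x) - u x)^2) \<partial>lborel)
     \<le> ennreal (8 * exp 1 * sqrt (4 * pi) ^ 3 * S / unit_ball_vol 3 * (\<rho> * R)^2)"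
proof -
  note [measurable] = square_integrableD(1)[OF u]
  \<comment> \<open>The dilation moves a point of the ball of radius \<open>R\<close> by at most
    \<open>\<rho> * R\<close>; a \<open>y\<close> within \<open>h\<close> of \<open>x\<close> is
    then within \<open>2 h\<close> of the dilated point.\<close>
  define h where "h = \<rho> * R"
  have h: "h > 0" using \<rho> R by (simp add: h_def)
  define l where "l = 1 + \<rho>"
  have l: "l \<ge> 1" "l > 0" using \<rho> by (auto simp: l_def)
  define F where "F p = ennreal (indicator {p. norm (fst p - snd p) \<le> 2 * h} p * (u (fst p) - u (snd p))^2)" for p :: "R3 \<times> R3"
  have [measurable]: "F \<in> borel_measurable lborel2" unfolding F_def by measurable
  define \<Phi> where "\<Phi> = (\<integral>\<^sup>+p. F p \<partial>lborel2)"
  have \<Phi>: "\<Phi> \<le> ennreal (2 * exp 1 * sqrt (4 * pi) ^ 3 * S * h^5)"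
    unfolding \<Phi>_def F_def by (rule nn_close_pairs[OF u h S])
  have iter: "(\<integral>\<^sup>+x. (\<integral>\<^sup>+y. F (x, y) \<partial>lborel) \<partial>lborel) = \<Phi>"
    unfolding \<Phi>_def by (rule lborel.nn_integral_fst) measurable
  have \<omega>: "unit_ball_vol 3 > (0::real)" by (rule unit_ball_vol_pos) simp
  let ?r = "\<lambda>x. ennreal (indicator {x. norm x \<le> R} x * (u (l *\<^sub>R x) - u x)^2)"
  have pt: "ennreal (unit_ball_vol 3 * h^3) * ?r x \<le> 2 * (\<integral>\<^sup>+y. F (l *\<^sub>R x, y) \<partial>lborel) + 2 * (\<integral>\<^sup>+y. F (x, y) \<partial>lborel)" for x
  proof (cases "norm x \<le> R")
    case True
    have "ennreal (unit_ball_vol 3 * h^3) * ?r x = (\<integral>\<^sup>+y. ?r x * indicator (cball x h) y \<partial>lborel)"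
      using emeasure_cball[of h x] h by (subst nn_integral_cmult_indicator) (auto simp: mult.commute)
    also have "\<dots> \<le> (\<integral>\<^sup>+y. 2 * F (l *\<^sub>R x, y) + 2 * F (x, y) \<partial>lborel)"
    proof (rule nn_integral_mono)
      fix y :: R3
      show "?r x * indicator (cball x h) y \<le> 2 * F (l *\<^sub>R x, y) + 2 * F (x, y)"
      proof (cases "y \<in> cball x h")
        case y: True
        have xy: "norm (x - y) \<le> h" using y by (simp add: dist_norm)
        have "norm (l *\<^sub>R x - y) \<le> norm (l *\<^sub>R x - x) + norm (x - y)" using norm_triangle_ineq[of "l *\<^sub>R x - x" "x - y"] by simp
        also have "l *\<^sub>R x - x = \<rho> *\<^sub>R x" by (simp add: l_def algebra_simps)
        also have "norm (\<rho> *\<^sub>R x) \<le> \<rho> * R" using True \<rho> by simp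
        finally have ly: "norm (l *\<^sub>R x - y) \<le> 2 * h" using xy by (simp add: h_def)
        have "(u (l *\<^sub>R x) - u x)^2 \<le> 2 * (u (l *\<^sub>R x) - u y)^2 + 2 * (u x - u y)^2"
          using sq_diff_le[of "u (l *\<^sub>R x) - u y" "u x - u y"] by simp
        then show ?thesis using y ly xy h True
          by (simp add: F_def ennreal_two_mult[symmetric] ennreal_plus[symmetric] ennreal_leI del: ennreal_plus)
      qed simp
    qed
    also have "\<dots> = 2 * (\<integral>\<^sup>+y. F (l *\<^sub>R x, y) \<partial>lborel) + 2 * (\<integral>\<^sup>+y. F (x, y) \<partial>lborel)"
      by (subst nn_integral_add, simp, simp, subst nn_integral_cmult, simp, subst nn_integral_cmult, simp, rule refl)
    finally show ?thesis .
  qed simp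
  have sc: "(\<integral>\<^sup>+x. (\<integral>\<^sup>+y. F (l *\<^sub>R x, y) \<partial>lborel) \<partial>lborel) \<le> \<Phi>"
  proof -
    have "(\<integral>\<^sup>+x. (\<integral>\<^sup>+y. F (l *\<^sub>R x, y) \<partial>lborel) \<partial>lborel) = ennreal (1 / l^3) * \<Phi>"
      unfolding iter[symmetric] by (rule nn_integral_scale_R3[where f="\<lambda>x. \<integral>\<^sup>+y. F (x, y) \<partial>lborel"]) (use l in auto)
    also have "\<dots> \<le> 1 * \<Phi>" using l by (intro mult_right_mono) (auto simp: ennreal_le_1)
    finally show ?thesis by simp
  qed
  have "ennreal (unit_ball_vol 3 * h^3) * (\<integral>\<^sup>+x. ?r x \<partial>lborel) = (\<integral>\<^sup>+x. ennreal (unit_ball_vol 3 * h^3) * ?r x \<partial>lborel)"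
    by (rule nn_integral_cmult[symmetric]) measurable
  also have "\<dots> \<le> (\<integral>\<^sup>+x. 2 * (\<integral>\<^sup>+y. F (l *\<^sub>R x, y) \<partial>lborel) + 2 * (\<integral>\<^sup>+y. F (x, y) \<partial>lborel) \<partial>lborel)"
    by (intro nn_integral_mono pt)
  also have "\<dots> = 2 * (\<integral>\<^sup>+x. (\<integral>\<^sup>+y. F (l *\<^sub>R x, y) \<partial>lborel) \<partial>lborel) + 2 * (\<integral>\<^sup>+x. (\<integral>\<^sup>+y. F (x, y) \<partial>lborel) \<partial>lborel)"
    by (subst nn_integral_add, measurable, subst nn_integral_cmult, measurable, subst nn_integral_cmult, measurable)
  also have "\<dots> \<le> 2 * \<Phi> + 2 * \<Phi>" using sc iter by (intro add_mono mult_left_mono) auto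
  also have "\<dots> = 4 * \<Phi>" by (simp flip: distrib_right)
  also have "\<dots> \<le> 4 * ennreal (2 * exp 1 * sqrt (4 * pi) ^ 3 * S * h^5)" by (intro mult_left_mono \<Phi>) auto
  also have "\<dots> = ennreal (unit_ball_vol 3 * h^3) * ennreal (8 * exp 1 * sqrt (4 * pi) ^ 3 * S / unit_ball_vol 3 * h^2)"
  proof -
    have "4 * ennreal y = ennreal (4 * y)" if "y \<ge> 0" for y using that by (simp add: ennreal_mult)
    then have "4 * ennreal (2 * exp 1 * sqrt (4 * pi) ^ 3 * S * h^5) = ennreal (4 * (2 * exp 1 * sqrt (4 * pi) ^ 3 * S * h^5))"
      using S(2) h by simp
    also have "4 * (2 * exp 1 * sqrt (4 * pi) ^ 3 * S * h^5) = (unit_ball_vol 3 * h^3) * (8 * exp 1 * sqrt (4 * pi) ^ 3 * S / unit_ball_vol 3 * h^2)"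
      using less_imp_neq[OF \<omega>] by (simp add: field_simps eval_nat_numeral)
    also have "ennreal \<dots> = ennreal (unit_ball_vol 3 * h^3) * ennreal (8 * exp 1 * sqrt (4 * pi) ^ 3 * S / unit_ball_vol 3 * h^2)"
      using \<omega> h S(2) by (intro ennreal_mult) auto
    finally show ?thesis .
  qed
  finally show ?thesis unfolding l_def h_def
    by (rule ennreal_mult_le_cancel[rotated]) (use \<omega> h in \<open>simp add: h_def\<close>)
qed

definition quartic_decay :: "(R3 \<Rightarrow> real) \<Rightarrow> real \<Rightarrow> real \<Rightarrow> bool"
  where "quartic_decay Q C R \<longleftrightarrow> R \<ge> 1 \<and> C \<ge> 0 \<and> (AE x in lborel. norm x \<ge> R \<longrightarrow> \<bar>Q x\<bar> \<le> C / norm x ^ 4)"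

lemma decay_square_bound:
  fixes q r \<rho> C :: real
  assumes "\<bar>q\<bar> \<le> C / r ^ 4" "r \<ge> \<rho>" "\<rho> \<ge> 1" "C \<ge> 0"
  shows "q^2 \<le> C^2 / \<rho>^4 * (1 / r^4)"
proof -
  have "\<bar>q\<bar>^2 \<le> (C / r^4)^2" using assms by (intro power_mono) auto
  also have "\<dots> = C^2 * (1 / r^4) * (1 / r^4)" by (simp add: power2_eq_square)
  also have "\<dots> \<le> C^2 * (1 / \<rho>^4) * (1 / r^4)"
    using assms by (intro mult_right_mono mult_left_mono divide_left_mono power_mono) auto
  finally show ?thesis by simp
qed

text \<open>Of the bound \<open>C^2 / |x|^8\<close>, half of the power is evaluated at radius
  \<open>R\<close>, the other half is kept to make the integral converge.\<close>

lemma decay_tail: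
  assumes Q: "Q \<in> borel_measurable borel" "quartic_decay Q C R0"
  obtains B where "B \<ge> 0" "\<And>R. R \<ge> R0 \<Longrightarrow> (\<integral>\<^sup>+x. ennreal (indicator {x. norm x \<ge> R} x * (Q x)^2) \<partial>lborel) \<le> ennreal (B / R^4)"
proof -
  obtain C1 where C1: "C1 > 0" "\<And>y::R3. (\<integral>\<^sup>+x. ennreal (indicator (cball y 1) x / norm (x - y)) \<partial>lborel) \<le> ennreal C1"
    "(\<integral>\<^sup>+(x::R3). ennreal (indicator {x. norm x \<ge> 1} x / norm x ^ 4) \<partial>lborel) \<le> ennreal C1"
    by (rule inverse_norm_local) blast
  have R0: "R0 \<ge> 1" "C \<ge> 0" and ae: "AE x in lborel. norm x \<ge> R0 \<longrightarrow> \<bar>Q x\<bar> \<le> C / norm x ^ 4"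
    using Q(2) by (auto simp: quartic_decay_def)
  show thesis
  proof (rule that[of "C^2 * C1"])
    fix R assume R: "R \<ge> R0"
    have "(\<integral>\<^sup>+x. ennreal (indicator {x. norm x \<ge> R} x * (Q x)^2) \<partial>lborel)
      \<le> (\<integral>\<^sup>+(x::R3). ennreal (C^2 / R^4) * ennreal (indicator {x. norm x \<ge> 1} x / norm x ^ 4) \<partial>lborel)"
    proof (rule nn_integral_mono_AE)
      show "AE x in lborel. ennreal (indicator {x. norm x \<ge> R} x * (Q x)^2) \<le> ennreal (C^2 / R^4) * ennreal (indicator {x. norm x \<ge> 1} x / norm x ^ 4)"
        using ae
      proof eventually_elim
        case (elim x)
        show ?case
        proof (cases "norm x \<ge> R")
          case True
          then have "(Q x)^2 \<le> C^2 / R^4 * (1 / norm x ^ 4)"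
            using elim R R0 by (intro decay_square_bound) auto
          then show ?thesis using True R R0
            by (subst ennreal_mult[symmetric]) (auto intro!: ennreal_leI split: split_indicator)
        qed simp
      qed
    qed
    also have "\<dots> = ennreal (C^2 / R^4) * (\<integral>\<^sup>+(x::R3). ennreal (indicator {x. norm x \<ge> 1} x / norm x ^ 4) \<partial>lborel)"
      by (rule nn_integral_cmult) measurable
    also have "\<dots> \<le> ennreal (C^2 / R^4) * ennreal C1" by (intro mult_left_mono C1) simp
    also have "\<dots> = ennreal (C^2 * C1 / R^4)" using C1(1) R R0 by (subst ennreal_mult[symmetric]) auto
    finally show "(\<integral>\<^sup>+x. ennreal (indicator {x. norm x \<ge> R} x * (Q x)^2) \<partial>lborel) \<le> ennreal (C^2 * C1 / R^4)" .
  qed (use C1(1) in simp)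
qed

text \<open>As \<open>l \<ge> 1\<close>, the dilation moves points outside the ball further out, so
  both terms are tails of \<open>u\<close>; its Jacobian factor \<open>1 / l^3\<close> is at most
  1.\<close>

lemma dilation_difference_outer:
  fixes u :: "R3 \<Rightarrow> real"
  assumes u[measurable]: "u \<in> borel_measurable borel" and l: "l \<ge> 1" and R: "R \<ge> 0"
  shows "(\<integral>\<^sup>+x. ennreal (indicator {x. norm x > R} x * (u (l *\<^sub>R x) - u x)^2) \<partial>lborel)
     \<le> 4 * (\<integral>\<^sup>+x. ennreal (indicator {x. norm x \<ge> R} x * (u x)^2) \<partial>lborel)"
proof -
  let ?T = "\<integral>\<^sup>+x. ennreal (indicator {x. norm x \<ge> R} x * (u x)^2) \<partial>lborel"
  have "(\<integral>\<^sup>+x. ennreal (indicator {x. norm x > R} x * (u (l *\<^sub>R x) - u x)^2) \<partial>lborel)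
    \<le> (\<integral>\<^sup>+x. 2 * ennreal (indicator {x. norm x \<ge> R} (l *\<^sub>R x) * (u (l *\<^sub>R x))^2) + 2 * ennreal (indicator {x. norm x \<ge> R} x * (u x)^2) \<partial>lborel)"
  proof (rule nn_integral_mono)
    fix x :: R3
    show "ennreal (indicator {x. norm x > R} x * (u (l *\<^sub>R x) - u x)^2) \<le> 2 * ennreal (indicator {x. norm x \<ge> R} (l *\<^sub>R x) * (u (l *\<^sub>R x))^2) + 2 * ennreal (indicator {x. norm x \<ge> R} x * (u x)^2)"
    proof (cases "norm x > R")
      case True
      have "norm x \<le> l * norm x" using l mult_right_mono[of 1 l "norm x"] by simp
      then have "R \<le> l * norm x" using True by linarith
      then show ?thesis using True l sq_diff_le[of "u (l *\<^sub>R x)" "u x"]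
        by (simp add: ennreal_two_mult[symmetric] ennreal_plus[symmetric] ennreal_leI del: ennreal_plus)
    qed simp
  qed
  also have "\<dots> = 2 * (\<integral>\<^sup>+x. ennreal (indicator {x. norm x \<ge> R} (l *\<^sub>R x) * (u (l *\<^sub>R x))^2) \<partial>lborel) + 2 * ?T"
    by (subst nn_integral_add, measurable, subst nn_integral_cmult, measurable, subst nn_integral_cmult, measurable)
  also have "(\<integral>\<^sup>+x. ennreal (indicator {x. norm x \<ge> R} (l *\<^sub>R x) * (u (l *\<^sub>R x))^2) \<partial>lborel) = ennreal (1 / l^3) * ?T"
    by (rule nn_integral_scale_R3[where f="\<lambda>x. ennreal (indicator {x. norm x \<ge> R} x * (u x)^2)"]) (use l in auto)
  also have "2 * (ennreal (1 / l^3) * ?T) + 2 * ?T \<le> 2 * (1 * ?T) + 2 * ?T"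
    using l by (intro add_mono mult_left_mono mult_right_mono) (auto simp: ennreal_le_1)
  also have "\<dots> = 4 * ?T" by (simp flip: distrib_right)
  finally show ?thesis .
qed

lemma integral_scale_R3:
  fixes g :: "R3 \<Rightarrow> complex"
  assumes [measurable]: "g \<in> borel_measurable borel" and c: "c > 0"
  shows "(\<integral>x. g (c *\<^sub>R x) \<partial>lborel) = (1 / c^3) *\<^sub>R (\<integral>x. g x \<partial>lborel)"
proof -
  have "(\<integral>x. g x \<partial>lborel) = (\<integral>x. g x \<partial>(density (distr lborel borel (\<lambda>x::R3. 0 + c *\<^sub>R x)) (\<lambda>_. \<bar>c\<bar>^DIM(R3))))"
    using lborel_affine[of c "0::R3"] c by simp
  also have "\<dots> = (\<bar>c\<bar>^3) *\<^sub>R (\<integral>x. g (c *\<^sub>R x) \<partial>lborel)"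
    by (subst integral_density) (auto simp: integral_distr)
  finally show ?thesis using c by simp
qed

lemma ft_dilation:
  assumes [measurable]: "u \<in> borel_measurable borel" and l: "l > 0"
  shows "ft (\<lambda>x. u (l *\<^sub>R x)) \<xi> = (1 / l^3) *\<^sub>R ft u ((1/l) *\<^sub>R \<xi>)"
proof -
  let ?g = "\<lambda>y. cis (- (y \<bullet> ((1/l) *\<^sub>R \<xi>))) * complex_of_real (u y)"
  have "(\<integral>x. cis (- (x \<bullet> \<xi>)) * complex_of_real (u (l *\<^sub>R x)) \<partial>lborel) = (\<integral>x. ?g (l *\<^sub>R x) \<partial>lborel)"
    using l by simp
  also have "\<dots> = (1 / l^3) *\<^sub>R (\<integral>x. ?g x \<partial>lborel)" by (rule integral_scale_R3) (use l in auto)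
  finally show ?thesis by (simp add: ft_lborel)
qed

text \<open>The transform of the dilate is \<open>l^-3\<close> times the transform at
  \<open>\<xi> / l\<close>; moment, square and Jacobian give
  \<open>l^(8 - 6 + 3) = l^5 \<le> 32\<close>. Integrability of \<open>u\<close> gives access to
  this explicit formula.\<close>

lemma high_frequency_dilation:
  assumes i: "integrable lborel u" and u: "square_integrable u" and l: "l \<ge> 1" "l \<le> 2"
    and S: "(\<integral>\<^sup>+\<xi>. ennreal (norm \<xi> ^ 8 * (cmod (fhat u \<xi>))^2) \<partial>lborel) \<le> ennreal S"
  shows "(\<integral>\<^sup>+\<xi>. ennreal (norm \<xi> ^ 8 * (cmod (fhat (\<lambda>x. u (l *\<^sub>R x)) \<xi>))^2) \<partial>lborel) \<le> 32 * ennreal S"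
proof -
  note [measurable] = square_integrableD(1)[OF u] fhat_measurable[OF u]
  have eq: "rescale 1 l 0 u = (\<lambda>x. u (l *\<^sub>R x))" by (simp add: rescale_def fun_eq_iff)
  have l0: "l > 0" using l by simp
  have su: "square_integrable (\<lambda>x. u (l *\<^sub>R x))" using square_integrable_rescale[OF u l0, of 1 0] by (simp add: eq)
  have iu: "integrable lborel (\<lambda>x. u (l *\<^sub>R x))"
  proof (rule integrableI_bounded)
    show "(\<integral>\<^sup>+x. ennreal (norm (u (l *\<^sub>R x))) \<partial>lborel) < \<infinity>"
      using nn_integral_scale_R3[of "\<lambda>x. ennreal (norm (u x))" l] i l0 by (auto simp: integrable_iff_bounded ennreal_mult_less_top)
  qed measurable
  let ?f = "\<lambda>\<xi>. ennreal (norm \<xi> ^ 8 * (cmod (ft u \<xi>))^2)"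
  have "(\<integral>\<^sup>+\<xi>. ennreal (norm \<xi> ^ 8 * (cmod (fhat (\<lambda>x. u (l *\<^sub>R x)) \<xi>))^2) \<partial>lborel)
     = (\<integral>\<^sup>+\<xi>. ennreal (norm \<xi> ^ 8 * (cmod (ft (\<lambda>x. u (l *\<^sub>R x)) \<xi>))^2) \<partial>lborel)"
    by (rule nn_integral_cong_AE) (use fhat_eq_ft[OF iu su] in \<open>eventually_elim, simp\<close>)
  also have "\<dots> = (\<integral>\<^sup>+\<xi>. ennreal (l^2) * ?f ((1/l) *\<^sub>R \<xi>) \<partial>lborel)"
  proof (rule nn_integral_cong)
    fix \<xi> :: R3
    have "norm \<xi> ^ 8 * (cmod (ft (\<lambda>x. u (l *\<^sub>R x)) \<xi>))^2 = l^2 * (norm ((1/l) *\<^sub>R \<xi>) ^ 8 * (cmod (ft u ((1/l) *\<^sub>R \<xi>)))^2)"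
      unfolding ft_dilation[OF square_integrableD(1)[OF u] l0] using l0
      by (simp add: power_divide power_mult_distrib) (simp add: field_simps eval_nat_numeral)
    then show "ennreal (norm \<xi> ^ 8 * (cmod (ft (\<lambda>x. u (l *\<^sub>R x)) \<xi>))^2) = ennreal (l^2) * ?f ((1/l) *\<^sub>R \<xi>)"
      by (simp add: ennreal_mult[symmetric])
  qed
  also have "\<dots> = ennreal (l^2) * (\<integral>\<^sup>+\<xi>. ?f ((1/l) *\<^sub>R \<xi>) \<partial>lborel)" by (rule nn_integral_cmult) measurable
  also have "(\<integral>\<^sup>+\<xi>. ?f ((1/l) *\<^sub>R \<xi>) \<partial>lborel) = ennreal (1 / (1/l)^3) * (\<integral>\<^sup>+\<xi>. ?f \<xi> \<partial>lborel)"
    by (rule nn_integral_scale_R3) (use l0 in auto)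
  also have "(\<integral>\<^sup>+\<xi>. ?f \<xi> \<partial>lborel) = (\<integral>\<^sup>+\<xi>. ennreal (norm \<xi> ^ 8 * (cmod (fhat u \<xi>))^2) \<partial>lborel)"
    by (rule nn_integral_cong_AE) (use fhat_eq_ft[OF i u] in \<open>eventually_elim, simp\<close>)
  also have "ennreal (l^2) * (ennreal (1 / (1/l)^3) * (\<integral>\<^sup>+\<xi>. ennreal (norm \<xi> ^ 8 * (cmod (fhat u \<xi>))^2) \<partial>lborel))
     = ennreal (l^5) * (\<integral>\<^sup>+\<xi>. ennreal (norm \<xi> ^ 8 * (cmod (fhat u \<xi>))^2) \<partial>lborel)"
  proof -
    have "ennreal (l^2) * ennreal (1 / (1/l)^3) = ennreal (l^2 * (1 / (1/l)^3))"
      using l0 by (intro ennreal_mult[symmetric]) auto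
    also have "l^2 * (1 / (1/l)^3) = l^5" using l0 by (simp add: power_divide eval_nat_numeral)
    finally show ?thesis by (simp only: mult.assoc[symmetric])
  qed
  also have "\<dots> \<le> ennreal 32 * ennreal S"
  proof (intro mult_mono S ennreal_leI)
    have "l^5 \<le> 2^5" using l by (intro power_mono) auto
    then show "l^5 \<le> 32" by simp
  qed auto
  finally show ?thesis by simp
qed

text \<open>Frequencies are split at \<open>M\<close>, with
  \<open>|\<xi>| \<le> M + |\<xi>|^8 / M^7\<close>. The eighth power is high enough for the kinetic
  energy of the virial remainder to be nearly as small as its mass.\<close>

lemma kinetic_interpolation:
  assumes u: "half_sobolev u" and M: "M > 0"
    and S: "(\<integral>\<^sup>+\<xi>. ennreal (norm \<xi> ^ 8 * (cmod (fhat u \<xi>))^2) \<partial>lborel) \<le> ennreal S" "S \<ge> 0"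
  shows "kinetic u \<le> M * mass u + S / M^7"
proof -
  note [measurable] = fhat_measurable[OF half_sobolevD(1)[OF u]]
  have "ennreal (kinetic u) \<le> (\<integral>\<^sup>+\<xi>. ennreal M * ennreal ((cmod (fhat u \<xi>))^2) + ennreal (1 / M^7) * ennreal (norm \<xi> ^ 8 * (cmod (fhat u \<xi>))^2) \<partial>lborel)"
    unfolding ennreal_kinetic[OF u] symbol_form_def
  proof (rule nn_integral_mono)
    fix \<xi> :: R3
    have "norm \<xi> \<le> M + 1 / M^7 * norm \<xi> ^ 8"
    proof (cases "norm \<xi> \<le> M")
      case True
      moreover have "0 \<le> 1 / M^7 * norm \<xi> ^ 8" using M by simp
      ultimately show ?thesis by linarith
    next
      case False
      then have "M^7 \<le> norm \<xi> ^ 7" using M by (intro power_mono) auto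
      then have "1 * norm \<xi> \<le> (norm \<xi> ^ 7 / M^7) * norm \<xi>" using M by (intro mult_right_mono) auto
      also have "\<dots> = 1 / M^7 * norm \<xi> ^ 8" by (simp add: eval_nat_numeral)
      finally show ?thesis using M by simp
    qed
    from mult_right_mono[OF this, of "(cmod (fhat u \<xi>))^2"]
    have "sqrt ((norm \<xi>)^2 + 0^2) * (cmod (fhat u \<xi>))^2 \<le> M * (cmod (fhat u \<xi>))^2 + 1 / M^7 * (norm \<xi> ^ 8 * (cmod (fhat u \<xi>))^2)"
      by (simp add: distrib_right mult.assoc)
    then have le: "ennreal (sqrt ((norm \<xi>)^2 + 0^2) * (cmod (fhat u \<xi>))^2) \<le> ennreal (M * (cmod (fhat u \<xi>))^2 + 1 / M^7 * (norm \<xi> ^ 8 * (cmod (fhat u \<xi>))^2))"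
      by (rule ennreal_leI)
    have lin: "ennreal (a * b + c * d) = ennreal a * ennreal b + ennreal c * ennreal d" if "a \<ge> 0" "b \<ge> 0" "c \<ge> 0" "d \<ge> 0" for a b c d
      using that by (simp add: ennreal_mult)
    show "ennreal (sqrt ((norm \<xi>)^2 + 0^2) * (cmod (fhat u \<xi>))^2) \<le> ennreal M * ennreal ((cmod (fhat u \<xi>))^2) + ennreal (1 / M^7) * ennreal (norm \<xi> ^ 8 * (cmod (fhat u \<xi>))^2)"
      by (rule order_trans[OF le], subst lin) (use M in auto)
  qed
  also have "\<dots> = ennreal M * ennreal (mass u) + ennreal (1 / M^7) * (\<integral>\<^sup>+\<xi>. ennreal (norm \<xi> ^ 8 * (cmod (fhat u \<xi>))^2) \<partial>lborel)"
    by (subst nn_integral_add, measurable, subst nn_integral_cmult, measurable, subst nn_integral_cmult, measurable)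
       (simp add: nn_fhat[OF half_sobolevD(1)[OF u]])
  also have "\<dots> \<le> ennreal M * ennreal (mass u) + ennreal (1 / M^7) * ennreal S"
    by (intro add_left_mono mult_left_mono S) simp
  also have "\<dots> = ennreal (M * mass u + S / M^7)"
    using M S(2) mass_nonneg[of u] by (simp add: ennreal_mult[symmetric] ennreal_plus[symmetric] del: ennreal_plus)
  finally show ?thesis using M S(2) mass_nonneg[of u] by (subst (asm) ennreal_le_iff) auto
qed

text \<open>Testing the equation with a dilate \<open>Q(\<lambda>\<cdot>)\<close> gives the virial inequality to first order in \<open>\<lambda> - 1\<close>,
  because the remainder \<open>Q - Q(\<lambda>\<cdot>)\<close> is \<open>o(\<lambda> - 1)\<close> in the square of the \<open>H\<^bsup>1/2\<^esup>\<close> norm.\<close>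

lemma pohozaev:
  assumes A: "hartree_bound A" and Q: "half_sobolev Q" and i: "integrable lborel Q"
    and decay: "quartic_decay Q C R0"
    and S2: "(\<integral>\<^sup>+\<xi>. ennreal ((norm \<xi>)^2 * (cmod (fhat Q \<xi>))^2) \<partial>lborel) \<le> ennreal S"
    and S8: "(\<integral>\<^sup>+\<xi>. ennreal (norm \<xi> ^ 8 * (cmod (fhat Q \<xi>))^2) \<partial>lborel) \<le> ennreal S" and S: "S \<ge> 0"
    and eq: "\<And>\<phi>. half_sobolev \<phi> \<Longrightarrow>
      multiplier_form norm Q \<phi> + (\<integral>x. Q x * \<phi> x \<partial>lebesgue) - (\<integral>x. coulomb_potential (\<lambda>y. (Q y)^2) x * Q x * \<phi> x \<partial>lebesgue) = 0"
  shows "kinetic Q + mass Q = enn2real (hart Q)" "kinetic Q \<le> mass Q"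
proof -
  note sQ = half_sobolevD(1)[OF Q]
  note Qm[measurable] = square_integrableD(1)[OF sQ]
  define K where "K = kinetic Q"
  define N where "N = mass Q"
  define D where "D = enn2real (hart Q)"
  have z: "kinetic (\<lambda>x. Q x - Q x) = 0" "mass (\<lambda>x. Q x - Q x) = 0" "coulomb (\<lambda>x. (Q x)^2) (\<lambda>x. (Q x - Q x)^2) = 0"
    using kinetic_seminorm[of "\<lambda>_. 0"] by (auto simp: mass_def coulomb_def seminorm_def square_integrable_def)
  \<comment> \<open>Testing with \<open>Q\<close> itself: the remainder is zero, so polarization
    collapses to this identity.\<close>
  have KND: "K + N = D"
    using eq[OF Q] unfolding multiplier_form_polarization[OF Q Q] integral_product_polarization[OF sQ sQ] potential_polarization[OF A Q Q Q] z
    by (simp add: K_def N_def D_def)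
  then show "kinetic Q + mass Q = enn2real (hart Q)" by (simp add: K_def N_def D_def)
  obtain B where B: "B \<ge> 0" "\<And>R. R \<ge> R0 \<Longrightarrow> (\<integral>\<^sup>+x. ennreal (indicator {x. norm x \<ge> R} x * (Q x)^2) \<partial>lborel) \<le> ennreal (B / R^4)"
    by (rule decay_tail[OF Qm decay]) blast
  have R0: "R0 \<ge> 1" using decay by (simp add: quartic_decay_def)
  define C1 where "C1 = 8 * exp 1 * sqrt (4 * pi) ^ 3 * S / unit_ball_vol 3"
  have C1: "C1 \<ge> 0" unfolding C1_def using S unit_ball_vol_pos[of 3] by simp
  \<comment> \<open>Everything is tied to one parameter \<open>x\<close>:
    \<open>\<rho> = x^-6\<close>, radius \<open>x^2\<close>, frequency split at \<open>x\<close>.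
    The mass of the remainder is then of order \<open>x^-8\<close> and its kinetic energy of order
    \<open>x^-7\<close>, which divided by \<open>\<rho>\<close> leaves \<open>1/x\<close>.\<close>
  have main: "K * (3 + 3 * \<rho> + \<rho>^2) + N * (2 + \<rho>) - (K + N) / 2 * (5 + 10 * \<rho> + 10 * \<rho>^2 + 5 * \<rho>^3 + \<rho>^4) \<le> 32 * (2 * (C1 + 4 * B) + 66 * S) * (1 / x)"
    if x: "x \<ge> R0" and \<rho>: "\<rho> = 1 / x^6" for x \<rho> :: real
  proof -
    have x1: "x \<ge> 1" using x R0 by simp
    have \<rho>0: "\<rho> > 0" "\<rho> \<le> 1" using x1 by (auto simp: \<rho>)
    define l where "l = 1 + \<rho>"
    have l: "l \<ge> 1" "l \<le> 2" "l > 0" using \<rho>0 by (auto simp: l_def)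
    define R where "R = x^2"
    have RR: "R \<ge> R0" "R > 0"
    proof -
      have "x * 1 \<le> x * x" using x1 by (intro mult_left_mono) auto
      then show "R \<ge> R0" using x by (simp add: R_def power2_eq_square)
      then show "R > 0" using R0 by simp
    qed
    define \<phi> where "\<phi> = (\<lambda>y. Q (l *\<^sub>R y))"
    have \<phi>r: "\<phi> = rescale 1 l 0 Q" by (simp add: \<phi>_def rescale_def fun_eq_iff)
    have h\<phi>: "half_sobolev \<phi>" unfolding \<phi>r by (rule half_sobolev_rescale[OF Q l(3)])
    note s\<phi> = half_sobolevD(1)[OF h\<phi>]
    have [measurable]: "\<phi> \<in> borel_measurable borel" by (rule square_integrableD(1)[OF s\<phi>])
    define r where "r = (\<lambda>y. Q y - \<phi> y)"
    have hr: "half_sobolev r" unfolding r_def by (rule half_sobolev_diff[OF Q h\<phi>])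
    note sr = half_sobolevD(1)[OF hr]
    note [measurable] = square_integrableD(1)[OF sr] fhat_measurable[OF sr] fhat_measurable[OF sQ] fhat_measurable[OF s\<phi>]
    have mr: "mass r \<le> (C1 + 4 * B) / x^8"
    proof -
      have "ennreal (mass r) = (\<integral>\<^sup>+y. ennreal (indicator {y. norm y \<le> R} y * (Q (l *\<^sub>R y) - Q y)^2) + ennreal (indicator {y. norm y > R} y * (Q (l *\<^sub>R y) - Q y)^2) \<partial>lborel)"
        unfolding nn_mass[OF sr, symmetric] by (intro nn_integral_cong) (auto simp: r_def \<phi>_def power2_commute split: split_indicator)
      also have "\<dots> = (\<integral>\<^sup>+y. ennreal (indicator {y. norm y \<le> R} y * (Q (l *\<^sub>R y) - Q y)^2) \<partial>lborel) + (\<integral>\<^sup>+y. ennreal (indicator {y. norm y > R} y * (Q (l *\<^sub>R y) - Q y)^2) \<partial>lborel)"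
        by (rule nn_integral_add) measurable
      also have "\<dots> \<le> ennreal (C1 * (\<rho> * R)^2) + 4 * ennreal (B / R^4)"
      proof (rule add_mono)
        show "(\<integral>\<^sup>+y. ennreal (indicator {y. norm y \<le> R} y * (Q (l *\<^sub>R y) - Q y)^2) \<partial>lborel) \<le> ennreal (C1 * (\<rho> * R)^2)"
          unfolding l_def C1_def by (rule dilation_difference_inner[OF sQ \<rho>0(1) RR(2) S2 S])
        have "(\<integral>\<^sup>+y. ennreal (indicator {y. norm y > R} y * (Q (l *\<^sub>R y) - Q y)^2) \<partial>lborel) \<le> 4 * (\<integral>\<^sup>+y. ennreal (indicator {y. norm y \<ge> R} y * (Q y)^2) \<partial>lborel)"
          by (rule dilation_difference_outer) (use l RR in auto)
        also have "\<dots> \<le> 4 * ennreal (B / R^4)" by (intro mult_left_mono B RR) simp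
        finally show "(\<integral>\<^sup>+y. ennreal (indicator {y. norm y > R} y * (Q (l *\<^sub>R y) - Q y)^2) \<partial>lborel) \<le> 4 * ennreal (B / R^4)" .
      qed
      also have "\<dots> = ennreal (C1 * (\<rho> * R)^2 + 4 * (B / R^4))"
      proof -
        have "4 * ennreal y = ennreal (4 * y)" if "y \<ge> 0" for y using that by (simp add: ennreal_mult)
        then have "4 * ennreal (B / R^4) = ennreal (4 * (B / R^4))" using B(1) by simp
        then show ?thesis using C1 B(1) by (simp only:) (rule ennreal_plus[symmetric], auto)
      qed
      also have "C1 * (\<rho> * R)^2 + 4 * (B / R^4) = (C1 + 4 * B) / x^8"
      proof -
        have "(\<rho> * R)^2 = 1 / x^8" "R^4 = x^8" using x1 by (simp_all add: \<rho> R_def power_divide field_simps flip: power_mult power_add)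
        then show ?thesis by (simp add: add_divide_distrib)
      qed
      finally show ?thesis using C1 B(1) by (subst (asm) ennreal_le_iff) auto
    qed
    have hf: "(\<integral>\<^sup>+\<xi>. ennreal (norm \<xi> ^ 8 * (cmod (fhat r \<xi>))^2) \<partial>lborel) \<le> ennreal (66 * S)"
    proof -
      have "(\<integral>\<^sup>+\<xi>. ennreal (norm \<xi> ^ 8 * (cmod (fhat r \<xi>))^2) \<partial>lborel)
        \<le> (\<integral>\<^sup>+\<xi>. 2 * ennreal (norm \<xi> ^ 8 * (cmod (fhat Q \<xi>))^2) + 2 * ennreal (norm \<xi> ^ 8 * (cmod (fhat \<phi> \<xi>))^2) \<partial>lborel)"
      proof (rule nn_integral_mono_AE)
        show "AE \<xi> in lborel. ennreal (norm \<xi> ^ 8 * (cmod (fhat r \<xi>))^2) \<le> 2 * ennreal (norm \<xi> ^ 8 * (cmod (fhat Q \<xi>))^2) + 2 * ennreal (norm \<xi> ^ 8 * (cmod (fhat \<phi> \<xi>))^2)"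
          using fhat_diff[OF sQ s\<phi>]
        proof eventually_elim
          case (elim \<xi>)
          have "norm \<xi> ^ 8 * (cmod (fhat r \<xi>))^2 \<le> norm \<xi> ^ 8 * (2 * (cmod (fhat Q \<xi>))^2 + 2 * (cmod (fhat \<phi> \<xi>))^2)"
            unfolding r_def elim by (intro mult_left_mono sq_diff_le) simp
          also have "\<dots> = 2 * (norm \<xi> ^ 8 * (cmod (fhat Q \<xi>))^2) + 2 * (norm \<xi> ^ 8 * (cmod (fhat \<phi> \<xi>))^2)"
            by (simp add: distrib_left)
          finally show ?case
            by (subst (1 2) ennreal_two_mult[symmetric], simp, simp, subst ennreal_plus[symmetric], simp, simp) (rule ennreal_leI)
        qed
      qed
      also have "\<dots> = 2 * (\<integral>\<^sup>+\<xi>. ennreal (norm \<xi> ^ 8 * (cmod (fhat Q \<xi>))^2) \<partial>lborel) + 2 * (\<integral>\<^sup>+\<xi>. ennreal (norm \<xi> ^ 8 * (cmod (fhat \<phi> \<xi>))^2) \<partial>lborel)"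
        by (subst nn_integral_add, measurable, subst nn_integral_cmult, measurable, subst nn_integral_cmult, measurable)
      also have "\<dots> \<le> 2 * ennreal S + 2 * (32 * ennreal S)"
        unfolding \<phi>_def by (intro add_mono mult_left_mono S8 high_frequency_dilation[OF i sQ l(1,2) S8]) auto
      also have "\<dots> = ennreal (66 * S)"
      proof -
        have "32 * ennreal S = ennreal (32 * S)" using S by (simp add: ennreal_mult)
        then show ?thesis using S by (simp add: ennreal_two_mult[symmetric] ennreal_plus[symmetric] del: ennreal_plus)
      qed
      finally show ?thesis .
    qed
    have "kinetic r \<le> x * mass r + 66 * S / x^7"
      by (rule kinetic_interpolation[OF hr _ hf]) (use x1 S in auto)
    also have "x * mass r \<le> x * ((C1 + 4 * B) / x^8)" using mr x1 by (intro mult_left_mono) auto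
    also have "x * ((C1 + 4 * B) / x^8) = (C1 + 4 * B) / x^7" using x1 by (simp add: eval_nat_numeral)
    finally have kr: "kinetic r \<le> (C1 + 4 * B) / x^7 + 66 * S / x^7" by simp
    have "x^7 \<le> x^8" using x1 by (intro power_increasing) auto
    then have "(C1 + 4 * B) / x^8 \<le> (C1 + 4 * B) / x^7" using x1 C1 B(1) by (intro divide_left_mono) auto
    then have rem: "kinetic r + mass r \<le> (2 * (C1 + 4 * B) + 66 * S) / x^7"
      using kr mr by (simp add: add_divide_distrib)
    define E where "E = (2 * (C1 + 4 * B) + 66 * S) / x^7"
    have E0: "E \<ge> 0" unfolding E_def using C1 B(1) S x1 by simp
    have k\<phi>: "kinetic \<phi> = K / l^2" "mass \<phi> = N / l^3" "enn2real (hart \<phi>) = D / l^5"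
      unfolding \<phi>r using kinetic_rescale[OF Q l(3), of 1 0] mass_rescale[OF sQ l(3), of 1 0] hart_rescale[OF Qm l(3), of 1 0] l
      by (simp_all add: K_def N_def D_def enn2real_mult)
    have "K + K / l^2 + N + N / l^3 - (D + D / l^5) / 2 - D \<le> kinetic r + mass r"
      using weak_equation_identity[OF A Q h\<phi> eq[OF h\<phi>]] unfolding k\<phi> r_def K_def N_def D_def .
    then have "K / l^2 + N / l^3 - (D + D / l^5) / 2 \<le> E" using rem KND unfolding E_def by linarith
    then have "l^5 * (K / l^2 + N / l^3 - (D + D / l^5) / 2) \<le> l^5 * E" using l by (intro mult_left_mono) auto
    also have "l^5 * (K / l^2 + N / l^3 - (D + D / l^5) / 2) = l^3 * K + l^2 * N - (l^5 + 1) * (D / 2)"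
      using l by (simp add: field_simps eval_nat_numeral)
    also have "l^5 * E \<le> 32 * E"
    proof (rule mult_right_mono[OF _ E0])
      have "l^5 \<le> 2^5" using l by (intro power_mono) auto
      then show "l^5 \<le> 32" by simp
    qed
    finally have "l^3 * K + l^2 * N - (l^5 + 1) * (D / 2) \<le> 32 * E" .
    moreover have "l^3 * K + l^2 * N - (l^5 + 1) * (D / 2)
       = \<rho> * (K * (3 + 3 * \<rho> + \<rho>^2) + N * (2 + \<rho>) - (K + N) / 2 * (5 + 10 * \<rho> + 10 * \<rho>^2 + 5 * \<rho>^3 + \<rho>^4))"
      unfolding l_def KND[symmetric] by (simp add: eval_nat_numeral algebra_simps add_divide_distrib diff_divide_distrib)
    moreover have "32 * E = \<rho> * (32 * (2 * (C1 + 4 * B) + 66 * S) * (1 / x))"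
      using x1 by (simp add: E_def \<rho> eval_nat_numeral)
    ultimately show ?thesis using \<rho>0(1) by (simp only: mult_le_cancel_left_pos)
  qed
  have "(K - N) / 2 \<le> 0"
  proof (rule tendsto_le[OF trivial_limit_at_top_linorder])
    have lim0: "((\<lambda>x::real. 1 / x ^ 6) \<longlongrightarrow> 0) at_top" "((\<lambda>x::real. 1 / x) \<longlongrightarrow> 0) at_top"
      by real_asymp+
    have "((\<lambda>x. 32 * (2 * (C1 + 4 * B) + 66 * S) * (1 / x)) \<longlongrightarrow> 32 * (2 * (C1 + 4 * B) + 66 * S) * 0) at_top"
      by (intro tendsto_intros lim0)
    then show "((\<lambda>x. 32 * (2 * (C1 + 4 * B) + 66 * S) * (1 / x)) \<longlongrightarrow> 0) at_top" by simp
    let ?g = "\<lambda>\<rho>. K * (3 + 3 * \<rho> + \<rho>^2) + N * (2 + \<rho>) - (K + N) / 2 * (5 + 10 * \<rho> + 10 * \<rho>^2 + 5 * \<rho>^3 + \<rho>^4)"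
    have g: "((\<lambda>x. ?g (1 / x^6)) \<longlongrightarrow> ?g 0) at_top" by (intro tendsto_intros lim0)
    \<comment> \<open>This is \<open>3 K + 2 N - 5 (K + N) / 2\<close>, the derivative at
      \<open>l = 1\<close> of \<open>l^3 K + l^2 N - (l^5 + 1) D / 2\<close>.\<close>
    have g0: "?g 0 = (K - N) / 2" by (simp add: field_simps)
    show "((\<lambda>x. ?g (1 / x^6)) \<longlongrightarrow> (K - N) / 2) at_top" using g unfolding g0 .
    show "\<forall>\<^sub>F x in at_top. ?g (1 / x^6) \<le> 32 * (2 * (C1 + 4 * B) + 66 * S) * (1 / x)"
      using eventually_ge_at_top[of R0] by eventually_elim (rule main, auto)
  qed
  then show "kinetic Q \<le> mass Q" by (simp add: K_def N_def)
qed

section \<open>Truncation and concentrating trial functions\<close>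

text \<open>Rises linearly from 0 at radius \<open>R > 0\<close> to \<open>pi / 2\<close> at radius
  \<open>2 R\<close>. Keeping the angle makes the companion cutoff, its sine, available with the
  same Lipschitz bound.\<close>

definition cutoff_angle :: "real \<Rightarrow> R3 \<Rightarrow> real"
  where "cutoff_angle R x = pi / 2 * max 0 (min 1 (norm x / R - 1))"

definition cutoff :: "real \<Rightarrow> (R3 \<Rightarrow> real) \<Rightarrow> R3 \<Rightarrow> real"
  where "cutoff R u x = cos (cutoff_angle R x) * u x"

lemma cutoff_angle_measurable[measurable]: "cutoff_angle R \<in> borel_measurable borel"
  unfolding cutoff_angle_def by measurable

lemma cutoff_measurable[measurable]: "u \<in> borel_measurable borel \<Longrightarrow> cutoff R u \<in> borel_measurable borel"
  unfolding cutoff_def[abs_def] by measurable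

lemma abs_cutoff_le: "\<bar>cutoff R u x\<bar> \<le> \<bar>u x\<bar>"
  unfolding cutoff_def abs_mult using abs_cos_le_one[of "cutoff_angle R x"] mult_right_mono[of "\<bar>cos (cutoff_angle R x)\<bar>" 1 "\<bar>u x\<bar>"] by simp

lemma cutoff_inside: "R > 0 \<Longrightarrow> norm x \<le> R \<Longrightarrow> cutoff R u x = u x"
  unfolding cutoff_def cutoff_angle_def by (simp add: max_def)

lemma cutoff_outside: "R > 0 \<Longrightarrow> norm x \<ge> 2 * R \<Longrightarrow> cutoff R u x = 0"
proof -
  assume "R > 0" "norm x \<ge> 2 * R"
  then have "norm x / R - 1 \<ge> 1" by (simp add: field_simps)
  then have "cutoff_angle R x = pi / 2" unfolding cutoff_angle_def by simp
  then have "cos (cutoff_angle R x) = 0" by (simp only: cos_pi_half)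
  then show ?thesis by (simp add: cutoff_def)
qed

lemma square_integrable_cutoff: "square_integrable u \<Longrightarrow> square_integrable (cutoff R u)"
  by (rule square_integrable_bound[of u]) (auto simp: square_integrable_def abs_cutoff_le)

lemma cutoff_angle_lipschitz:
  assumes "R > 0" shows "\<bar>cutoff_angle R x - cutoff_angle R y\<bar> \<le> 2 * (norm (x - y) / R)"
proof -
  have "\<bar>max 0 (min 1 a) - max 0 (min 1 b)\<bar> \<le> \<bar>a - b\<bar>" for a b :: real by (auto simp: max_def min_def)
  from this[of "norm x / R - 1" "norm y / R - 1"]
  have 1: "\<bar>max 0 (min 1 (norm x / R - 1)) - max 0 (min 1 (norm y / R - 1))\<bar> \<le> \<bar>norm x - norm y\<bar> / R"
    using assms by (simp flip: diff_divide_distrib)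
  also have "\<dots> \<le> norm (x - y) / R" using assms norm_triangle_ineq3[of x y] by (intro divide_right_mono) auto
  finally have "pi / 2 * \<bar>max 0 (min 1 (norm x / R - 1)) - max 0 (min 1 (norm y / R - 1))\<bar> \<le> 2 * (norm (x - y) / R)"
    using pi_less_4 assms by (intro mult_mono) auto
  moreover have "cutoff_angle R x - cutoff_angle R y = pi / 2 * (max 0 (min 1 (norm x / R - 1)) - max 0 (min 1 (norm y / R - 1)))"
    by (simp add: cutoff_angle_def right_diff_distrib)
  moreover have "\<bar>pi / 2 * d\<bar> = pi / 2 * \<bar>d\<bar>" for d by (simp add: abs_mult)
  ultimately show ?thesis by (simp only:)
qed

text \<open>The partition of unity \<open>cos\<^sup>2 \<theta> + sin\<^sup>2 \<theta> = 1\<close> localises the quadratic form up to the error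
  \<open>2 u(x) u(y) (1 - cos (\<theta>(x) - \<theta>(y)))\<close>; the companion \<open>sin \<theta> u\<close> only adds a nonnegative term.\<close>

lemma cutoff_pointwise:
  assumes R: "R > 0" and xy: "x \<noteq> y"
  shows "(cutoff R u x - cutoff R u y)^2 / norm (x - y) ^ 4 \<le> (u x - u y)^2 / norm (x - y) ^ 4
    + 2 / R^4 * (radial_weight (norm (x - y) / R) *
      (R * (indicator {x. norm x \<ge> R} x * (u x)^2) + (u y)^2 / R + R * (indicator {x. norm x \<ge> R} y * (u y)^2) + (u x)^2 / R))"
proof -
  define r where "r = norm (x - y)"
  have r: "r > 0" using xy by (simp add: r_def)
  define a where "a = cutoff_angle R x"
  define b where "b = cutoff_angle R y"
  define P where "P = R * (indicator {x. norm x \<ge> R} x * (u x)^2) + (u y)^2 / R + R * (indicator {x. norm x \<ge> R} y * (u y)^2) + (u x)^2 / R"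
  \<comment> \<open>Divided by \<open>r^4\<close> this is
    \<open>radial_weight (r / R) / R^4\<close>. Up to a factor 2 it bounds
    \<open>1 - cos (a - b)\<close>, near the diagonal by the Lipschitz bound and far from it
    trivially.\<close>
  define k where "k = r^4 / R^4 * radial_weight (r / R)"
  have k: "k = (if r \<le> R then r^2 / R^2 else 1)"
    using r R by (auto simp: k_def radial_weight_def divide_le_eq_1 power_divide field_simps eval_nat_numeral)
  have P0: "P \<ge> 0" using R by (auto simp: P_def)
  have c1: "1 - cos (a - b) \<le> 2 * k"
  proof -
    have "\<bar>a - b\<bar>\<^sup>2 \<le> (2 * (r / R))^2" unfolding a_def b_def r_def by (intro power_mono cutoff_angle_lipschitz R) simp
    then have "(a - b)^2 \<le> 4 * (r^2 / R^2)" by (simp add: power_mult_distrib power_divide)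
    moreover have "1 - cos (a - b) \<le> (a - b)^2 / 2"
    proof -
      have "2 * ((a - b) / 2) = a - b" by simp
      then have "cos (a - b) = 1 - 2 * (sin ((a - b) / 2))^2" using cos_double_sin[of "(a - b) / 2"] by (simp only:)
      moreover have "(sin ((a - b) / 2))^2 \<le> ((a - b) / 2)^2"
        using abs_sin_x_le_abs_x[of "(a - b) / 2"] by (simp only: abs_le_square_iff)
      moreover have "((a - b) / 2)^2 = (a - b)^2 / 4" by (simp add: power_divide)
      ultimately show ?thesis by linarith
    qed
    ultimately have "1 - cos (a - b) \<le> 2 * (r^2 / R^2)" by simp
    moreover have "1 - cos (a - b) \<le> 2" using cos_ge_minus_one[of "a - b"] by simp
    ultimately show ?thesis by (simp add: k)
  qed
  have k0: "k \<ge> 0" by (simp add: k)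
  \<comment> \<open>Inside the ball both angles vanish, so an error requires a point outside. The
    weights \<open>R\<close> and \<open>1/R\<close> in the arithmetic-geometric mean put the large
    factor on the tail, small by decay, and the small one on the full mass.\<close>
  have err: "2 * (u x * u y) * (1 - cos (a - b)) \<le> 2 * k * P"
  proof (cases "norm x \<ge> R \<or> norm y \<ge> R")
    case True
    have am: "2 * \<bar>s * t\<bar> \<le> R * s^2 + t^2 / R" for s t :: real
    proof -
      have "0 \<le> (R * \<bar>s\<bar> - \<bar>t\<bar>)^2 / R" using R by simp
      also have "\<dots> = R * s^2 + t^2 / R - 2 * \<bar>s * t\<bar>" using R by (simp add: field_simps power2_eq_square abs_mult)
      finally show ?thesis by simp
    qed
    have uP: "2 * \<bar>u x * u y\<bar> \<le> P"
    proof (cases "norm x \<ge> R")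
      case True
      have "0 \<le> R * (indicator {x. norm x \<ge> R} y * (u y)^2) + (u x)^2 / R" using R by simp
      then show ?thesis using am[of "u x" "u y"] True by (simp add: P_def)
    next
      case False
      then have y: "norm y \<ge> R" using \<open>norm x \<ge> R \<or> norm y \<ge> R\<close> by simp
      have "0 \<le> (u y)^2 / R" using R by simp
      then show ?thesis using am[of "u y" "u x"] False y by (simp add: P_def mult.commute)
    qed
    have "2 * (u x * u y) * (1 - cos (a - b)) \<le> (2 * \<bar>u x * u y\<bar>) * (1 - cos (a - b))"
      by (intro mult_right_mono) auto
    also have "\<dots> \<le> P * (2 * k)" using uP c1 k0 P0 by (intro mult_mono) auto
    finally show ?thesis by (simp add: mult_ac)
  next
    case False
    then have "norm x / R \<le> 1" "norm y / R \<le> 1" using R by auto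
    then have "a = 0" "b = 0" unfolding a_def b_def cutoff_angle_def by (auto simp: max_def)
    then show ?thesis using k0 P0 by simp
  qed
  have sc: "(cos a)^2 + (sin a)^2 = 1" "(cos b)^2 + (sin b)^2 = 1" by simp_all
  have alg: "(p * s - q * t)^2 + (p' * s - q' * t)^2 = s^2 * (p^2 + p'^2) + t^2 * (q^2 + q'^2) - 2 * (s * t) * (p * q + p' * q')"
    for p q p' q' s t :: real
    by (simp add: power2_eq_square algebra_simps)
  have "(cos a * u x - cos b * u y)^2 + (sin a * u x - sin b * u y)^2
     = (u x)^2 * ((cos a)^2 + (sin a)^2) + (u y)^2 * ((cos b)^2 + (sin b)^2) - 2 * (u x * u y) * (cos a * cos b + sin a * sin b)"
    by (rule alg)
  also have "\<dots> = (u x)^2 + (u y)^2 - 2 * (u x * u y) * cos (a - b)"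
    unfolding sc cos_diff by simp
  also have "\<dots> = (u x - u y)^2 + 2 * (u x * u y) * (1 - cos (a - b))"
    by (simp add: power2_eq_square algebra_simps)
  finally have "(cos a * u x - cos b * u y)^2 + (sin a * u x - sin b * u y)^2 = (u x - u y)^2 + 2 * (u x * u y) * (1 - cos (a - b))" .
  moreover have "0 \<le> (sin a * u x - sin b * u y)^2" by simp
  ultimately have "(cutoff R u x - cutoff R u y)^2 \<le> (u x - u y)^2 + 2 * k * P"
    unfolding cutoff_def a_def[symmetric] b_def[symmetric] using err by linarith
  then have "(cutoff R u x - cutoff R u y)^2 / r^4 \<le> ((u x - u y)^2 + 2 * k * P) / r^4" using r by (intro divide_right_mono) auto
  also have "\<dots> = (u x - u y)^2 / r^4 + 2 / R^4 * (radial_weight (r / R) * P)"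
    using r R by (simp add: k_def field_simps)
  finally show ?thesis unfolding r_def P_def .
qed

lemma nn_radial_convolution:
  assumes Cw: "(\<integral>\<^sup>+(z::R3). ennreal (radial_weight (norm z)) \<partial>lborel) = ennreal Cw" "Cw \<ge> 0" and R: "R > 0"
    and [measurable]: "f \<in> borel_measurable borel"
  shows "(\<integral>\<^sup>+p. ennreal (radial_weight (norm (fst p - snd p) / R)) * f (fst p) \<partial>lborel2) = ennreal (Cw * R^3) * (\<integral>\<^sup>+x. f x \<partial>lborel)"
    and "(\<integral>\<^sup>+p. ennreal (radial_weight (norm (fst p - snd p) / R)) * f (snd p) \<partial>lborel2) = ennreal (Cw * R^3) * (\<integral>\<^sup>+x. f x \<partial>lborel)"
proof -
  let ?g = "\<lambda>z::R3. ennreal (radial_weight (norm z / R))"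
  have I: "(\<integral>\<^sup>+z. ?g z \<partial>lborel) = ennreal (Cw * R^3)"
  proof -
    have "(\<integral>\<^sup>+z. ?g z \<partial>lborel) = (\<integral>\<^sup>+z. ennreal (radial_weight (norm ((1/R) *\<^sub>R (z::R3)))) \<partial>lborel)" using R by simp
    also have "\<dots> = ennreal (1 / (1/R)^3) * ennreal Cw"
      unfolding Cw(1)[symmetric] by (rule nn_integral_scale_R3) (use R in auto)
    also have "\<dots> = ennreal (Cw * R^3)" using R Cw(2) by (subst ennreal_mult[symmetric]) (auto simp: power_divide mult.commute)
    finally show ?thesis .
  qed
  have "(\<integral>\<^sup>+p. ?g (fst p - snd p) * f (fst p) \<partial>lborel2) = (\<integral>\<^sup>+x. \<integral>\<^sup>+y. ?g (x - y) * f x \<partial>lborel \<partial>lborel)"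
    by (subst lborel.nn_integral_fst[symmetric]) auto
  also have "\<dots> = (\<integral>\<^sup>+x. ennreal (Cw * R^3) * f x \<partial>lborel)"
    using nn_integral_reflect_R3[of ?g] I by (simp add: nn_integral_multc)
  finally show "(\<integral>\<^sup>+p. ?g (fst p - snd p) * f (fst p) \<partial>lborel2) = ennreal (Cw * R^3) * (\<integral>\<^sup>+x. f x \<partial>lborel)"
    by (simp add: nn_integral_cmult)
  have "(\<integral>\<^sup>+p. ?g (fst p - snd p) * f (snd p) \<partial>lborel2) = (\<integral>\<^sup>+y. \<integral>\<^sup>+x. ?g (x - y) * f y \<partial>lborel \<partial>lborel)"
    by (subst lborel_pair.nn_integral_snd[symmetric]) auto
  also have "\<dots> = (\<integral>\<^sup>+y. ennreal (Cw * R^3) * f y \<partial>lborel)"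
    using nn_integral_translate_diff_R3[of ?g] I by (simp add: nn_integral_multc)
  finally show "(\<integral>\<^sup>+p. ?g (fst p - snd p) * f (snd p) \<partial>lborel2) = ennreal (Cw * R^3) * (\<integral>\<^sup>+x. f x \<partial>lborel)"
    by (simp add: nn_integral_cmult)
qed

text \<open>Convolution with the rescaled weight costs \<open>R^3\<close> against the prefactor
  \<open>R^-4\<close>; tail and mass then contribute \<open>R^-4\<close> and \<open>R^-2\<close>. An
  error of order \<open>R^-2\<close> stays negligible after the later magnification of energies by
  \<open>2 R\<close>.\<close>

lemma cutoff_seminorm:
  assumes u: "square_integrable u" and tail: "\<And>R. R \<ge> R0 \<Longrightarrow> (\<integral>\<^sup>+x. ennreal (indicator {x. norm x \<ge> R} x * (u x)^2) \<partial>lborel) \<le> ennreal (B / R^4)"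
    and B: "B \<ge> 0" and R0: "R0 \<ge> 1"
  obtains C where "C \<ge> 0" "\<And>R. R \<ge> R0 \<Longrightarrow> seminorm (cutoff R u) \<le> seminorm u + ennreal (C / R^2)"
proof -
  note [measurable] = square_integrableD(1)[OF u]
  obtain Cw where Cw: "(\<integral>\<^sup>+(z::R3). ennreal (radial_weight (norm z)) \<partial>lborel) = ennreal Cw" "Cw \<ge> 0"
    using nn_integral_radial_weight by (cases "\<integral>\<^sup>+(z::R3). ennreal (radial_weight (norm z)) \<partial>lborel") auto
  show thesis
  proof (rule that[of "4 * Cw * (B + mass u)"])
    fix R assume RR: "R \<ge> R0"
    then have R: "R \<ge> 1" "R > 0" using R0 by auto
    let ?k = "\<lambda>p::R3 \<times> R3. ennreal (radial_weight (norm (fst p - snd p) / R))"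
    let ?t = "\<lambda>x. ennreal (R * (indicator {x. norm x \<ge> R} x * (u x)^2))" and ?m = "\<lambda>x. ennreal ((u x)^2 / R)"
    have "seminorm (cutoff R u) \<le> (\<integral>\<^sup>+p. ennreal ((u (fst p) - u (snd p))^2 / norm (fst p - snd p) ^ 4)
       + ennreal (2 / R^4) * ((?k p * ?t (fst p) + ?k p * ?m (snd p)) + (?k p * ?t (snd p) + ?k p * ?m (fst p))) \<partial>lborel2)"
      unfolding seminorm_def
    proof (rule nn_integral_mono)
      fix p :: "R3 \<times> R3"
      show "ennreal ((cutoff R u (fst p) - cutoff R u (snd p))^2 / norm (fst p - snd p) ^ 4)
        \<le> ennreal ((u (fst p) - u (snd p))^2 / norm (fst p - snd p) ^ 4)
       + ennreal (2 / R^4) * ((?k p * ?t (fst p) + ?k p * ?m (snd p)) + (?k p * ?t (snd p) + ?k p * ?m (fst p)))"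
      proof (cases "fst p = snd p")
        case False
        have lin: "ennreal (q + c * (w * (t1 + m1 + t2 + m2))) = ennreal q + ennreal c * ((ennreal w * ennreal t1 + ennreal w * ennreal m1) + (ennreal w * ennreal t2 + ennreal w * ennreal m2))"
          if "q \<ge> 0" "c \<ge> 0" "w \<ge> 0" "t1 \<ge> 0" "m1 \<ge> 0" "t2 \<ge> 0" "m2 \<ge> 0" for q c w t1 m1 t2 m2
          using that by (simp add: ennreal_mult distrib_left add.assoc)
        show ?thesis
          by (rule order_trans[OF ennreal_leI[OF cutoff_pointwise[OF R(2) False]]], subst lin) (use R radial_weight_nonneg in auto)
      qed simp
    qed
    also have "\<dots> = seminorm u + ennreal (2 / R^4) * (((\<integral>\<^sup>+p. ?k p * ?t (fst p) \<partial>lborel2) + (\<integral>\<^sup>+p. ?k p * ?m (snd p) \<partial>lborel2))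
        + ((\<integral>\<^sup>+p. ?k p * ?t (snd p) \<partial>lborel2) + (\<integral>\<^sup>+p. ?k p * ?m (fst p) \<partial>lborel2)))"
      unfolding seminorm_def
      by (subst nn_integral_add, measurable, subst nn_integral_cmult, measurable, subst nn_integral_add, measurable, subst (1 2) nn_integral_add, measurable)
    also have "\<dots> = seminorm u + ennreal (2 / R^4) * ((ennreal (Cw * R^3) * (\<integral>\<^sup>+x. ?t x \<partial>lborel) + ennreal (Cw * R^3) * (\<integral>\<^sup>+x. ?m x \<partial>lborel))
        + (ennreal (Cw * R^3) * (\<integral>\<^sup>+x. ?t x \<partial>lborel) + ennreal (Cw * R^3) * (\<integral>\<^sup>+x. ?m x \<partial>lborel)))"
      by (subst (1 2) nn_radial_convolution[OF Cw R(2)], measurable, subst (1 2) nn_radial_convolution[OF Cw R(2)], measurable)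
    also have "\<dots> \<le> seminorm u + ennreal (2 / R^4) * ((ennreal (Cw * R^3) * ennreal (B / R^3) + ennreal (Cw * R^3) * ennreal (mass u / R))
        + (ennreal (Cw * R^3) * ennreal (B / R^3) + ennreal (Cw * R^3) * ennreal (mass u / R)))"
    proof -
      have "(\<integral>\<^sup>+x. ?t x \<partial>lborel) = ennreal R * (\<integral>\<^sup>+x. ennreal (indicator {x. norm x \<ge> R} x * (u x)^2) \<partial>lborel)"
        using R by (subst nn_integral_cmult[symmetric]) (auto simp: ennreal_mult)
      also have "\<dots> \<le> ennreal R * ennreal (B / R^4)" by (intro mult_left_mono tail RR) simp
      also have "\<dots> = ennreal (B / R^3)" using R B by (subst ennreal_mult[symmetric]) (auto simp: eval_nat_numeral)
      finally have t: "(\<integral>\<^sup>+x. ?t x \<partial>lborel) \<le> ennreal (B / R^3)" .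
      have "(\<integral>\<^sup>+x. ?m x \<partial>lborel) = ennreal (1/R) * (\<integral>\<^sup>+x. ennreal ((u x)^2) \<partial>lborel)"
        using R by (subst nn_integral_cmult[symmetric]) (auto simp: ennreal_mult[symmetric])
      also have "\<dots> = ennreal (mass u / R)" using R mass_nonneg[of u] by (simp add: nn_mass[OF u] ennreal_mult[symmetric])
      finally have m: "(\<integral>\<^sup>+x. ?m x \<partial>lborel) \<le> ennreal (mass u / R)" by simp
      show ?thesis by (intro add_left_mono mult_left_mono add_mono t m) auto
    qed
    also have "\<dots> = seminorm u + ennreal (2 / R^4 * ((Cw * R^3 * (B / R^3) + Cw * R^3 * (mass u / R)) + (Cw * R^3 * (B / R^3) + Cw * R^3 * (mass u / R))))"
      using R B Cw(2) mass_nonneg[of u] by (simp add: ennreal_mult[symmetric] ennreal_plus[symmetric] del: ennreal_plus)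
    also have "\<dots> \<le> seminorm u + ennreal (4 * Cw * (B + mass u) / R^2)"
    proof (intro add_left_mono ennreal_leI)
      have "2 / R^4 * ((Cw * R^3 * (B / R^3) + Cw * R^3 * (mass u / R)) + (Cw * R^3 * (B / R^3) + Cw * R^3 * (mass u / R)))
        = 4 * Cw * (B / R^4 + mass u / R^2)"
        using R by (simp add: field_simps eval_nat_numeral)
      also have "\<dots> \<le> 4 * Cw * (B / R^2 + mass u / R^2)"
        using R B Cw(2) by (intro mult_left_mono add_right_mono divide_left_mono power_increasing) auto
      also have "\<dots> = 4 * Cw * (B + mass u) / R^2" by (simp only: add_divide_distrib distrib_left times_divide_eq_right)
      finally show "2 / R^4 * ((Cw * R^3 * (B / R^3) + Cw * R^3 * (mass u / R)) + (Cw * R^3 * (B / R^3) + Cw * R^3 * (mass u / R))) \<le> 4 * Cw * (B + mass u) / R^2" .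
    qed
    finally show "seminorm (cutoff R u) \<le> seminorm u + ennreal (4 * Cw * (B + mass u) / R^2)" .
  qed (use Cw(2) B mass_nonneg[of u] in auto)
qed

lemma cutoff_mass:
  assumes u: "square_integrable u" and tail: "(\<integral>\<^sup>+x. ennreal (indicator {x. norm x \<ge> R} x * (u x)^2) \<partial>lborel) \<le> ennreal b" and R: "R > 0" and b: "b \<ge> 0"
  shows "mass u \<le> mass (cutoff R u) + b" "mass (cutoff R u) \<le> mass u"
proof -
  note su = square_integrable_cutoff[OF u, of R]
  note [measurable] = square_integrableD(1)[OF u]
  have "ennreal (mass u) \<le> (\<integral>\<^sup>+x. ennreal ((cutoff R u x)^2) + ennreal (indicator {x. norm x \<ge> R} x * (u x)^2) \<partial>lborel)"
    unfolding nn_mass[OF u, symmetric] using cutoff_inside[OF R]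
    by (intro nn_integral_mono) (auto split: split_indicator)
  also have "\<dots> = ennreal (mass (cutoff R u)) + (\<integral>\<^sup>+x. ennreal (indicator {x. norm x \<ge> R} x * (u x)^2) \<partial>lborel)"
    by (subst nn_integral_add) (auto simp: nn_mass[OF su])
  also have "\<dots> \<le> ennreal (mass (cutoff R u)) + ennreal b" by (intro add_left_mono tail)
  also have "\<dots> = ennreal (mass (cutoff R u) + b)" using b mass_nonneg by simp
  finally show "mass u \<le> mass (cutoff R u) + b" using b mass_nonneg[of "cutoff R u"] by (subst (asm) ennreal_le_iff) auto
  show "mass (cutoff R u) \<le> mass u" unfolding mass_def
    using square_integrableD(2)[OF u] square_integrableD(2)[OF su] abs_cutoff_le by (intro integral_mono) (auto simp: abs_le_square_iff)
qed

text \<open>Only pairs with a point outside the ball lose anything. The potential generated by the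
  tail is bounded uniformly: within distance 1 the decay factor is at most 1 and the Coulomb
  singularity is integrable, beyond it the kernel is at most 1 and the decay is integrable.\<close>

lemma cutoff_hart:
  assumes u: "square_integrable u" and decay: "quartic_decay u C R0"
  obtains B where "B \<ge> 0" "\<And>R. R \<ge> R0 \<Longrightarrow> hart u \<le> hart (cutoff R u) + ennreal (B / R^4)"
proof -
  note [measurable] = square_integrableD(1)[OF u]
  obtain C1 where C1: "C1 > 0" "\<And>y::R3. (\<integral>\<^sup>+x. ennreal (indicator (cball y 1) x / norm (x - y)) \<partial>lborel) \<le> ennreal C1"
    "(\<integral>\<^sup>+(x::R3). ennreal (indicator {x. norm x \<ge> 1} x / norm x ^ 4) \<partial>lborel) \<le> ennreal C1"
    by (rule inverse_norm_local) blast
  have R0: "R0 \<ge> 1" "C \<ge> 0" and ae: "AE x in lborel. norm x \<ge> R0 \<longrightarrow> \<bar>u x\<bar> \<le> C / norm x ^ 4"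
    using decay by (auto simp: quartic_decay_def)
  show thesis
  proof (rule that[of "4 * C^2 * C1 * mass u"])
    fix R assume RR: "R \<ge> R0"
    then have R: "R \<ge> 1" "R > 0" using R0 by auto
    let ?t = "\<lambda>x. indicator {x. norm x \<ge> R} x * (u x)^2"
    have inner: "(\<integral>\<^sup>+x. ennreal (?t x / norm (y - x)) \<partial>lborel) \<le> ennreal (C^2 / R^4 * (2 * C1))" for y
    proof -
      have [measurable]: "(\<lambda>x. indicator (cball y 1) x :: real) \<in> borel_measurable borel" by (rule borel_measurable_indicator) simp
      have "(\<integral>\<^sup>+x. ennreal (?t x / norm (y - x)) \<partial>lborel) \<le> (\<integral>\<^sup>+x. ennreal (C^2 / R^4) * (ennreal (indicator (cball y 1) x / norm (x - y)) + ennreal (indicator {x. norm x \<ge> 1} x / norm x ^ 4)) \<partial>lborel)"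
      proof (rule nn_integral_mono_AE)
        show "AE x in lborel. ennreal (?t x / norm (y - x)) \<le> ennreal (C^2 / R^4) * (ennreal (indicator (cball y 1) x / norm (x - y)) + ennreal (indicator {x. norm x \<ge> 1} x / norm x ^ 4))"
          using ae
        proof eventually_elim
          case (elim x)
          show ?case
          proof (cases "norm x \<ge> R")
            case True
            then have q: "(u x)^2 \<le> C^2 / R^4 * (1 / norm x ^ 4)" using elim RR R R0 by (intro decay_square_bound) auto
            have n1: "norm x \<ge> 1" using True R by simp
            have "1 / norm x ^ 4 * (1 / norm (y - x)) \<le> indicator (cball y 1) x / norm (x - y) + 1 / norm x ^ 4"
            proof (cases "norm (y - x) \<le> 1")
              case True
              have "1 / norm x ^ 4 \<le> 1" using n1 by (simp add: divide_le_eq)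
              then have "1 / norm x ^ 4 * (1 / norm (y - x)) \<le> 1 * (1 / norm (y - x))" by (intro mult_right_mono) auto
              moreover have "0 \<le> 1 / norm x ^ 4" by simp
              moreover have "indicator (cball y 1) x / norm (x - y) = 1 * (1 / norm (y - x))"
                using True by (simp add: dist_norm norm_minus_commute)
              ultimately show ?thesis by linarith
            next
              case False
              then have "1 / norm (y - x) \<le> 1" by (simp add: divide_le_eq)
              then have "1 / norm x ^ 4 * (1 / norm (y - x)) \<le> 1 / norm x ^ 4 * 1" by (intro mult_left_mono) auto
              then show ?thesis using False by (simp add: dist_norm)
            qed
            then have "C^2 / R^4 * (1 / norm x ^ 4 * (1 / norm (y - x))) \<le> C^2 / R^4 * (indicator (cball y 1) x / norm (x - y) + 1 / norm x ^ 4)"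
              by (intro mult_left_mono) auto
            moreover have "(u x)^2 * (1 / norm (y - x)) \<le> C^2 / R^4 * (1 / norm x ^ 4) * (1 / norm (y - x))"
              using q by (intro mult_right_mono) auto
            ultimately have "?t x / norm (y - x) \<le> C^2 / R^4 * (indicator (cball y 1) x / norm (x - y) + 1 / norm x ^ 4)"
              using True by (simp add: mult.assoc)
            from ennreal_leI[OF this]
            have "ennreal (?t x / norm (y - x)) \<le> ennreal (C^2 / R^4) * ennreal (indicator (cball y 1) x / norm (x - y) + 1 / norm x ^ 4)"
              by (subst (asm) ennreal_mult) auto
            then show ?thesis using n1 by (subst (asm) ennreal_plus) auto
          qed simp
        qed
      qed
      also have "\<dots> = ennreal (C^2 / R^4) * ((\<integral>\<^sup>+x. ennreal (indicator (cball y 1) x / norm (x - y)) \<partial>lborel) + (\<integral>\<^sup>+(x::R3). ennreal (indicator {x. norm x \<ge> 1} x / norm x ^ 4) \<partial>lborel))"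
        by (subst nn_integral_cmult, measurable, subst nn_integral_add, measurable)
      also have "\<dots> \<le> ennreal (C^2 / R^4) * (ennreal C1 + ennreal C1)" by (intro mult_left_mono add_mono C1) simp
      also have "\<dots> = ennreal (C^2 / R^4 * (2 * C1))" using C1(1) by (simp add: ennreal_mult[symmetric] ennreal_plus[symmetric] del: ennreal_plus)
      finally show ?thesis .
    qed
    have "coulomb (\<lambda>x. (u x)^2) ?t = (\<integral>\<^sup>+y. ennreal ((u y)^2) * (\<integral>\<^sup>+x. ennreal (?t x / norm (y - x)) \<partial>lborel) \<partial>lborel)"
      by (rule coulomb_iterated) auto
    also have "\<dots> \<le> (\<integral>\<^sup>+y. ennreal ((u y)^2) * ennreal (C^2 / R^4 * (2 * C1)) \<partial>lborel)"
      by (intro nn_integral_mono mult_left_mono inner) simp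
    also have "\<dots> = ennreal (mass u) * ennreal (C^2 / R^4 * (2 * C1))" by (simp add: nn_integral_multc nn_mass[OF u])
    finally have ct: "coulomb (\<lambda>x. (u x)^2) ?t \<le> ennreal (mass u) * ennreal (C^2 / R^4 * (2 * C1))" .
    let ?k = "\<lambda>p::R3 \<times> R3. norm (fst p - snd p)"
    have "hart u \<le> (\<integral>\<^sup>+p. ennreal ((cutoff R u (fst p))^2 * (cutoff R u (snd p))^2 / ?k p)
        + (ennreal (?t (fst p) * (u (snd p))^2 / ?k p) + ennreal ((u (fst p))^2 * ?t (snd p) / ?k p)) \<partial>lborel2)"
      unfolding coulomb_def
    proof (rule nn_integral_mono)
      fix p :: "R3 \<times> R3"
      have "(u (fst p))^2 * (u (snd p))^2 / ?k p \<le> (cutoff R u (fst p))^2 * (cutoff R u (snd p))^2 / ?k p + (?t (fst p) * (u (snd p))^2 / ?k p + (u (fst p))^2 * ?t (snd p) / ?k p)"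
        using cutoff_inside[OF R(2), of "fst p" u] cutoff_inside[OF R(2), of "snd p" u]
        by (auto split: split_indicator)
      note le = ennreal_leI[OF this]
      have lin: "ennreal (a + (b + c)) = ennreal a + (ennreal b + ennreal c)" if "a \<ge> 0" "b \<ge> 0" "c \<ge> 0" for a b c
        using that by simp
      show "ennreal ((u (fst p))^2 * (u (snd p))^2 / ?k p) \<le> ennreal ((cutoff R u (fst p))^2 * (cutoff R u (snd p))^2 / ?k p)
        + (ennreal (?t (fst p) * (u (snd p))^2 / ?k p) + ennreal ((u (fst p))^2 * ?t (snd p) / ?k p))"
        by (rule order_trans[OF le], subst lin) auto
    qed
    also have "\<dots> = hart (cutoff R u) + (coulomb ?t (\<lambda>x. (u x)^2) + coulomb (\<lambda>x. (u x)^2) ?t)"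
      unfolding coulomb_def by (subst nn_integral_add, measurable, subst nn_integral_add, measurable)
    also have "coulomb ?t (\<lambda>x. (u x)^2) = coulomb (\<lambda>x. (u x)^2) ?t" by (rule coulomb_sym) measurable
    also have "hart (cutoff R u) + (coulomb (\<lambda>x. (u x)^2) ?t + coulomb (\<lambda>x. (u x)^2) ?t)
       \<le> hart (cutoff R u) + (ennreal (mass u) * ennreal (C^2 / R^4 * (2 * C1)) + ennreal (mass u) * ennreal (C^2 / R^4 * (2 * C1)))"
      by (intro add_left_mono add_mono ct)
    also have "\<dots> = hart (cutoff R u) + ennreal (4 * C^2 * C1 * mass u / R^4)"
      using C1(1) mass_nonneg[of u] by (simp add: ennreal_mult[symmetric] ennreal_plus[symmetric] mult_ac del: ennreal_plus)
    finally show "hart u \<le> hart (cutoff R u) + ennreal (4 * C^2 * C1 * mass u / R^4)" .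
  qed (use C1(1) mass_nonneg[of u] in auto)
qed

section \<open>Mass correction and choice of the centre\<close>

text \<open>Above frequency \<open>M\<close> the excess of the symbol over \<open>|\<xi>|\<close> is
  at most \<open>m^2 / M\<close>. Below it is at most \<open>|m|\<close>, and the mass carried there
  is dominated by a heat form at time \<open>1 / M^2\<close>, hence by \<open>M^3\<close> times the
  squared \<open>L\<^sup>1\<close> norm up to a constant. Concentrating functions have small
  \<open>L\<^sup>1\<close> norm.\<close>

lemma relativistic_excess:
  assumes w: "half_sobolev w" and i: "integrable lborel w" and M: "M > 0"
  shows "enn2real (symbol_form m w) \<le> kinetic w + m^2 / M * mass w + \<bar>m\<bar> * exp 1 * M^3 * (\<integral>x. \<bar>w x\<bar> \<partial>lborel)^2"
proof -
  note sw = half_sobolevD(1)[OF w]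
  note [measurable] = fhat_measurable[OF sw] square_integrableD(1)[OF sw]
  define t where "t = 1 / M^2"
  have t: "t > 0" using M by (simp add: t_def)
  define L where "L = (\<integral>x. \<bar>w x\<bar> \<partial>lborel)"
  define H where "H = (\<integral>\<xi>. exp (- t * (norm \<xi>)^2) * (cmod (fhat w \<xi>))^2 \<partial>lborel)"
  have H: "(\<integral>\<^sup>+\<xi>. ennreal (exp (- t * (norm \<xi>)^2) * (cmod (fhat w \<xi>))^2) \<partial>lborel) = ennreal H" "H \<ge> 0"
  proof -
    have "integrable lborel (\<lambda>\<xi>. exp (- t * (norm \<xi>)^2) * (cmod (fhat w \<xi>))^2)"
      by (rule Bochner_Integration.integrable_bound[OF fhat_sq_integrable[OF sw]])
         (use t in \<open>auto intro!: AE_I2 mult_left_le_one_le\<close>)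
    then show "(\<integral>\<^sup>+\<xi>. ennreal (exp (- t * (norm \<xi>)^2) * (cmod (fhat w \<xi>))^2) \<partial>lborel) = ennreal H"
      unfolding H_def by (rule nn_integral_eq_integral) auto
    show "H \<ge> 0" unfolding H_def by (intro integral_nonneg_AE) auto
  qed
  have HL: "H \<le> M^3 * L^2"
  proof -
    have hM: "heat t z \<le> M^3" for z
    proof -
      have "sqrt (4 * pi * t) = sqrt (4 * pi) / M" using M by (simp add: t_def real_sqrt_divide)
      moreover have "sqrt (4 * pi) \<ge> 1" using pi_gt3 by simp
      ultimately have "1 / M \<le> sqrt (4 * pi * t)" using M by (simp add: divide_right_mono)
      then have "(1 / M)^3 \<le> sqrt (4 * pi * t) ^ 3" using M by (intro power_mono) auto
      then have "1 / sqrt (4 * pi * t) ^ 3 \<le> 1 / (1 / M)^3" using M t by (intro divide_left_mono) auto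
      also have "1 / (1/M)^3 = M^3" by (simp add: power_divide)
      finally have 1: "1 / sqrt (4 * pi * t) ^ 3 \<le> M^3" .
      have "exp (- (norm z)\<^sup>2 / (4 * t)) \<le> 1" using t by simp
      then have "heat t z \<le> 1 / sqrt (4 * pi * t) ^ 3" unfolding heat_def using t by (intro divide_right_mono) auto
      then show ?thesis using 1 by linarith
    qed
    have ai: "integrable lborel (\<lambda>x. \<bar>w x\<bar>)" using i by simp
    have hb: "has_bochner_integral lborel2 (\<lambda>p. M^3 * (\<bar>w (fst p)\<bar> * \<bar>w (snd p)\<bar>)) (M^3 * (L * L))"
      unfolding L_def by (intro has_bochner_integral_mult_right has_bochner_product ai)
    have "H = (\<integral>p. heat t (fst p - snd p) * w (fst p) * w (snd p) \<partial>lborel2)"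
      unfolding H_def by (rule fhat_heat_integral[OF sw t])
    also have "\<dots> \<le> (\<integral>p. M^3 * (\<bar>w (fst p)\<bar> * \<bar>w (snd p)\<bar>) \<partial>lborel2)"
    proof (rule integral_mono)
      fix p :: "R3 \<times> R3"
      have "heat t (fst p - snd p) * w (fst p) * w (snd p) \<le> \<bar>heat t (fst p - snd p) * w (fst p) * w (snd p)\<bar>" by simp
      also have "\<dots> = heat t (fst p - snd p) * (\<bar>w (fst p)\<bar> * \<bar>w (snd p)\<bar>)" using heat_nonneg[OF t] by (simp add: abs_mult)
      also have "\<dots> \<le> M^3 * (\<bar>w (fst p)\<bar> * \<bar>w (snd p)\<bar>)" by (intro mult_right_mono hM) simp
      finally show "heat t (fst p - snd p) * w (fst p) * w (snd p) \<le> M^3 * (\<bar>w (fst p)\<bar> * \<bar>w (snd p)\<bar>)" .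
    qed (use heat_form_integrable[OF sw t] hb in \<open>auto simp: has_bochner_integral_iff\<close>)
    also have "\<dots> = M^3 * L^2" using hb by (simp add: has_bochner_integral_iff power2_eq_square)
    finally show ?thesis .
  qed
  have "symbol_form m w \<le> (\<integral>\<^sup>+\<xi>. ennreal (norm \<xi> * (cmod (fhat w \<xi>))^2) + (ennreal (m^2 / M) * ennreal ((cmod (fhat w \<xi>))^2)
      + ennreal (\<bar>m\<bar> * exp 1) * ennreal (exp (- t * (norm \<xi>)^2) * (cmod (fhat w \<xi>))^2)) \<partial>lborel)"
    unfolding symbol_form_def
  proof (rule nn_integral_mono)
    fix \<xi> :: R3
    have "sqrt ((norm \<xi>)^2 + m^2) \<le> norm \<xi> + (m^2 / M + \<bar>m\<bar> * exp 1 * exp (- t * (norm \<xi>)^2))"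
    proof (cases "norm \<xi> \<ge> M")
      case True
      have "m^2 * 1 \<le> m^2 * (2 * norm \<xi> / M)" using True M by (intro mult_left_mono) (auto simp: field_simps)
      moreover have "m^2 * (2 * norm \<xi> / M) = 2 * norm \<xi> * (m^2 / M)" by (simp add: mult_ac)
      moreover have "0 \<le> (m^2 / M)^2" by (rule zero_le_power2)
      ultimately have "(norm \<xi>)^2 + m^2 \<le> (norm \<xi>)^2 + 2 * norm \<xi> * (m^2 / M) + (m^2 / M)^2" by linarith
      also have "\<dots> = (norm \<xi> + m^2 / M)^2" by (simp add: power2_sum)
      finally have "sqrt ((norm \<xi>)^2 + m^2) \<le> norm \<xi> + m^2 / M" using M by (intro real_le_lsqrt) auto
      moreover have "0 \<le> \<bar>m\<bar> * exp 1 * exp (- t * (norm \<xi>)^2)" by simp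
      ultimately show ?thesis by linarith
    next
      case False
      then have "(norm \<xi>)^2 \<le> M^2" by (intro power_mono) auto
      then have "t * (norm \<xi>)^2 \<le> 1" using M by (simp add: t_def)
      then have "1 \<le> exp (1 + (- t * (norm \<xi>)^2))" by simp
      then have "\<bar>m\<bar> * 1 \<le> \<bar>m\<bar> * exp (1 + (- t * (norm \<xi>)^2))" by (intro mult_left_mono) auto
      then have "\<bar>m\<bar> \<le> \<bar>m\<bar> * exp 1 * exp (- t * (norm \<xi>)^2)" by (simp only: exp_add mult.assoc mult_1_right)
      moreover have "sqrt ((norm \<xi>)^2 + m^2) \<le> norm \<xi> + \<bar>m\<bar>"
        using sqrt_sum_squares_le_sum_abs[of "norm \<xi>" m] by simp
      moreover have "0 \<le> m^2 / M" using M by simp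
      ultimately show ?thesis by linarith
    qed
    from mult_right_mono[OF this, of "(cmod (fhat w \<xi>))^2"]
    have le: "sqrt ((norm \<xi>)^2 + m^2) * (cmod (fhat w \<xi>))^2 \<le> norm \<xi> * (cmod (fhat w \<xi>))^2 + (m^2 / M * (cmod (fhat w \<xi>))^2 + \<bar>m\<bar> * exp 1 * (exp (- t * (norm \<xi>)^2) * (cmod (fhat w \<xi>))^2))"
      by (simp add: distrib_right mult.assoc)
    have lin: "ennreal (a + (b * c + d * e)) = ennreal a + (ennreal b * ennreal c + ennreal d * ennreal e)" if "a \<ge> 0" "b \<ge> 0" "c \<ge> 0" "d \<ge> 0" "e \<ge> 0" for a b c d e
      using that by (simp add: ennreal_mult)
    show "ennreal (sqrt ((norm \<xi>)^2 + m^2) * (cmod (fhat w \<xi>))^2) \<le> ennreal (norm \<xi> * (cmod (fhat w \<xi>))^2) + (ennreal (m^2 / M) * ennreal ((cmod (fhat w \<xi>))^2)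
      + ennreal (\<bar>m\<bar> * exp 1) * ennreal (exp (- t * (norm \<xi>)^2) * (cmod (fhat w \<xi>))^2))"
      by (rule order_trans[OF ennreal_leI[OF le]], subst lin) (use M in auto)
  qed
  also have "\<dots> = ennreal (kinetic w) + (ennreal (m^2 / M) * ennreal (mass w) + ennreal (\<bar>m\<bar> * exp 1) * ennreal H)"
  proof -
    have k: "(\<integral>\<^sup>+\<xi>. ennreal (norm \<xi> * (cmod (fhat w \<xi>))^2) \<partial>lborel) = ennreal (kinetic w)"
      unfolding ennreal_kinetic[OF w] symbol_form_def by simp
    show ?thesis unfolding k[symmetric] nn_fhat[OF sw, symmetric] H(1)[symmetric]
      by (subst nn_integral_add, measurable, subst nn_integral_add, measurable, subst nn_integral_cmult, measurable, subst nn_integral_cmult, measurable)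
  qed
  also have "\<dots> = ennreal (kinetic w + (m^2 / M * mass w + \<bar>m\<bar> * exp 1 * H))"
    using M H(2) mass_nonneg[of w] kinetic_nonneg[OF sw] by (simp add: ennreal_mult[symmetric] ennreal_plus[symmetric] del: ennreal_plus)
  finally have "enn2real (symbol_form m w) \<le> kinetic w + (m^2 / M * mass w + \<bar>m\<bar> * exp 1 * H)"
    using M H(2) mass_nonneg[of w] kinetic_nonneg[OF sw] by (intro enn2real_leI) auto
  also have "\<bar>m\<bar> * exp 1 * H \<le> \<bar>m\<bar> * exp 1 * (M^3 * L^2)" by (intro mult_left_mono HL) auto
  finally show ?thesis unfolding L_def by (simp add: mult.assoc)
qed

text \<open>Averaging over the centre \<open>x0\<close> replaces the Lebesgue differentiation theorem.\<close>

lemma concentration_point: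
  fixes W p :: "R3 \<Rightarrow> real" and l :: "nat \<Rightarrow> real"
  assumes W: "integrable lborel W" "\<And>x. W x \<ge> 0" and p: "integrable lborel p" "\<And>x. p x \<ge> 0"
    and P: "(\<integral>x. p x \<partial>lborel) = P" "P > 0"
    and S[measurable]: "S \<in> sets borel" and \<alpha>: "emeasure lborel S = ennreal \<alpha>" "\<alpha> > 0"
    and c: "\<And>x. x \<in> S \<Longrightarrow> W x \<le> c" "c \<ge> 0" and d: "c < d"
    and l: "\<And>n. l n > 0" "filterlim l at_top sequentially"
  shows "\<forall>\<^sub>F n in sequentially. \<exists>x0\<in>S. (\<integral>\<^sup>+y. ennreal (p y * W (x0 + (1 / l n) *\<^sub>R y)) \<partial>lborel) \<le> ennreal (P * d)"
proof -
  have [measurable]: "W \<in> borel_measurable borel" "p \<in> borel_measurable borel"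
    using W p by (auto dest: borel_measurable_integrable)
  define F where "F n x0 = (\<integral>\<^sup>+y. ennreal (p y * W (x0 + (1 / l n) *\<^sub>R y)) \<partial>lborel)" for n x0
  \<comment> \<open>The inner integral when the centre is integrated out before \<open>y\<close>; by
    continuity of translations in \<open>L\<^sup>1\<close> its limit \<open>G\<close> no longer
    depends on \<open>y\<close>.\<close>
  define g where "g n y = (\<integral>\<^sup>+x. indicator S x * ennreal (W (x + (1 / l n) *\<^sub>R y)) \<partial>lborel)" for n and y :: R3
  define G where "G = (\<integral>\<^sup>+x. indicator S x * ennreal (W x) \<partial>lborel)"
  have [measurable]: "F n \<in> borel_measurable borel" "g n \<in> borel_measurable borel" for n
    unfolding F_def g_def by measurable
  have Wf: "(\<integral>\<^sup>+x. ennreal (W x) \<partial>lborel) < \<infinity>" using W by (simp add: integrable_iff_bounded)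
  have pf: "(\<integral>\<^sup>+x. ennreal (p x) \<partial>lborel) = ennreal P" using p P by (subst nn_integral_eq_integral) auto
  have gle: "g n y \<le> (\<integral>\<^sup>+x. ennreal (W x) \<partial>lborel)" for n y
  proof -
    have "g n y \<le> (\<integral>\<^sup>+x. ennreal (W (x + (1 / l n) *\<^sub>R y)) \<partial>lborel)"
      unfolding g_def by (intro nn_integral_mono) (auto split: split_indicator)
    also have "\<dots> = (\<integral>\<^sup>+x. ennreal (W x) \<partial>lborel)" by (rule nn_integral_translate_R3) measurable
    finally show ?thesis .
  qed
  have glim: "(\<lambda>n. g n y) \<longlonglongrightarrow> G" for y
  proof -
    have "(\<lambda>n. (1 / l n) *\<^sub>R y) \<longlonglongrightarrow> 0 *\<^sub>R y"
      by (intro tendsto_intros tendsto_divide_0[OF tendsto_const filterlim_at_top_imp_at_infinity[OF l(2)]])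
    then have "(\<lambda>n. \<integral>\<^sup>+x. ennreal \<bar>W (x + (1 / l n) *\<^sub>R y) - W x\<bar> \<partial>lborel) \<longlonglongrightarrow> 0"
      by (intro translation_L1 W) simp
    then have L: "(\<lambda>n. \<integral>\<^sup>+x. ennreal (norm (indicator S x * W (x + (1 / l n) *\<^sub>R y) - indicator S x * W x)) \<partial>lborel) \<longlonglongrightarrow> 0"
      by (rule ennreal_tendsto_0_le) (auto intro!: nn_integral_mono split: split_indicator)
    have ii: "integrable lborel (\<lambda>x. indicator S x * W (x + h))" for h
    proof -
      have "integrable lborel (\<lambda>x. W (x + h))"
        using nn_integral_translate_R3[of "\<lambda>x. ennreal (W x)" h] Wf W(2) by (intro integrableI_nonneg) auto
      then show ?thesis by (rule Bochner_Integration.integrable_bound) (auto split: split_indicator)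
    qed
    have "(\<lambda>n. \<integral>x. indicator S x * W (x + (1 / l n) *\<^sub>R y) \<partial>lborel) \<longlonglongrightarrow> (\<integral>x. indicator S x * W x \<partial>lborel)"
      by (rule tendsto_L1_int[OF ii _ L]) (use ii[of 0] in simp)
    then have "(\<lambda>n. ennreal (\<integral>x. indicator S x * W (x + (1 / l n) *\<^sub>R y) \<partial>lborel)) \<longlonglongrightarrow> ennreal (\<integral>x. indicator S x * W x \<partial>lborel)"
      by (rule tendsto_ennrealI)
    moreover have "g n y = ennreal (\<integral>x. indicator S x * W (x + (1 / l n) *\<^sub>R y) \<partial>lborel)" for n
      unfolding g_def using W(2) by (subst nn_integral_eq_integral[symmetric, OF ii]) (auto intro!: nn_integral_cong split: split_indicator)
    moreover have "G = ennreal (\<integral>x. indicator S x * W x \<partial>lborel)"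
      unfolding G_def using W(2) ii[of 0] by (subst nn_integral_eq_integral[symmetric]) (auto intro!: nn_integral_cong split: split_indicator)
    ultimately show ?thesis by simp
  qed
  have swap: "(\<integral>\<^sup>+x. indicator S x * F n x \<partial>lborel) = (\<integral>\<^sup>+y. ennreal (p y) * g n y \<partial>lborel)" for n
  proof -
    have "(\<integral>\<^sup>+x. indicator S x * F n x \<partial>lborel) = (\<integral>\<^sup>+x. (\<integral>\<^sup>+y. indicator S x * ennreal (p y * W (x + (1 / l n) *\<^sub>R y)) \<partial>lborel) \<partial>lborel)"
      unfolding F_def by (intro nn_integral_cong nn_integral_cmult[symmetric]) measurable
    also have "\<dots> = (\<integral>\<^sup>+y. (\<integral>\<^sup>+x. indicator S x * ennreal (p y * W (x + (1 / l n) *\<^sub>R y)) \<partial>lborel) \<partial>lborel)"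
      by (rule lborel_pair.Fubini') measurable
    also have "\<dots> = (\<integral>\<^sup>+y. ennreal (p y) * g n y \<partial>lborel)"
      unfolding g_def using p(2) W(2)
      by (intro nn_integral_cong) (subst nn_integral_cmult[symmetric], auto intro!: nn_integral_cong simp: ennreal_mult mult_ac)
    finally show ?thesis .
  qed
  have "(\<lambda>n. \<integral>\<^sup>+y. ennreal (p y) * g n y \<partial>lborel) \<longlonglongrightarrow> (\<integral>\<^sup>+y. ennreal (p y) * G \<partial>lborel)"
  proof (rule nn_integral_dominated_convergence[where w="\<lambda>y. ennreal (p y) * (\<integral>\<^sup>+x. ennreal (W x) \<partial>lborel)"])
    show "(\<integral>\<^sup>+y. ennreal (p y) * (\<integral>\<^sup>+x. ennreal (W x) \<partial>lborel) \<partial>lborel) < \<infinity>"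
      using Wf by (simp add: nn_integral_multc pf ennreal_mult_less_top)
    show "AE y in lborel. (\<lambda>n. ennreal (p y) * g n y) \<longlonglongrightarrow> ennreal (p y) * G"
    proof (rule AE_I2)
      fix y
      show "(\<lambda>n. ennreal (p y) * g n y) \<longlonglongrightarrow> ennreal (p y) * G"
        by (intro ennreal_tendsto_cmult glim) simp
    qed
    show "AE y in lborel. ennreal (p y) * g n y \<le> ennreal (p y) * (\<integral>\<^sup>+x. ennreal (W x) \<partial>lborel)" for n
      by (intro AE_I2 mult_left_mono gle) simp
  qed auto
  then have lim: "(\<lambda>n. \<integral>\<^sup>+x. indicator S x * F n x \<partial>lborel) \<longlonglongrightarrow> ennreal P * G"
    unfolding swap by (simp add: nn_integral_multc pf)
  have "G \<le> (\<integral>\<^sup>+x. ennreal c * indicator S x \<partial>lborel)"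
    unfolding G_def using c by (intro nn_integral_mono) (auto split: split_indicator intro!: ennreal_leI)
  also have "\<dots> = ennreal c * ennreal \<alpha>" by (subst nn_integral_cmult_indicator) (auto simp: \<alpha>)
  finally have "ennreal P * G \<le> ennreal P * (ennreal c * ennreal \<alpha>)" by (intro mult_left_mono) auto
  also have "\<dots> = ennreal (P * (c * \<alpha>))" using P c \<alpha> by (simp add: ennreal_mult)
  also have "\<dots> < ennreal (P * d * \<alpha>)"
  proof (rule ennreal_lessI)
    have "P * (c * \<alpha>) < P * (d * \<alpha>)" using P \<alpha> d by (intro mult_strict_left_mono mult_strict_right_mono) auto
    then show "P * (c * \<alpha>) < P * d * \<alpha>" by (simp add: mult.assoc)
    show "0 < P * d * \<alpha>" using P \<alpha> d c by simp
  qed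
  finally have "\<forall>\<^sub>F n in sequentially. (\<integral>\<^sup>+x. indicator S x * F n x \<partial>lborel) < ennreal (P * d * \<alpha>)"
    using order_tendstoD(2)[OF lim] by simp
  then show ?thesis
  proof eventually_elim
    case (elim n)
    show ?case
    proof (rule ccontr)
      \<comment> \<open>If every centre failed, integrating over \<open>S\<close> would give at
        least \<open>P * d * \<alpha>\<close>, although the integrals converge to a limit of at most
        \<open>P * c * \<alpha>\<close>.\<close>
      assume "\<not> (\<exists>x0\<in>S. (\<integral>\<^sup>+y. ennreal (p y * W (x0 + (1 / l n) *\<^sub>R y)) \<partial>lborel) \<le> ennreal (P * d))"
      then have big: "ennreal (P * d) \<le> F n x" if "x \<in> S" for x using that unfolding F_def by (meson linorder_le_cases)
      have "ennreal (P * d * \<alpha>) = ennreal (P * d) * emeasure lborel S"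
        using P d c \<alpha> by (simp add: ennreal_mult)
      also have "\<dots> = (\<integral>\<^sup>+x. ennreal (P * d) * indicator S x \<partial>lborel)" by (subst nn_integral_cmult_indicator) auto
      also have "\<dots> \<le> (\<integral>\<^sup>+x. indicator S x * F n x \<partial>lborel)"
        using big by (intro nn_integral_mono) (auto split: split_indicator)
      finally show False using elim by simp
    qed
  qed
qed

text \<open>Intersected with a large ball, the sublevel set has finite measure and keeps positive
  measure; otherwise it would be a countable union of null sets.\<close>

lemma sublevel_positive_measure:
  fixes V :: "R3 \<Rightarrow> real"
  assumes V[measurable]: "V \<in> borel_measurable borel" and e: "\<not> (AE x in lborel. V x \<ge> c)"
  obtains \<rho> \<alpha> where "\<rho> > 0" "\<alpha> > 0" "{x. V x < c \<and> norm x \<le> \<rho>} \<in> sets borel" "emeasure lborel {x. V x < c \<and> norm x \<le> \<rho>} = ennreal \<alpha>"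
proof -
  have meas: "{x. V x < c \<and> norm x \<le> \<rho>} \<in> sets borel" for \<rho> by measurable
  have "\<exists>n::nat. emeasure lborel {x. V x < c \<and> norm x \<le> real n} \<noteq> 0"
  proof (rule ccontr)
    assume "\<not> (\<exists>n::nat. emeasure lborel {x. V x < c \<and> norm x \<le> real n} \<noteq> 0)"
    then have "{x. V x < c \<and> norm x \<le> real n} \<in> null_sets lborel" for n :: nat
      using meas by (auto simp: null_sets_def)
    then have "AE x in lborel. x \<notin> {x. V x < c \<and> norm x \<le> real n}" for n :: nat by (rule AE_not_in)
    then have "AE x in lborel. \<forall>n::nat. x \<notin> {x. V x < c \<and> norm x \<le> real n}" by (subst AE_all_countable) auto
    then have "AE x in lborel. V x \<ge> c"
      by eventually_elim (use real_arch_simple in \<open>force simp: not_less\<close>)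
    then show False using e by simp
  qed
  then obtain n :: nat where n: "emeasure lborel {x. V x < c \<and> norm x \<le> real n} \<noteq> 0" by blast
  let ?\<rho> = "real n + 1"
  have le: "emeasure lborel {x. V x < c \<and> norm x \<le> real n} \<le> emeasure lborel {x. V x < c \<and> norm x \<le> ?\<rho>}"
    using meas by (intro emeasure_mono) auto
  have "emeasure lborel {x. V x < c \<and> norm x \<le> ?\<rho>} \<le> emeasure lborel (cball (0::R3) ?\<rho>)"
    by (intro emeasure_mono) auto
  also have "\<dots> < \<infinity>" using emeasure_lborel_cball_finite[of "0::R3" ?\<rho>] by simp
  finally obtain \<alpha> where "emeasure lborel {x. V x < c \<and> norm x \<le> ?\<rho>} = ennreal \<alpha>" "\<alpha> \<ge> 0"
    by (cases "emeasure lborel {x. V x < c \<and> norm x \<le> ?\<rho>}") auto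
  moreover have "\<alpha> \<noteq> 0" using n le calculation by auto
  ultimately show thesis using that[of ?\<rho> \<alpha>] meas by force
qed

lemma quartic_limits:
  fixes R :: "nat \<Rightarrow> real"
  assumes "filterlim R at_top sequentially"
  shows "(\<lambda>n. inverse (R n)) \<longlonglongrightarrow> 0" "(\<lambda>n. inverse (sqrt (2 * R n))) \<longlonglongrightarrow> 0"
proof -
  show "(\<lambda>n. inverse (R n)) \<longlonglongrightarrow> 0" by (rule tendsto_inverse_0_at_top[OF assms])
  have "filterlim (\<lambda>n. 2 * R n) at_top sequentially"
    by (rule filterlim_tendsto_pos_mult_at_top[OF tendsto_const _ assms]) simp
  then have "filterlim (\<lambda>n. sqrt (2 * R n)) at_top sequentially"
    by (rule filterlim_compose[OF sqrt_at_top])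
  then show "(\<lambda>n. inverse (sqrt (2 * R n))) \<longlonglongrightarrow> 0" by (rule tendsto_inverse_0_at_top)
qed

text \<open>The scale \<open>2 R\<close> compresses the support of the truncation at radius \<open>2 R\<close> into a unit ball.\<close>

lemma concentrating_trial_function:
  assumes V: "trapping V" and A: "hartree_bound A" and Q: "half_sobolev Q" "integrable lborel Q" "quartic_decay Q C R0"
    and KNQ: "kinetic Q = A" "mass Q = A" and D: "enn2real (hart Q) = 2 * A"
    and c: "c \<ge> 0" "\<And>\<epsilon>. \<epsilon> > 0 \<Longrightarrow> \<not> (AE x in lborel. V x \<ge> c + \<epsilon>)" and e: "e > 0"
  shows "\<exists>w. admissible V w \<and> total_energy m V A w \<le> c + e \<and> enn2real (hart w) \<ge> \<Lambda>"
proof -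
  note sQ = half_sobolevD(1)[OF Q(1)]
  have A0: "A > 0" by (rule hartree_boundD(1)[OF A])
  have [measurable]: "V \<in> borel_measurable borel" and V0: "\<And>x. V x \<ge> 0"
    using V unfolding trapping_def by auto
  note [measurable] = square_integrableD(1)[OF sQ]
  have R0: "R0 \<ge> 1" using Q(3) by (simp add: quartic_decay_def)
  obtain B where B: "B \<ge> 0" "\<And>R. R \<ge> R0 \<Longrightarrow> (\<integral>\<^sup>+x. ennreal (indicator {x. norm x \<ge> R} x * (Q x)^2) \<partial>lborel) \<le> ennreal (B / R^4)"
    by (rule decay_tail[OF square_integrableD(1)[OF sQ] Q(3)]) blast
  obtain C1 where C1: "C1 \<ge> 0" "\<And>R. R \<ge> R0 \<Longrightarrow> seminorm (cutoff R Q) \<le> seminorm Q + ennreal (C1 / R^2)"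
    using cutoff_seminorm[OF sQ B(2,1) R0] by metis
  obtain B1 where B1: "B1 \<ge> 0" "\<And>R. R \<ge> R0 \<Longrightarrow> hart Q \<le> hart (cutoff R Q) + ennreal (B1 / R^4)"
    by (rule cutoff_hart[OF sQ Q(3)]) blast
  define L where "L = (\<integral>x. \<bar>Q x\<bar> \<partial>lborel)"
  \<comment> \<open>The margins \<open>e/4\<close>, \<open>e/2\<close> and \<open>e\<close> are
    strictly nested: they belong to the values of \<open>V\<close> on \<open>S\<close>, the averaged
    potential energy and the final energy.\<close>
  define d where "d = c + e / 2"
  have "\<not> (AE x in lborel. V x \<ge> c + e / 4)" using c(2)[of "e/4"] e by simp
  then obtain \<rho> \<alpha> where \<rho>: "\<rho> > 0" "\<alpha> > 0" "{x. V x < c + e / 4 \<and> norm x \<le> \<rho>} \<in> sets borel"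
      "emeasure lborel {x. V x < c + e / 4 \<and> norm x \<le> \<rho>} = ennreal \<alpha>"
    by (rule sublevel_positive_measure[rotated]) auto
  define S where "S = {x. V x < c + e / 4 \<and> norm x \<le> \<rho>}"
  \<comment> \<open>The potential on a ball containing every possible support, since centres have
    norm at most \<open>\<rho>\<close> and trial functions live within distance 1 of them. The
    restriction makes it integrable.\<close>
  define W where "W x = indicator (cball 0 (\<rho> + 1)) x * V x" for x
  have [measurable]: "(indicator (cball (0::R3) (\<rho> + 1)) :: R3 \<Rightarrow> real) \<in> borel_measurable borel"
    by (rule borel_measurable_indicator) simp
  have [measurable]: "W \<in> borel_measurable borel" unfolding W_def by measurable
  obtain M where M: "AE x in lborel. norm x \<le> \<rho> + 1 \<longrightarrow> V x \<le> M"
    using V unfolding trapping_def by blast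
  have Wi: "integrable lborel W"
  proof (rule integrableI_bounded_set[where A="cball (0::R3) (\<rho> + 1)" and B="max 0 M"])
    show "emeasure lborel (cball (0::R3) (\<rho> + 1)) < \<infinity>" using emeasure_lborel_cball_finite[of "0::R3" "\<rho> + 1"] by simp
    show "AE x in lborel. x \<in> cball 0 (\<rho> + 1) \<longrightarrow> norm (W x) \<le> max 0 M"
      using M by eventually_elim (use V0 in \<open>auto simp: W_def\<close>)
  qed (auto simp: W_def)
  define R where "R n = R0 + real n" for n :: nat
  have RR0: "R n \<ge> R0" "R n \<ge> 1" for n using R0 by (auto simp: R_def)
  have Rtop: "filterlim R at_top sequentially"
    unfolding R_def by (rule filterlim_tendsto_add_at_top[OF tendsto_const filterlim_real_sequentially])
  have ltop: "filterlim (\<lambda>n. 2 * R n) at_top sequentially"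
    by (rule filterlim_tendsto_pos_mult_at_top[OF tendsto_const _ Rtop]) simp
  note lims = quartic_limits[OF Rtop]
  have conc: "\<forall>\<^sub>F n in sequentially. \<exists>x0\<in>S. (\<integral>\<^sup>+y. ennreal ((Q y)^2 * W (x0 + (1 / (2 * R n)) *\<^sub>R y)) \<partial>lborel) \<le> ennreal (A * d)"
  proof (rule concentration_point[where c="c + e/4" and \<alpha>=\<alpha>])
    show "(\<integral>x. (Q x)^2 \<partial>lborel) = A" using KNQ(2) by (simp add: mass_def)
    show "integrable lborel (\<lambda>x. (Q x)^2)" using square_integrableD[OF sQ] by simp
    show "W x \<le> c + e/4" if "x \<in> S" for x using that \<rho>(1) V0[of x] c(1) e by (auto simp: S_def W_def split: split_indicator)
    show "2 * R n > 0" for n using RR0(2)[of n] by linarith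
    show "integrable lborel W" by (rule Wi)
  qed (use V0 A0 \<rho> c e ltop in \<open>auto simp: W_def S_def d_def\<close>)
  \<comment> \<open>In this order: the truncation error of kinetic minus Hartree energy, the two
    mass corrections, and the potential energy, which tends to \<open>d\<close>.\<close>
  define err where "err n = 8 * (kappa * C1 + B1) / A * inverse (R n) + m^2 * inverse (sqrt (2 * R n))
    + \<bar>m\<bar> * exp 1 * (2 * L^2 / A) * inverse (sqrt (2 * R n)) ^ 3 + A * d / (A - B * inverse (R n) ^ 4)" for n
  have "err \<longlonglongrightarrow> 8 * (kappa * C1 + B1) / A * 0 + m^2 * 0 + \<bar>m\<bar> * exp 1 * (2 * L^2 / A) * 0 ^ 3 + A * d / (A - B * 0 ^ 4)"
    unfolding err_def by (intro tendsto_intros lims) (use A0 in auto)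
  then have "err \<longlonglongrightarrow> d" using A0 by simp
  then have ev1: "\<forall>\<^sub>F n in sequentially. err n < c + e" by (rule order_tendstoD(2)) (use e in \<open>simp add: d_def\<close>)
  have "(\<lambda>n. B * inverse (R n) ^ 4) \<longlonglongrightarrow> B * 0 ^ 4" by (intro tendsto_intros lims)
  then have ev2: "\<forall>\<^sub>F n in sequentially. B * inverse (R n) ^ 4 < A / 2" by (rule order_tendstoD(2)) (use A0 in simp)
  have "(\<lambda>n. B1 * inverse (R n) ^ 4) \<longlonglongrightarrow> B1 * 0 ^ 4" by (intro tendsto_intros lims)
  then have ev3: "\<forall>\<^sub>F n in sequentially. B1 * inverse (R n) ^ 4 < A" by (rule order_tendstoD(2)) (use A0 in simp)
  \<comment> \<open>The Hartree energy of the trial function will be at least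
    \<open>2 * R n / A\<close>.\<close>
  have ev4: "\<forall>\<^sub>F n in sequentially. A * \<Lambda> \<le> 2 * R n"
    using ltop unfolding filterlim_at_top by blast
  obtain n x0 where n: "err n < c + e" "B * inverse (R n) ^ 4 < A / 2" "B1 * inverse (R n) ^ 4 < A" "A * \<Lambda> \<le> 2 * R n"
    and x0: "x0 \<in> S" "(\<integral>\<^sup>+y. ennreal ((Q y)^2 * W (x0 + (1 / (2 * R n)) *\<^sub>R y)) \<partial>lborel) \<le> ennreal (A * d)"
    using eventually_happens'[OF sequentially_bot eventually_conj[OF conc eventually_conj[OF ev1 eventually_conj[OF ev2 eventually_conj[OF ev3 ev4]]]]] by blast
  define r where "r = R n"
  have r: "r \<ge> R0" "r \<ge> 1" "r > 0" using RR0[of n] by (auto simp: r_def)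
  define u where "u = cutoff r Q"
  have su: "square_integrable u" unfolding u_def by (rule square_integrable_cutoff[OF sQ])
  note [measurable] = square_integrableD(1)[OF su]
  have semu: "seminorm u \<le> seminorm Q + ennreal (C1 / r^2)" unfolding u_def by (rule C1(2)[OF r(1)])
  have semQ: "seminorm Q + ennreal (C1 / r^2) < \<infinity>" using half_sobolevD(2)[OF Q(1)] by simp
  have hu: "half_sobolev u" unfolding half_sobolev_def using su semu semQ by (auto intro: le_less_trans)
  have inv4: "b / r^4 = b * inverse r ^ 4" for b by (simp add: divide_inverse power_inverse)
  define N where "N = mass u"
  have N: "N \<le> A" "A - B * inverse r ^ 4 \<le> N"
    using cutoff_mass[OF sQ B(2)[OF r(1)] r(3)] B(1) r KNQ unfolding N_def u_def inv4 by auto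
  then have N2: "N \<ge> A / 2" "N > 0" using n(2) A0 by (auto simp: r_def)
  have K: "kinetic u \<le> A + kappa * C1 / r^2"
  proof -
    have "enn2real (seminorm u) \<le> enn2real (seminorm Q + ennreal (C1 / r^2))" by (rule enn2real_mono[OF semu semQ[unfolded infinity_ennreal_def]])
    also have "\<dots> = enn2real (seminorm Q) + C1 / r^2" using half_sobolevD(2)[OF Q(1)] C1(1) by (subst enn2real_plus) auto
    finally have "kappa * enn2real (seminorm u) \<le> kappa * (enn2real (seminorm Q) + C1 / r^2)"
      using kappa_pos by (intro mult_left_mono) auto
    then show ?thesis using KNQ(1) unfolding kinetic_seminorm[OF su] kinetic_seminorm[OF sQ] by (simp add: distrib_left)
  qed
  have hfin: "hart u < \<infinity>" by (rule hartree_boundD(2)[OF A hu])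
  have Dl: "2 * A \<le> enn2real (hart u) + B1 / r^4"
  proof -
    have "enn2real (hart Q) \<le> enn2real (hart u + ennreal (B1 / r^4))"
      using B1(2)[OF r(1)] hfin unfolding u_def[symmetric] by (intro enn2real_mono) auto
    also have "\<dots> = enn2real (hart u) + B1 / r^4" using hfin B1(1) by (subst enn2real_plus) auto
    finally show ?thesis using D by simp
  qed
  define l where "l = 2 * r"
  have l: "l > 0" "l \<ge> 1" using r by (auto simp: l_def)
  \<comment> \<open>Normalizes the mass to 1, since the rescaling multiplies it by
    \<open>s^2 / l^3\<close>.\<close>
  define s where "s = sqrt (l^3 / N)"
  have s2: "s^2 = l^3 / N" unfolding s_def using l N2 by simp
  have s4: "s^4 = l^6 / N^2" using s2 power_mult[of s 2 2] by (simp add: power_divide power_mult[symmetric])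
  define w where "w = rescale s l x0 u"
  have hw: "half_sobolev w" unfolding w_def by (rule half_sobolev_rescale[OF hu l(1)])
  note sw = half_sobolevD(1)[OF hw]
  note [measurable] = square_integrableD(1)[OF sw]
  have mw: "mass w = 1" unfolding w_def mass_rescale[OF su l(1)] s2 using l N2 by (simp add: N_def[symmetric])
  have kw: "kinetic w = l * (kinetic u / N)" unfolding w_def kinetic_rescale[OF hu l(1)] s2
    using l by (simp add: power3_eq_cube power2_eq_square)
  have hartw: "enn2real (hart w) = l * (enn2real (hart u) / N^2)"
  proof -
    have "s^4 / l^5 = l / N^2" unfolding s4 using l by (simp add: eval_nat_numeral)
    then show ?thesis unfolding w_def hart_rescale[OF square_integrableD(1)[OF su] l(1)]
      using l by (simp add: enn2real_mult)
  qed
  have pot: "potential_form V w \<le> ennreal (1 / N) * ennreal (A * d)"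
  proof -
    have ns: "norm x0 \<le> \<rho>" using x0(1) by (simp add: S_def)
    have pw: "V x * (w x)^2 \<le> s^2 * ((Q (l *\<^sub>R (x - x0)))^2 * W x)" for x
    proof (cases "norm (x - x0) \<le> 1")
      case True
      then have "norm x \<le> \<rho> + 1" using ns norm_triangle_ineq[of "x - x0" x0] by simp
      then have "W x = V x" by (simp add: W_def)
      moreover have "(u (l *\<^sub>R (x - x0)))^2 \<le> (Q (l *\<^sub>R (x - x0)))^2"
        using abs_cutoff_le[of r Q "l *\<^sub>R (x - x0)"] unfolding u_def by (simp add: abs_le_square_iff)
      then have "s^2 * (V x * (u (l *\<^sub>R (x - x0)))^2) \<le> s^2 * (V x * (Q (l *\<^sub>R (x - x0)))^2)"
        using V0 by (intro mult_left_mono) auto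
      ultimately show ?thesis by (simp add: w_def rescale_def power_mult_distrib mult_ac)
    next
      case False
      then have "norm (l *\<^sub>R (x - x0)) \<ge> 2 * r" using l r by (simp add: l_def)
      then have "u (l *\<^sub>R (x - x0)) = 0" unfolding u_def by (rule cutoff_outside[OF r(3)])
      then show ?thesis using V0[of x] by (simp add: w_def rescale_def W_def)
    qed
    have le: "(\<integral>\<^sup>+x. ennreal ((Q (l *\<^sub>R (x - x0)))^2 * W x) \<partial>lborel) \<le> ennreal (1 / l^3) * ennreal (A * d)"
    proof -
      have "(\<integral>\<^sup>+x. ennreal ((Q (l *\<^sub>R (x - x0)))^2 * W x) \<partial>lborel)
          = (\<integral>\<^sup>+x. ennreal ((Q (l *\<^sub>R (x - x0)))^2 * W (x0 + (1 / l) *\<^sub>R (l *\<^sub>R (x - x0)))) \<partial>lborel)"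
        using l by simp
      also have "\<dots> = ennreal (1 / l^3) * (\<integral>\<^sup>+y. ennreal ((Q y)^2 * W (x0 + (1 / l) *\<^sub>R y)) \<partial>lborel)"
        by (rule nn_affine_R3[where f="\<lambda>y. ennreal ((Q y)^2 * W (x0 + (1 / l) *\<^sub>R y))"]) (use l in auto)
      finally show ?thesis using x0(2) unfolding l_def r_def by (simp add: mult_left_mono)
    qed
    have "potential_form V w \<le> (\<integral>\<^sup>+x. ennreal (s^2) * ennreal ((Q (l *\<^sub>R (x - x0)))^2 * W x) \<partial>lborel)"
      unfolding potential_form_def by (intro nn_integral_mono) (use pw in \<open>simp add: ennreal_mult[symmetric] ennreal_leI W_def V0\<close>)
    also have "\<dots> = ennreal (s^2) * (\<integral>\<^sup>+x. ennreal ((Q (l *\<^sub>R (x - x0)))^2 * W x) \<partial>lborel)"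
      by (rule nn_integral_cmult) measurable
    also have "\<dots> \<le> ennreal (s^2) * (ennreal (1 / l^3) * ennreal (A * d))" by (rule mult_left_mono[OF le]) simp
    also have "\<dots> = ennreal (1 / N) * ennreal (A * d)"
      unfolding mult.assoc[symmetric] using s2 l N2 by (subst ennreal_mult[symmetric]) auto
    finally show ?thesis .
  qed
  have d0: "d \<ge> 0" using c e by (simp add: d_def)
  have pot2: "enn2real (potential_form V w) \<le> A * d / (A - B * inverse r ^ 4)"
  proof -
    have "enn2real (potential_form V w) \<le> 1 / N * (A * d)"
      using pot N2 A0 d0 by (intro enn2real_leI) (auto simp: ennreal_mult[symmetric])
    also have "\<dots> \<le> A * d / (A - B * inverse r ^ 4)"
      using N A0 d0 n(2) N2 unfolding r_def by (simp add: divide_left_mono)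
    finally show ?thesis .
  qed
  have adm: "admissible V w" unfolding admissible_def using hw mw pot by (auto intro: le_less_trans simp: ennreal_mult_less_top)
  have ui: "integrable lborel u"
    by (rule Bochner_Integration.integrable_bound[OF Q(2)]) (use abs_cutoff_le[of r Q] in \<open>auto simp: u_def\<close>)
  have uL: "(\<integral>x. \<bar>u x\<bar> \<partial>lborel) \<le> L" unfolding L_def
    by (intro integral_mono integrable_abs ui Q(2)) (use abs_cutoff_le[of r Q] in \<open>auto simp: u_def\<close>)
  have wnn: "(\<integral>\<^sup>+x. ennreal \<bar>w x\<bar> \<partial>lborel) = ennreal (s / l^3 * (\<integral>x. \<bar>u x\<bar> \<partial>lborel))"
  proof -
    have s0: "s \<ge> 0" unfolding s_def using l N2 by simp
    have "(\<integral>\<^sup>+x. ennreal \<bar>w x\<bar> \<partial>lborel) = (\<integral>\<^sup>+x. ennreal s * ennreal \<bar>u (l *\<^sub>R (x - x0))\<bar> \<partial>lborel)"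
      unfolding w_def rescale_def using s0 by (intro nn_integral_cong) (simp add: abs_mult ennreal_mult)
    also have "\<dots> = ennreal s * (\<integral>\<^sup>+x. ennreal \<bar>u (l *\<^sub>R (x - x0))\<bar> \<partial>lborel)" by (rule nn_integral_cmult) measurable
    also have "(\<integral>\<^sup>+x. ennreal \<bar>u (l *\<^sub>R (x - x0))\<bar> \<partial>lborel) = ennreal (1 / l^3) * (\<integral>\<^sup>+x. ennreal \<bar>u x\<bar> \<partial>lborel)"
      by (rule nn_affine_R3[where f="\<lambda>x. ennreal \<bar>u x\<bar>"]) (use l in auto)
    also have "(\<integral>\<^sup>+x. ennreal \<bar>u x\<bar> \<partial>lborel) = ennreal (\<integral>x. \<bar>u x\<bar> \<partial>lborel)"
      by (rule nn_integral_eq_integral) (use ui in auto)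
    finally show ?thesis using s0 l by (simp add: ennreal_mult[symmetric])
  qed
  have wi: "integrable lborel w" using wnn by (intro integrableI_bounded) auto
  have wL: "(\<integral>x. \<bar>w x\<bar> \<partial>lborel) = s / l^3 * (\<integral>x. \<bar>u x\<bar> \<partial>lborel)"
    using wnn unfolding s_def by (subst integral_eq_nn_integral) (use l N2 in auto)
  \<comment> \<open>Splitting at frequency \<open>sqrt l\<close> makes both mass corrections vanish
    as \<open>l\<close> grows: one is \<open>m^2 / sqrt l\<close>, and in the other the squared
    \<open>L\<^sup>1\<close> norm is of order \<open>l^-3\<close> against
    \<open>M'^3 = l^(3/2)\<close>.\<close>
  define M' where "M' = sqrt l"
  have M': "M' > 0" "M'^2 = l" using l by (auto simp: M'_def)
  have wL2: "M'^3 * (\<integral>x. \<bar>w x\<bar> \<partial>lborel)^2 \<le> (2 * L^2 / A) * inverse M' ^ 3"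
  proof -
    have u0: "(\<integral>x. \<bar>u x\<bar> \<partial>lborel) \<ge> 0" by (intro integral_nonneg_AE) auto
    have l6: "l^3 = M'^6" using M'(2)[symmetric] by (simp add: power_mult[symmetric])
    have "M'^3 * (\<integral>x. \<bar>w x\<bar> \<partial>lborel)^2 = M'^3 * (l^3 / N / (l^3)^2 * (\<integral>x. \<bar>u x\<bar> \<partial>lborel)^2)"
      unfolding wL by (simp add: power_mult_distrib power_divide s2)
    also have "\<dots> = (inverse M' ^ 3 / N) * (\<integral>x. \<bar>u x\<bar> \<partial>lborel)^2"
      unfolding l6 using M'(1) N2(2) by (simp add: field_simps eval_nat_numeral)
    also have "\<dots> \<le> (inverse M' ^ 3 / N) * L^2"
      using uL u0 M'(1) N2 by (intro mult_left_mono power_mono) auto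
    also have "\<dots> \<le> (inverse M' ^ 3 / (A / 2)) * L^2"
      using M'(1) N2 A0 by (intro mult_right_mono divide_left_mono) auto
    finally show ?thesis by (simp add: mult_ac)
  qed
  have "enn2real (symbol_form m w) \<le> kinetic w + m^2 / M' * 1 + \<bar>m\<bar> * exp 1 * M'^3 * (\<integral>x. \<bar>w x\<bar> \<partial>lborel)^2"
    using relativistic_excess[OF hw wi M'(1), of m] mw by simp
  moreover have "\<bar>m\<bar> * exp 1 * M'^3 * (\<integral>x. \<bar>w x\<bar> \<partial>lborel)^2 \<le> \<bar>m\<bar> * exp 1 * (2 * L^2 / A) * inverse M' ^ 3"
    using mult_left_mono[OF wL2, of "\<bar>m\<bar> * exp 1"] by (simp add: mult.assoc)
  moreover have "m^2 / M' * 1 = m^2 * inverse M'" by (simp add: divide_inverse)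
  \<comment> \<open>Both energies are magnified by \<open>l = 2 r\<close>, while the truncation
    error of their difference is of order \<open>r^-2\<close>.\<close>
  moreover have "kinetic w - A / 2 * enn2real (hart w) \<le> 8 * (kappa * C1 + B1) / A * inverse r"
  proof -
    have k0: "kappa * C1 \<ge> 0" using kappa_pos C1(1) by simp
    have "kinetic u * N \<le> (A + kappa * C1 / r^2) * A"
      using K N N2 A0 k0 by (intro mult_mono) auto
    moreover have "A / 2 * (2 * A) \<le> A / 2 * (enn2real (hart u) + B1 / r^4)"
      using Dl A0 by (intro mult_left_mono) auto
    moreover have "B1 / r^4 \<le> B1 / r^2"
      using r B1(1) by (intro divide_left_mono power_increasing) auto
    then have "A / 2 * (B1 / r^4) \<le> A * (B1 / r^2)" using A0 B1(1) r by (intro mult_mono) auto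
    moreover have "(A + kappa * C1 / r^2) * A = A / 2 * (2 * A) + A * (kappa * C1 / r^2)" by (simp add: algebra_simps)
    moreover have "A / 2 * (enn2real (hart u) + B1 / r^4) = A / 2 * enn2real (hart u) + A / 2 * (B1 / r^4)" by (rule distrib_left)
    moreover have "A * ((kappa * C1 + B1) / r^2) = A * (kappa * C1 / r^2) + A * (B1 / r^2)" by (simp add: distrib_left add_divide_distrib)
    ultimately have 1: "kinetic u * N - A / 2 * enn2real (hart u) \<le> A * ((kappa * C1 + B1) / r^2)" by linarith
    have 2: "kinetic w - A / 2 * enn2real (hart w) = l / N^2 * (kinetic u * N - A / 2 * enn2real (hart u))"
      unfolding kw hartw using N2(2) by (simp add: field_simps power2_eq_square)
    also have "\<dots> \<le> l / N^2 * (A * ((kappa * C1 + B1) / r^2))" using 1 l by (intro mult_left_mono) auto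
    also have "\<dots> \<le> l / (A / 2)^2 * (A * ((kappa * C1 + B1) / r^2))"
      using N2 A0 l k0 B1(1) by (intro mult_right_mono divide_left_mono power_mono) auto
    also have "\<dots> = 8 * (kappa * C1 + B1) / A * inverse r"
      unfolding l_def using A0 r by (simp add: field_simps power2_eq_square)
    finally show ?thesis .
  qed
  ultimately have "total_energy m V A w \<le> err n"
    using pot2 unfolding total_energy_def err_def r_def[symmetric] l_def[symmetric] M'_def[symmetric] by linarith
  moreover have "enn2real (hart w) \<ge> \<Lambda>"
  proof -
    have "A \<le> enn2real (hart u)" using Dl n(3)[folded r_def] unfolding inv4 by linarith
    then have "A / A^2 \<le> enn2real (hart u) / N^2" using A0 N N2 by (intro frac_le power_mono) auto
    then have "l * (A / A^2) \<le> enn2real (hart w)" unfolding hartw using l by (intro mult_left_mono) auto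
    moreover have "\<Lambda> \<le> l * (A / A^2)" using n(4) A0 unfolding l_def r_def by (simp add: field_simps power2_eq_square)
    ultimately show ?thesis by linarith
  qed
  ultimately show ?thesis using adm n(1) by (intro exI[of _ w]) auto
qed

section \<open>Nonexistence at the threshold\<close>

text \<open>All products \<open>u x * v x\<close> vanish, so the only cross term in the squared
  differences is the nonlocal one, \<open>2 \<tau>\<close> times the interaction \<open>P\<close>,
  and it lowers the seminorm. It stands on the left-hand side because subtraction on
  \<open>ennreal\<close> truncates.\<close>

lemma disjoint_sum_energy:
  assumes u: "square_integrable u" "\<And>x. u x \<ge> 0" and v: "square_integrable v" "\<And>x. v x \<ge> 0"
    and disj: "\<And>x. u x * v x = 0" and \<tau>: "\<tau> \<ge> 0"
  defines "w \<equiv> \<lambda>x. u x + \<tau> * v x"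
    and "P \<equiv> (\<integral>\<^sup>+p. ennreal ((u (fst p) * v (snd p) + u (snd p) * v (fst p)) / norm (fst p - snd p) ^ 4) \<partial>lborel2)"
  shows "seminorm w + ennreal (2 * \<tau>) * P = seminorm u + ennreal (\<tau>^2) * seminorm v"
    and "(\<integral>\<^sup>+x. ennreal ((w x)^2) \<partial>lborel) = ennreal (mass u + \<tau>^2 * mass v)"
    and "hart u \<le> hart w"
proof -
  note [measurable] = square_integrableD(1)[OF u(1)] square_integrableD(1)[OF v(1)]
  have [measurable]: "w \<in> borel_measurable borel" unfolding w_def by measurable
  have pt: "(w x - w y)^2 / n + 2 * \<tau> * ((u x * v y + u y * v x) / n) = (u x - u y)^2 / n + \<tau>^2 * ((v x - v y)^2 / n)" for x y and n :: real
  proof -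
    have "(w x - w y)^2 + 2 * \<tau> * (u x * v y + u y * v x)
        = (u x - u y)^2 + \<tau>^2 * (v x - v y)^2 + 2 * \<tau> * (u x * v x) + 2 * \<tau> * (u y * v y)"
      unfolding w_def by (simp add: power2_eq_square algebra_simps)
    then have "(w x - w y)^2 + 2 * \<tau> * (u x * v y + u y * v x) = (u x - u y)^2 + \<tau>^2 * (v x - v y)^2"
      using disj[of x] disj[of y] by simp
    then show ?thesis by (simp add: add_divide_distrib[symmetric])
  qed
  have "seminorm w + ennreal (2 * \<tau>) * P = (\<integral>\<^sup>+p. ennreal ((w (fst p) - w (snd p))^2 / norm (fst p - snd p) ^ 4)
      + ennreal (2 * \<tau>) * ennreal ((u (fst p) * v (snd p) + u (snd p) * v (fst p)) / norm (fst p - snd p) ^ 4) \<partial>lborel2)"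
    unfolding seminorm_def P_def
    by (subst nn_integral_cmult[symmetric], measurable, subst nn_integral_add, measurable)
  also have "\<dots> = (\<integral>\<^sup>+p. ennreal ((u (fst p) - u (snd p))^2 / norm (fst p - snd p) ^ 4)
      + ennreal (\<tau>^2) * ennreal ((v (fst p) - v (snd p))^2 / norm (fst p - snd p) ^ 4) \<partial>lborel2)"
  proof (rule nn_integral_cong)
    fix p :: "R3 \<times> R3"
    have l: "ennreal a + ennreal b * ennreal c = ennreal (a + b * c)" if "a \<ge> 0" "b \<ge> 0" "c \<ge> 0" for a b c
      using that by (simp add: ennreal_mult)
    have a: "0 \<le> (u (fst p) * v (snd p) + u (snd p) * v (fst p)) / norm (fst p - snd p) ^ 4" using u(2) v(2) by simp
    show "ennreal ((w (fst p) - w (snd p))^2 / norm (fst p - snd p) ^ 4)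
      + ennreal (2 * \<tau>) * ennreal ((u (fst p) * v (snd p) + u (snd p) * v (fst p)) / norm (fst p - snd p) ^ 4)
      = ennreal ((u (fst p) - u (snd p))^2 / norm (fst p - snd p) ^ 4)
      + ennreal (\<tau>^2) * ennreal ((v (fst p) - v (snd p))^2 / norm (fst p - snd p) ^ 4)"
    proof (subst l)
      show "ennreal ((w (fst p) - w (snd p))^2 / norm (fst p - snd p) ^ 4 + 2 * \<tau> * ((u (fst p) * v (snd p) + u (snd p) * v (fst p)) / norm (fst p - snd p) ^ 4))
        = ennreal ((u (fst p) - u (snd p))^2 / norm (fst p - snd p) ^ 4)
        + ennreal (\<tau>^2) * ennreal ((v (fst p) - v (snd p))^2 / norm (fst p - snd p) ^ 4)"
        by (subst l) (simp_all only: pt, simp_all)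
    qed (use a \<tau> in auto)
  qed
  also have "\<dots> = seminorm u + ennreal (\<tau>^2) * seminorm v"
    unfolding seminorm_def
    by (subst nn_integral_add, measurable, subst nn_integral_cmult, measurable)
  finally show "seminorm w + ennreal (2 * \<tau>) * P = seminorm u + ennreal (\<tau>^2) * seminorm v" .
  have "(\<integral>\<^sup>+x. ennreal ((w x)^2) \<partial>lborel) = (\<integral>\<^sup>+x. ennreal ((u x)^2) + ennreal (\<tau>^2) * ennreal ((v x)^2) \<partial>lborel)"
  proof (rule nn_integral_cong)
    fix x
    have "(w x)^2 = (u x)^2 + \<tau>^2 * (v x)^2 + 2 * \<tau> * (u x * v x)" unfolding w_def by (simp add: power2_eq_square algebra_simps)
    then show "ennreal ((w x)^2) = ennreal ((u x)^2) + ennreal (\<tau>^2) * ennreal ((v x)^2)" using disj[of x] by (simp add: ennreal_mult)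
  qed
  also have "\<dots> = ennreal (mass u) + ennreal (\<tau>^2) * ennreal (mass v)"
    unfolding nn_mass[OF u(1), symmetric] nn_mass[OF v(1), symmetric]
    by (subst nn_integral_add, measurable, subst nn_integral_cmult, measurable)
  also have "\<dots> = ennreal (mass u + \<tau>^2 * mass v)" using mass_nonneg by (simp add: ennreal_mult)
  finally show "(\<integral>\<^sup>+x. ennreal ((w x)^2) \<partial>lborel) = ennreal (mass u + \<tau>^2 * mass v)" .
  have "(u x)^2 \<le> (w x)^2" for x using u(2)[of x] v(2)[of x] \<tau> unfolding w_def by (intro power_mono) auto
  then show "hart u \<le> hart w" unfolding coulomb_def
    by (intro nn_integral_mono ennreal_leI divide_right_mono mult_mono) auto
qed

text \<open>The kernel \<open>1 / |x - y|^4\<close> is strictly positive off the diagonal, so a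
  vanishing interaction would force \<open>u x * v y = 0\<close> for almost all pairs, against the
  positive masses.\<close>

lemma interaction_positive:
  assumes u: "square_integrable u" "\<And>x. u x \<ge> 0" "mass u > 0" and v: "square_integrable v" "\<And>x. v x \<ge> 0" "mass v > 0"
    and disj: "\<And>x. u x * v x = 0"
  shows "(\<integral>\<^sup>+p. ennreal ((u (fst p) * v (snd p) + u (snd p) * v (fst p)) / norm (fst p - snd p) ^ 4) \<partial>lborel2) \<noteq> 0"
proof
  note [measurable] = square_integrableD(1)[OF u(1)] square_integrableD(1)[OF v(1)]
  assume "(\<integral>\<^sup>+p. ennreal ((u (fst p) * v (snd p) + u (snd p) * v (fst p)) / norm (fst p - snd p) ^ 4) \<partial>lborel2) = 0"
  then have "AE p in lborel2. ennreal ((u (fst p) * v (snd p) + u (snd p) * v (fst p)) / norm (fst p - snd p) ^ 4) = 0"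
    by (subst (asm) nn_integral_0_iff_AE) auto
  then have "AE p in lborel2. ennreal ((u (fst p))^2 * (v (snd p))^2) = 0"
  proof eventually_elim
    case (elim p)
    have "u (fst p) * v (snd p) = 0"
    proof (cases "fst p = snd p")
      case False
      have nn: "0 \<le> u (fst p) * v (snd p)" "0 \<le> u (snd p) * v (fst p)" using u(2) v(2) by auto
      have "(u (fst p) * v (snd p) + u (snd p) * v (fst p)) / norm (fst p - snd p) ^ 4 \<le> 0" using elim by (simp add: ennreal_eq_0_iff)
      then have "u (fst p) * v (snd p) + u (snd p) * v (fst p) \<le> 0" using False by (simp add: divide_le_0_iff)
      then show ?thesis using nn by linarith
    qed (use disj[of "snd p"] in simp)
    then have "(u (fst p))^2 * (v (snd p))^2 = 0" by auto
    then show ?case by (simp only: ennreal_0)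
  qed
  then have "(\<integral>\<^sup>+p. ennreal ((u (fst p))^2 * (v (snd p))^2) \<partial>lborel2) = 0"
    by (subst nn_integral_0_iff_AE) auto
  moreover have "(\<integral>\<^sup>+p. ennreal ((u (fst p))^2 * (v (snd p))^2) \<partial>lborel2) = ennreal (mass u) * ennreal (mass v)"
  proof -
    have "(\<integral>\<^sup>+p. ennreal ((u (fst p))^2 * (v (snd p))^2) \<partial>lborel2) = (\<integral>\<^sup>+x. (\<integral>\<^sup>+y. ennreal ((u x)^2) * ennreal ((v y)^2) \<partial>lborel) \<partial>lborel)"
      by (subst lborel.nn_integral_fst[symmetric]) (auto simp: ennreal_mult)
    also have "\<dots> = (\<integral>\<^sup>+x. ennreal ((u x)^2) * ennreal (mass v) \<partial>lborel)"
      by (intro nn_integral_cong) (simp add: nn_integral_cmult nn_mass[OF v(1)])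
    also have "\<dots> = ennreal (mass u) * ennreal (mass v)" by (simp add: nn_integral_multc nn_mass[OF u(1)])
    finally show ?thesis .
  qed
  ultimately show False using u(3) v(3) by simp
qed

text \<open>Superposing a small far copy of \<open>u\<close> gains kinetic energy to first order in \<open>\<tau>\<close>, while its mass
  costs only second order.\<close>

lemma no_bounded_support_optimizer:
  assumes A: "hartree_bound A" and u: "half_sobolev u" "\<And>x. u x \<ge> 0" "mass u = 1"
    and le: "kinetic u \<le> A / 2 * enn2real (hart u)" and supp: "\<And>x. norm x \<ge> R \<Longrightarrow> u x = 0"
  shows False
proof -
  note su = half_sobolevD(1)[OF u(1)]
  \<comment> \<open>A shift by \<open>2 |R|\<close> separates the supports; the absolute value
    spares a case distinction on the sign of \<open>R\<close>.\<close>
  define p :: R3 where "p = (2 * \<bar>R\<bar>) *\<^sub>R axis 1 1"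
  have np: "norm p = 2 * \<bar>R\<bar>" by (simp add: p_def norm_axis_1)
  define v where "v = rescale 1 1 p u"
  have v_eq: "v x = u (x - p)" for x by (simp add: v_def rescale_def)
  have hv: "half_sobolev v" unfolding v_def by (rule half_sobolev_rescale[OF u(1)]) simp
  note sv = half_sobolevD(1)[OF hv]
  have mv: "mass v = 1" unfolding v_def using mass_rescale[OF su, of 1 1 p] u(3) by simp
  have semv: "seminorm v = seminorm u" unfolding v_def using seminorm_rescale[OF square_integrableD(1)[OF su], of 1 1 p] by simp
  have v0: "v x \<ge> 0" for x using u(2) by (simp add: v_eq)
  have disj: "u x * v x = 0" for x
  proof (cases "norm x \<ge> R")
    case False
    then have "norm (x - p) \<ge> R" using np norm_triangle_ineq2[of p x] by (simp add: norm_minus_commute)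
    then show ?thesis by (simp add: v_eq supp)
  qed (simp add: supp)
  define P where "P = (\<integral>\<^sup>+p. ennreal ((u (fst p) * v (snd p) + u (snd p) * v (fst p)) / norm (fst p - snd p) ^ 4) \<partial>lborel2)"
  have P0: "P \<noteq> 0" unfolding P_def
    by (rule interaction_positive) (use su sv u(2,3) v0 mv disj in auto)
  define S where "S = enn2real (seminorm u)"
  have S: "seminorm u = ennreal S" "S \<ge> 0" unfolding S_def using half_sobolevD(2)[OF u(1)] by auto
  note D = disjoint_sum_energy[OF su u(2) sv v0 disj, folded P_def, unfolded semv]
  have "ennreal (2 * 1) * P \<le> seminorm (\<lambda>x. u x + 1 * v x) + ennreal (2 * 1) * P" by (rule add_increasing) auto
  also have "\<dots> = seminorm u + ennreal (1^2) * seminorm u" by (rule D(1)) simp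
  finally have "ennreal (2 * 1) * P \<le> seminorm u + ennreal (1^2) * seminorm u" .
  moreover have "1 * P \<le> ennreal (2 * 1) * P" by (intro mult_right_mono) (auto simp: one_le_numeral)
  ultimately have "P \<le> seminorm u + seminorm u" by simp
  also have "\<dots> < \<infinity>" using half_sobolevD(2)[OF u(1)] by simp
  finally have "P < \<infinity>" .
  then obtain q where q: "P = ennreal q" "q \<ge> 0" by (cases P) auto
  then have q0: "q > 0" using P0 by (cases "q = 0") auto
  \<comment> \<open>The Hartree inequality for \<open>u + \<tau> v\<close> against optimality of
    \<open>u\<close>, with the common factor \<open>kappa\<close> removed: the seminorm drops by
    \<open>2 \<tau> q\<close> to first order, while the added seminorm and mass are of order
    \<open>\<tau>^2\<close>.\<close>
  have key: "S \<le> (S + \<tau>^2 * S - 2 * \<tau> * q) * (1 + \<tau>^2)" if \<tau>: "\<tau> > 0" for \<tau>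
  proof -
    define w where "w x = u x + \<tau> * v x" for x
    have Dw: "seminorm w + ennreal (2 * \<tau>) * ennreal q = ennreal S + ennreal (\<tau>^2) * ennreal S"
      "(\<integral>\<^sup>+x. ennreal ((w x)^2) \<partial>lborel) = ennreal (1 + \<tau>^2)" "hart u \<le> hart w"
      using D[of \<tau>] \<tau> u(3) mv unfolding w_def q(1) S(1) by auto
    have wm: "w \<in> borel_measurable borel" unfolding w_def using square_integrableD(1)[OF su] square_integrableD(1)[OF sv] by measurable
    have sw: "square_integrable w" using Dw(2) wm by (simp add: square_integrable_iff_nn)
    have "seminorm w \<le> ennreal S + ennreal (\<tau>^2) * ennreal S" unfolding Dw(1)[symmetric] by simp
    also have "\<dots> < \<infinity>" by (simp add: ennreal_mult_less_top)
    finally have hw: "half_sobolev w" using sw by (simp add: half_sobolev_def)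
    then obtain z where z: "seminorm w = ennreal z" "z \<ge> 0" using half_sobolevD(2)[OF hw] by (cases "seminorm w") auto
    have "ennreal (z + 2 * \<tau> * q) = ennreal (S + \<tau>^2 * S)"
      using Dw(1) z \<tau> q S unfolding z(1) by (simp add: ennreal_mult)
    moreover have "0 \<le> z + 2 * \<tau> * q" "0 \<le> S + \<tau>^2 * S" using z \<tau> q S by auto
    ultimately have "z + 2 * \<tau> * q = S + \<tau>^2 * S" by (metis ennreal_inj)
    then have zz: "z = S + \<tau>^2 * S - 2 * \<tau> * q" by linarith
    have mw: "mass w = 1 + \<tau>^2" using Dw(2) nn_mass[OF sw] mass_nonneg[of w] by (metis ennreal_inj add_nonneg_nonneg zero_le_one zero_le_power2)
    have "kappa * S \<le> A / 2 * enn2real (hart u)" using le by (simp add: kinetic_seminorm[OF su] S_def)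
    also have "\<dots> \<le> A / 2 * enn2real (hart w)"
      using Dw(3) hartree_boundD(1)[OF A] hartree_boundD(2)[OF A hw] by (intro mult_left_mono enn2real_mono) auto
    also have "\<dots> \<le> kinetic w * mass w" by (rule hartree_boundD(3)[OF A hw])
    also have "\<dots> = kappa * (z * (1 + \<tau>^2))" using z by (simp add: kinetic_seminorm[OF sw] mw)
    finally show ?thesis unfolding zz using kappa_pos by simp
  qed
  \<comment> \<open>Ensures \<open>3 \<tau> S < q\<close>, enough for the linear gain to dominate
    all higher terms; the summand 1 guards against \<open>S = 0\<close>.\<close>
  define \<tau> where "\<tau> = min 1 (q / (3 * S + 1))"
  have \<tau>: "\<tau> > 0" "\<tau> \<le> 1" using q0 S(2) by (auto simp: \<tau>_def)
  have \<tau>q: "\<tau> * (3 * S + 1) \<le> q"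
    using S(2) by (subst pos_le_divide_eq[symmetric]) (auto simp: \<tau>_def)
  have "(S + \<tau>^2 * S - 2 * \<tau> * q) * (1 + \<tau>^2) = S + \<tau> * (\<tau> * (2 * S) + \<tau> * (\<tau>^2 * S) - 2 * q - 2 * (\<tau>^2 * q))"
    by (simp add: power2_eq_square algebra_simps)
  then have "0 \<le> \<tau> * (\<tau> * (2 * S) + \<tau> * (\<tau>^2 * S) - 2 * q - 2 * (\<tau>^2 * q))" using key[OF \<tau>(1)] by linarith
  then have "0 \<le> \<tau> * (2 * S) + \<tau> * (\<tau>^2 * S) - 2 * q - 2 * (\<tau>^2 * q)" using \<tau>(1) by (simp add: zero_le_mult_iff)
  moreover have "\<tau>^2 * S \<le> 1 * S" using \<tau> S(2) by (intro mult_right_mono power_le_one) auto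
  then have "\<tau> * (\<tau>^2 * S) \<le> \<tau> * S" using \<tau>(1) by simp
  moreover have "\<tau>^2 * q \<ge> 0" using q by simp
  moreover have "\<tau> * (3 * S + 1) = \<tau> * (2 * S) + \<tau> * S + \<tau>" by (simp add: algebra_simps)
  ultimately show False using \<tau> \<tau>q q0 by linarith
qed

section \<open>The essential infimum and the critical case\<close>

text \<open>The supremum of all almost everywhere lower bounds. It is finite because
  \<open>V\<close> is essentially bounded above on the unit ball, a set of positive measure, and it
  is attained by a countable intersection.\<close>

lemma essential_infimum:
  assumes V: "trapping V"
  obtains c where "c \<ge> 0" "AE x in lborel. V x \<ge> c" "\<And>\<epsilon>. \<epsilon> > 0 \<Longrightarrow> \<not> (AE x in lborel. V x \<ge> c + \<epsilon>)"
proof -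
  define S where "S = {r. AE x in lborel. V x \<ge> r}"
  have S0: "0 \<in> S" using V by (simp add: S_def trapping_def)
  obtain M where M: "AE x in lborel. norm x \<le> 1 \<longrightarrow> V x \<le> M" using V unfolding trapping_def by blast
  have up: "r \<le> M" if "r \<in> S" for r
  proof (rule ccontr)
    assume neg: "\<not> r \<le> M"
    have "AE x in lborel. V x \<ge> r" using that by (simp add: S_def)
    then have "AE x in lborel. \<not> norm (x::R3) \<le> 1" using M by eventually_elim (use neg in auto)
    moreover have "{x \<in> space lborel. \<not> \<not> norm (x::R3) \<le> 1} = cball 0 1" by auto
    ultimately have "emeasure lborel (cball (0::R3) 1) = 0" by (subst (asm) AE_iff_measurable) auto
    then have "measure lborel (cball (0::R3) 1) = 0" by (simp add: measure_def)
    then show False using content_cball_pos[of 1 "0::R3"] by simp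
  qed
  have bdd: "bdd_above S" using up by (auto simp: bdd_above_def)
  define c where "c = Sup S"
  show thesis
  proof (rule that)
    show "c \<ge> 0" unfolding c_def by (rule cSup_upper[OF S0 bdd])
    have "AE x in lborel. V x \<ge> c - 1 / real (Suc n)" for n
    proof -
      have "c - 1 / real (Suc n) < Sup S" by (simp add: c_def)
      then obtain r where "r \<in> S" "c - 1 / real (Suc n) < r" using less_cSup_iff[of S] S0 bdd by blast
      then have "AE x in lborel. V x \<ge> r" by (simp add: S_def)
      then show ?thesis by eventually_elim (use \<open>c - 1 / real (Suc n) < r\<close> in linarith)
    qed
    then have "AE x in lborel. \<forall>n. V x \<ge> c - 1 / real (Suc n)" by (subst AE_all_countable) auto
    then show "AE x in lborel. V x \<ge> c"
    proof eventually_elim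
      case (elim x)
      show ?case
      proof (rule ccontr)
        assume "\<not> V x \<ge> c"
        then obtain n where "inverse (real (Suc n)) < c - V x" using reals_Archimedean[of "c - V x"] by auto
        then show False using elim[rule_format, of n] by (simp add: inverse_eq_divide)
      qed
    qed
    fix \<epsilon> :: real assume "\<epsilon> > 0"
    show "\<not> (AE x in lborel. V x \<ge> c + \<epsilon>)"
    proof
      assume "AE x in lborel. V x \<ge> c + \<epsilon>"
      then have "c + \<epsilon> \<le> Sup S" by (intro cSup_upper bdd) (simp add: S_def)
      then show False using \<open>\<epsilon> > 0\<close> by (simp add: c_def)
    qed
  qed
qed

text \<open>These notions of the statement see just the almost everywhere class, so Lebesgue
  measurable functions can be exchanged for Borel ones.\<close>

lemma
  assumes [measurable]: "u \<in> borel_measurable lebesgue" "v \<in> borel_measurable lebesgue"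
    and ae: "AE x in lebesgue. u x = v x"
  shows L2_cong: "L2 u \<longleftrightarrow> L2 v"
    and L2_norm_sq_cong: "L2_norm_sq u = L2_norm_sq v"
    and sobolev_cong: "u \<in> sobolev s \<longleftrightarrow> v \<in> sobolev s"
    and multiplier_qform_cong: "multiplier_qform \<sigma> u = multiplier_qform \<sigma> v"
    and multiplier_form_cong: "multiplier_form \<sigma> u \<phi> = multiplier_form \<sigma> v \<phi>"
    and hartree_cong: "hartree u = hartree v"
proof -
  show L: "L2 u \<longleftrightarrow> L2 v"
    unfolding L2_def using ae assms(1,2) by (auto intro: integrable_cong_AE_imp)
  show "L2_norm_sq u = L2_norm_sq v"
    unfolding L2_norm_sq_def by (rule integral_cong_AE) (use ae in auto)
  note F = fourier_real_cong[OF assms]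
  show "u \<in> sobolev s \<longleftrightarrow> v \<in> sobolev s" unfolding sobolev_def by (simp add: L F)
  show "multiplier_qform \<sigma> u = multiplier_qform \<sigma> v" unfolding multiplier_qform_def by (simp add: F)
  show "multiplier_form \<sigma> u \<phi> = multiplier_form \<sigma> v \<phi>" unfolding multiplier_form_def by (simp add: F)
  have m: "(\<lambda>x. coulomb_potential (\<lambda>y. (v y)^2) x) \<in> borel_measurable lebesgue"
  proof -
    obtain w where w: "w \<in> borel_measurable borel" "AE x in lebesgue. v x = w x" using borel_representative[OF assms(2)] .
    show ?thesis unfolding coulomb_potential_cong[OF assms(2) borel_imp_lebesgue[OF w(1)] w(2)]
      by (rule borel_imp_lebesgue[OF coulomb_potential_measurable[OF w(1)]])
  qed
  show "hartree u = hartree v" unfolding hartree_def coulomb_potential_cong[OF assms]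
    by (rule integral_cong_AE) (use ae m in \<open>auto intro!: borel_measurable_times\<close>)
qed

lemma no_critical_minimizer:
  assumes V: "trapping V" and A: "hartree_bound A" and Q: "half_sobolev Q" "integrable lborel Q" "quartic_decay Q C R0"
    and KNQ: "kinetic Q = A" "mass Q = A" and D: "enn2real (hart Q) = 2 * A"
    and v: "admissible V v" and opt: "\<And>w. admissible V w \<Longrightarrow> total_energy m V A v \<le> total_energy m V A w"
  shows False
proof -
  obtain c where c: "c \<ge> 0" "AE x in lborel. V x \<ge> c" "\<And>\<epsilon>. \<epsilon> > 0 \<Longrightarrow> \<not> (AE x in lborel. V x \<ge> c + \<epsilon>)"
    using essential_infimum[OF V] by metis
  have A0: "A > 0" by (rule hartree_boundD(1)[OF A])
  have [measurable]: "V \<in> borel_measurable borel" and V0: "\<And>x. V x \<ge> 0" using V unfolding trapping_def by auto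
  define u where "u x = \<bar>v x\<bar>" for x
  have u: "admissible V u" "total_energy m V A u \<le> total_energy m V A v"
    using admissible_abs[OF v] unfolding u_def by auto
  have hu: "half_sobolev u" and pu: "potential_form V u < \<infinity>" and mu: "mass u = 1" using u(1) by (auto simp: admissible_def)
  note su = half_sobolevD(1)[OF hu]
  note [measurable] = square_integrableD(1)[OF su]
  have "total_energy m V A u \<le> c + e" if e: "e > 0" for e
    using concentrating_trial_function[OF V A Q KNQ D c(1,3) e, of m 0] opt u(2) by force
  \<comment> \<open>As \<open>e\<close> was arbitrary, the optimal energy cannot exceed the
    essential infimum.\<close>
  then have Ec: "total_energy m V A u \<le> c" by (rule field_le_epsilon)
  define p where "p = enn2real (potential_form V u)"
  have pc: "p \<le> c" using total_energy_lower[OF A _ order_refl u(1), of m] A0 Ec by (simp add: p_def)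
  have iV: "integrable lborel (\<lambda>x. V x * (u x)^2)" and pI: "p = (\<integral>x. V x * (u x)^2 \<partial>lborel)"
  proof -
    show "integrable lborel (\<lambda>x. V x * (u x)^2)"
      using pu V0 unfolding potential_form_def by (intro integrableI_nonneg) auto
    show "p = (\<integral>x. V x * (u x)^2 \<partial>lborel)"
      unfolding p_def potential_form_def using V0 by (subst integral_eq_nn_integral) auto
  qed
  have iu: "integrable lborel (\<lambda>x. (u x)^2)" using square_integrableD[OF su] by simp
  have id: "integrable lborel (\<lambda>x. V x * (u x)^2 - c * (u x)^2)" using iV iu by auto
  have nn: "AE x in lborel. 0 \<le> V x * (u x)^2 - c * (u x)^2"
    using c(2) by eventually_elim (simp add: mult_right_mono)
  have eq: "(\<integral>x. V x * (u x)^2 - c * (u x)^2 \<partial>lborel) = p - c"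
    using iV iu mu by (simp add: pI mass_def)
  \<comment> \<open>The energy bound gives \<open>p \<le> c\<close>, mass 1 and
    \<open>V \<ge> c\<close> give the converse; equality then forces \<open>V = c\<close> almost
    everywhere on the set where \<open>u\<close> is nonzero.\<close>
  then have pc': "p = c" using integral_nonneg_AE[OF nn] pc by linarith
  then have z: "AE x in lborel. V x * (u x)^2 - c * (u x)^2 = 0"
    using eq integral_nonneg_eq_0_iff_AE[OF id nn] by simp
  have kin: "kinetic u \<le> A / 2 * enn2real (hart u)"
    using Ec kinetic_le_symbol_form[OF hu, of m] pc' unfolding total_energy_def p_def by linarith
  obtain R where R: "AE x in lborel. norm x \<ge> R \<longrightarrow> V x \<ge> c + 1" using V unfolding trapping_def by blast
  have uz: "AE x in lborel. norm x \<ge> R \<longrightarrow> u x = 0"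
    using R z
  proof eventually_elim
    case (elim x)
    show ?case
    proof
      assume "norm x \<ge> R"
      then have "V x - c \<ge> 1" using elim by simp
      moreover have "(V x - c) * (u x)^2 = 0" using elim(2) by (simp add: left_diff_distrib)
      ultimately show "u x = 0" by simp
    qed
  qed
  \<comment> \<open>A change on a null set, after which vanishing outside the ball holds pointwise,
    as the superposition argument requires.\<close>
  define w where "w x = (if norm x \<ge> R then 0 else u x)" for x
  have [measurable]: "w \<in> borel_measurable borel" unfolding w_def by measurable
  have ae: "AE x in lebesgue. u x = w x" using uz unfolding AE_completion_iff by eventually_elim (simp add: w_def)
  note cong = borel_imp_lebesgue[OF square_integrableD(1)[OF su]] borel_imp_lebesgue[OF \<open>w \<in> borel_measurable borel\<close>] ae
  have sw: "square_integrable w"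
    using L2_cong[OF cong] su L2_iff_square_integrable[OF square_integrableD(1)[OF su]] L2_iff_square_integrable[OF \<open>w \<in> borel_measurable borel\<close>] by blast
  have hw: "half_sobolev w" using sobolev_cong[OF cong] hu half_sobolev_iff_sobolev[OF su] half_sobolev_iff_sobolev[OF sw] by blast
  have "kinetic w \<le> A / 2 * enn2real (hart w)"
    using kin hartree_cong[OF cong] multiplier_qform_cong[OF cong] unfolding kinetic_def by (simp add: hartree_eq su sw)
  moreover have "mass w = 1" using L2_norm_sq_cong[OF cong] mu by (simp add: L2_norm_sq_mass su sw)
  ultimately show False
    by (intro no_bounded_support_optimizer[OF A hw, of R]) (auto simp: w_def u_def)
qed

section \<open>Representatives of the data\<close>

text \<open>Division by zero gives 0, so a positive infimum excludes a vanishing denominator for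
  nonzero \<open>u\<close>. An infinite Hartree energy would also appear as 0 through
  \<open>enn2real\<close>, so finiteness follows at the same time.\<close>

lemma hartree_bound_of_infimum:
  assumes A: "A > 0" and opt: "A / 2 = (INF u \<in> {u \<in> sobolev (1/2). \<not> (AE x in lebesgue. u x = 0)}.
         kinetic u * L2_norm_sq u / hartree u)"
  shows "hartree_bound A"
  unfolding hartree_bound_def
proof (intro conjI allI impI A)
  fix u assume u: "half_sobolev u"
  note su = half_sobolevD(1)[OF u]
  note [measurable] = square_integrableD(1)[OF su]
  have "hart u < \<infinity> \<and> A / 2 * enn2real (hart u) \<le> kinetic u * mass u"
  proof (cases "AE x in lebesgue. u x = 0")
    case True
    then have "AE x in lborel. u x = 0" by (simp add: AE_completion_iff)
    then have "hart u = 0" by (subst coulomb_iterated) (auto simp: nn_integral_0_iff_AE)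
    then show ?thesis using kinetic_nonneg[OF su] mass_nonneg[of u] by simp
  next
    case False
    \<comment> \<open>A real infimum bounds the members of its set once the set is known to be
      bounded below.\<close>
    have "bdd_below ((\<lambda>u. kinetic u * L2_norm_sq u / hartree u) ` {u \<in> sobolev (1/2). \<not> (AE x in lebesgue. u x = 0)})"
    proof (rule bdd_belowI2[where m=0])
      fix u :: "R3 \<Rightarrow> real"
      have "kinetic u \<ge> 0" unfolding kinetic_def multiplier_qform_def by (intro integral_nonneg_AE) simp
      moreover have "L2_norm_sq u \<ge> 0" unfolding L2_norm_sq_def by (intro integral_nonneg_AE) simp
      moreover have "hartree u \<ge> 0" unfolding hartree_def by (intro integral_nonneg_AE) (simp add: coulomb_potential_nonneg)
      ultimately show "0 \<le> kinetic u * L2_norm_sq u / hartree u" by simp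
    qed
    then have le: "A / 2 \<le> kinetic u * mass u / enn2real (hart u)"
      unfolding opt L2_norm_sq_mass[OF su, symmetric] hartree_eq[OF su, symmetric]
      by (rule cINF_lower) (use False u half_sobolev_iff_sobolev[OF su] in simp)
    then have "enn2real (hart u) \<noteq> 0" using A by auto
    then have pos: "enn2real (hart u) > 0" using enn2real_nonneg[of "hart u"] by linarith
    then have "hart u < \<infinity>" by (cases "hart u") auto
    moreover have "A / 2 * enn2real (hart u) \<le> kinetic u * mass u" using le unfolding pos_le_divide_eq[OF pos] .
    ultimately show ?thesis by blast
  qed
  then show "hart u < \<infinity>" "A / 2 * enn2real (hart u) \<le> kinetic u * mass u" by blast+
qed

text \<open>On a ball \<open>|u| \<le> u^2 + 1\<close>; outside it the decay \<open>|x|^-4\<close>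
  is integrable in three dimensions.\<close>

lemma integrable_of_quartic_decay:
  assumes u: "square_integrable u" and d: "quartic_decay u C R"
  shows "integrable lborel u"
proof -
  note [measurable] = square_integrableD(1)[OF u]
  have [measurable]: "(indicator (cball (0::R3) R) :: R3 \<Rightarrow> real) \<in> borel_measurable borel"
    by (rule borel_measurable_indicator) simp
  have R: "R \<ge> 1" "C \<ge> 0" "AE x in lborel. norm x \<ge> R \<longrightarrow> \<bar>u x\<bar> \<le> C / norm x ^ 4" using d by (auto simp: quartic_decay_def)
  obtain K where K: "(\<integral>\<^sup>+(x::R3). ennreal (indicator {x. norm x \<ge> 1} x / norm x ^ 4) \<partial>lborel) \<le> ennreal K"
    by (rule inverse_norm_local) blast
  have [measurable]: "(indicator {x::R3. norm x \<ge> 1} :: R3 \<Rightarrow> real) \<in> borel_measurable borel"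
    by (rule borel_measurable_indicator) simp
  define g :: "R3 \<Rightarrow> real" where "g x = indicator {x. norm x \<ge> 1} x / norm x ^ 4" for x
  have [measurable]: "g \<in> borel_measurable borel" unfolding g_def by measurable
  have "integrable lborel g"
    using K by (intro integrableI_nonneg) (auto simp: g_def intro: le_less_trans)
  moreover have "integrable lborel (\<lambda>x. indicator (cball (0::R3) R) x :: real)"
    using emeasure_lborel_cball_finite[of "0::R3" R] by simp
  ultimately have "integrable lborel (\<lambda>x. (u x)^2 + indicator (cball (0::R3) R) x + C * g x)"
    using square_integrableD(2)[OF u] by auto
  then show ?thesis
  proof (rule Bochner_Integration.integrable_bound)
    show "AE x in lborel. norm (u x) \<le> norm ((u x)^2 + indicator (cball (0::R3) R) x + C * g x)"
      using R(3)
    proof eventually_elim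
      case (elim x)
      have g0: "g x \<ge> 0" by (simp add: g_def)
      have "\<bar>u x\<bar> \<le> (u x)^2 + indicator (cball (0::R3) R) x + C * g x"
      proof (cases "norm x \<le> R")
        case True
        have "0 \<le> (\<bar>u x\<bar> - 1)^2" by simp
        then have "2 * \<bar>u x\<bar> \<le> (u x)^2 + 1" by (simp add: power2_diff)
        moreover have "C * g x \<ge> 0" using g0 R(2) by simp
        ultimately show ?thesis using True by simp
      next
        case False
        then have "C * g x = C / norm x ^ 4" using R(1) by (simp add: g_def)
        moreover have "\<bar>u x\<bar> \<le> C / norm x ^ 4" using elim False by simp
        moreover have "(u x)^2 \<ge> 0" "(indicator (cball (0::R3) R) x :: real) \<ge> 0" by auto
        ultimately show ?thesis by linarith
      qed
      then show ?case by simp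
    qed
  qed auto
qed

context
  fixes V Vb :: "R3 \<Rightarrow> real"
  assumes V[measurable]: "V \<in> borel_measurable lebesgue" and Vb: "trapping Vb" and VV: "AE x in lebesgue. V x = Vb x"
begin

lemma energy_space_borel_representative:
  assumes u[measurable]: "u \<in> borel_measurable lebesgue" and w: "w \<in> borel_measurable borel" and ae: "AE x in lebesgue. u x = w x"
  shows "u \<in> energy_space V \<and> L2_norm_sq u = 1 \<longleftrightarrow> admissible Vb w"
    and "admissible Vb w \<Longrightarrow> energy m V a u = total_energy m Vb a w"
proof -
  note wl[measurable] = borel_imp_lebesgue[OF w]
  note cong = u wl ae
  have Vbm: "Vb \<in> borel_measurable borel" and Vb0: "\<And>x. Vb x \<ge> 0" using Vb by (auto simp: trapping_def)
  note [measurable] = borel_imp_lebesgue[OF Vbm]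
  have m: "(\<lambda>x. Vb x * (w x)^2) \<in> borel_measurable borel" using Vbm w by measurable
  have ae2: "AE x in lebesgue. V x * (u x)^2 = Vb x * (w x)^2" using ae VV by eventually_elim simp
  have I: "integrable lebesgue (\<lambda>x. V x * (u x)^2) \<longleftrightarrow> potential_form Vb w < \<infinity>"
  proof -
    have "integrable lebesgue (\<lambda>x. V x * (u x)^2) \<longleftrightarrow> integrable lebesgue (\<lambda>x. Vb x * (w x)^2)"
      by (rule integrable_cong_AE) (use ae2 in auto)
    also have "\<dots> \<longleftrightarrow> integrable lborel (\<lambda>x. Vb x * (w x)^2)" using m by (simp add: integrable_completion)
    also have "\<dots> \<longleftrightarrow> potential_form Vb w < \<infinity>" using m Vb0 by (simp add: integrable_iff_bounded potential_form_def)
    finally show ?thesis .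
  qed
  have S: "u \<in> sobolev (1/2) \<longleftrightarrow> half_sobolev w"
  proof -
    have "u \<in> sobolev (1/2) \<longleftrightarrow> w \<in> sobolev (1/2)" by (rule sobolev_cong[OF cong])
    also have "\<dots> \<longleftrightarrow> half_sobolev w"
      using half_sobolev_iff_sobolev[of w] half_sobolevD(1)[of w] L2_iff_square_integrable[OF w] by (auto simp: sobolev_def)
    finally show ?thesis .
  qed
  have N: "L2_norm_sq u = mass w" if "half_sobolev w"
    using L2_norm_sq_cong[OF cong] L2_norm_sq_mass[OF half_sobolevD(1)[OF that]] by simp
  show "u \<in> energy_space V \<and> L2_norm_sq u = 1 \<longleftrightarrow> admissible Vb w"
    using I S N by (auto simp: energy_space_def admissible_def)
  assume "admissible Vb w"
  then have sw: "square_integrable w" by (auto simp: admissible_def dest: half_sobolevD)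
  have "(\<integral>x. V x * (u x)^2 \<partial>lebesgue) = (\<integral>x. Vb x * (w x)^2 \<partial>lborel)"
    unfolding lebesgue_integral_borel[OF m, symmetric] by (rule integral_cong_AE) (use ae2 in auto)
  also have "\<dots> = enn2real (potential_form Vb w)"
    unfolding potential_form_def using m Vb0 by (intro integral_eq_nn_integral) auto
  finally show "energy m V a u = total_energy m Vb a w"
    unfolding energy_def total_energy_def
    using multiplier_qform_cong[OF cong] hartree_cong[OF cong] by (simp add: relativistic_form_eq[OF sw] hartree_eq[OF sw])
qed

text \<open>Every competitor has a Borel representative of the same energy, so the infimum over
  Lebesgue measurable functions is one over admissible Borel functions, and minimality becomes a
  family of real inequalities without \<open>ereal\<close>.\<close>

lemma minimizer_borel_representative:
  assumes u: "u \<in> borel_measurable lebesgue" and w: "w \<in> borel_measurable borel" and ae: "AE x in lebesgue. u x = w x"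
  shows "minimizer m V a u \<longleftrightarrow> admissible Vb w \<and> (\<forall>v. admissible Vb v \<longrightarrow> total_energy m Vb a w \<le> total_energy m Vb a v)"
proof -
  note R = energy_space_borel_representative[OF u w ae]
  have self: "v \<in> energy_space V \<and> L2_norm_sq v = 1" "energy m V a v = total_energy m Vb a v" if "admissible Vb v" for v
    using energy_space_borel_representative[OF borel_imp_lebesgue, of v v] square_integrableD(1)[OF half_sobolevD(1)] that
    by (auto simp: admissible_def)
  have E: "ground_energy m V a = (INF v \<in> {v. admissible Vb v}. ereal (total_energy m Vb a v))"
    unfolding ground_energy_def
  proof (rule antisym)
    show "(INF u \<in> {u \<in> energy_space V. L2_norm_sq u = 1}. ereal (energy m V a u)) \<le> (INF v \<in> {v. admissible Vb v}. ereal (total_energy m Vb a v))"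
    proof (rule INF_greatest)
      fix v assume "v \<in> {v. admissible Vb v}"
      then show "(INF u \<in> {u \<in> energy_space V. L2_norm_sq u = 1}. ereal (energy m V a u)) \<le> ereal (total_energy m Vb a v)"
        using self[of v] by (intro INF_lower2[of v]) auto
    qed
    show "(INF v \<in> {v. admissible Vb v}. ereal (total_energy m Vb a v)) \<le> (INF u \<in> {u \<in> energy_space V. L2_norm_sq u = 1}. ereal (energy m V a u))"
    proof (rule INF_greatest)
      fix z assume z: "z \<in> {u \<in> energy_space V. L2_norm_sq u = 1}"
      then have zm: "z \<in> borel_measurable lebesgue" by (auto simp: energy_space_def sobolev_def L2_def)
      obtain v where v: "v \<in> borel_measurable borel" "AE x in lebesgue. z x = v x" using borel_representative[OF zm] .
      note Z = energy_space_borel_representative[OF zm v]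
      have "admissible Vb v" using Z(1) z by simp
      then show "(INF v \<in> {v. admissible Vb v}. ereal (total_energy m Vb a v)) \<le> ereal (energy m V a z)"
        using Z(2) by (intro INF_lower2[of v]) auto
    qed
  qed
  show ?thesis
  proof
    assume "minimizer m V a u"
    then have a: "admissible Vb w" and e: "ereal (total_energy m Vb a w) = ground_energy m V a"
      using R unfolding minimizer_def by auto
    have "ereal (total_energy m Vb a w) \<le> ereal (total_energy m Vb a v)" if "admissible Vb v" for v
      unfolding e E using that by (intro INF_lower) auto
    then show "admissible Vb w \<and> (\<forall>v. admissible Vb v \<longrightarrow> total_energy m Vb a w \<le> total_energy m Vb a v)" using a by simp
  next
    assume h: "admissible Vb w \<and> (\<forall>v. admissible Vb v \<longrightarrow> total_energy m Vb a w \<le> total_energy m Vb a v)"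
    then have "ground_energy m V a = ereal (total_energy m Vb a w)"
      unfolding E by (intro antisym INF_lower2[of w] INF_greatest) auto
    then show "minimizer m V a u" using R h unfolding minimizer_def by auto
  qed
qed

end

text \<open>The positive part of a Borel version: nonnegativity is wanted everywhere, the other
  properties are inherited almost everywhere.\<close>

lemma trapping_representative:
  fixes V :: "R3 \<Rightarrow> real"
  assumes V: "V \<in> borel_measurable lebesgue" "\<And>K. compact K \<Longrightarrow> bounded (V ` K)" "filterlim V at_top at_infinity" "\<And>x. V x \<ge> 0"
  obtains Vb where "trapping Vb" "AE x in lebesgue. V x = Vb x"
proof -
  obtain V' where V': "V' \<in> borel_measurable borel" "AE x in lebesgue. V x = V' x" using borel_representative[OF V(1)] .
  define Vb where "Vb x = max 0 (V' x)" for x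
  have ae: "AE x in lebesgue. V x = Vb x" using V'(2) by eventually_elim (use V(4) in \<open>metis Vb_def max.absorb2\<close>)
  have ae': "AE x in lborel. V x = Vb x" using ae by (simp add: AE_completion_iff)
  have "trapping Vb" unfolding trapping_def
  proof (intro conjI allI)
    show "Vb \<in> borel_measurable borel" unfolding Vb_def using V'(1) by measurable
    show "Vb x \<ge> 0" for x by (simp add: Vb_def)
    show "\<exists>R. AE x in lborel. norm x \<ge> R \<longrightarrow> Vb x \<ge> M" for M
    proof -
      have "eventually (\<lambda>x. V x \<ge> M) at_infinity" using V(3) unfolding filterlim_at_top by blast
      then obtain R where R: "\<And>x. norm x \<ge> R \<Longrightarrow> V x \<ge> M" unfolding eventually_at_infinity by blast
      have "AE x in lborel. norm x \<ge> R \<longrightarrow> Vb x \<ge> M" using ae' by eventually_elim (use R in force)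
      then show ?thesis by blast
    qed
    show "\<exists>M. AE x in lborel. norm x \<le> R \<longrightarrow> Vb x \<le> M" for R
    proof -
      have "bounded (V ` cball 0 R)" by (rule V(2)) simp
      then obtain M where M: "\<And>x. x \<in> cball 0 R \<Longrightarrow> \<bar>V x\<bar> \<le> M" unfolding bounded_iff by (metis imageI real_norm_def)
      have "AE x in lborel. norm x \<le> R \<longrightarrow> Vb x \<le> M" using ae' by eventually_elim (use M in force)
      then show ?thesis by blast
    qed
  qed
  then show thesis using ae that by blast
qed

text \<open>Collects what the virial argument consumes: decay yields integrability, Sobolev
  regularity yields moments of the transform, and the weak equation carries over to a Borel
  representative.\<close>

lemma ground_state_representative:
  assumes Q: "ground_state Q" and reg: "\<And>s. s \<ge> 1/2 \<Longrightarrow> Q \<in> sobolev s"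
    and dec: "\<exists>C R. AE x in lebesgue. norm x \<ge> R \<longrightarrow> \<bar>Q x\<bar> \<le> C / norm x ^ 4"
    and opt: "L2_norm_sq Q / 2 = (INF u \<in> {u \<in> sobolev (1/2). \<not> (AE x in lebesgue. u x = 0)}.
         kinetic u * L2_norm_sq u / hartree u)"
  obtains q C R where "hartree_bound (L2_norm_sq Q)" "half_sobolev q" "integrable lborel q" "quartic_decay q C R"
    "kinetic q = L2_norm_sq Q" "mass q = L2_norm_sq Q" "enn2real (hart q) = 2 * L2_norm_sq Q"
proof -
  define A where "A = L2_norm_sq Q"
  have Qs: "Q \<in> sobolev (1/2)" by (rule reg) simp
  then have Qm[measurable]: "Q \<in> borel_measurable lebesgue" by (auto simp: sobolev_def L2_def)
  obtain q where qm: "q \<in> borel_measurable borel" and ae: "AE x in lebesgue. Q x = q x" using borel_representative[OF Qm] .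
  note [measurable] = borel_imp_lebesgue[OF qm]
  note cong = Qm borel_imp_lebesgue[OF qm] ae
  have sob: "q \<in> sobolev s" if "s \<ge> 1/2" for s using sobolev_cong[OF cong] reg[OF that] by blast
  have sq: "square_integrable q" using sob[of "1/2"] L2_iff_square_integrable[OF qm] by (simp add: sobolev_def)
  have hq: "half_sobolev q" using half_sobolev_iff_sobolev[OF sq] sob[of "1/2"] by simp
  have mq: "mass q = A" using L2_norm_sq_cong[OF cong] L2_norm_sq_mass[OF sq] by (simp add: A_def)
  have "\<not> (AE x in lebesgue. Q x = 0)" using Q by (simp add: ground_state_def nontrivial_solution_def)
  then have nz: "\<not> (AE x in lborel. q x = 0)"
  proof (rule contrapos_nn)
    assume "AE x in lborel. q x = 0"
    then have "AE x in lebesgue. q x = 0" by (rule AE_completion)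
    then show "AE x in lebesgue. Q x = 0" using ae by eventually_elim simp
  qed
  have A0: "A > 0"
  proof -
    have "A \<noteq> 0"
    proof
      assume "A = 0"
      then have "(\<integral>\<^sup>+x. ennreal ((q x)^2) \<partial>lborel) = 0" using nn_mass[OF sq] mq by simp
      then show False using nz qm by (simp add: nn_integral_0_iff_AE)
    qed
    then show ?thesis using mass_nonneg[of q] mq by linarith
  qed
  have HB: "hartree_bound A" by (rule hartree_bound_of_infimum[OF A0]) (use opt in \<open>simp add: A_def\<close>)
  obtain C R where CR: "AE x in lebesgue. norm x \<ge> R \<longrightarrow> \<bar>Q x\<bar> \<le> C / norm x ^ 4" using dec by blast
  have "AE x in lebesgue. norm x \<ge> max 1 R \<longrightarrow> \<bar>q x\<bar> \<le> max 0 C / norm x ^ 4"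
    using CR ae
  proof eventually_elim
    case (elim x)
    have "C / norm x ^ 4 \<le> max 0 C / norm x ^ 4" by (intro divide_right_mono) auto
    then show ?case using elim by auto
  qed
  then have qd: "quartic_decay q (max 0 C) (max 1 R)" unfolding quartic_decay_def AE_completion_iff by simp
  have iq: "integrable lborel q" by (rule integrable_of_quartic_decay[OF sq qd])
  define T where "T s = (\<integral>\<^sup>+\<xi>. ennreal ((1 + (norm \<xi>)^2) powr s * (cmod (fhat q \<xi>))^2) \<partial>lborel)" for s
  have T: "T s < \<infinity>" if "s \<ge> 1/2" for s using sobolev_iff_nn[OF sq] sob[OF that] by (simp add: T_def)
  \<comment> \<open>Sobolev orders 1 and 4 dominate the second and the eighth moment of the
    transform.\<close>
  define S where "S = max (enn2real (T 1)) (enn2real (T 4))"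
  have TS: "T 1 \<le> ennreal S" "T 4 \<le> ennreal S"
    using T[of 1] T[of 4] ennreal_leI[of "enn2real (T 1)" S] ennreal_leI[of "enn2real (T 4)" S] by (auto simp: S_def)
  have S2: "(\<integral>\<^sup>+\<xi>. ennreal ((norm \<xi>)^2 * (cmod (fhat q \<xi>))^2) \<partial>lborel) \<le> ennreal S"
    by (rule order_trans[OF _ TS(1)], unfold T_def, intro nn_integral_mono ennreal_leI mult_right_mono) (auto simp: add_pos_nonneg)
  have S8: "(\<integral>\<^sup>+\<xi>. ennreal (norm \<xi> ^ 8 * (cmod (fhat q \<xi>))^2) \<partial>lborel) \<le> ennreal S"
  proof (rule order_trans[OF _ TS(2)], unfold T_def, intro nn_integral_mono ennreal_leI mult_right_mono)
    fix \<xi> :: R3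
    have "norm \<xi> ^ 8 = ((norm \<xi>)^2) ^ 4" by simp
    also have "\<dots> \<le> (1 + (norm \<xi>)^2) ^ 4" by (intro power_mono) auto
    also have "\<dots> = (1 + (norm \<xi>)^2) powr 4" by (subst powr_numeral) (auto simp: add_pos_nonneg)
    finally show "norm \<xi> ^ 8 \<le> (1 + (norm \<xi>)^2) powr 4" .
  qed simp
  have eq: "multiplier_form norm q \<phi> + (\<integral>x. q x * \<phi> x \<partial>lebesgue) - (\<integral>x. coulomb_potential (\<lambda>y. (q y)^2) x * q x * \<phi> x \<partial>lebesgue) = 0"
    if \<phi>: "half_sobolev \<phi>" for \<phi>
  proof -
    note s\<phi> = half_sobolevD(1)[OF \<phi>]
    note [measurable] = borel_imp_lebesgue[OF square_integrableD(1)[OF s\<phi>]] borel_imp_lebesgue[OF coulomb_potential_measurable[OF qm]]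
    have "multiplier_form norm Q \<phi> + (\<integral>x. Q x * \<phi> x \<partial>lebesgue) - (\<integral>x. coulomb_potential (\<lambda>y. (Q y)^2) x * Q x * \<phi> x \<partial>lebesgue) = 0"
      using Q half_sobolev_iff_sobolev[OF s\<phi>] \<phi> unfolding ground_state_def nontrivial_solution_def by blast
    moreover have "(\<integral>x. Q x * \<phi> x \<partial>lebesgue) = (\<integral>x. q x * \<phi> x \<partial>lebesgue)"
      by (rule integral_cong_AE) (use ae in auto)
    moreover have "(\<integral>x. coulomb_potential (\<lambda>y. (q y)^2) x * Q x * \<phi> x \<partial>lebesgue) = (\<integral>x. coulomb_potential (\<lambda>y. (q y)^2) x * q x * \<phi> x \<partial>lebesgue)"
      by (rule integral_cong_AE) (use ae in auto)
    ultimately show ?thesis by (simp add: multiplier_form_cong[OF cong] coulomb_potential_cong[OF cong])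
  qed
  have "S \<ge> 0" by (simp add: S_def le_max_iff_disj)
  note P = pohozaev[OF HB hq iq qd S2 S8 this eq]
  have "A * (enn2real (hart q) / 2) \<le> A * kinetic q" using hartree_boundD(3)[OF HB hq] mq by (simp add: mult_ac)
  then have "enn2real (hart q) \<le> 2 * kinetic q" using A0 by simp
  \<comment> \<open>Here \<open>A \<le> K\<close> follows from \<open>K + A = D \<le> 2 K\<close>,
    and \<open>K \<le> A\<close> is the virial inequality.\<close>
  then have "kinetic q = A" "enn2real (hart q) = 2 * A" using P mq by auto
  then show thesis using that[OF _ hq iq qd] HB mq unfolding A_def by blast
qed

theorem theorem1p1:
  fixes m :: real and V Q :: "real^3 \<Rightarrow> real"
  assumes V_measurable: "V \<in> borel_measurable lebesgue"
    and V_locally_bounded: "\<And>K. compact K \<Longrightarrow> bounded (V ` K)"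
    and V_at_infinity: "filterlim V at_top at_infinity"
    and V_inf: "(INF x. ereal (V x)) = 0"
    and Q_ground_state: "ground_state Q"
    and Q_positive: "AE x in lebesgue. Q x > 0"
    and Q_regular: "\<And>s. s \<ge> 1/2 \<Longrightarrow> Q \<in> sobolev s"
    and Q_decay: "\<exists>C R. AE x in lebesgue. norm x \<ge> R \<longrightarrow> \<bar>Q x\<bar> \<le> C / norm x ^ 4"
    and Q_optimal: "L2_norm_sq Q / 2 =
      (INF u \<in> {u \<in> sobolev (1/2). \<not> (AE x in lebesgue. u x = 0)}.
         kinetic u * L2_norm_sq u / hartree u)"
  shows "(\<forall>a. 0 \<le> a \<and> a < L2_norm_sq Q \<longrightarrow>
            (\<exists>u. minimizer m V a u \<and> (\<forall>x. 0 \<le> u x)))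
       \<and> (\<forall>a. a \<ge> L2_norm_sq Q \<longrightarrow> \<not> (\<exists>u. minimizer m V a u))"
proof -
  define A where "A = L2_norm_sq Q"
  have "V x \<ge> 0" for x using INF_lower[of x UNIV "\<lambda>x. ereal (V x)"] V_inf by simp
  then obtain Vb where Vb: "trapping Vb" "AE x in lebesgue. V x = Vb x"
    using trapping_representative[OF V_measurable V_locally_bounded V_at_infinity] by blast
  obtain q C R where HB: "hartree_bound A" and q: "half_sobolev q" "integrable lborel q" "quartic_decay q C R"
    "kinetic q = A" "mass q = A" "enn2real (hart q) = 2 * A"
    using ground_state_representative[OF Q_ground_state Q_regular Q_decay Q_optimal, folded A_def] by metis
  obtain c where c: "c \<ge> 0" "\<And>\<epsilon>. \<epsilon> > 0 \<Longrightarrow> \<not> (AE x in lborel. Vb x \<ge> c + \<epsilon>)"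
    using essential_infimum[OF Vb(1)] by metis
  \<comment> \<open>Serves twice: with arbitrary \<open>\<Lambda>\<close> it shows that admissible
    functions exist, with a large one that their Hartree energy is unbounded while the critical
    energy stays bounded.\<close>
  note trial = concentrating_trial_function[OF Vb(1) HB q c zero_less_one, of m]
  note rep = minimizer_borel_representative[OF V_measurable Vb]
  have "\<exists>u. minimizer m V a u \<and> (\<forall>x. 0 \<le> u x)" if a: "0 \<le> a" "a < A" for a
  proof -
    obtain w0 where "admissible Vb w0" using trial by blast
    then obtain v where v: "admissible Vb v" "\<And>w. admissible Vb w \<Longrightarrow> total_energy m Vb a v \<le> total_energy m Vb a w" "\<And>x. 0 \<le> v x"
      using exists_minimizer[OF HB a Vb(1)] by blast
    then have "v \<in> borel_measurable borel" by (auto simp: admissible_def dest: half_sobolevD square_integrableD)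
    then have "minimizer m V a v" using rep[OF borel_imp_lebesgue, of v v m a] v by simp
    then show ?thesis using v(3) by blast
  qed
  moreover have False if a: "a \<ge> A" and u: "minimizer m V a u" for a u
  proof -
    have um: "u \<in> borel_measurable lebesgue" using u by (auto simp: minimizer_def energy_space_def sobolev_def L2_def)
    obtain v where v: "v \<in> borel_measurable borel" "AE x in lebesgue. u x = v x" using borel_representative[OF um] .
    have adm: "admissible Vb v" and le: "\<And>w. admissible Vb w \<Longrightarrow> total_energy m Vb a v \<le> total_energy m Vb a w"
      using rep[OF um v, of m a] u by auto
    show False
    proof (cases "a = A")
      case True
      show False by (rule no_critical_minimizer[OF Vb(1) HB q adm]) (use le True in auto)
    next
      case False
      have half_mult: "b / 2 * (2 * r / b) = r" if "b \<noteq> 0" for b r :: real using that by simp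
      \<comment> \<open>Chosen so that passing from \<open>A\<close> to \<open>a\<close> lowers the
        energy of \<open>w\<close> by at least \<open>c + 2 - E\<close>, with \<open>E\<close> the
        energy of \<open>v\<close>; starting from at most \<open>c + 1\<close> it ends at or below
        \<open>E - 1\<close>.\<close>
      define \<Lambda> where "\<Lambda> = 2 * (c + 2 - total_energy m Vb a v) / (a - A)"
      obtain w where w: "admissible Vb w" "total_energy m Vb A w \<le> c + 1" "enn2real (hart w) \<ge> \<Lambda>" using trial by blast
      have "total_energy m Vb a w = total_energy m Vb A w - (a - A) / 2 * enn2real (hart w)"
        unfolding total_energy_def by (simp add: algebra_simps add_divide_distrib diff_divide_distrib)
      moreover have "(a - A) / 2 * \<Lambda> \<le> (a - A) / 2 * enn2real (hart w)" using w(3) a by (intro mult_left_mono) auto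
      moreover have "(a - A) / 2 * \<Lambda> = c + 2 - total_energy m Vb a v" unfolding \<Lambda>_def by (rule half_mult) (use False in simp)
      ultimately show False using le[OF w(1)] w(2) by linarith
    qed
  qed
  ultimately show ?thesis unfolding A_def by blast
qed

end
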